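(* Let $f:X\to X$ be a transitive (one-sided) subshift of finite type and let $k\in\mathbb N$. Then there exist integers $1\le \ell_1\le \ell_2\le N$, a partition of $LC_k(X,\mathbb R)$ into finitely many convex cones $\mathcal U_1,\dots,\mathcal U_{\ell_1},\mathcal U_{\ell_1+1},\dots,\mathcal U_{\ell_2},\mathcal U_{\ell_2+1},\dots,\mathcal U_N$, and finite sets of ergodic $f$-invariant probability measures $\mathcal M_1,\dots,\mathcal M_N$ such that the following properties hold. (a) The sets $\mathcal U_1,\dots,\mathcal U_{\ell_1}$ are open in $LC_k(X,\mathbb R)$ and the closure of their union is $LC_k(X,\mathbb R)$. For $1\le i\le \ell_1$, $\mathcal M_i=\{\mu_{x_i}\}$, where $x_i$ is a $k$-elementary periodic point. Moreover, for any $\phi\in\mathcal U_i$, $\mu_{\infty,\phi}=\mu_{x_i}$, and $\mu_{x_i}$ is the unique maximizing measure of $\phi$. (b) For $\ell_1<i\le \ell_2$, $\mathcal M_i=\{\mu_i\}$, where $\mu_i$ is the unique measure of maximal entropy of a non-discrete transitive subshift of finite type $X_i\subset X$. Moreover, for any $\phi\in\mathcal U_i$, $\mu_{\infty,\phi}=\mu_i$. (c) For $\ell_2<i\le N$, $\mathcal M_i=\{\mu_i^1,\dots,\mu_i^{n_i}\}$, where $n_i\ge 2$ and each $\mu_i^j$ is the unique measure of maximal entropy of some transitive subshift of finite type $X_i^j\subset X$, all with the same entropy, i.e. $h_{\mu_i^{j_1}}(f)=h_{\mu_i^{j_2}}(f)$ for $1\le j_1,j_2\le n_i$. Further, for any $\phi\in\mathcal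 U_i$, $$\mu_{\infty,\phi}=a_{1,\phi}\mu_i^1+\dots+a_{n_i,\phi}\mu_i^{n_i},$$ where $0\le a_{j,\phi}\le 1$ and $\sum_j a_{j,\phi}=1$. Moreover, in each such $\mathcal U_i$ there are only finitely many choices for the coefficients $a_{j,\phi}$ (i.e. the set of coefficient vectors $(a_{1,\phi},\dots,a_{n_i,\phi})$, $\phi\in\mathcal U_i$, is finite).
   Context: Subshifts. Let $\mathcal A=\{0,\dots,d-1\}$ and let $A$ be a $d\times d$ matrix with entries in $\{0,1\}$. The one-sided subshift of finite type is $X=X_A=\{x=(x_n)_{n\ge1}\in\mathcal A^{\mathbb N}: A_{x_n,x_{n+1}}=1 \text{ for all } n\}$ with the shift map $f(x)_n=x_{n+1}$; every letter of $\mathcal A$ is assumed to occur in some sequence in $X$. Transitive means topologically transitive, i.e. $A$ is irreducible. A subset $Y\subset X$ is called a (transitive) subshift of finite type if it is closed and $f$-invariant and $f|_Y$ is topologically conjugate to a (transitive) one-sided subshift of finite type; a single periodic orbit is allowed, and non-discrete means that $Y$ is not a discrete (finite) set. Cylinders and locally constant functions. For $x\in X$ and $k\in\mathbb N$, $\mathcal C_k(x)=\{y\in X:y_1=x_1,\dots,y_k=x_k\}$ is the cylinder of length $k$ generated by $x$. $LC_k(X,\mathbb R)$ is the space of functions $\phi:X\to\mathbb R$ that are constant on each cylinder of length $k$; with $m_c(k)$ the number of cylinders of length $k$, it is identified with $\mathbb R^{m_c(k)}$ and given the standard norm topology. Convex cone. A subset $K$ of a real vector space is a convex cone if it is convex and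 $tx\in K$ for all $x\in K$, $t>0$. Periodic points. For a periodic point $x$ with prime period $n$, $\mu_x=\frac1n(\delta_x+\delta_{f(x)}+\dots+\delta_{f^{n-1}(x)})$. Such an $x$ is $k$-elementary if $\mathcal C_k(f^i(x))\neq\mathcal C_k(f^j(x))$ for all $0\le i\neq j\le n-1$. Measures. $\mathcal M$ is the set of $f$-invariant Borel probability measures with the weak$^*$ topology, and $h_\mu(f)$ is the measure-theoretic entropy. A measure $\mu\in\mathcal M$ is a maximizing measure of $\phi$ if $\int\phi\,d\mu\ge\int\phi\,d\nu$ for all $\nu\in\mathcal M$. For locally constant $\phi$ and $t\ge 0$, $\mu_{t\phi}$ denotes the unique equilibrium state of $t\phi$, i.e. the unique measure in $\mathcal M$ maximizing $h_\mu(f)+\int t\phi\,d\mu$. The zero-temperature measure of $\phi$ is the weak$^*$ limit $\mu_{\infty,\phi}=\lim_{t\to\infty}\mu_{t\phi}$, which is known to exist for locally constant $\phi$. A measure of maximal entropy of a subshift $Y\subset X$ is an $f$-invariant probability measure supported on $Y$ whose entropy equals the topological entropy $h_{\rm top}(f|_Y)$. *)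

theory Defs
  imports "HOL-Probability.Probability" "Jordan_Normal_Form.Matrix"
begin

section \<open>Entropy\<close>

text \<open>
  The family \<open>U \<or> T\<^sup>-\<^sup>1 U \<or> \<dots> \<or> T\<^sup>-\<^sup>(\<^sup>n\<^sup>-\<^sup>1\<^sup>) U\<close> of subsets of \<open>S\<close>, for a partition or a cover \<open>U\<close>
  of \<open>S\<close>. It may contain the empty set, which contributes neither to the Shannon entropy of a
  partition nor to the minimal cardinality of a subcover.
\<close>
definition iterated_join :: "('a \<Rightarrow> 'a) \<Rightarrow> 'a set \<Rightarrow> 'a set set \<Rightarrow> nat \<Rightarrow> 'a set set" where
  "iterated_join T S U n = {{x \<in> S. \<forall>i<n. (T ^^ i) x \<in> Q i} | Q. Q \<in> {..<n} \<rightarrow> U}"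

definition partition_entropy :: "'a measure \<Rightarrow> 'a set set \<Rightarrow> real" where
  "partition_entropy M P = - (\<Sum>B\<in>P. measure M B * ln (measure M B))"

text \<open>Measure-theoretic (Kolmogorov--Sinai) entropy, with natural logarithms.\<close>
definition measure_entropy :: "('a \<Rightarrow> 'a) \<Rightarrow> 'a measure \<Rightarrow> ereal" where
  "measure_entropy T M =
     (SUP P \<in> {P. finite P \<and> P \<subseteq> sets M \<and> partition_on (space M) P}.
        ereal (lim (\<lambda>n. partition_entropy M (iterated_join T (space M) P n) / real n)))"

definition min_subcover_card :: "'a set \<Rightarrow> 'a set set \<Rightarrow> nat" where
  "min_subcover_card S U = (LEAST n. \<exists>V\<subseteq>U. finite V \<and> card V = n \<and> S \<subseteq> \<Union>V)"

text \<open>Topological entropy of \<open>T\<close> on the compact invariant set \<open>S\<close>, in terms of open covers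
  (Adler--Konheim--McAndrew).\<close>
definition top_entropy :: "('a::topological_space \<Rightarrow> 'a) \<Rightarrow> 'a set \<Rightarrow> ereal" where
  "top_entropy T S =
     (SUP U \<in> {U. (\<forall>B\<in>U. openin (top_of_set S) B) \<and> S \<subseteq> \<Union>U}.
        ereal (lim (\<lambda>n. ln (real (min_subcover_card S (iterated_join T S U n))) / real n)))"


section \<open>Subshifts of finite type\<close>

text \<open>
  Sequences are indexed from 0, so \<open>x n\<close> stands for $x_{n+1}$. The type \<open>nat \<Rightarrow> nat\<close> carries the
  product of the discrete topologies.
\<close>
definition shift_map :: "(nat \<Rightarrow> nat) \<Rightarrow> nat \<Rightarrow> nat" where
  "shift_map x = (\<lambda>n. x (Suc n))"

definition sft :: "nat mat \<Rightarrow> (nat \<Rightarrow> nat) set" where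
  "sft A = {x. (\<forall>n. x n < dim_row A) \<and> (\<forall>n. A $$ (x n, x (Suc n)) = 1)}"

definition sft_matrix :: "nat mat \<Rightarrow> bool" where
  "sft_matrix A \<longleftrightarrow> square_mat A \<and> dim_row A > 0
     \<and> (\<forall>i<dim_row A. \<forall>j<dim_row A. A $$ (i, j) \<in> {0, 1})
     \<and> (\<forall>a<dim_row A. \<exists>x\<in>sft A. \<exists>n. x n = a)"

definition irreducible_mat :: "nat mat \<Rightarrow> bool" where
  "irreducible_mat A \<longleftrightarrow>
     (\<forall>i<dim_row A. \<forall>j<dim_row A. \<exists>n\<ge>1. (A ^\<^sub>m n) $$ (i, j) > 0)"

definition transitive_sub_sft :: "(nat \<Rightarrow> nat) set \<Rightarrow> (nat \<Rightarrow> nat) set \<Rightarrow> bool" where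
  "transitive_sub_sft X Y \<longleftrightarrow> Y \<subseteq> X \<and> closedin (top_of_set X) Y \<and> shift_map ` Y \<subseteq> Y
     \<and> (\<exists>B h g. sft_matrix B \<and> irreducible_mat B \<and> homeomorphism Y (sft B) h g
          \<and> (\<forall>y\<in>Y. h (shift_map y) = shift_map (h y)))"


section \<open>Locally constant functions\<close>

definition cylinder :: "(nat \<Rightarrow> nat) set \<Rightarrow> nat \<Rightarrow> (nat \<Rightarrow> nat) \<Rightarrow> (nat \<Rightarrow> nat) set" where
  "cylinder X k x = {y \<in> X. \<forall>i<k. y i = x i}"

definition cylinders :: "(nat \<Rightarrow> nat) set \<Rightarrow> nat \<Rightarrow> (nat \<Rightarrow> nat) set set" where
  "cylinders X k = cylinder X k ` X"

text \<open>
  A function on \<open>X\<close> is represented by its extension by 0, which makes the representation unique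
  and compatible with the pointwise vector space operations.
\<close>
definition LC :: "(nat \<Rightarrow> nat) set \<Rightarrow> nat \<Rightarrow> ((nat \<Rightarrow> nat) \<Rightarrow> real) set" where
  "LC X k = {\<phi>. (\<forall>x\<in>X. \<forall>y\<in>cylinder X k x. \<phi> y = \<phi> x) \<and> (\<forall>x. x \<notin> X \<longrightarrow> \<phi> x = 0)}"

text \<open>
  The identification with $\mathbb{R}^{m_c(k)}$ sends \<open>\<phi>\<close> to its values on the cylinders;
  for \<open>C \<in> cylinders X k\<close>, \<open>the_elem (\<phi> ` C)\<close> is the value of \<open>\<phi>\<close> on \<open>C\<close>.
\<close>
definition LC_dist :: "(nat \<Rightarrow> nat) set \<Rightarrow> nat
    \<Rightarrow> ((nat \<Rightarrow> nat) \<Rightarrow> real) \<Rightarrow> ((nat \<Rightarrow> nat) \<Rightarrow> real) \<Rightarrow> real" where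
  "LC_dist X k \<phi> \<psi> =
     L2_set (\<lambda>C. the_elem (\<phi> ` C) - the_elem (\<psi> ` C)) (cylinders X k)"

definition LC_topology ::
    "(nat \<Rightarrow> nat) set \<Rightarrow> nat \<Rightarrow> ((nat \<Rightarrow> nat) \<Rightarrow> real) topology" where
  "LC_topology X k = Metric_space.mtopology (LC X k) (LC_dist X k)"

lemma the_elem_LC:
  assumes "\<phi> \<in> LC X k" "x \<in> X"
  shows "the_elem (\<phi> ` cylinder X k x) = \<phi> x"
proof -
  have "x \<in> cylinder X k x" using assms by (simp add: cylinder_def)
  moreover have "\<phi> y = \<phi> x" if "y \<in> cylinder X k x" for y
    using assms that unfolding LC_def by blast
  ultimately have "\<phi> ` cylinder X k x = {\<phi> x}" by blast
  then show ?thesis by simp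
qed

lemma finite_cylinders: "finite (cylinders (sft A) k)"
proof -
  have "cylinders (sft A) k \<subseteq> cylinder (sft A) k ` ({..<k} \<rightarrow>\<^sub>E {..<dim_row A})"
  proof
    fix C assume "C \<in> cylinders (sft A) k"
    then obtain x where x: "x \<in> sft A" "C = cylinder (sft A) k x"
      by (auto simp: cylinders_def)
    have "C = cylinder (sft A) k (restrict x {..<k})"
      using x(2) by (auto simp: cylinder_def)
    moreover have "restrict x {..<k} \<in> {..<k} \<rightarrow>\<^sub>E {..<dim_row A}"
      using x(1) by (auto simp: sft_def)
    ultimately show "C \<in> cylinder (sft A) k ` ({..<k} \<rightarrow>\<^sub>E {..<dim_row A})" by blast
  qed
  moreover have "finite ({..<k} \<rightarrow>\<^sub>E {..<dim_row A})" by (rule finite_PiE) simp_all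
  ultimately show ?thesis by (meson finite_imageI finite_subset)
qed

lemma Metric_space_LC: "Metric_space (LC (sft A) k) (LC_dist (sft A) k)"
proof
  fix \<phi> \<psi> \<theta>
  show "0 \<le> LC_dist (sft A) k \<phi> \<psi>" by (simp add: LC_dist_def)
  show "LC_dist (sft A) k \<phi> \<psi> = LC_dist (sft A) k \<psi> \<phi>"
    by (simp add: LC_dist_def L2_set_def power2_commute)
  show "LC_dist (sft A) k \<phi> \<theta> \<le> LC_dist (sft A) k \<phi> \<psi> + LC_dist (sft A) k \<psi> \<theta>"
    using L2_set_triangle_ineq[of "\<lambda>C. the_elem (\<phi> ` C) - the_elem (\<psi> ` C)"
        "\<lambda>C. the_elem (\<psi> ` C) - the_elem (\<theta> ` C)" "cylinders (sft A) k"]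
    by (simp add: LC_dist_def)
  assume LC: "\<phi> \<in> LC (sft A) k" "\<psi> \<in> LC (sft A) k"
  show "LC_dist (sft A) k \<phi> \<psi> = 0 \<longleftrightarrow> \<phi> = \<psi>"
  proof
    assume "LC_dist (sft A) k \<phi> \<psi> = 0"
    then have *: "the_elem (\<phi> ` C) = the_elem (\<psi> ` C)" if "C \<in> cylinders (sft A) k" for C
      using that by (simp add: LC_dist_def L2_set_eq_0_iff finite_cylinders)
    show "\<phi> = \<psi>"
    proof
      fix x show "\<phi> x = \<psi> x"
      proof (cases "x \<in> sft A")
        case True
        then show ?thesis
          using *[of "cylinder (sft A) k x"] LC by (simp add: cylinders_def the_elem_LC)
      next
        case False
        then have "\<phi> x = 0" "\<psi> x = 0" using LC unfolding LC_def by blast+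
        then show ?thesis by simp
      qed
    qed
  qed (simp add: LC_dist_def L2_set_def)
qed

definition fun_convex_cone :: "('a \<Rightarrow> real) set \<Rightarrow> bool" where
  "fun_convex_cone K \<longleftrightarrow>
     (\<forall>\<phi>\<in>K. \<forall>\<psi>\<in>K. \<forall>u\<ge>0. \<forall>v\<ge>0. u + v = 1 \<longrightarrow> (\<lambda>x. u * \<phi> x + v * \<psi> x) \<in> K)
     \<and> (\<forall>\<phi>\<in>K. \<forall>t>0. (\<lambda>x. t * \<phi> x) \<in> K)"


section \<open>Invariant measures\<close>

definition invariant_measures :: "(nat \<Rightarrow> nat) set \<Rightarrow> (nat \<Rightarrow> nat) measure set" where
  "invariant_measures X =
     {\<mu>. sets \<mu> = sets (restrict_space borel X) \<and> prob_space \<mu> \<and> distr \<mu> \<mu> shift_map = \<mu>}"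

definition ergodic_measure :: "(nat \<Rightarrow> nat) set \<Rightarrow> (nat \<Rightarrow> nat) measure \<Rightarrow> bool" where
  "ergodic_measure X \<mu> \<longleftrightarrow> \<mu> \<in> invariant_measures X
     \<and> (\<forall>B\<in>sets \<mu>. shift_map -` B \<inter> X = B \<longrightarrow> measure \<mu> B = 0 \<or> measure \<mu> B = 1)"

text \<open>The linear combination $\sum_{j \in J} a_j m_j$ of Borel measures on \<open>X\<close>, for \<open>a j \<ge> 0\<close>.\<close>
definition measure_comb :: "(nat \<Rightarrow> nat) set \<Rightarrow> 'j set \<Rightarrow> ('j \<Rightarrow> real)
    \<Rightarrow> ('j \<Rightarrow> (nat \<Rightarrow> nat) measure) \<Rightarrow> (nat \<Rightarrow> nat) measure" where
  "measure_comb X J a m =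
     measure_of X (sets (restrict_space borel X)) (\<lambda>B. \<Sum>j\<in>J. ennreal (a j) * emeasure (m j) B)"

definition periodic_point :: "(nat \<Rightarrow> nat) \<Rightarrow> bool" where
  "periodic_point x \<longleftrightarrow> (\<exists>n>0. (shift_map ^^ n) x = x)"

definition prime_period :: "(nat \<Rightarrow> nat) \<Rightarrow> nat" where
  "prime_period x = (LEAST n. n > 0 \<and> (shift_map ^^ n) x = x)"

definition k_elementary :: "(nat \<Rightarrow> nat) set \<Rightarrow> nat \<Rightarrow> (nat \<Rightarrow> nat) \<Rightarrow> bool" where
  "k_elementary X k x \<longleftrightarrow> x \<in> X \<and> periodic_point x
     \<and> (\<forall>i<prime_period x. \<forall>j<prime_period x. i \<noteq> j \<longrightarrow>
          cylinder X k ((shift_map ^^ i) x) \<noteq> cylinder X k ((shift_map ^^ j) x))"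

definition orbit_measure :: "(nat \<Rightarrow> nat) set \<Rightarrow> (nat \<Rightarrow> nat) \<Rightarrow> (nat \<Rightarrow> nat) measure" where
  "orbit_measure X x = measure_comb X {..<prime_period x} (\<lambda>_. 1 / real (prime_period x))
     (\<lambda>i. return (restrict_space borel X) ((shift_map ^^ i) x))"

definition maximizing_measure ::
    "(nat \<Rightarrow> nat) set \<Rightarrow> ((nat \<Rightarrow> nat) \<Rightarrow> real) \<Rightarrow> (nat \<Rightarrow> nat) measure \<Rightarrow> bool" where
  "maximizing_measure X \<phi> \<mu> \<longleftrightarrow> \<mu> \<in> invariant_measures X
     \<and> (\<forall>\<nu>\<in>invariant_measures X. integral\<^sup>L \<nu> \<phi> \<le> integral\<^sup>L \<mu> \<phi>)"

definition is_equilibrium_state ::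
    "(nat \<Rightarrow> nat) set \<Rightarrow> ((nat \<Rightarrow> nat) \<Rightarrow> real) \<Rightarrow> (nat \<Rightarrow> nat) measure \<Rightarrow> bool" where
  "is_equilibrium_state X \<phi> \<mu> \<longleftrightarrow> \<mu> \<in> invariant_measures X
     \<and> (\<forall>\<nu>\<in>invariant_measures X.
          measure_entropy shift_map \<nu> + ereal (integral\<^sup>L \<nu> \<phi>)
            \<le> measure_entropy shift_map \<mu> + ereal (integral\<^sup>L \<mu> \<phi>))"

text \<open>Well defined for locally constant \<open>\<phi>\<close> on a transitive subshift of finite type, where the
  equilibrium state exists and is unique.\<close>
definition equilibrium_state ::
    "(nat \<Rightarrow> nat) set \<Rightarrow> ((nat \<Rightarrow> nat) \<Rightarrow> real) \<Rightarrow> (nat \<Rightarrow> nat) measure" where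
  "equilibrium_state X \<phi> = (THE \<mu>. is_equilibrium_state X \<phi> \<mu>)"

definition weak_star_limit :: "(nat \<Rightarrow> nat) set \<Rightarrow> ('i \<Rightarrow> (nat \<Rightarrow> nat) measure)
    \<Rightarrow> (nat \<Rightarrow> nat) measure \<Rightarrow> 'i filter \<Rightarrow> bool" where
  "weak_star_limit X m \<mu> F \<longleftrightarrow>
     (\<forall>g :: (nat \<Rightarrow> nat) \<Rightarrow> real. continuous_on X g \<longrightarrow>
        ((\<lambda>t. integral\<^sup>L (m t) g) \<longlongrightarrow> integral\<^sup>L \<mu> g) F)"

text \<open>\<open>\<mu>\<close> is the zero-temperature measure of \<open>\<phi>\<close>. Stated as a relation, so that the existence of
  the limit is part of it; weak* limits within \<open>invariant_measures X\<close> are unique.\<close>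
definition zero_temperature_measure ::
    "(nat \<Rightarrow> nat) set \<Rightarrow> ((nat \<Rightarrow> nat) \<Rightarrow> real) \<Rightarrow> (nat \<Rightarrow> nat) measure \<Rightarrow> bool" where
  "zero_temperature_measure X \<phi> \<mu> \<longleftrightarrow> \<mu> \<in> invariant_measures X
     \<and> weak_star_limit X (\<lambda>t::real. equilibrium_state X (\<lambda>x. t * \<phi> x)) \<mu> at_top"

definition is_max_entropy_measure ::
    "(nat \<Rightarrow> nat) set \<Rightarrow> (nat \<Rightarrow> nat) set \<Rightarrow> (nat \<Rightarrow> nat) measure \<Rightarrow> bool" where
  "is_max_entropy_measure X Y \<mu> \<longleftrightarrow> \<mu> \<in> invariant_measures X \<and> emeasure \<mu> Y = 1
     \<and> measure_entropy shift_map \<mu> = top_entropy shift_map Y"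

definition unique_max_entropy_measure ::
    "(nat \<Rightarrow> nat) set \<Rightarrow> (nat \<Rightarrow> nat) set \<Rightarrow> (nat \<Rightarrow> nat) measure \<Rightarrow> bool" where
  "unique_max_entropy_measure X Y \<mu> \<longleftrightarrow> (\<forall>\<nu>. is_max_entropy_measure X Y \<nu> \<longleftrightarrow> \<nu> = \<mu>)"

end

theory Submission
 imports Defs "HOL-Real_Asymp.Real_Asymp"
begin

text \<open>Coding a point by its words of length \<open>k\<close> turns \<open>\<phi>\<close> into a vertex potential \<open>\<psi>\<close> of a finite
 strongly connected graph, and the equilibrium state of \<open>t \<phi>\<close> into the Markov measure built from the
 Perron eigenvectors of the weights \<open>exp (t \<psi> v)\<close>. A cone consists of the \<open>\<phi>\<close> with the same set \<open>F\<close> of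
 edges carried by maximizing circulations; \<open>F\<close> is a disjoint union of strongly connected components.

 The stationary and transition probabilities are algebraic over the exponential sums in \<open>t\<close>, with
 complexity bounded independently of \<open>\<psi>\<close>, so they converge as \<open>t \<rightarrow> \<infinity>\<close>, with finitely many possible
 limits. Entropies being bounded, the variational principle shows that the limit is maximizing, with
 entropy at least that of each component; equality in Gibbs' inequality then makes it a convex
 combination of the measures of maximal entropy of the components of largest growth rate.

 Perturbing \<open>\<psi>\<close> along a chordless cycle in \<open>F\<close> reduces \<open>F\<close> to this cycle, and upper semicontinuity
 of \<open>F\<close> makes the cones of simple cycles open.\<close>

section \<open>Exponential sums and algebraic limits\<close>

text \<open>The pairs of consecutive letters of an invariant measure form a circulation, and the
  circulations form a polytope. \<open>F\<close> is the support of the face on which \<psi> is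
  maximal and determines that face, so the cones are the cells of a normal fan; this is why they are
  finitely many, disjoint and convex. Inside a cone the components of \<open>F\<close> are fixed,
  but their weights in the limit may also depend on circulations that are not maximizing, hence on
  \<psi>. Finiteness of the weights therefore needs a bound uniform in \<psi>: the exponents of the
  exponential sums move with \<psi>, whereas the number of terms and the integer coefficients stay
  bounded, and only these enter a limiting polynomial equation. An intermediate value argument then
  yields convergence without fractional power expansions. The second obstacle is that entropy is a
  supremum over all finite partitions and the equilibrium state a definite description. Generator
  theorem, variational principle and uniqueness are all reduced to Gibbs' inequality: a Markov
  kernel serves as a code, its expected cost bounds the entropy, and equality forces the Markov
  property.\<close>

definition exp_sum :: "(int \<times> real) list => real => real" where
 "exp_sum xs t = (\<Sum>(c, a)\<leftarrow>xs. of_int c * exp (t * a))"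

text \<open>Coefficients are restricted to -1, 0 and 1 but exponents may repeat. So the single
  number \<open>B\<close> bounds both the number of terms and, after equal exponents are collected,
  every integer coefficient, while the exponents remain arbitrary.\<close>

definition exp_sums :: "nat => (real => real) set" where
 "exp_sums B = {exp_sum xs | xs. length xs \<le> B \<and> (\<forall>(c, a)\<in>set xs. \<bar>c\<bar> \<le> 1)}"

lemma exp_sums_mono: "B \<le> B' ==> exp_sums B \<subseteq> exp_sums B'"
 by (fastforce simp: exp_sums_def)

lemma exp_sums_zero: "(%t. 0) \<in> exp_sums B"
 unfolding exp_sums_def by (auto intro!: exI[of _ "[]"] simp: exp_sum_def)

lemma exp_sums_exp: "(%t. exp (t * a)) \<in> exp_sums 1"
 unfolding exp_sums_def by (auto intro!: exI[of _ "[(1, a)]"] simp: exp_sum_def)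

lemma exp_sums_one: "(%t. 1) \<in> exp_sums 1"
 using exp_sums_exp[of 0] by simp

lemma exp_sums_uminus:
 assumes "e \<in> exp_sums B" shows "(%t. - e t) \<in> exp_sums B"
proof -
 obtain xs where xs: "e = exp_sum xs" "length xs \<le> B" "\<forall>(c, a)\<in>set xs. \<bar>c\<bar> \<le> 1"
  using assms by (auto simp: exp_sums_def)
 have "exp_sum (map (%(c, a). (- c, a)) ys) t = - exp_sum ys t" for ys t
  by (induction ys) (auto simp: exp_sum_def)
 then show ?thesis unfolding exp_sums_def using xs
  by (fastforce intro!: exI[of _ "map (%(c, a). (- c, a)) xs"])
qed

lemma exp_sums_add:
 assumes "e \<in> exp_sums B" "e' \<in> exp_sums B'"
 shows "(%t. e t + e' t) \<in> exp_sums (B + B')"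
proof -
 obtain xs where xs: "e = exp_sum xs" "length xs \<le> B" "\<forall>(c, a)\<in>set xs. \<bar>c\<bar> \<le> 1"
  using assms by (auto simp: exp_sums_def)
 obtain ys where ys: "e' = exp_sum ys" "length ys \<le> B'" "\<forall>(c, a)\<in>set ys. \<bar>c\<bar> \<le> 1"
  using assms by (auto simp: exp_sums_def)
 show ?thesis unfolding exp_sums_def using xs ys
  by (auto intro!: exI[of _ "xs @ ys"] simp: exp_sum_def)
qed

lemma exp_sums_mult:
 assumes "e \<in> exp_sums B" "e' \<in> exp_sums B'"
 shows "(%t. e t * e' t) \<in> exp_sums (B * B')"
proof -
 obtain xs where xs: "e = exp_sum xs" "length xs \<le> B" "\<forall>(c, a)\<in>set xs. \<bar>c\<bar> \<le> 1"
  using assms by (auto simp: exp_sums_def)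
 obtain ys where ys: "e' = exp_sum ys" "length ys \<le> B'" "\<forall>(c, a)\<in>set ys. \<bar>c\<bar> \<le> 1"
  using assms by (auto simp: exp_sums_def)
 define m where "m = (%(c, a) (d, b). (c * d, a + b) :: int \<times> real)"
 have 1: "exp_sum (map (m x) zs) t = of_int (fst x) * exp (t * snd x) * exp_sum zs t" for x zs t
  by (induction zs) (auto simp: exp_sum_def m_def split_beta algebra_simps exp_add)
 have 2: "exp_sum (concat (map (%x. map (m x) ys) zs)) t = exp_sum zs t * exp_sum ys t" for zs t
 proof (induction zs)
  case (Cons x zs)
  then show ?case using 1[of x ys t]
   by (simp add: exp_sum_def split_beta algebra_simps)
 qed (simp add: exp_sum_def)
 have 3: "length (concat (map (%x. map (m x) ys) zs)) = length zs * length ys" for zs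
  by (induction zs) auto
 have "length xs * length ys \<le> B * B'" using xs ys by (simp add: mult_le_mono)
 moreover have "\<forall>(c, a)\<in>set (concat (map (%x. map (m x) ys) xs)). \<bar>c\<bar> \<le> 1"
  using xs(3) ys(3) by (fastforce simp: m_def abs_mult intro: mult_le_one)
 ultimately show ?thesis unfolding exp_sums_def using xs ys 2 3
  by (intro CollectI exI[of _ "concat (map (%x. map (m x) ys) xs)"]) auto
qed

lemma exp_sum_collect:
 assumes "finite S" "snd ` set xs \<subseteq> S"
 shows "exp_sum xs t = (\<Sum>a\<in>S. of_int (\<Sum>x\<leftarrow>xs. if snd x = a then fst x else 0) * exp (t * a))"
 using assms(2)
proof (induction xs)
 case (Cons x xs)
 have "(\<Sum>a\<in>S. of_int (\<Sum>x\<leftarrow>x # xs. if snd x = a then fst x else 0) * exp (t * a) :: real)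
  = (\<Sum>a\<in>S. (if snd x = a then of_int (fst x) * exp (t * a) else 0)
     + of_int (\<Sum>x\<leftarrow>xs. if snd x = a then fst x else 0) * exp (t * a))"
  by (intro sum.cong) (auto simp: split_beta algebra_simps)
 also have "\<dots> = of_int (fst x) * exp (t * snd x) + exp_sum xs t"
  using Cons assms(1) by (simp add: sum.distrib)
 finally show ?case by (auto simp: exp_sum_def split_beta)
qed (simp add: exp_sum_def)

lemma tendsto_exp_neg: "(a::real) < 0 ==> ((%t. exp (t * a)) \<longlongrightarrow> 0) at_top"
 by real_asymp

text \<open>Divided by the exponential with the largest surviving exponent, the sum tends to the
  integer coefficient of that exponent, which is at most the number of terms.\<close>

lemma exp_sums_leading:
 assumes "e \<in> exp_sums B" "e t0 ~= 0"
 obtains a and c :: int where "c ~= 0" "\<bar>c\<bar> \<le> int B"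
  "((%t. e t * exp (- (t * a))) \<longlongrightarrow> of_int c) at_top"
proof -
 obtain xs where xs: "e = exp_sum xs" "length xs \<le> B" "\<forall>(c, a)\<in>set xs. \<bar>c\<bar> \<le> 1"
  using assms by (auto simp: exp_sums_def)
 define C where "C a = (\<Sum>x\<leftarrow>xs. if snd x = a then fst x else 0)" for a
 \<comment> \<open>Exponents whose terms cancel are dropped, so that the maximum of \<open>S\<close>
   really dominates; a nonzero value of \<open>e\<close> shows that something survives.\<close>
 define S where "S = {a \<in> snd ` set xs. C a ~= 0}"
 have fin: "finite S" by (simp add: S_def)
 have e: "e t = (\<Sum>a\<in>S. of_int (C a) * exp (t * a))" for t
  using exp_sum_collect[of "snd ` set xs" xs t]
  by (auto simp: xs(1) C_def S_def intro!: sum.mono_neutral_right)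
 have "S ~= {}" using assms(2) e[of t0] by auto
 define a where "a = Max S"
 have a: "a \<in> S" "!!b. b \<in> S ==> b \<le> a" using fin \<open>S ~= {}\<close> by (auto simp: a_def)
 have Cle: "\<bar>\<Sum>x\<leftarrow>ys. if snd x = a then fst x else 0\<bar> \<le> int (length ys)"
  if "\<forall>(c, a)\<in>set ys. \<bar>c\<bar> \<le> 1" for ys :: "(int \<times> real) list"
  using that by (induction ys) auto
 have lim: "((%t. \<Sum>b\<in>S. of_int (C b) * exp (t * (b - a))) \<longlongrightarrow>
   (\<Sum>b\<in>S. if b = a then of_int (C a) else 0)) at_top"
 proof (rule tendsto_sum)
  fix b assume "b \<in> S"
  show "((%t. of_int (C b) * exp (t * (b - a))) \<longlongrightarrow> (if b = a then of_int (C a) else 0)) at_top"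
  proof (cases "b = a")
   case False
   then have "b - a < 0" using a(2)[OF \<open>b \<in> S\<close>] by simp
   from tendsto_mult_right_zero[OF tendsto_exp_neg[OF this]] show ?thesis using False by simp
  qed auto
 qed
 have "(%t. e t * exp (- (t * a))) = (%t. \<Sum>b\<in>S. of_int (C b) * exp (t * (b - a)))"
  by (simp add: e sum_distrib_right mult.assoc exp_add[symmetric] right_diff_distrib)
 with lim have "((%t. e t * exp (- (t * a))) \<longlongrightarrow> of_int (C a)) at_top"
  using fin a(1) by simp
 moreover have "\<bar>C a\<bar> \<le> int B" using Cle[OF xs(3)] xs(2) by (simp add: C_def)
 moreover have "C a ~= 0" using a by (simp add: S_def)
 ultimately show ?thesis using that by blast
qed

text \<open>There are no zero divisors: by its leading term each factor is nonzero for all large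
  arguments, so both are nonzero at a common one.\<close>

lemma exp_sums_nonzero_mult:
 assumes "e \<in> exp_sums B" "e t0 ~= 0" "e' \<in> exp_sums B'" "e' t1 ~= 0"
 obtains t where "e t * e' t ~= 0"
proof -
 have nz: "eventually (%t. e t ~= 0) at_top" if e: "e \<in> exp_sums B" "e t0 ~= 0" for e B t0
 proof -
  from exp_sums_leading[OF e] obtain a and c :: int where ac: "c ~= 0" "\<bar>c\<bar> \<le> int B"
   "((%t. e t * exp (- (t * a))) \<longlongrightarrow> of_int c) at_top" .
  then have "eventually (%t. e t * exp (- (t * a)) ~= 0) at_top"
   by (intro tendsto_imp_eventually_ne[OF ac(3)]) simp
  then show ?thesis by eventually_elim auto
 qed
 have "eventually (%t. e t * e' t ~= 0) at_top"
  using nz[OF assms(1,2)] nz[OF assms(3,4)] by eventually_elim simp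
 then show ?thesis using that unfolding eventually_at_top_linorder by blast
qed

text \<open>The coefficients of a relation must all be divided by the same exponential. That of the
  fastest growing coefficient is used: slower ones tend to 0, and at least one limit is a nonzero
  integer.\<close>

lemma exp_sums_leading_family:
 assumes "finite I" "!!i. i \<in> I ==> c i \<in> exp_sums B" "i0 \<in> I" "c i0 t0 ~= 0"
 obtains a and K :: "'i => int" where "!!i. i \<in> I ==> \<bar>K i\<bar> \<le> int B"
  "!!i. i \<in> I ==> ((%t. c i t * exp (- (t * a))) \<longlongrightarrow> of_int (K i)) at_top" "\<exists>i\<in>I. K i ~= 0"
proof -
 define J where "J = {i \<in> I. \<exists>t. c i t ~= 0}"
 have "\<exists>a k. k ~= 0 \<and> \<bar>k\<bar> \<le> int B \<and> ((%t. c i t * exp (- (t * a))) \<longlongrightarrow> of_int k) at_top"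
  if "i \<in> J" for i
 proof -
  obtain t where "c i t ~= 0" "c i \<in> exp_sums B" using \<open>i \<in> J\<close> assms(2) by (auto simp: J_def)
  then show ?thesis using exp_sums_leading[of "c i" B t] by metis
 qed
 then obtain a k where ak: "!!i. i \<in> J ==> k i ~= 0 \<and> \<bar>k i\<bar> \<le> int B \<and>
   ((%t. c i t * exp (- (t * a i))) \<longlongrightarrow> of_int (k i)) at_top" by metis
 have J: "finite J" "i0 \<in> J" using assms by (auto simp: J_def)
 define b where "b = Max (a ` J)"
 have b: "a i \<le> b" if "i \<in> J" for i using J that by (simp add: b_def)
 obtain j where j: "j \<in> J" "a j = b"
  using Max_in[of "a ` J"] J unfolding b_def by (metis empty_iff finite_imageI imageE image_is_empty)
 define K where "K i = (if i \<in> J \<and> a i = b then k i else 0)" for i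
 have "((%t. c i t * exp (- (t * b))) \<longlongrightarrow> of_int (K i)) at_top" if "i \<in> I" for i
 proof (cases "i \<in> J")
  case iJ: True
  show ?thesis
  proof (cases "a i = b")
   case True
   then show ?thesis using ak[OF iJ] iJ by (simp add: K_def)
  next
   case False
   then have "a i - b < 0" using b[OF iJ] by simp
   from tendsto_mult[OF _ tendsto_exp_neg[OF this], of "%t. c i t * exp (- (t * a i))"] ak[OF iJ]
   have "((%t. (c i t * exp (- (t * a i))) * exp (t * (a i - b))) \<longlongrightarrow> 0) at_top" by auto
   moreover have "(c i t * exp (- (t * a i))) * exp (t * (a i - b)) = c i t * exp (- (t * b))" for t
    by (simp add: exp_add[symmetric] algebra_simps)
   ultimately show ?thesis using False by (simp add: K_def)
  qed
 next
  case False
  then have "c i t = 0" for t using that by (auto simp: J_def)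
  then show ?thesis using False by (simp add: K_def)
 qed
 then show ?thesis using ak j by (intro that[of K b]) (auto simp: K_def J_def)
qed

section \<open>Limits of bounded continuous solutions of algebraic equations\<close>

definition bounded_roots :: "nat => nat => real set" where
 "bounded_roots N B = (\<Union>K\<in>{K \<in> {..N} \<rightarrow>\<^sub>E {- int B..int B}. \<exists>i\<le>N. K i ~= 0}.
  {x. (\<Sum>i\<le>N. of_int (K i) * x ^ i) = 0})"

lemma finite_bounded_roots: "finite (bounded_roots N B)"
 unfolding bounded_roots_def
proof (rule finite_UN_I)
 show "finite {K \<in> {..N} \<rightarrow>\<^sub>E {- int B..int B}. \<exists>i\<le>N. K i ~= 0}"
  by (rule finite_subset[OF _ finite_PiE[of "{..N}" "%_. {- int B..int B}"]]) auto
 fix K :: "nat => int" assume "K \<in> {K \<in> {..N} \<rightarrow>\<^sub>E {- int B..int B}. \<exists>i\<le>N. K i ~= 0}"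
 then have "\<exists>i\<le>N. (of_int (K i) :: real) ~= 0" by auto
 then show "finite {x::real. (\<Sum>i\<le>N. of_int (K i) * x ^ i) = 0}"
  by (subst polyfun_finite_roots)
qed

text \<open>By the intermediate value theorem a function that eventually avoids a level eventually
  stays on one side of it. As this holds for all but finitely many levels, the limit is the supremum
  of the levels that are eventually exceeded.\<close>

lemma connected_limit_finite:
 fixes w :: "real => real"
 assumes cont: "continuous_on UNIV w" and bd: "!!t. 0 \<le> w t \<and> w t \<le> 1"
  and fin: "finite R"
  and ne: "!!c. c \<notin> R ==> eventually (%t. w t ~= c) at_top"
 obtains l where "(w \<longlongrightarrow> l) at_top"
proof -
 have dich: "eventually (%t. w t < c) at_top \<or> eventually (%t. w t > c) at_top" if c: "c \<notin> R" for c
 proof -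
  obtain T where T: "!!t. t \<ge> T ==> w t ~= c"
   using ne[OF c] by (auto simp: eventually_at_top_linorder)
  have iv: "connected (w ` {T..})"
   by (intro connected_continuous_image continuous_on_subset[OF cont]) auto
  show ?thesis
  proof (cases "w T < c")
   case True
   have "w t < c" if "t \<ge> T" for t
   proof (rule ccontr)
    assume "\<not> w t < c"
    then have "c \<in> w ` {T..}"
     using connectedD_interval[OF iv, of "w T" "w t" c] that True by auto
    then show False using T by auto
   qed
   then show ?thesis by (auto simp: eventually_at_top_linorder)
  next
   case False
   have "w t > c" if "t \<ge> T" for t
   proof (rule ccontr)
    assume "\<not> w t > c"
    then have "c \<in> w ` {T..}"
     using connectedD_interval[OF iv, of "w t" "w T" c] that False by auto
    then show False using T by auto
   qed
   then show ?thesis by (auto simp: eventually_at_top_linorder)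
  qed
 qed
 define L where "L = {c. eventually (%t. w t > c) at_top}"
 have L1: "c \<le> 1" if "c \<in> L" for c
 proof -
  obtain t where "\<forall>s\<ge>t. w s > c"
   using \<open>c \<in> L\<close> unfolding L_def eventually_at_top_linorder by blast
  then have "w t > c" by simp
  then show ?thesis using bd[of t] by linarith
 qed
 have L0: "-1 \<in> L"
 proof -
  have "w t > -1" for t using bd[of t] by linarith
  then show ?thesis by (simp add: L_def)
 qed
 have bdd: "bdd_above L" using L1 by (auto simp: bdd_above_def)
 have "(w \<longlongrightarrow> Sup L) at_top"
 proof (rule order_tendstoI)
  fix a assume "a < Sup L"
  then obtain c where "c \<in> L" "a < c" using less_cSup_iff[of L a] L0 bdd by auto
  then show "eventually (%t. a < w t) at_top" unfolding L_def
   by (auto elim: eventually_mono)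
 next
  fix a assume a: "Sup L < a"
  \<comment> \<open>Some level between \<open>Sup L\<close> and \<open>a\<close> is not exceptional;
    it is not in \<open>L\<close>, so the function eventually stays below it.\<close>
  have "infinite {Sup L<..<a}" using a by simp
  then obtain c where c: "c \<in> {Sup L<..<a}" "c \<notin> R" using fin by (meson finite_subset subsetI)
  have "c \<notin> L" using c(1) cSup_upper[OF _ bdd, of c] by auto
  then have "eventually (%t. w t < c) at_top" using dich[OF c(2)] by (auto simp: L_def)
  then show "eventually (%t. w t < a) at_top" using c(1) by (auto elim: eventually_mono)
 qed
 then show ?thesis using that by blast
qed

text \<open>After division by the dominant exponential the coefficients converge to integers, not
  all zero. Hence \<open>w\<close> eventually avoids every number that is not a root of the limiting
  polynomial \<open>q\<close>, and its limit is a root. Only \<open>N\<close> and \<open>B\<close>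
  restrict \<open>q\<close>, so the set of possible limits does not depend on the exponents.\<close>

lemma algebraic_limit:
 fixes w :: "real => real"
 assumes cont: "continuous_on UNIV w" and bd: "!!t. 0 \<le> w t \<and> w t \<le> 1"
  and c: "!!i. i \<le> N ==> c i \<in> exp_sums B" and i0: "i0 \<le> N" "c i0 t0 ~= 0"
  and rel: "!!t. (\<Sum>i\<le>N. c i t * w t ^ i) = 0"
 obtains l where "l \<in> bounded_roots N B" "(w \<longlongrightarrow> l) at_top"
proof -
 obtain a and K :: "nat => int" where K: "!!i. i \<in> {..N} ==> \<bar>K i\<bar> \<le> int B"
  "!!i. i \<in> {..N} ==> ((%t. c i t * exp (- (t * a))) \<longlongrightarrow> of_int (K i)) at_top"
  "\<exists>i\<in>{..N}. K i ~= 0"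
  by (rule exp_sums_leading_family[of "{..N}" c B i0 t0]) (use c i0 in auto)
 define q where "q x = (\<Sum>i\<le>N. of_int (K i) * x ^ i)" for x :: real
 define K' where "K' = restrict K {..N}"
 have "K' \<in> {K \<in> {..N} \<rightarrow>\<^sub>E {- int B..int B}. \<exists>i\<le>N. K i ~= 0}"
  using K(1,3) by (auto simp: K'_def abs_le_iff minus_le_iff)
 moreover have "q x = (\<Sum>i\<le>N. of_int (K' i) * x ^ i)" for x
  by (simp add: q_def K'_def)
 ultimately have roots: "{x. q x = 0} \<subseteq> bounded_roots N B"
  unfolding bounded_roots_def by auto
 have q0: "((%t. q (w t)) \<longlongrightarrow> 0) at_top"
 proof -
  \<comment> \<open>Since \<open>w\<close> is bounded, replacing the scaled coefficients by their
    limits costs an error that tends to 0.\<close>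
  have *: "((%t. \<Sum>i\<le>N. (of_int (K i) - c i t * exp (- (t * a))) * w t ^ i) \<longlongrightarrow> (\<Sum>i\<le>N. 0)) at_top"
  proof (rule tendsto_sum)
   fix i assume "i \<in> {..N}"
   then have "((%t. of_int (K i) - c i t * exp (- (t * a))) \<longlongrightarrow> of_int (K i) - of_int (K i)) at_top"
    by (intro tendsto_diff tendsto_const K(2))
   then have z: "((%t. of_int (K i) - c i t * exp (- (t * a))) \<longlongrightarrow> 0) at_top" by simp
   show "((%t. (of_int (K i) - c i t * exp (- (t * a))) * w t ^ i) \<longlongrightarrow> 0) at_top"
   proof (rule Lim_null_comparison[OF _ tendsto_rabs_zero[OF z]])
    have "\<bar>x * w t ^ i\<bar> \<le> \<bar>x\<bar>" for x t
    proof -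
     have "\<bar>w t ^ i\<bar> \<le> 1" using bd[of t] by (simp add: power_le_one)
     then show ?thesis by (simp add: abs_mult mult_left_le)
    qed
    then show "\<forall>\<^sub>F t in at_top. norm ((of_int (K i) - c i t * exp (- (t * a))) * w t ^ i)
      \<le> \<bar>of_int (K i) - c i t * exp (- (t * a))\<bar>" by simp
   qed
  qed
  have "(\<Sum>i\<le>N. (of_int (K i) - c i t * exp (- (t * a))) * w t ^ i) = q (w t)" for t
  proof -
   have "(\<Sum>i\<le>N. (of_int (K i) - c i t * exp (- (t * a))) * w t ^ i)
     = q (w t) - exp (- (t * a)) * (\<Sum>i\<le>N. c i t * w t ^ i)"
    unfolding q_def sum_distrib_left sum_subtractf[symmetric]
    by (intro sum.cong) (auto simp: algebra_simps)
   then show ?thesis using rel[of t] by simp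
  qed
  with * show ?thesis by simp
 qed
 have contq: "isCont q x" for x unfolding q_def by (intro continuous_intros)
 have ne: "eventually (%t. w t ~= x) at_top" if "x \<notin> bounded_roots N B" for x
 proof -
  have "q x ~= 0" using that roots by auto
  then have "eventually (%t. q (w t) ~= q x) at_top"
   using tendsto_imp_eventually_ne[OF q0, of "q x"] by simp
  then show ?thesis by eventually_elim auto
 qed
 from connected_limit_finite[OF cont bd finite_bounded_roots ne] obtain l where l: "(w \<longlongrightarrow> l) at_top"
  by blast
 have "((%t. q (w t)) \<longlongrightarrow> q l) at_top" using isCont_tendsto_compose[OF contq l] .
 then have "q l = 0" using q0 by (metis tendsto_unique trivial_limit_at_top_linorder)
 then show ?thesis using that l roots by auto
qed

text \<open>The bound \<open>B'\<close> is fixed before the vectors \<open>a\<close> are chosen,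
  which is the uniformity required later. The \<open>itself\<close> argument only fixes the type of
  their index, which the other arguments do not mention.\<close>

definition exp_dependent :: "'i itself => 'd set => nat => nat => nat => bool" where
 "exp_dependent TYPE('i) D n B B' \<longleftrightarrow> (\<forall>(I :: 'i set) (a :: 'i => 'd => real => real).
  finite I --> card I = n --> (\<forall>i\<in>I. \<forall>j\<in>D. a i j \<in> exp_sums B) -->
  (\<exists>c. (\<forall>i\<in>I. c i \<in> exp_sums B') \<and> (\<exists>i\<in>I. \<exists>t. c i t ~= 0) \<and>
   (\<forall>j\<in>D. \<forall>t. (\<Sum>i\<in>I. c i t * a i j t) = 0)))"

lemma exp_dependentD:
 fixes I :: "'i set" and D :: "'d set" and a :: "'i => 'd => real => real"
 assumes "exp_dependent TYPE('i) D n B B'" "finite I" "card I = n"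
  "!!i j. i \<in> I ==> j \<in> D ==> a i j \<in> exp_sums B"
 obtains c i t where "!!i. i \<in> I ==> c i \<in> exp_sums B'" "i \<in> I" "c i t ~= 0"
  "!!j t. j \<in> D ==> (\<Sum>i\<in>I. c i t * a i j t) = 0"
proof -
 have "\<exists>c. (\<forall>i\<in>I. c i \<in> exp_sums B') \<and> (\<exists>i\<in>I. \<exists>t. c i t ~= 0) \<and>
   (\<forall>j\<in>D. \<forall>t. (\<Sum>i\<in>I. c i t * a i j t) = 0)"
  using assms(1)[unfolded exp_dependent_def, rule_format, of I a] assms(2-4) by simp
 then show ?thesis using that by blast
qed

text \<open>One step of Gaussian elimination raises the bound from \<open>B\<close> to \<open>2 B\<^sup>2\<close>, so the bound on
 the relation depends only on \<open>B\<close> and the dimension.\<close>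
lemma exp_sums_dependent:
 fixes D :: "'d set"
 assumes "finite D"
 shows "\<exists>B'. exp_dependent TYPE('i) D (Suc (card D)) B B'"
 using assms
proof (induction D arbitrary: B rule: finite_induct)
 case empty
 have "exp_dependent TYPE('i) ({} :: 'd set) (Suc 0) B 1"
  unfolding exp_dependent_def
  using exp_sums_one by (auto intro!: exI[of _ "%_ _. 1"] simp: card_Suc_eq)
 then show ?case by auto
next
 case (insert d D)
 \<comment> \<open>One bound serves both cases: \<open>B\<close> for the entries themselves if the
   column \<open>d\<close> vanishes identically, and \<open>B * B + B * B\<close> for the 2 by 2
   determinants that eliminate it otherwise.\<close>
 obtain B1 where B1: "exp_dependent TYPE('i) D (Suc (card D)) (B + (B * B + B * B)) B1"
  using insert.IH by blast
 \<comment> \<open>The summands are for the three kinds of coefficients: unchanged ones, those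
   multiplied by the pivot entry, and that of the pivot vector, a sum over \<open>card D + 1\<close>
   indices.\<close>
 define B2 where "B2 = B1 + B1 * B + (card D + 1) * (B1 * B)"
 have "exp_dependent TYPE('i) (insert d D) (Suc (card (insert d D))) B B2"
  unfolding exp_dependent_def
 proof (intro allI impI)
  fix I :: "'i set" and a :: "'i => 'd => real => real"
  assume I: "finite I" "card I = Suc (card (insert d D))"
   and a: "\<forall>i\<in>I. \<forall>j\<in>insert d D. a i j \<in> exp_sums B"
  have cI: "card I = card D + 2" using I insert by simp
  show "\<exists>c. (\<forall>i\<in>I. c i \<in> exp_sums B2) \<and> (\<exists>i\<in>I. \<exists>t. c i t ~= 0) \<and>
   (\<forall>j\<in>insert d D. \<forall>t. (\<Sum>i\<in>I. c i t * a i j t) = 0)"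
  proof (cases "\<exists>i\<in>I. \<exists>t. a i d t ~= 0")
   case False
   have sub: "exp_sums B \<subseteq> exp_sums (B + (B * B + B * B))" by (rule exp_sums_mono) simp
   obtain k where k: "k \<in> I" using cI by fastforce
   have I': "finite (I - {k})" "card (I - {k}) = Suc (card D)"
    using I(1) cI k by auto
   obtain c i t where c: "!!i. i \<in> I - {k} ==> c i \<in> exp_sums B1" "i \<in> I - {k}" "c i t ~= 0"
    "!!j t. j \<in> D ==> (\<Sum>i\<in>I - {k}. c i t * a i j t) = 0"
    by (rule exp_dependentD[OF B1 I'(1,2), of a]) (use a sub in auto)
   define c' where "c' i = (if i = k then (%_. 0) else c i)" for i
   have "(\<Sum>i\<in>I. c' i t * a i j t) = (\<Sum>i\<in>I - {k}. c i t * a i j t)" for j t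
    using I by (intro sum.mono_neutral_cong_right) (auto simp: c'_def)
   moreover have "exp_sums B1 \<subseteq> exp_sums B2" by (rule exp_sums_mono) (simp add: B2_def)
   moreover have "c' i t ~= 0" using c(2,3) by (auto simp: c'_def)
   moreover have "(\<Sum>i\<in>I - {k}. c i t * a i d t) = 0" for t
    using False by (intro sum.neutral) auto
   moreover have "c' i \<in> exp_sums B2" if "i \<in> I" for i
    using that c(1)[of i] \<open>exp_sums B1 \<subseteq> exp_sums B2\<close> by (auto simp: c'_def exp_sums_zero)
   moreover have "i \<in> I" using c(2) by simp
   ultimately show ?thesis using c(4) by (intro exI[of _ c']) auto
  next
   case True
   then obtain k s where k: "k \<in> I" "a k d s ~= 0" by auto
   define I' where "I' = I - {k}"
   define a' where "a' i j t = a k d t * a i j t + - (a i d t * a k j t)" for i j t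
   have I': "finite I'" "card I' = card D + 1" "k \<notin> I'"
    using I(1) cI k by (auto simp: I'_def)
   have I3: "I = insert k I'" using k by (auto simp: I'_def)
   have I'I: "I' \<subseteq> I" by (auto simp: I'_def)
   have a': "a' i j \<in> exp_sums (B + (B * B + B * B))" if "i \<in> I'" "j \<in> D" for i j
   proof -
    have "a' i j \<in> exp_sums (B * B + B * B)" unfolding a'_def
     by (intro exp_sums_add exp_sums_mult exp_sums_uminus) (use that a k I'I in auto)
    then show ?thesis using exp_sums_mono[of "B * B + B * B" "B + (B * B + B * B)"] by auto
   qed
   obtain c i1 t1 where c: "!!i. i \<in> I' ==> c i \<in> exp_sums B1" "i1 \<in> I'" "c i1 t1 ~= 0"
    "!!j t. j \<in> D ==> (\<Sum>i\<in>I'. c i t * a' i j t) = 0"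
    by (rule exp_dependentD[OF B1, of I' a']) (use I' a' in auto)
   \<comment> \<open>Multiplying the relation among the eliminated vectors by the pivot entry avoids
     division; the coefficient of \<open>k\<close> is then chosen to annihilate the column
     \<open>d\<close>.\<close>
   define c' where "c' i t = (if i = k then - (\<Sum>i\<in>I'. c i t * a i d t) else c i t * a k d t)" for i t
   have s: "(%t. \<Sum>i\<in>H. c i t * a i d t) \<in> exp_sums (card H * (B1 * B))" if "finite H" "H \<subseteq> I'" for H
    using that
   proof (induction H rule: finite_induct)
    case (insert i H)
    have "(%t. c i t * a i d t + (\<Sum>i\<in>H. c i t * a i d t)) \<in> exp_sums (B1 * B + card H * (B1 * B))"
     by (intro exp_sums_add exp_sums_mult) (use insert c a I'I in auto)
    then show ?case using insert by (simp add: algebra_simps)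
   qed (simp add: exp_sums_zero)
   have "c' i \<in> exp_sums B2" if "i \<in> I" for i
   proof (cases "i = k")
    case True
    have "c' i \<in> exp_sums ((card D + 1) * (B1 * B))"
     using exp_sums_uminus[OF s[OF I'(1)]] True I'(2) by (simp add: c'_def[abs_def])
    then show ?thesis
     using exp_sums_mono[of "(card D + 1) * (B1 * B)" B2] by (auto simp: B2_def)
   next
    case False
    have "(%t. c i t * a k d t) \<in> exp_sums (B1 * B)"
     using False that I3 c a k by (intro exp_sums_mult) blast+
    then have "c' i \<in> exp_sums (B1 * B)" using False by (simp add: c'_def[abs_def])
    then show ?thesis using exp_sums_mono[of "B1 * B" B2] by (auto simp: B2_def)
   qed
   \<comment> \<open>The relation stays nontrivial because a product of two nonzero exponential sums
     is nonzero.\<close>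
   moreover have "\<exists>i\<in>I. \<exists>t. c' i t ~= 0"
   proof -
    have "c i1 \<in> exp_sums B1" "a k d \<in> exp_sums B" using c a k by auto
    then obtain t' where "c i1 t' * a k d t' ~= 0"
     using exp_sums_nonzero_mult[of "c i1" B1 t1 "a k d" B s] c(3) k(2) by metis
    then have "c' i1 t' ~= 0" using c(2) I' by (auto simp: c'_def)
    then show ?thesis using c(2) I'I by auto
   qed
   moreover have "(\<Sum>i\<in>I. c' i t * a i j t) = 0" if j: "j \<in> insert d D" for j t
   proof -
    have "(\<Sum>i\<in>I. c' i t * a i j t) = c' k t * a k j t + (\<Sum>i\<in>I'. c' i t * a i j t)"
     using I' by (simp add: I3)
    also have "(\<Sum>i\<in>I'. c' i t * a i j t) = (\<Sum>i\<in>I'. c i t * a k d t * a i j t)"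
     using I' by (intro sum.cong) (auto simp: c'_def)
    also have "c' k t * a k j t = - (\<Sum>i\<in>I'. c i t * a i d t * a k j t)"
     by (simp add: c'_def sum_distrib_right)
    finally have "(\<Sum>i\<in>I. c' i t * a i j t) = (\<Sum>i\<in>I'. c i t * a' i j t)"
     unfolding sum_negf[symmetric] sum.distrib[symmetric]
     by (simp add: a'_def algebra_simps)
    moreover have "(\<Sum>i\<in>I'. c i t * a' i j t) = 0"
     using j c(4) by (cases "j = d") (auto simp: a'_def)
    ultimately show ?thesis by simp
   qed
   ultimately show ?thesis by blast
  qed
 qed
 then show ?case by blast
qed

section \<open>Perron--Frobenius theory\<close>

lemma finite_convergent_subseq:
 fixes x :: "nat => 'v => real"
 assumes "finite V" "!!v. v \<in> V ==> bounded (range (%n. x n v))"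
 obtains s where "strict_mono s" "!!v. v \<in> V ==> convergent (%n. x (s n) v)"
proof -
 have "\<exists>s. strict_mono s \<and> (\<forall>v\<in>V. convergent (%n. x (s n) v))"
  using assms
 proof (induction V rule: finite_induct)
  case empty
  then show ?case by (intro exI[of _ id]) (auto simp: strict_mono_def)
 next
  case (insert v V)
  then obtain s where s: "strict_mono s" "\<forall>v\<in>V. convergent (%n. x (s n) v)" by auto
  have "bounded (range (%n. x (s n) v))"
   by (rule bounded_subset[OF insert.prems[of v]]) auto
  then obtain l s' where s': "strict_mono s'" "((%n. x (s n) v) \<circ> s') \<longlonglongrightarrow> l"
   using bounded_imp_convergent_subsequence by blast
  have "convergent (%n. x ((s \<circ> s') n) u)" if "u \<in> insert v V" for u
  proof (cases "u = v")
   case True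
   then show ?thesis using s'(2) by (auto simp: convergent_def o_def)
  next
   case False
   then have "convergent ((%n. x (s n) u) \<circ> s')"
    using that s(2) s'(1) convergent_subseq_convergent by blast
   then show ?thesis by (simp add: o_def)
  qed
  moreover have "strict_mono (s \<circ> s')" using s(1) s'(1) by (simp add: strict_mono_o)
  ultimately show ?case by blast
 qed
 then show ?thesis using that by blast
qed

text \<open>Irreducibility by cuts: every proper nonempty set of states can be left. This form
  passes easily to transposes and to Schur complements. On a single state the row condition excludes
  the zero matrix.\<close>

definition irreducible :: "'v set => ('v => 'v => real) => bool" where
 "irreducible V L \<longleftrightarrow> finite V \<and> V ~= {} \<and> (\<forall>v\<in>V. \<forall>w\<in>V. 0 \<le> L v w)
  \<and> (\<forall>v\<in>V. \<exists>w\<in>V. L v w > 0)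
  \<and> (\<forall>S. S \<subseteq> V --> S ~= {} --> S ~= V --> (\<exists>v\<in>S. \<exists>w\<in>V - S. L v w > 0))"

definition pos_eigen :: "'v set => ('v => 'v => real) => real => ('v => real) => bool" where
 "pos_eigen V L c r \<longleftrightarrow> (\<forall>v\<in>V. r v > 0 \<and> (\<Sum>w\<in>V. L v w * r w) = c * r v)"

lemma irreducibleD:
 assumes "irreducible V L"
 shows "finite V" "V ~= {}" "!!v w. v \<in> V ==> w \<in> V ==> 0 \<le> L v w"
  "!!v. v \<in> V ==> \<exists>w\<in>V. L v w > 0"
  "!!S. S \<subseteq> V ==> S ~= {} ==> S ~= V ==> \<exists>v\<in>S. \<exists>w\<in>V - S. L v w > 0"
 using assms by (simp_all add: irreducible_def)

lemma irreducible_transpose: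
 assumes "irreducible V L" shows "irreducible V (%v w. L w v)"
proof -
 note D = irreducibleD[OF assms]
 have cut: "\<exists>v\<in>S. \<exists>w\<in>V - S. L w v > 0" if S: "S \<subseteq> V" "S ~= {}" "S ~= V" for S
 proof -
  have "\<exists>v\<in>V - S. \<exists>w\<in>V - (V - S). L v w > 0" by (rule D(5)) (use S in auto)
  then show ?thesis using S by blast
 qed
 have row: "\<exists>w\<in>V. L w v > 0" if "v \<in> V" for v
 proof (cases "V = {v}")
  case True
  then show ?thesis using D(4)[of v] by auto
 next
  case False
  then show ?thesis using cut[of "{v}"] that by auto
 qed
 show ?thesis unfolding irreducible_def using D(1-3) cut row by auto
qed

lemma row_sum_pos:
 assumes "irreducible V L" "!!w. w \<in> V ==> x w > 0" "v \<in> V"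
 shows "(\<Sum>w\<in>V. L v w * x w) > 0"
proof -
 note D = irreducibleD[OF assms(1)]
 obtain w where w: "w \<in> V" "L v w > 0" using D(4) assms(3) by blast
 show ?thesis
  by (rule sum_pos2[OF D(1) w(1)])
   (use assms w D(3) in \<open>auto intro!: mult_pos_pos mult_nonneg_nonneg simp: less_imp_le\<close>)
qed

text \<open>The infimum \<open>l\<close> of the numbers \<open>c\<close> with a positive vector
  satisfying \<open>L x \<le> c x\<close> is attained, by compactness. Among the vectors attaining
  it, one with the most strict inequalities cannot have all of them strict, as \<open>c\<close>
  could be lowered, nor only some, as strictness spreads along transitions; so it is an
  eigenvector.\<close>

lemma perron_frobenius:
 assumes irr: "irreducible V L"
 obtains c r where "c > 0" "pos_eigen V L c r"
proof -
 note D = irreducibleD[OF irr]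
 define sub where "sub c x \<longleftrightarrow> (\<forall>v\<in>V. x v > 0 \<and> (\<Sum>w\<in>V. L v w * x w) \<le> c * x v)" for c x
 define Cs where "Cs = {c. \<exists>x. sub c x}"
 have pos: "c > 0" if "sub c x" for c x
 proof -
  obtain v where v: "v \<in> V" using D(2) by auto
  have "0 < (\<Sum>w\<in>V. L v w * x w)"
   by (rule row_sum_pos[OF irr _ v]) (use that in \<open>auto simp: sub_def\<close>)
  also have "\<dots> \<le> c * x v" using that v by (auto simp: sub_def)
  finally show ?thesis using that v by (auto simp: sub_def zero_less_mult_iff)
 qed
 have "sub (\<Sum>v\<in>V. \<Sum>w\<in>V. L v w) (%_. 1)"
 proof -
  have "(\<Sum>w\<in>V. L v w) \<le> (\<Sum>v\<in>V. \<Sum>w\<in>V. L v w)" if "v \<in> V" for v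
   by (rule member_le_sum[of v V "%v. \<Sum>w\<in>V. L v w"]) (use that D in \<open>auto intro!: sum_nonneg\<close>)
  then show ?thesis by (auto simp: sub_def)
 qed
 then have ne: "Cs ~= {}" by (auto simp: Cs_def)
 have bdd: "bdd_below Cs" using pos by (auto simp: Cs_def bdd_below_def intro!: exI[of _ 0] less_imp_le)
 define l where "l = Inf Cs"
 have "\<exists>x. sub (l + 1 / Suc n) x \<and> (\<Sum>v\<in>V. x v) = 1" for n
 proof -
  have "Inf Cs < l + 1 / Suc n" by (simp add: l_def)
  then obtain c where c: "c \<in> Cs" "c < l + 1 / Suc n" using cInf_lessD[OF ne] by blast
  then obtain x where x: "sub c x" by (auto simp: Cs_def)
  define s where "s = (\<Sum>v\<in>V. x v)"
  have s: "s > 0" using x D by (auto simp: s_def sub_def intro!: sum_pos)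
  have "(\<Sum>w\<in>V. L v w * (x w / s)) \<le> (l + 1 / Suc n) * (x v / s)" if "v \<in> V" for v
  proof -
   have "(\<Sum>w\<in>V. L v w * (x w / s)) = (\<Sum>w\<in>V. L v w * x w) / s"
    by (simp add: sum_divide_distrib)
   also have "\<dots> \<le> (c * x v) / s" using x that s by (intro divide_right_mono) (auto simp: sub_def)
   also have "\<dots> \<le> ((l + 1 / Suc n) * x v) / s"
    using x that s c by (intro divide_right_mono mult_right_mono) (auto simp: sub_def less_imp_le)
   finally show ?thesis by simp
  qed
  then have "sub (l + 1 / Suc n) (%v. x v / s)" using x s by (auto simp: sub_def)
  moreover have "(\<Sum>v\<in>V. x v / s) = 1" using s by (simp add: s_def flip: sum_divide_distrib)
  ultimately show ?thesis by blast
 qed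
 then obtain X where X: "!!n. sub (l + 1 / Suc n) (X n)" "!!n. (\<Sum>v\<in>V. X n v) = 1" by metis
 have X01: "0 < X n v \<and> X n v \<le> 1" if "v \<in> V" for n v
 proof -
  have p: "!!v. v \<in> V ==> 0 < X n v" using X(1)[of n] by (auto simp: sub_def)
  have "X n v \<le> (\<Sum>v\<in>V. X n v)"
   by (rule member_le_sum) (use that D p in \<open>auto simp: less_imp_le\<close>)
  then show ?thesis using p[OF that] X(2) by simp
 qed
 have bd: "bounded (range (%n. X n v))" if "v \<in> V" for v
  using X01[OF that] by (intro boundedI[of _ 1]) (auto simp: abs_le_iff less_imp_le intro: order_trans[of _ 0])
 obtain s where s: "strict_mono s" "!!v. v \<in> V ==> convergent (%n. X (s n) v)"
  by (rule finite_convergent_subseq[OF D(1), of X]) (use bd in auto)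
 define x where "x v = lim (%n. X (s n) v)" for v
 have x: "(%n. X (s n) v) \<longlonglongrightarrow> x v" if "v \<in> V" for v
  using s(2)[OF that] by (simp add: x_def convergent_LIMSEQ_iff)
 have x0: "x v \<ge> 0" if "v \<in> V" for v
  by (rule LIMSEQ_le_const[OF x[OF that]]) (use X01[OF that] in \<open>auto simp: less_imp_le\<close>)
 have xle: "(\<Sum>w\<in>V. L v w * x w) \<le> l * x v" if "v \<in> V" for v
 proof (rule LIMSEQ_le)
  show "(%n. \<Sum>w\<in>V. L v w * X (s n) w) \<longlonglongrightarrow> (\<Sum>w\<in>V. L v w * x w)"
   by (intro tendsto_intros x)
  have "(%n. l + 1 / Suc (s n)) \<longlonglongrightarrow> l + 0"
   using LIMSEQ_subseq_LIMSEQ[OF LIMSEQ_inverse_real_of_nat s(1)]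
   by (intro tendsto_add tendsto_const) (simp add: o_def inverse_eq_divide)
  then show "(%n. (l + 1 / Suc (s n)) * X (s n) v) \<longlonglongrightarrow> l * x v"
   by (intro tendsto_mult x that) simp
  show "\<exists>N. \<forall>n\<ge>N. (\<Sum>w\<in>V. L v w * X (s n) w) \<le> (l + 1 / Suc (s n)) * X (s n) v"
   using X(1) that by (auto simp: sub_def)
 qed
 have xsum: "(\<Sum>v\<in>V. x v) = 1"
 proof (rule LIMSEQ_unique)
  show "(%n. \<Sum>v\<in>V. X (s n) v) \<longlonglongrightarrow> (\<Sum>v\<in>V. x v)" by (intro tendsto_intros x)
  show "(%n. \<Sum>v\<in>V. X (s n) v) \<longlonglongrightarrow> 1" by (simp add: X(2))
 qed
 \<comment> \<open>If the limit vector had zeros, a transition would lead from one of them to a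
   state with a positive entry, which subinvariance forbids.\<close>
 have xpos: "x v > 0" if "v \<in> V" for v
 proof (rule ccontr)
  assume "\<not> x v > 0"
  define S where "S = {v \<in> V. x v = 0}"
  have "S ~= {}" using that x0[OF that] \<open>\<not> x v > 0\<close> by (auto simp: S_def)
  moreover have "S ~= V" using xsum unfolding S_def by (metis (mono_tags, lifting) mem_Collect_eq sum.neutral zero_neq_one)
  ultimately obtain a b where ab: "a \<in> S" "b \<in> V - S" "L a b > 0"
   using D(5)[of S] by (auto simp: S_def)
  then have "0 < L a b * x b" using x0[of b] by (auto simp: S_def less_le)
  also have "\<dots> \<le> (\<Sum>w\<in>V. L a w * x w)"
   using ab D x0 by (intro member_le_sum) (auto simp: S_def)
  also have "\<dots> \<le> l * x a" using xle[of a] ab by (auto simp: S_def)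
  finally show False using ab by (auto simp: S_def)
 qed
 have subl: "sub l x" using xpos xle by (simp add: sub_def)
 have lpos: "l > 0" using pos subl by blast
 define strict where "strict x = {v \<in> V. (\<Sum>w\<in>V. L v w * x w) < l * x v}" for x
 have "card (strict x) \<le> card V" for x using D(1) by (auto simp: strict_def intro: card_mono)
 then obtain y where y: "sub l y" "!!z. sub l z ==> card (strict z) \<le> card (strict y)"
  using ex_has_greatest_nat[of "sub l" x "%x. card (strict x)" "Suc (card V)"] subl
  by (metis le_imp_less_Suc)
 have "strict y ~= V"
 proof
  assume all: "strict y = V"
  define c where "c = Max ((%v. (\<Sum>w\<in>V. L v w * y w) / y v) ` V)"
  have "c < l" unfolding c_def
   using all y(1) D by (subst Max_less_iff) (auto simp: strict_def sub_def pos_divide_less_eq)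
  have "(\<Sum>w\<in>V. L v w * y w) / y v \<le> c" if "v \<in> V" for v
   unfolding c_def using D that by (intro Max_ge) auto
  then have "sub c y" using y(1) by (auto simp: sub_def pos_divide_le_eq)
  then have "l \<le> c" unfolding l_def by (intro cInf_lower[OF _ bdd]) (auto simp: Cs_def)
  then show False using \<open>c < l\<close> by simp
 qed
 moreover have "strict y ~= {} ==> strict y = V"
 proof (rule ccontr)
  assume S: "strict y ~= {}" "strict y ~= V"
  have "\<exists>v\<in>V - strict y. \<exists>w\<in>V - (V - strict y). L v w > 0"
   by (rule D(5)) (use S in \<open>auto simp: strict_def\<close>)
  then obtain v w where vw: "v \<in> V" "v \<notin> strict y" "w \<in> strict y" "L v w > 0" by blast
  have wV: "w \<in> V" using vw by (auto simp: strict_def)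
  \<comment> \<open>Half of the slack at \<open>w\<close>, in units of \<open>l\<close>: after
    lowering \<open>y w\<close> by \<open>e\<close> the inequality at \<open>w\<close> is still
    strict, and the one at \<open>v\<close>, which has a transition to \<open>w\<close>, becomes
    strict.\<close>
  define e where "e = (l * y w - (\<Sum>u\<in>V. L w u * y u)) / (2 * l)"
  have e: "e > 0" "l * (y w - e) > (\<Sum>u\<in>V. L w u * y u)"
   using vw(3) lpos by (auto simp: e_def strict_def field_simps)
  define z where "z = y(w := y w - e)"
  have zsum: "(\<Sum>u\<in>V. L a u * z u) = (\<Sum>u\<in>V. L a u * y u) - e * L a w" if "a \<in> V" for a
  proof -
   have "(\<Sum>u\<in>V. L a u * z u) = (\<Sum>u\<in>V. L a u * y u - (if u = w then e * L a w else 0))"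
    by (intro sum.cong) (auto simp: z_def algebra_simps)
   then show ?thesis using D(1) wV by (simp add: sum_subtractf)
  qed
  have le: "(\<Sum>u\<in>V. L a u * z u) \<le> (\<Sum>u\<in>V. L a u * y u)" if "a \<in> V" for a
   using zsum[OF that] e D(3)[OF that wV] by simp
  have zw: "(\<Sum>u\<in>V. L w u * z u) < l * z w" using le[OF wV] e by (simp add: z_def)
  have "0 < (\<Sum>u\<in>V. L w u * y u)"
   by (rule row_sum_pos[OF irr _ wV]) (use y(1) in \<open>auto simp: sub_def\<close>)
  then have "0 < l * (y w - e)" using e by linarith
  then have zpos: "z a > 0" if "a \<in> V" for a
   using that y(1) lpos by (auto simp: z_def sub_def zero_less_mult_iff)
  have "sub l z" unfolding sub_def
  proof (intro ballI conjI zpos)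
   fix a assume a: "a \<in> V"
   show "(\<Sum>u\<in>V. L a u * z u) \<le> l * z a"
    using le[OF a] y(1) a zw by (cases "a = w") (auto simp: sub_def z_def)
  qed
  have "insert v (strict y) \<subseteq> strict z"
  proof
   fix a assume a: "a \<in> insert v (strict y)"
   then have aV: "a \<in> V" using vw by (auto simp: strict_def)
   show "a \<in> strict z"
   proof (cases "a = w")
    case True
    then show ?thesis using zw wV by (auto simp: strict_def)
   next
    case False
    have "(\<Sum>u\<in>V. L a u * z u) < l * y a"
    proof (cases "a = v")
     case True
     have "(\<Sum>u\<in>V. L v u * y u) \<le> l * y v" using y(1) vw by (auto simp: sub_def)
     moreover have "e * L v w > 0" using e vw by simp
     ultimately show ?thesis using zsum[OF aV] True by simp
    next
     case False
     then show ?thesis using a le[OF aV] by (auto simp: strict_def)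
    qed
    then show ?thesis using False aV by (auto simp: strict_def z_def)
   qed
  qed
  then have "card (insert v (strict y)) \<le> card (strict z)"
   using D(1) by (intro card_mono) (auto simp: strict_def)
  moreover have "finite (strict y)" using D(1) by (auto simp: strict_def)
  ultimately show False using y(2)[OF \<open>sub l z\<close>] vw(2) by simp
 qed
 ultimately have "strict y = {}" by blast
 then have "pos_eigen V L l y" using y(1) unfolding pos_eigen_def sub_def strict_def
  by (auto simp: order.order_iff_strict)
 then show ?thesis using that lpos by blast
qed

lemma eigen_pairing:
 fixes c :: real
 assumes "finite V" "!!v. v \<in> V ==> (\<Sum>w\<in>V. L v w * r w) = c * r v"
 shows "(\<Sum>v\<in>V. l v * (\<Sum>w\<in>V. L v w * r w)) = c * (\<Sum>v\<in>V. l v * r v)"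
 unfolding sum_distrib_left[of c] using assms by (intro sum.cong) auto

text \<open>Pairing a right with a left eigenvector evaluates to both eigenvalues times the same
  positive number. With the left one held fixed, this also makes the eigenvalue of a positive right
  eigenvector unique.\<close>

lemma pos_eigen_transpose_eq:
 assumes V: "finite V" "V ~= {}" and r: "pos_eigen V L c r"
  and l: "pos_eigen V (%v w. L w v) d l"
 shows "c = d"
proof -
 have "(\<Sum>v\<in>V. l v * (\<Sum>w\<in>V. L v w * r w)) = c * (\<Sum>v\<in>V. l v * r v)"
  by (rule eigen_pairing) (use V r in \<open>auto simp: pos_eigen_def\<close>)
 moreover have "(\<Sum>w\<in>V. r w * (\<Sum>v\<in>V. L v w * l v)) = d * (\<Sum>w\<in>V. r w * l w)"
  by (rule eigen_pairing[where L = "%v w. L w v"]) (use V l in \<open>auto simp: pos_eigen_def\<close>)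
 moreover have "(\<Sum>v\<in>V. l v * (\<Sum>w\<in>V. L v w * r w)) = (\<Sum>w\<in>V. r w * (\<Sum>v\<in>V. L v w * l v))"
  unfolding sum_distrib_left by (subst sum.swap) (simp add: mult_ac)
 moreover have "(\<Sum>v\<in>V. l v * r v) > 0"
  using V r l by (intro sum_pos) (auto simp: pos_eigen_def)
 ultimately show ?thesis by (simp add: mult.commute)
qed

section \<open>The Perron eigenvalue and its eigenvectors\<close>

definition pf_val :: "'v set => ('v => 'v => real) => real" where
 "pf_val V L = (THE c. \<exists>r. pos_eigen V L c r)"

definition pf_vec :: "'v set => ('v => 'v => real) => 'v => real" where
 "pf_vec V L = (SOME r. pos_eigen V L (pf_val V L) r)"

lemma pf_val_eqI:
 assumes "irreducible V L" "pos_eigen V L c r" shows "pf_val V L = c"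
proof -
 note D = irreducibleD[OF assms(1)]
 obtain d l where l: "pos_eigen V (%v w. L w v) d l"
  using perron_frobenius[OF irreducible_transpose[OF assms(1)]] by blast
 show ?thesis unfolding pf_val_def
  using pos_eigen_transpose_eq[OF D(1,2) _ l] assms(2) by (intro the_equality) blast+
qed

lemma pf_vec:
 assumes "irreducible V L" shows "pos_eigen V L (pf_val V L) (pf_vec V L)"
proof -
 obtain c r where "pos_eigen V L c r" using perron_frobenius[OF assms] by blast
 with pf_val_eqI[OF assms this] have "pos_eigen V L (pf_val V L) r" by simp
 then show ?thesis unfolding pf_vec_def by (rule someI[of "pos_eigen V L (pf_val V L)"])
qed

lemma pf_vec_pos: "irreducible V L ==> v \<in> V ==> pf_vec V L v > 0"
 using pf_vec[of V L] by (simp add: pos_eigen_def)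

lemma pf_vec_eq:
 "irreducible V L ==> v \<in> V ==> (\<Sum>w\<in>V. L v w * pf_vec V L w) = pf_val V L * pf_vec V L v"
 using pf_vec[of V L] by (simp add: pos_eigen_def)

lemma pf_val_pos:
 assumes "irreducible V L" shows "pf_val V L > 0"
proof -
 obtain c r where "c > 0" "pos_eigen V L c r" by (rule perron_frobenius[OF assms])
 then show ?thesis using pf_val_eqI[OF assms] by simp
qed

lemma pf_val_transpose:
 assumes "irreducible V L" shows "pf_val V (%v w. L w v) = pf_val V L"
 using pos_eigen_transpose_eq[OF irreducibleD(1,2)[OF assms] pf_vec[OF assms]
   pf_vec[OF irreducible_transpose[OF assms]]] by simp

definition pf_left :: "'v set => ('v => 'v => real) => 'v => real" where
 "pf_left V L = pf_vec V (%v w. L w v)"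

lemma pf_left_pos: "irreducible V L ==> v \<in> V ==> pf_left V L v > 0"
 unfolding pf_left_def by (rule pf_vec_pos[OF irreducible_transpose])

lemma pf_left_eq:
 assumes "irreducible V L" "w \<in> V"
 shows "(\<Sum>v\<in>V. pf_left V L v * L v w) = pf_val V L * pf_left V L w"
 using pf_vec_eq[OF irreducible_transpose[OF assms(1)] assms(2)]
 unfolding pf_left_def pf_val_transpose[OF assms(1)] by (simp only: mult.commute)

text \<open>The left eigenvector of \<open>L'\<close> is paired with the right eigenvector of
  \<open>L\<close>. The factor \<open>d\<close> is what later yields continuity of the eigenvalue in
  the inverse temperature.\<close>

lemma pf_val_mono:
 assumes irr: "irreducible V L" and irr': "irreducible V L'"
  and le: "!!v w. v \<in> V ==> w \<in> V ==> L' v w \<le> d * L v w"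
 shows "pf_val V L' \<le> d * pf_val V L"
proof -
 let ?l = "pf_left V L'" and ?r = "pf_vec V L"
 note D = irreducibleD[OF irr]
 have s: "(\<Sum>v\<in>V. ?l v * ?r v) > 0"
  using D by (intro sum_pos mult_pos_pos pf_left_pos[OF irr'] pf_vec_pos[OF irr]) auto
 have "pf_val V L' * (\<Sum>w\<in>V. ?l w * ?r w) = (\<Sum>w\<in>V. (\<Sum>v\<in>V. ?l v * L' v w) * ?r w)"
  unfolding sum_distrib_left[of "pf_val V L'"]
  by (intro sum.cong refl) (simp add: pf_left_eq[OF irr'])
 also have "\<dots> \<le> (\<Sum>w\<in>V. (\<Sum>v\<in>V. ?l v * (d * L v w)) * ?r w)"
  by (intro sum_mono mult_right_mono mult_left_mono le less_imp_le[OF pf_left_pos[OF irr']]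
    less_imp_le[OF pf_vec_pos[OF irr]])
 also have "\<dots> = (\<Sum>v\<in>V. ?l v * (d * (\<Sum>w\<in>V. L v w * ?r w)))"
  unfolding sum_distrib_left sum_distrib_right
  by (subst sum.swap) (intro sum.cong refl, simp only: mult_ac)
 also have "\<dots> = d * pf_val V L * (\<Sum>v\<in>V. ?l v * ?r v)"
  unfolding sum_distrib_left[of "d * pf_val V L"]
  by (intro sum.cong refl) (simp add: pf_vec_eq[OF irr])
 finally show ?thesis using s by simp
qed

text \<open>Subtract from \<open>x\<close> the largest multiple of \<open>p\<close> below it. The
  remainder is nonnegative and vanishes somewhere; if it were positive elsewhere, positivity would
  flow along a transition into a zero.\<close>

lemma left_eigen_unique:
 assumes irr: "irreducible V L" and c: "c > 0"
  and p: "!!w. w \<in> V ==> p w > 0" "!!w. w \<in> V ==> (\<Sum>v\<in>V. p v * L v w) = c * p w"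
  and x: "!!w. w \<in> V ==> (\<Sum>v\<in>V. x v * L v w) = c * x w"
 obtains d where "!!v. v \<in> V ==> x v = d * p v"
proof -
 note D = irreducibleD[OF irr]
 define d where "d = Min ((%v. x v / p v) ` V)"
 have "d \<in> (%v. x v / p v) ` V" unfolding d_def using D by (intro Min_in) auto
 then obtain u where u: "u \<in> V" "d = x u / p u" by auto
 define z where "z v = x v - d * p v" for v
 have z0: "z v \<ge> 0" if "v \<in> V" for v
 proof -
  have "d \<le> x v / p v" unfolding d_def using D that by (intro Min_le) auto
  then show ?thesis using p(1)[OF that] by (simp add: z_def pos_le_divide_eq)
 qed
 have zu: "z u = 0" using u p(1)[of u] by (simp add: z_def)
 have zeq: "(\<Sum>v\<in>V. z v * L v w) = c * z w" if "w \<in> V" for w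
 proof -
  have "(\<Sum>v\<in>V. z v * L v w) = (\<Sum>v\<in>V. x v * L v w) - d * (\<Sum>v\<in>V. p v * L v w)"
   by (simp add: z_def left_diff_distrib sum_subtractf sum_distrib_left mult.assoc)
  then show ?thesis using p(2)[OF that] x[OF that] by (simp add: z_def algebra_simps)
 qed
 define S where "S = {v \<in> V. z v > 0}"
 have "S = {}"
 proof (rule ccontr)
  assume "S ~= {}"
  moreover have "u \<notin> S" using zu by (simp add: S_def)
  then have "S ~= V" using u by blast
  ultimately obtain v w where vw: "v \<in> S" "w \<in> V - S" "L v w > 0"
   using D(5)[of S] by (auto simp: S_def)
  have "0 < z v * L v w" using vw by (auto simp: S_def)
  also have "\<dots> \<le> (\<Sum>v\<in>V. z v * L v w)"
   by (rule member_le_sum[where f = "%v. z v * L v w"])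
    (use vw D z0 in \<open>auto simp: S_def intro!: mult_nonneg_nonneg\<close>)
  also have "\<dots> = c * z w" using zeq vw by auto
  finally have "z w > 0" using c by (simp add: zero_less_mult_iff)
  then show False using vw by (auto simp: S_def)
 qed
 then have "z v = 0" if "v \<in> V" for v using z0[OF that] that by (auto simp: S_def less_le)
 then show ?thesis using that[of d] by (auto simp: z_def)
qed

text \<open>Field operations on functions, with division only by functions that vanish nowhere.
  State elimination uses nothing else about the entries.\<close>

definition field_closed :: "('a => real) set => bool" where
 "field_closed F \<longleftrightarrow> (\<forall>c::int. (%_. of_int c) \<in> F)
  \<and> (\<forall>f\<in>F. \<forall>g\<in>F. (%a. f a + g a) \<in> F \<and> (%a. f a * g a) \<in> F
     \<and> ((\<forall>a. g a ~= 0) --> (%a. f a / g a) \<in> F))"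

lemma field_closed:
 assumes "field_closed F"
 shows "(%_. of_int c) \<in> F" "f \<in> F ==> g \<in> F ==> (%a. f a + g a) \<in> F"
  "f \<in> F ==> g \<in> F ==> (%a. f a * g a) \<in> F"
  "f \<in> F ==> g \<in> F ==> (!!a. g a ~= 0) ==> (%a. f a / g a) \<in> F"
  "f \<in> F ==> g \<in> F ==> (%a. f a - g a) \<in> F"
proof -
 show mult: "(%a. f a * g a) \<in> F" if "f \<in> F" "g \<in> F" for f g
  using assms that by (simp add: field_closed_def)
 show add: "(%a. f a + g a) \<in> F" if "f \<in> F" "g \<in> F" for f g
  using assms that by (simp add: field_closed_def)
 show const: "(%_. of_int c) \<in> F" for c using assms by (simp add: field_closed_def)
 show "(%a. f a / g a) \<in> F" if "f \<in> F" "g \<in> F" "!!a. g a ~= 0"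
  using assms that by (simp add: field_closed_def)
 show "(%a. f a - g a) \<in> F" if "f \<in> F" "g \<in> F"
  using add[OF that(1) mult[OF const[of "-1"] that(2)]] by simp
qed

lemma field_closed_sum:
 assumes "field_closed F" "finite I" "!!i. i \<in> I ==> f i \<in> F"
 shows "(%a. \<Sum>i\<in>I. f i a) \<in> F"
 using assms(2,3)
proof (induction I rule: finite_induct)
 case empty
 then show ?case using field_closed(1)[OF assms(1), of 0] by simp
next
 case (insert i I)
 then show ?case using field_closed(2)[OF assms(1), of "f i"] by simp
qed

text \<open>State elimination: deleting the state \<open>v\<close> replaces \<open>L\<close> by its Schur complement
 \<open>L x y + L x v L v y / (% - L v v)\<close>, which has the same eigenvector on the remaining states.\<close>
lemma eigen_ratio_closed:
 assumes F: "field_closed F" and lam: "lam \<in> F"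
  and irr: "!!a. irreducible V (L a)" and L: "!!v w. v \<in> V ==> w \<in> V ==> (%a. L a v w) \<in> F"
  and r: "!!a. pos_eigen V (L a) (lam a) (r a)" and uw: "u \<in> V" "w \<in> V"
 shows "(%a. r a u / r a w) \<in> F"
proof (cases "u = w")
 case True
 have "r a w ~= 0" for a using r[of a] uw by (auto simp: pos_eigen_def)
 then have "(%a. r a u / r a w) = (%_. of_int 1)" using True by auto
 then show ?thesis using field_closed(1)[OF F, of 1] by simp
next
 case uneq: False
 have "card V \<ge> 2"
 proof -
  have "card {u, w} \<le> card V"
   using uw irreducibleD(1)[OF irr] by (intro card_mono) auto
  then show ?thesis using uneq by simp
 qed
 then show ?thesis using irr L r uw
 \<comment> \<open>Elimination ends with the two states \<open>u\<close> and \<open>w\<close>, where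
   the eigenvector equation at \<open>u\<close> alone determines the ratio.\<close>
 proof (induction "card V" arbitrary: V L rule: nat_induct_at_least)
  case base
  have fin: "finite V" using irreducibleD(1)[OF base(2)] .
  have V: "V = {u, w}"
   using card_subset_eq[OF fin, of "{u, w}"] base uneq by simp
  have eq: "L a u u * r a u + L a u w * r a w = lam a * r a u" for a
   using base(4)[of a] uneq V by (simp add: pos_eigen_def)
  have pos: "r a u > 0" "r a w > 0" for a using base(4)[of a] V by (auto simp: pos_eigen_def)
  have Lp: "L a u w > 0" for a
   using irreducibleD(5)[OF base(2)[of a], of "{u}"] V uneq by auto
  have "L a u w * r a w > 0" for a using Lp pos by simp
  then have gt: "(lam a - L a u u) * r a u > 0" for a using eq[of a]
   by (simp add: left_diff_distrib) (metis add_diff_cancel_left' diff_gt_0_iff_gt)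
  have nz: "lam a - L a u u ~= 0" for a using gt[of a] by auto
  have "r a u / r a w = L a u w / (lam a - L a u u)" for a
   using eq[of a] nz[of a] pos[of a] by (simp add: field_simps)
  moreover have "(%a. L a u w / (lam a - L a u u)) \<in> F"
   by (intro field_closed(4,5)[OF F] lam base(3) nz) (use V in auto)
  ultimately show ?case by simp
 next
  case (Suc n)
  have fin: "finite V" using irreducibleD(1)[OF Suc(4)] .
  have "V ~= {u, w}"
  proof
   assume "V = {u, w}"
   then have "card V = 2" using uneq by simp
   then show False using Suc(1,3) by simp
  qed
  then obtain v where v: "v \<in> V" "v ~= u" "v ~= w" using Suc(7,8) by blast
  define V' where "V' = V - {v}"
  have V': "finite V'" "V = insert v V'" "v \<notin> V'" "card V' = n" "u \<in> V'" "w \<in> V'" "V' \<subseteq> V"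
   using fin v Suc(3,7,8) by (auto simp: V'_def)
  have pos: "r a x > 0" if "x \<in> V" for a x using Suc(6)[of a] that by (auto simp: pos_eigen_def)
  have eq: "(\<Sum>y\<in>V'. L a x y * r a y) + L a x v * r a v = lam a * r a x" if "x \<in> V" for a x
   using Suc(6)[of a] that V'(1,3) unfolding pos_eigen_def V'(2) by (auto simp: add.commute)
  have nonneg: "L a x y \<ge> 0" if "x \<in> V" "y \<in> V" for a x y
   using irreducibleD(3)[OF Suc(4)] that by blast
  \<comment> \<open>The pivot is positive because \<open>v\<close> has a transition to another
    state, so the division is by a function without zeros.\<close>
  have gt: "lam a - L a v v > 0" for a
  proof -
   have "\<exists>s\<in>{v}. \<exists>y\<in>V - {v}. L a s y > 0"
    by (rule irreducibleD(5)[OF Suc(4)]) (use v Suc(7) in auto)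
   then obtain y where y: "y \<in> V'" "L a v y > 0" by (auto simp: V'_def)
   have "(\<Sum>y\<in>V'. L a v y * r a y) > 0"
    by (rule sum_pos2[OF V'(1) y(1)])
     (use y pos nonneg v V' in \<open>auto intro!: mult_nonneg_nonneg simp: less_imp_le\<close>)
   then have "(lam a - L a v v) * r a v > 0" using eq[OF v(1), of a] by (simp add: algebra_simps)
   then show ?thesis using pos[OF v(1), of a] by (simp add: zero_less_mult_iff)
  qed
  define L' where "L' a x y = L a x y + L a x v * L a v y / (lam a - L a v v)" for a x y
  have ge: "L' a x y \<ge> L a x y" if "x \<in> V'" "y \<in> V'" for a x y
   using nonneg[of x v a] nonneg[of v y a] gt[of a] that V' v
   by (auto simp: L'_def intro!: divide_nonneg_pos mult_nonneg_nonneg)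
  \<comment> \<open>A cut of \<open>V'\<close> crossed in \<open>L\<close> only by way of
    \<open>v\<close> is crossed directly in the Schur complement.\<close>
  have cut: "\<exists>x\<in>S. \<exists>y\<in>V' - S. L' a x y > 0" if S: "S \<subseteq> V'" "S ~= {}" "S ~= V'" for S a
  proof (cases "\<exists>x\<in>S. \<exists>y\<in>V' - S. L a x y > 0")
   case True
   then show ?thesis using ge S by (meson DiffD1 less_le_trans subsetD)
  next
   case False
   have "\<exists>x\<in>S. \<exists>y\<in>V - S. L a x y > 0"
    by (rule irreducibleD(5)[OF Suc(4)]) (use S V' in auto)
   then obtain x where x: "x \<in> S" "L a x v > 0" using False by (auto simp: V'_def)
   have "\<exists>x\<in>insert v S. \<exists>y\<in>V - insert v S. L a x y > 0"
    by (rule irreducibleD(5)[OF Suc(4)]) (use S V' in auto)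
   then obtain y where y: "y \<in> V' - S" "L a v y > 0" using False by (auto simp: V'_def)
   have "L a x y \<ge> 0" using nonneg x y S V' by blast
   moreover have "L a x v * L a v y / (lam a - L a v v) > 0" using x y gt[of a] by simp
   ultimately have "L' a x y > 0" by (simp add: L'_def)
   then show ?thesis using x y by blast
  qed
  have irr': "irreducible V' (L' a)" for a unfolding irreducible_def
  proof (intro conjI ballI allI impI cut)
   fix x y assume "x \<in> V'" "y \<in> V'"
   then have "0 \<le> L a x y" using nonneg V'(7) by blast
   then show "0 \<le> L' a x y" using ge[OF \<open>x \<in> V'\<close> \<open>y \<in> V'\<close>, of a] by linarith
  next
   fix x assume "x \<in> V'"
   moreover have "{x} ~= V'" using V'(5,6) uneq by auto
   ultimately show "\<exists>y\<in>V'. L' a x y > 0" using cut[of "{x}" a] by auto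
  qed (use V' in auto)
  have "pos_eigen V' (L' a) (lam a) (r a)" for a unfolding pos_eigen_def
  proof (intro ballI conjI)
   fix x assume x: "x \<in> V'"
   then show "r a x > 0" using pos V'(7) by blast
   have "(\<Sum>y\<in>V'. L a v y * r a y) = (lam a - L a v v) * r a v"
    using eq[OF v(1), of a] by (simp add: algebra_simps)
   then have "L a x v / (lam a - L a v v) * (\<Sum>y\<in>V'. L a v y * r a y) = L a x v * r a v"
    using gt[of a] by (simp only:) simp
   moreover have "(\<Sum>y\<in>V'. L' a x y * r a y) = (\<Sum>y\<in>V'. L a x y * r a y)
     + L a x v / (lam a - L a v v) * (\<Sum>y\<in>V'. L a v y * r a y)"
    unfolding L'_def sum_distrib_left sum.distrib[symmetric]
    by (intro sum.cong refl) (simp add: distrib_right)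
   ultimately show "(\<Sum>y\<in>V'. L' a x y * r a y) = lam a * r a x"
    using eq[of x a] x V'(7) by auto
  qed
  moreover have "(%a. L' a x y) \<in> F" if "x \<in> V'" "y \<in> V'" for x y
  proof -
   have "(%a. L a x y) \<in> F" "(%a. L a x v) \<in> F" "(%a. L a v y) \<in> F" "(%a. L a v v) \<in> F"
    using Suc(5) that V'(7) v(1) by blast+
   moreover have "lam a - L a v v ~= 0" for a using gt[of a] by simp
   ultimately show ?thesis unfolding L'_def by (intro field_closed[OF F] lam) auto
  qed
  ultimately show ?case using Suc(2)[of V' L'] V' irr' by simp
 qed
qed

section \<open>Families of algebraic functions of exponential sums\<close>

text \<open>That the number \<open>B\<close> of terms is independent of \<open>p\<close> is what leaves finitely many limits over
 all \<open>p\<close>.\<close>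
definition exp_families :: "('p \<times> real => real) set" where
 "exp_families = {e. \<exists>B. \<forall>p. (%t. e (p, t)) \<in> exp_sums B}"

lemma exp_families_zero: "(%_. 0) \<in> exp_families"
 unfolding exp_families_def using exp_sums_zero by auto

lemma exp_families_one: "(%_. 1) \<in> exp_families"
 unfolding exp_families_def using exp_sums_one by auto

lemma exp_families_uminus: "e \<in> exp_families ==> (%a. - e a) \<in> exp_families"
 unfolding exp_families_def using exp_sums_uminus by blast

lemma exp_families_add:
 assumes "e \<in> exp_families" "e' \<in> exp_families" shows "(%a. e a + e' a) \<in> exp_families"
proof -
 obtain B B' where "!!p. (%t. e (p, t)) \<in> exp_sums B" "!!p. (%t. e' (p, t)) \<in> exp_sums B'"
  using assms by (auto simp: exp_families_def)
 then have "!!p. (%t. e (p, t) + e' (p, t)) \<in> exp_sums (B + B')" by (rule exp_sums_add)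
 then show ?thesis unfolding exp_families_def by blast
qed

lemma exp_families_mult:
 assumes "e \<in> exp_families" "e' \<in> exp_families" shows "(%a. e a * e' a) \<in> exp_families"
proof -
 obtain B B' where "!!p. (%t. e (p, t)) \<in> exp_sums B" "!!p. (%t. e' (p, t)) \<in> exp_sums B'"
  using assms by (auto simp: exp_families_def)
 then have "!!p. (%t. e (p, t) * e' (p, t)) \<in> exp_sums (B * B')" by (rule exp_sums_mult)
 then show ?thesis unfolding exp_families_def by blast
qed

lemma exp_families_sum:
 assumes "finite I" "!!i. i \<in> I ==> f i \<in> exp_families"
 shows "(%a. \<Sum>i\<in>I. f i a) \<in> exp_families"
 using assms
proof (induction I rule: finite_induct)
 case (insert i I)
 then show ?case using exp_families_add[of "f i"] by simp
qed (simp add: exp_families_zero)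

lemma exp_families_int: "(%_. of_int c) \<in> exp_families"
proof (induction c rule: int_induct[of _ 0])
 case (step1 i)
 then show ?case using exp_families_add[OF step1(2) exp_families_one] by simp
next
 case (step2 i)
 then show ?case using exp_families_add[OF step2(2) exp_families_uminus[OF exp_families_one]] by simp
qed (simp add: exp_families_zero)

text \<open>Eigenvalues, for a fixed eigenvector \<open>r\<close>, of matrices of exponential sums. They form a ring,
 which avoids polynomials in the Perron eigenvalue.\<close>
definition eigen_families :: "'v set => ('p \<times> real => 'v => real) => ('p \<times> real => real) set" where
 "eigen_families V r = {g. \<exists>G. (\<forall>v\<in>V. \<forall>w\<in>V. (%a. G a v w) \<in> exp_families)
  \<and> (\<forall>a. \<forall>v\<in>V. (\<Sum>w\<in>V. G a v w * r a w) = g a * r a v)}"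

lemma eigen_familiesE:
 assumes "g \<in> eigen_families V r"
 obtains G where "!!v w. v \<in> V ==> w \<in> V ==> (%a. G a v w) \<in> exp_families"
  "!!a v. v \<in> V ==> (\<Sum>w\<in>V. G a v w * r a w) = g a * r a v"
proof -
 have "\<exists>G. (\<forall>v\<in>V. \<forall>w\<in>V. (%a. G a v w) \<in> exp_families)
  \<and> (\<forall>a. \<forall>v\<in>V. (\<Sum>w\<in>V. G a v w * r a w) = g a * r a v)"
  using assms unfolding eigen_families_def by (rule CollectD)
 then obtain G where "\<forall>v\<in>V. \<forall>w\<in>V. (%a. G a v w) \<in> exp_families"
  "\<forall>a. \<forall>v\<in>V. (\<Sum>w\<in>V. G a v w * r a w) = g a * r a v" by blast
 then show ?thesis by (intro that[of G]) blast+
qed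

lemma eigen_families_exp:
 assumes "finite V" "e \<in> exp_families" shows "e \<in> eigen_families V r"
 unfolding eigen_families_def
proof (intro CollectI exI[of _ "%a v w. if v = w then e a else 0"] conjI ballI allI)
 fix v w :: 'a assume "v \<in> V" "w \<in> V"
 show "(%a. if v = w then e a else 0) \<in> exp_families"
  using assms exp_families_zero by (cases "v = w") auto
next
 fix a v assume "v \<in> V"
 have "(\<Sum>w\<in>V. (if v = w then e a else 0) * r a w) = (\<Sum>w\<in>V. if v = w then e a * r a w else 0)"
  by (intro sum.cong) auto
 then show "(\<Sum>w\<in>V. (if v = w then e a else 0) * r a w) = e a * r a v"
  using \<open>v \<in> V\<close> assms(1) by simp
qed

lemma eigen_families_add:
 assumes "g \<in> eigen_families V r" "h \<in> eigen_families V r"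
 shows "(%a. g a + h a) \<in> eigen_families V r"
proof -
 obtain G where G: "!!v w. v \<in> V ==> w \<in> V ==> (%a. G a v w) \<in> exp_families"
   "!!a v. v \<in> V ==> (\<Sum>w\<in>V. G a v w * r a w) = g a * r a v"
  using eigen_familiesE[OF assms(1)] by metis
 obtain H where H: "!!v w. v \<in> V ==> w \<in> V ==> (%a. H a v w) \<in> exp_families"
   "!!a v. v \<in> V ==> (\<Sum>w\<in>V. H a v w * r a w) = h a * r a v"
  using eigen_familiesE[OF assms(2)] by metis
 show ?thesis unfolding eigen_families_def
  using G H
  by (intro CollectI exI[of _ "%a v w. G a v w + H a v w"])
   (auto intro!: exp_families_add simp: distrib_right sum.distrib)
qed

lemma eigen_families_mult:
 assumes "finite V" "g \<in> eigen_families V r" "h \<in> eigen_families V r"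
 shows "(%a. g a * h a) \<in> eigen_families V r"
proof -
 obtain G where G: "!!v w. v \<in> V ==> w \<in> V ==> (%a. G a v w) \<in> exp_families"
   "!!a v. v \<in> V ==> (\<Sum>w\<in>V. G a v w * r a w) = g a * r a v"
  using eigen_familiesE[OF assms(2)] by metis
 obtain H where H: "!!v w. v \<in> V ==> w \<in> V ==> (%a. H a v w) \<in> exp_families"
   "!!a v. v \<in> V ==> (\<Sum>w\<in>V. H a v w * r a w) = h a * r a v"
  using eigen_familiesE[OF assms(3)] by metis
 have "(\<Sum>w\<in>V. (\<Sum>u\<in>V. G a v u * H a u w) * r a w) = g a * h a * r a v" if "v \<in> V" for a v
 proof -
  have "(\<Sum>w\<in>V. (\<Sum>u\<in>V. G a v u * H a u w) * r a w) = (\<Sum>u\<in>V. G a v u * (\<Sum>w\<in>V. H a u w * r a w))"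
   unfolding sum_distrib_left sum_distrib_right
   by (subst sum.swap) (intro sum.cong refl, simp only: mult_ac)
  also have "\<dots> = (\<Sum>u\<in>V. G a v u * (h a * r a u))"
   by (intro sum.cong refl) (simp add: H(2))
  also have "\<dots> = h a * (\<Sum>u\<in>V. G a v u * r a u)"
   unfolding sum_distrib_left by (intro sum.cong refl) (simp only: mult_ac)
  finally show ?thesis using G(2)[OF that] by simp
 qed
 then show ?thesis unfolding eigen_families_def
  using G(1) H(1) assms(1)
  by (intro CollectI exI[of _ "%a v w. \<Sum>u\<in>V. G a v u * H a u w"])
   (auto intro!: exp_families_sum exp_families_mult)
qed

lemma eigen_families_power:
 assumes "finite V" "g \<in> eigen_families V r"
 shows "(%a. g a ^ n) \<in> eigen_families V r"
proof (induction n)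
 case 0
 then show ?case using eigen_families_exp[OF assms(1) exp_families_one] by simp
next
 case (Suc n)
 then show ?case using eigen_families_mult[OF assms Suc] by simp
qed

text \<open>Quotients of elements of the eigenvalue ring. Continuity in \<open>t\<close> is demanded
  separately, because limits are found by an intermediate value argument.\<close>

definition algebraic_families :: "'v set => ('p \<times> real => 'v => real) => ('p \<times> real => real) set" where
 "algebraic_families V r = {f. (\<forall>p. continuous_on UNIV (%t. f (p, t)))
  \<and> (\<exists>g\<in>eigen_families V r. \<exists>h\<in>eigen_families V r. \<forall>a. h a ~= 0 \<and> f a = g a / h a)}"

lemma algebraic_familiesI:
 assumes "finite V" "g \<in> eigen_families V r" "!!p. continuous_on UNIV (%t. g (p, t))"
 shows "g \<in> algebraic_families V r"
 unfolding algebraic_families_def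
 using assms eigen_families_exp[OF assms(1) exp_families_one, of r]
 by (intro CollectI conjI allI bexI[of _ g] bexI[of _ "%_. 1"]) auto

lemma field_closed_algebraic:
 assumes V: "finite V" shows "field_closed (algebraic_families V r)"
 unfolding field_closed_def
proof (intro conjI ballI impI allI)
 fix c :: int
 show "(%_. of_int c) \<in> algebraic_families V r"
  by (intro algebraic_familiesI V eigen_families_exp exp_families_int continuous_intros)
next
 fix f f' assume f: "f \<in> algebraic_families V r" "f' \<in> algebraic_families V r"
 obtain g h where gh: "g \<in> eigen_families V r" "h \<in> eigen_families V r" "!!a. h a ~= 0" "!!a. f a = g a / h a"
  using f(1) by (auto simp: algebraic_families_def)
 obtain g' h' where gh': "g' \<in> eigen_families V r" "h' \<in> eigen_families V r" "!!a. h' a ~= 0"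
   "!!a. f' a = g' a / h' a"
  using f(2) by (auto simp: algebraic_families_def)
 have c: "continuous_on UNIV (%t. f (p, t))" "continuous_on UNIV (%t. f' (p, t))" for p
  using f by (auto simp: algebraic_families_def)
 note m = eigen_families_mult[OF V]
 have "f a + f' a = (g a * h' a + g' a * h a) / (h a * h' a)" for a
  using gh gh' by (simp add: field_simps)
 moreover have "(%a. g a * h' a + g' a * h a) \<in> eigen_families V r"
  by (intro eigen_families_add m gh gh')
 moreover have hh: "(%a. h a * h' a) \<in> eigen_families V r" by (intro m gh gh')
 ultimately show "(%a. f a + f' a) \<in> algebraic_families V r"
  unfolding algebraic_families_def using c gh(3) gh'(3)
  by (intro CollectI conjI allI continuous_intros bexI[of _ "%a. g a * h' a + g' a * h a"]
    bexI[of _ "%a. h a * h' a"]) auto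
 have "f a * f' a = (g a * g' a) / (h a * h' a)" for a
  using gh gh' by (simp add: field_simps)
 moreover have "(%a. g a * g' a) \<in> eigen_families V r" by (intro m gh gh')
 ultimately show "(%a. f a * f' a) \<in> algebraic_families V r"
  unfolding algebraic_families_def using c gh(3) gh'(3) hh
  by (intro CollectI conjI allI continuous_intros bexI[of _ "%a. g a * g' a"]
    bexI[of _ "%a. h a * h' a"]) auto
 assume nz: "\<forall>a. f' a ~= 0"
 then have nz: "f' a ~= 0" for a by blast
 then have nz': "g' a ~= 0" for a using gh'(4)[of a] nz[of a] by auto
 have "f a / f' a = (g a * h' a) / (h a * g' a)" for a
  by (simp add: gh(4) gh'(4))
 moreover have "(%a. g a * h' a) \<in> eigen_families V r" "(%a. h a * g' a) \<in> eigen_families V r"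
  by (intro m gh gh')+
 ultimately show "(%a. f a / f' a) \<in> algebraic_families V r"
  unfolding algebraic_families_def using c gh(3) nz' nz
  by (intro CollectI conjI allI continuous_intros bexI[of _ "%a. g a * h' a"]
    bexI[of _ "%a. h a * g' a"]) auto
qed

text \<open>The matrices with eigenvalues \<open>g\<^sup>i h\<^sup>N\<^sup>-\<^sup>i\<close>, for \<open>0 \<le> i \<le> N = |V|\<^sup>2\<close>, are linearly dependent over
 the exponential sums; applied to \<open>r\<close>, a dependence is a polynomial equation for \<open>g / h\<close>.\<close>
lemma algebraic_families_limit:
 fixes V :: "'v set" and r :: "'p \<times> real => 'v => real"
 assumes V: "finite V" and v0: "v0 \<in> V" and r: "!!a. r a v0 ~= 0"
  and f: "f \<in> algebraic_families V r" and bd: "!!a. 0 \<le> f a \<and> f a \<le> 1"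
 obtains R where "finite R" "!!p. \<exists>l\<in>R. ((%t. f (p, t)) \<longlongrightarrow> l) at_top"
proof -
 obtain g h where gh: "g \<in> eigen_families V r" "h \<in> eigen_families V r" "!!a. h a ~= 0" "!!a. f a = g a / h a"
  using f by (auto simp: algebraic_families_def)
 have cont: "continuous_on UNIV (%t. f (p, t))" for p
  using f by (auto simp: algebraic_families_def)
 define N where "N = card (V \<times> V)"
 have "(%a. g a ^ i * h a ^ (N - i)) \<in> eigen_families V r" for i
  by (intro eigen_families_mult eigen_families_power V gh)
 then have "\<forall>i. \<exists>G. (\<forall>v\<in>V. \<forall>w\<in>V. (%a. G a v w) \<in> exp_families)
  \<and> (\<forall>a. \<forall>v\<in>V. (\<Sum>w\<in>V. G a v w * r a w) = g a ^ i * h a ^ (N - i) * r a v)"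
  unfolding eigen_families_def by simp
 then obtain G where G: "!!i v w. v \<in> V ==> w \<in> V ==> (%a. G i a v w) \<in> exp_families"
  "!!i a v. v \<in> V ==> (\<Sum>w\<in>V. G i a v w * r a w) = g a ^ i * h a ^ (N - i) * r a v"
  by metis
 define B where "B i vw = (SOME B. \<forall>p. (%t. G i (p, t) (fst vw) (snd vw)) \<in> exp_sums B)" for i vw
 have B: "(%t. G i (p, t) v w) \<in> exp_sums (B i (v, w))" if "v \<in> V" "w \<in> V" for i v w p
 proof -
  have "\<exists>B. \<forall>p. (%t. G i (p, t) v w) \<in> exp_sums B" using G(1)[OF that] by (simp add: exp_families_def)
  from someI_ex[OF this] show ?thesis by (simp add: B_def)
 qed
 define B0 where "B0 = (\<Sum>i\<le>N. \<Sum>vw\<in>V \<times> V. B i vw)"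
 have B0: "(%t. G i (p, t) v w) \<in> exp_sums B0" if "i \<le> N" "v \<in> V" "w \<in> V" for i p v w
 proof -
  have "B i (v, w) \<le> (\<Sum>vw\<in>V \<times> V. B i vw)" by (rule member_le_sum) (use V that in auto)
  also have "\<dots> \<le> B0" unfolding B0_def
   by (rule member_le_sum[of i "{..N}" "%i. \<Sum>vw\<in>V \<times> V. B i vw"]) (use that in auto)
  finally show ?thesis using B[OF that(2,3)] exp_sums_mono by blast
 qed
 obtain B1 where B1: "exp_dependent TYPE(nat) (V \<times> V) (Suc N) B0 B1"
  using exp_sums_dependent[of "V \<times> V" B0] V by (auto simp: N_def)
 show ?thesis
 \<comment> \<open>The set of possible limits is fixed before \<open>p\<close> is: neither
   \<open>N\<close> nor \<open>B1\<close> depends on \<open>p\<close>.\<close>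
 proof (rule that[OF finite_bounded_roots])
  fix p
  obtain c i t where c: "!!i. i \<in> {..N} ==> c i \<in> exp_sums B1" "i \<in> {..N}" "c i t ~= 0"
   "!!vw t. vw \<in> V \<times> V ==> (\<Sum>i\<in>{..N}. c i t * G i (p, t) (fst vw) (snd vw)) = 0"
   by (rule exp_dependentD[OF B1, of "{..N}" "%i vw t. G i (p, t) (fst vw) (snd vw)"])
    (use B0 in auto)
  have rel: "(\<Sum>i\<le>N. c i t * f (p, t) ^ i) = 0" for t
  proof -
   let ?a = "(p, t)"
   have "(\<Sum>i\<le>N. c i t * (g ?a ^ i * h ?a ^ (N - i))) * r ?a v0
     = (\<Sum>i\<le>N. c i t * (\<Sum>w\<in>V. G i ?a v0 w * r ?a w))"
    by (simp add: G(2)[OF v0] sum_distrib_right mult.assoc)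
   also have "\<dots> = (\<Sum>w\<in>V. (\<Sum>i\<le>N. c i t * G i ?a v0 w) * r ?a w)"
    unfolding sum_distrib_left sum_distrib_right by (subst sum.swap) (simp add: mult.assoc)
   also have "\<dots> = 0"
    using c(4)[of "(v0, _)" t] v0 by (intro sum.neutral) simp
   finally have "(\<Sum>i\<le>N. c i t * (g ?a ^ i * h ?a ^ (N - i))) = 0" using r by simp
   moreover have "g ?a ^ i * h ?a ^ (N - i) = f ?a ^ i * h ?a ^ N" if "i \<le> N" for i
    using gh(3)[of ?a] that
    by (simp add: gh(4) power_divide field_simps flip: power_add)
   ultimately have "(\<Sum>i\<le>N. c i t * f ?a ^ i) * h ?a ^ N = 0"
    by (simp add: sum_distrib_right mult.assoc)
   then show ?thesis using gh(3)[of ?a] by simp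
  qed
  obtain l where "l \<in> bounded_roots N B1" "((%t. f (p, t)) \<longlongrightarrow> l) at_top"
   by (rule algebraic_limit[OF cont bd, of N c B1 i t p]) (use c rel in auto)
  then show "\<exists>l\<in>bounded_roots N B1. ((%t. f (p, t)) \<longlongrightarrow> l) at_top" by blast
 qed
qed

section \<open>Circulations on a finite graph\<close>

text \<open>Paths have positive length, so that a single vertex must carry a loop and every vertex
  has a successor.\<close>

definition strongly_connected :: "'v set => ('v \<times> 'v) set => bool" where
 "strongly_connected V E \<longleftrightarrow> finite V \<and> V ~= {} \<and> E \<subseteq> V \<times> V \<and> (\<forall>v\<in>V. \<forall>w\<in>V. (v, w) \<in> E\<^sup>+)"

lemma strongly_connectedD:
 assumes "strongly_connected V E"
 shows "finite V" "V ~= {}" "E \<subseteq> V \<times> V" "!!v w. v \<in> V ==> w \<in> V ==> (v, w) \<in> E\<^sup>+"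
  "!!v. v \<in> V ==> \<exists>w\<in>V. (v, w) \<in> E"
proof -
 show "!!v. v \<in> V ==> \<exists>w\<in>V. (v, w) \<in> E"
 proof -
  fix v assume "v \<in> V"
  then have "(v, v) \<in> E\<^sup>+" using assms by (simp add: strongly_connected_def)
  then obtain w where "(v, w) \<in> E" by (meson tranclD)
  then show "\<exists>w\<in>V. (v, w) \<in> E" using assms by (auto simp: strongly_connected_def)
 qed
qed (use assms in \<open>auto simp: strongly_connected_def\<close>)

lemma closed_trancl: "(v, w) \<in> E\<^sup>+ ==> v \<in> S ==> (!!x y. x \<in> S ==> (x, y) \<in> E ==> y \<in> S) ==> w \<in> S"
 by (induction rule: trancl_induct) auto

lemma irreducibleI:
 assumes G: "strongly_connected V E"
  and L: "!!v w. v \<in> V ==> w \<in> V ==> 0 \<le> L v w" "!!v w. (v, w) \<in> E ==> 0 < L v w"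
 shows "irreducible V L"
 unfolding irreducible_def
proof (intro conjI ballI allI impI)
 note D = strongly_connectedD[OF G]
 show "\<exists>w\<in>V. L v w > 0" if "v \<in> V" for v using D(5)[OF that] L(2) by blast
 show "\<exists>v\<in>S. \<exists>w\<in>V - S. L v w > 0" if S: "S \<subseteq> V" "S ~= {}" "S ~= V" for S
 proof (rule ccontr)
  assume *: "\<not> ?thesis"
  obtain v w where "v \<in> S" "w \<in> V" "w \<notin> S" using S by blast
  moreover from this have "(v, w) \<in> E\<^sup>+" using D(4) S by blast
  moreover have "y \<in> S" if "x \<in> S" "(x, y) \<in> E" for x y
   using * L(2)[OF that(2)] that D(3) by blast
  ultimately show False using closed_trancl[of v w E S] by blast
 qed
qed (use strongly_connectedD[OF G] L in auto)

definition edge_weight :: "('v \<times> 'v) set => ('v => real) => 'v => 'v => real" where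
 "edge_weight E \<psi> v w = (if (v, w) \<in> E then exp (\<psi> v) else 0)"

lemma irreducible_edge_weight: "strongly_connected V E ==> irreducible V (edge_weight E \<psi>)"
 by (rule irreducibleI) (auto simp: edge_weight_def)

text \<open>Models the joint distribution of two consecutive vertices under an invariant measure:
  invariance becomes equality of outflow and inflow at each vertex.\<close>

definition circulation :: "'v set => ('v \<times> 'v) set => ('v => 'v => real) => bool" where
 "circulation V E p \<longleftrightarrow> (\<forall>v w. 0 \<le> p v w \<and> ((v, w) \<notin> E --> p v w = 0))
  \<and> (\<forall>v\<in>V. (\<Sum>w\<in>V. p v w) = (\<Sum>w\<in>V. p w v)) \<and> (\<Sum>v\<in>V. \<Sum>w\<in>V. p v w) = 1"

definition circ_val :: "'v set => ('v => real) => ('v => 'v => real) => real" where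
 "circ_val V \<psi> p = (\<Sum>v\<in>V. \<Sum>w\<in>V. p v w * \<psi> v)"

definition max_circ :: "'v set => ('v \<times> 'v) set => ('v => real) => ('v => 'v => real) => bool" where
 "max_circ V E \<psi> p \<longleftrightarrow> circulation V E p \<and> (\<forall>p'. circulation V E p' --> circ_val V \<psi> p' \<le> circ_val V \<psi> p)"

text \<open>The support of the face of maximizing circulations. By \<open>max_circ_iff\<close> it
  determines the face, so it can index the cones.\<close>

definition max_edges :: "'v set => ('v \<times> 'v) set => ('v => real) => ('v \<times> 'v) set" where
 "max_edges V E \<psi> = {(v, w). \<exists>p. max_circ V E \<psi> p \<and> p v w > 0}"

text \<open>Differences \<open>u v - u w\<close> along edges integrate to 0. This removes the
  logarithms of eigenvectors from the entropy formulas.\<close>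

lemma circulation_coboundary:
 assumes "finite V" "circulation V E p"
 shows "(\<Sum>v\<in>V. \<Sum>w\<in>V. p v w * u v) = (\<Sum>v\<in>V. \<Sum>w\<in>V. p v w * u w)"
proof -
 have "(\<Sum>v\<in>V. \<Sum>w\<in>V. p v w * u v) = (\<Sum>v\<in>V. (\<Sum>w\<in>V. p v w) * u v)"
  by (simp add: sum_distrib_right)
 also have "\<dots> = (\<Sum>v\<in>V. (\<Sum>w\<in>V. p w v) * u v)"
  using assms(2) by (intro sum.cong refl) (simp add: circulation_def)
 also have "\<dots> = (\<Sum>v\<in>V. \<Sum>w\<in>V. p v w * u w)"
  unfolding sum_distrib_right by (rule sum.swap)
 finally show ?thesis .
qed

section \<open>Simple cycles as circulations\<close>

definition cycle_circulation :: "'v set => ('v => 'v) => 'v => 'v => real" where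
 "cycle_circulation S s v w = (if v \<in> S \<and> w = s v then 1 / card S else 0)"

lemma cycle_circulation_row:
 assumes "finite V" "S \<subseteq> V" "bij_betw s S S"
 shows "(\<Sum>w\<in>V. cycle_circulation S s v w) = (if v \<in> S then 1 / card S else 0)"
proof (cases "v \<in> S")
 case True
 then have "s v \<in> V" using assms(2,3) by (auto simp: bij_betw_def)
 then show ?thesis using True assms(1) by (simp add: cycle_circulation_def)
qed (simp add: cycle_circulation_def)

lemma circulation_cycle:
 assumes V: "finite V" "S \<subseteq> V" "S ~= {}" and s: "bij_betw s S S" "!!v. v \<in> S ==> (v, s v) \<in> E"
 shows "circulation V E (cycle_circulation S s)"
 unfolding circulation_def
proof (intro conjI ballI allI impI)
 fix v w
 show "0 \<le> cycle_circulation S s v w" by (simp add: cycle_circulation_def)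
 show "cycle_circulation S s v w = 0" if "(v, w) \<notin> E"
  using s(2) that by (auto simp: cycle_circulation_def)
next
 have S: "finite S" using V finite_subset by blast
 note row = cycle_circulation_row[OF V(1,2) s(1)]
 have "(\<Sum>v\<in>V. \<Sum>w\<in>V. cycle_circulation S s v w) = (\<Sum>v\<in>S. 1 / card S)"
  unfolding row using V by (intro sum.mono_neutral_cong_right) auto
 then show "(\<Sum>v\<in>V. \<Sum>w\<in>V. cycle_circulation S s v w) = 1" using V S by simp
 fix v assume "v \<in> V"
 have "(\<Sum>w\<in>V. cycle_circulation S s w v) = (if v \<in> S then 1 / card S else 0)"
 proof (cases "v \<in> S")
  case True
  then have "v \<in> s ` S" using s(1) by (simp add: bij_betw_def)
  then obtain w where w: "w \<in> S" "s w = v" by blast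
  have "cycle_circulation S s w' v = (if w' = w then 1 / card S else 0)" for w'
   using w s(1) by (auto simp: cycle_circulation_def bij_betw_def inj_on_def)
  moreover have "w \<in> V" using w V by blast
  ultimately show ?thesis using True V by simp
 next
  case False
  then have "cycle_circulation S s w v = 0" for w
   using s(1) by (auto simp: cycle_circulation_def bij_betw_def)
  then show ?thesis using False by simp
 qed
 then show "(\<Sum>w\<in>V. cycle_circulation S s v w) = (\<Sum>w\<in>V. cycle_circulation S s w v)"
  using row by simp
qed

lemma minimal_closed_set:
 assumes "finite V" "V ~= {}" "!!v. v \<in> V ==> \<exists>w\<in>V. (v, w) \<in> F"
 obtains S where "S \<subseteq> V" "S ~= {}" "!!v. v \<in> S ==> \<exists>w\<in>S. (v, w) \<in> F"
  "!!S'. S' \<subseteq> S ==> S' ~= {} ==> (!!v. v \<in> S' ==> \<exists>w\<in>S'. (v, w) \<in> F) ==> S' = S"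
proof -
 define P where "P S \<longleftrightarrow> S \<subseteq> V \<and> S ~= {} \<and> (\<forall>v\<in>S. \<exists>w\<in>S. (v, w) \<in> F)" for S
 have "P V" using assms by (simp add: P_def)
 then obtain S where S: "P S" "!!S'. P S' ==> card S \<le> card S'"
  using ex_has_least_nat[of P V card] by blast
 have fin: "finite S" using S(1) assms(1) finite_subset unfolding P_def by blast
 show ?thesis
 proof (rule that[of S])
  fix S' assume S': "S' \<subseteq> S" "S' ~= {}" "!!v. v \<in> S' ==> \<exists>w\<in>S'. (v, w) \<in> F"
  then have "P S'" using S(1) unfolding P_def by blast
  then show "S' = S" using S(2)[of S'] S'(1) fin card_seteq by blast
 qed (use S(1) in \<open>auto simp: P_def\<close>)
qed

text \<open>A minimal set of vertices closed under having a successor is a simple cycle without chords: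
 otherwise some choice of successors would not be surjective, and its image would be smaller.\<close>
lemma minimal_closed_cycle:
 assumes S: "finite S" "!!v. v \<in> S ==> \<exists>w\<in>S. (v, w) \<in> F"
  and min: "!!S'. S' \<subseteq> S ==> S' ~= {} ==> (!!v. v \<in> S' ==> \<exists>w\<in>S'. (v, w) \<in> F) ==> S' = S"
 obtains s where "bij_betw s S S" "F \<inter> S \<times> S = (%v. (v, s v)) ` S"
proof (cases "S = {}")
 case True
 then show ?thesis using that[of id] by auto
next
 case ne: False
 have bij: "bij_betw s S S" if s: "!!v. v \<in> S ==> s v \<in> S \<and> (v, s v) \<in> F" for s
 proof -
  have "s ` S = S"
  proof (rule min)
   fix v assume "v \<in> s ` S"
   then have "v \<in> S" using s by auto
   then show "\<exists>w\<in>s ` S. (v, w) \<in> F" using s by auto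
  qed (use s ne in auto)
  then show ?thesis by (simp add: bij_betw_def eq_card_imp_inj_on S(1))
 qed
 obtain s where s: "!!v. v \<in> S ==> s v \<in> S \<and> (v, s v) \<in> F" using S(2) by metis
 have "w = s v" if vw: "v \<in> S" "w \<in> S" "(v, w) \<in> F" for v w
 proof (rule ccontr)
  assume ne: "w ~= s v"
  have "bij_betw (s(v := w)) S S" by (rule bij) (use s vw in auto)
  moreover have "w \<in> s ` S" using bij[OF s] vw(2) by (simp add: bij_betw_def)
  then obtain v' where v': "v' \<in> S" "s v' = w" by blast
  moreover have "(s(v := w)) v' = (s(v := w)) v" "v' ~= v" using v' ne by auto
  ultimately show False using vw(1) unfolding bij_betw_def inj_on_def by blast
 qed
 then have "F \<inter> S \<times> S = (%v. (v, s v)) ` S" using s by force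
 then show ?thesis using that bij[OF s] by blast
qed

lemma circulationD:
 assumes "circulation V E p"
 shows "!!v w. 0 \<le> p v w" "!!v w. (v, w) \<notin> E ==> p v w = 0"
  "!!v. v \<in> V ==> (\<Sum>w\<in>V. p v w) = (\<Sum>w\<in>V. p w v)" "(\<Sum>v\<in>V. \<Sum>w\<in>V. p v w) = 1"
 using assms by (auto simp: circulation_def)

lemma circulation_support: "circulation V E p ==> 0 < p v w ==> (v, w) \<in> E"
 using circulationD(2)[of V E p v w] by fastforce

lemma circulation_tendsto:
 assumes F: "F ~= bot" and p: "!!t. circulation V E (p t)" and lim: "!!v w. ((%t. p t v w) \<longlongrightarrow> q v w) F"
 shows "circulation V E q"
 unfolding circulation_def
proof (intro conjI allI ballI impI)
 note c = circulationD[OF p]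
 show "0 \<le> q v w" for v w by (rule tendsto_lowerbound[OF lim]) (use c(1) F in auto)
 show "q v w = 0" if "(v, w) \<notin> E" for v w
  using lim[of v w] c(2)[OF that] F by (simp add: tendsto_const_iff)
 show "(\<Sum>w\<in>V. q v w) = (\<Sum>w\<in>V. q w v)" if "v \<in> V" for v
  by (rule tendsto_unique[OF F tendsto_sum[OF lim]]) (unfold c(3)[OF that], rule tendsto_sum[OF lim])
 show "(\<Sum>v\<in>V. \<Sum>w\<in>V. q v w) = 1"
  by (rule tendsto_unique[OF F tendsto_sum[OF tendsto_sum[OF lim]]]) (simp add: c(4))
qed

lemma circulation_affine:
 assumes "circulation V E p" "circulation V E q" "!!v w. 0 \<le> a * p v w + b * q v w" "a + b = 1"
 shows "circulation V E (%v w. a * p v w + b * q v w)"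
 unfolding circulation_def
proof (intro conjI allI ballI impI)
 note p = circulationD[OF assms(1)] and q = circulationD[OF assms(2)]
 show "0 \<le> a * p v w + b * q v w" for v w by (rule assms(3))
 show "a * p v w + b * q v w = 0" if "(v, w) \<notin> E" for v w using p(2) q(2) that by simp
 show "(\<Sum>w\<in>V. a * p v w + b * q v w) = (\<Sum>w\<in>V. a * p w v + b * q w v)" if "v \<in> V" for v
  using p(3)[OF that] q(3)[OF that] by (simp add: sum.distrib flip: sum_distrib_left)
 have "(\<Sum>v\<in>V. \<Sum>w\<in>V. a * p v w + b * q v w) = a * (\<Sum>v\<in>V. \<Sum>w\<in>V. p v w) + b * (\<Sum>v\<in>V. \<Sum>w\<in>V. q v w)"
  by (simp add: sum.distrib sum_distrib_left)
 then show "(\<Sum>v\<in>V. \<Sum>w\<in>V. a * p v w + b * q v w) = 1" using p(4) q(4) assms(4) by simp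
qed

lemma circ_val_affine:
 "circ_val V \<psi> (%v w. a * p v w + b * q v w) = a * circ_val V \<psi> p + b * circ_val V \<psi> q"
 unfolding circ_val_def sum_distrib_left sum.distrib[symmetric]
 by (intro sum.cong refl) (simp add: algebra_simps)

section \<open>The face of maximizing circulations\<close>

context
 fixes V :: "'v set" and E :: "('v \<times> 'v) set"
 assumes G: "strongly_connected V E"
begin

private lemma D: "finite V" "V ~= {}" "E \<subseteq> V \<times> V" "!!v w. v \<in> V ==> w \<in> V ==> (v, w) \<in> E\<^sup>+"
 using strongly_connectedD[OF G] by blast+

text \<open>The circulations have entries in the unit interval and are closed under limits, so a
  maximizing sequence has a convergent subsequence.\<close>

lemma max_circ_exists: obtains p where "max_circ V E \<psi> p"
proof -
 let ?C = "{p. circulation V E p}"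
 have entry: "p v w \<le> 1" if p: "circulation V E p" for p v w
 proof (cases "(v, w) \<in> E")
  case True
  then have vw: "v \<in> V" "w \<in> V" using D(3) by auto
  note c = circulationD[OF p]
  have "p v w \<le> (\<Sum>w\<in>V. p v w)" using vw c(1) D(1) by (intro member_le_sum) auto
  also have "\<dots> \<le> (\<Sum>v\<in>V. \<Sum>w\<in>V. p v w)"
   using vw c(1) D(1) by (intro member_le_sum[of v V "%v. \<Sum>w\<in>V. p v w"]) (auto intro: sum_nonneg)
  finally show ?thesis using c(4) by simp
 qed (simp add: circulationD(2)[OF p])
 have bdd: "bdd_above (circ_val V \<psi> ` ?C)"
 proof (rule bdd_aboveI2)
  fix p assume "p \<in> ?C"
  then have p: "circulation V E p" by simp
  show "circ_val V \<psi> p \<le> (\<Sum>v\<in>V. \<Sum>w\<in>V. \<bar>\<psi> v\<bar>)"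
   unfolding circ_val_def
  proof (intro sum_mono)
   fix v w
   have "p v w * \<psi> v \<le> \<bar>p v w * \<psi> v\<bar>" by simp
   also have "\<dots> \<le> 1 * \<bar>\<psi> v\<bar>"
    unfolding abs_mult using entry[OF p] circulationD(1)[OF p] by (intro mult_right_mono) auto
   finally show "p v w * \<psi> v \<le> \<bar>\<psi> v\<bar>" by simp
  qed
 qed
 \<comment> \<open>A minimal set of vertices closed under having a successor is a cycle and carries
   a circulation.\<close>
 have ne: "?C ~= {}"
 proof -
  obtain S where S: "S \<subseteq> V" "S ~= {}" "!!v. v \<in> S ==> \<exists>w\<in>S. (v, w) \<in> E"
   "!!S'. S' \<subseteq> S ==> S' ~= {} ==> (!!v. v \<in> S' ==> \<exists>w\<in>S'. (v, w) \<in> E) ==> S' = S"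
   by (rule minimal_closed_set[OF D(1,2) strongly_connectedD(5)[OF G]]) auto
  obtain s where s: "bij_betw s S S" "E \<inter> S \<times> S = (%v. (v, s v)) ` S"
   by (rule minimal_closed_cycle[OF finite_subset[OF S(1) D(1)] S(3,4)]) auto
  have "circulation V E (cycle_circulation S s)"
   by (rule circulation_cycle[OF D(1) S(1,2) s(1)]) (use s(2) in blast)
  then show ?thesis by blast
 qed
 define M where "M = Sup (circ_val V \<psi> ` ?C)"
 have "\<exists>p\<in>?C. M - 1 / Suc n < circ_val V \<psi> p" for n
  using less_cSup_iff[OF _ bdd, of "M - 1 / Suc n"] ne by (auto simp: M_def)
 then obtain p where p: "!!n. circulation V E (p n)" "!!n. M - 1 / Suc n < circ_val V \<psi> (p n)"
  by simp metis
 obtain s where s: "strict_mono s" "!!e. e \<in> V \<times> V ==> convergent (%n. p (s n) (fst e) (snd e))"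
 proof (rule finite_convergent_subseq[of "V \<times> V" "%n e. p n (fst e) (snd e)"])
  show "bounded (range (%n. p n (fst e) (snd e)))" for e
   using circulationD(1)[OF p(1)] entry[OF p(1)] by (intro boundedI[of _ 1]) auto
 qed (use D(1) in auto)
 define q where "q v w = lim (%n. p (s n) v w)" for v w
 have lim: "(%n. p (s n) v w) \<longlonglongrightarrow> q v w" for v w
 proof (cases "(v, w) \<in> V \<times> V")
  case True
  then show ?thesis using s(2)[OF True] unfolding q_def by (simp add: convergent_LIMSEQ_iff)
 next
  case False
  then have "(v, w) \<notin> E" using D(3) by blast
  then show ?thesis using circulationD(2)[OF p(1)] by (simp add: q_def)
 qed
 have q: "circulation V E q" by (rule circulation_tendsto[OF sequentially_bot p(1) lim])
 have "(%n. circ_val V \<psi> (p (s n))) \<longlonglongrightarrow> circ_val V \<psi> q"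
  unfolding circ_val_def by (intro tendsto_intros lim)
 moreover have "(%n. M - 1 / Suc (s n)) \<longlonglongrightarrow> M - 0"
  using LIMSEQ_subseq_LIMSEQ[OF LIMSEQ_inverse_real_of_nat s(1)]
  by (intro tendsto_diff tendsto_const) (simp add: o_def inverse_eq_divide)
 ultimately have "M \<le> circ_val V \<psi> q"
  using p(2) by (intro LIMSEQ_le) (auto intro!: exI[of _ 0] less_imp_le)
 moreover have "circ_val V \<psi> p' \<le> M" if "circulation V E p'" for p'
  unfolding M_def using bdd that by (intro cSup_upper) auto
 ultimately show ?thesis using that[of q] q unfolding max_circ_def by force
qed

lemma max_edges_subset: "max_edges V E \<psi> \<subseteq> E"
 using circulation_support by (fastforce simp: max_edges_def max_circ_def)

lemma circulation_exists_edge: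
 assumes "circulation V E p" obtains v w where "p v w > 0"
proof -
 have "\<exists>v\<in>V. \<exists>w\<in>V. p v w ~= 0"
 proof (rule ccontr)
  assume "\<not> ?thesis"
  then have "(\<Sum>v\<in>V. \<Sum>w\<in>V. p v w) = 0" by simp
  then show False using circulationD(4)[OF assms] by simp
 qed
 then obtain v w where "p v w ~= 0" by blast
 then have "p v w > 0" using assms by (simp add: circulation_def less_le)
 then show ?thesis using that by blast
qed

text \<open>Averaging finitely many maximizing circulations gives one in the relative interior of
  the face.\<close>

lemma max_circ_full:
 obtains p where "max_circ V E \<psi> p" "!!v w. p v w > 0 \<longleftrightarrow> (v, w) \<in> max_edges V E \<psi>"
proof -
 let ?F = "max_edges V E \<psi>"
 obtain p0 where p0: "max_circ V E \<psi> p0" by (rule max_circ_exists)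
 have "finite ?F" using max_edges_subset D(1,3) by (meson finite_SigmaI finite_subset)
 moreover have "\<exists>p. max_circ V E \<psi> p \<and> (\<forall>(v, w)\<in>H. p v w > 0)" if "finite H" "H \<subseteq> ?F" for H
  using that
 proof (induction H rule: finite_induct)
  case empty
  then show ?case using p0 by blast
 next
  case (insert e H)
  obtain v w where e: "e = (v, w)" by fastforce
  obtain p where p: "max_circ V E \<psi> p" "\<forall>(v, w)\<in>H. p v w > 0" using insert by blast
  obtain q where q: "max_circ V E \<psi> q" "q v w > 0"
   using insert.prems by (auto simp: max_edges_def e)
  define r where "r v w = 1/2 * p v w + 1/2 * q v w" for v w
  have nn: "p v w \<ge> 0" "q v w \<ge> 0" for v w
   using p(1) q(1) by (auto simp: max_circ_def circulation_def)
  have "circulation V E r" unfolding r_def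
   by (rule circulation_affine) (use p q nn in \<open>auto simp: max_circ_def\<close>)
  moreover have "circ_val V \<psi> p = circ_val V \<psi> q"
   using p(1) q(1) by (intro antisym) (auto simp: max_circ_def)
  moreover have "circ_val V \<psi> r = 1/2 * circ_val V \<psi> p + 1/2 * circ_val V \<psi> q"
   unfolding r_def by (rule circ_val_affine)
  ultimately have "max_circ V E \<psi> r" using p(1) by (simp add: max_circ_def)
  moreover have "\<forall>(v, w)\<in>insert e H. r v w > 0"
   using p(2) q(2) nn by (force simp: r_def e add_nonneg_pos add_pos_nonneg)
  ultimately show ?case by blast
 qed
 ultimately obtain p where "max_circ V E \<psi> p" "\<forall>(v, w)\<in>?F. p v w > 0" by blast
 then show ?thesis using that[of p] by (auto simp: max_edges_def)
qed

text \<open>Extrapolation: the full maximizer \<open>m\<close> can be moved slightly away from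
  \<open>p\<close> without leaving the polytope, since it charges all edges that \<open>p\<close>
  charges. Optimality of \<open>m\<close> along that direction shows that \<open>p\<close> is no
  worse.\<close>

lemma max_circ_iff:
 "max_circ V E \<psi> p \<longleftrightarrow> circulation V E p \<and> (\<forall>v w. p v w > 0 --> (v, w) \<in> max_edges V E \<psi>)"
proof
 let ?F = "max_edges V E \<psi>"
 assume p: "circulation V E p \<and> (\<forall>v w. p v w > 0 --> (v, w) \<in> ?F)"
 obtain m where m: "max_circ V E \<psi> m" "!!v w. m v w > 0 \<longleftrightarrow> (v, w) \<in> ?F"
  by (rule max_circ_full[of \<psi>]) blast
 have c: "circulation V E p" "circulation V E m" using p m(1) by (auto simp: max_circ_def)
 note cp = circulationD[OF c(1)] and cm = circulationD[OF c(2)]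
 have "finite ?F" using max_edges_subset D(1,3) by (meson finite_SigmaI finite_subset)
 \<comment> \<open>At most the smallest ratio of \<open>m\<close> to \<open>p\<close>, so that
   \<open>m - e * p\<close> stays nonnegative; the 1 only makes the set nonempty.\<close>
 define e where "e = Min (insert 1 ((%(v, w). m v w / p v w) ` {(v, w) \<in> ?F. p v w > 0}))"
 have fin: "finite (insert 1 ((%(v, w). m v w / p v w) ` {(v, w) \<in> ?F. p v w > 0}))"
  using \<open>finite ?F\<close> by (auto intro: finite_subset)
 have e: "e > 0" unfolding e_def using fin m(2) by (auto simp: Min_gr_iff)
 have le: "e * p v w \<le> m v w" for v w
 proof (cases "p v w > 0")
  case True
  then have "e \<le> m v w / p v w" unfolding e_def using fin p by (intro Min_le) auto
  then show ?thesis using True by (simp add: pos_le_divide_eq)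
 next
  case False
  then have "p v w = 0" using cp(1)[of v w] by simp
  then show ?thesis using cm(1) by simp
 qed
 have "circulation V E (%v w. (1 + e) * m v w + - e * p v w)"
 proof (rule circulation_affine[OF c(2,1)])
  show "0 \<le> (1 + e) * m v w + - e * p v w" for v w
  proof -
   have "0 \<le> e * m v w" using e cm(1) by simp
   then show ?thesis using le[of v w] by (simp only: distrib_right)
  qed
 qed simp
 then have "(1 + e) * circ_val V \<psi> m + - e * circ_val V \<psi> p \<le> circ_val V \<psi> m"
  using m(1) unfolding max_circ_def circ_val_affine[symmetric] by blast
 then have "e * circ_val V \<psi> m \<le> e * circ_val V \<psi> p" by (simp add: algebra_simps)
 then have "circ_val V \<psi> m \<le> circ_val V \<psi> p" using e by simp
 then show "max_circ V E \<psi> p" using m(1) c(1) unfolding max_circ_def by (meson order_trans)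
qed (auto simp: max_circ_def max_edges_def)

lemma max_edges_nonempty: "max_edges V E \<psi> ~= {}"
proof -
 obtain p where p: "max_circ V E \<psi> p" by (rule max_circ_exists)
 then obtain v w where "p v w > 0" using circulation_exists_edge[of p] by (auto simp: max_circ_def)
 then show ?thesis using p by (auto simp: max_edges_def)
qed

text \<open>No flow leaves the set of vertices reachable from \<open>w\<close>, so none enters it.\<close>
lemma circulation_support_recurrent:
 assumes p: "circulation V E p" and F: "F = {(v, w). p v w > 0}" and vw: "(v, w) \<in> F"
 shows "(w, v) \<in> F\<^sup>*"
proof (rule ccontr)
 assume *: "(w, v) \<notin> F\<^sup>*"
 define Z where "Z = {z. (w, z) \<in> F\<^sup>*}"
 have nn: "p x y \<ge> 0" for x y using p by (auto simp: circulation_def)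
 have sub: "F \<subseteq> V \<times> V" using circulation_support[OF p] D(3) unfolding F by blast
 have Z: "Z \<subseteq> V"
 proof
  fix z assume "z \<in> Z"
  then have "(w, z) \<in> F\<^sup>*" by (simp add: Z_def)
  then show "z \<in> V" using vw sub by (cases rule: rtranclE) auto
 qed
 have out: "p x y = 0" if "x \<in> Z" "y \<notin> Z" for x y
 proof (rule ccontr)
  assume "p x y ~= 0"
  then have "(x, y) \<in> F" using nn[of x y] by (simp add: F less_le)
  then show False using that by (auto simp: Z_def intro: rtrancl_into_rtrancl)
 qed
 have fZ: "finite Z" using Z D(1) finite_subset by blast
 have "(\<Sum>x\<in>Z. \<Sum>y\<in>V. p x y) = (\<Sum>x\<in>Z. \<Sum>y\<in>V. p y x)"
  by (rule sum.cong[OF refl], rule circulationD(3)[OF p]) (use Z in auto)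
 moreover have "(\<Sum>x\<in>Z. \<Sum>y\<in>V. p x y) = (\<Sum>x\<in>Z. \<Sum>y\<in>Z. p x y)"
  using Z D(1) out by (intro sum.cong refl sum.mono_neutral_right) auto
 moreover have "(\<Sum>x\<in>Z. \<Sum>y\<in>V. p y x) = (\<Sum>x\<in>Z. \<Sum>y\<in>Z. p y x) + (\<Sum>x\<in>Z. \<Sum>y\<in>V - Z. p y x)"
  by (simp add: sum.subset_diff[OF Z D(1)] sum.distrib)
 moreover have "(\<Sum>x\<in>Z. \<Sum>y\<in>Z. p y x) = (\<Sum>x\<in>Z. \<Sum>y\<in>Z. p x y)" by (rule sum.swap)
 ultimately have 0: "(\<Sum>x\<in>Z. \<Sum>y\<in>V - Z. p y x) = 0" by simp
 have "w \<in> Z" "v \<in> V - Z" using * vw sub by (auto simp: Z_def)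
 then have "p v w \<le> (\<Sum>y\<in>V - Z. p y w)"
  using nn D(1) by (intro member_le_sum[of v "V - Z" "%y. p y w"]) auto
 also have "\<dots> \<le> (\<Sum>x\<in>Z. \<Sum>y\<in>V - Z. p y x)"
  using \<open>w \<in> Z\<close> nn fZ by (intro member_le_sum[of w Z "%x. \<Sum>y\<in>V - Z. p y x"]) (auto intro: sum_nonneg)
 finally show False using 0 vw by (simp add: F)
qed

lemma max_edges_recurrent: "(v, w) \<in> max_edges V E \<psi> ==> (w, v) \<in> (max_edges V E \<psi>)\<^sup>*"
proof -
 assume vw: "(v, w) \<in> max_edges V E \<psi>"
 obtain p where p: "max_circ V E \<psi> p" "!!v w. p v w > 0 \<longleftrightarrow> (v, w) \<in> max_edges V E \<psi>"
  using max_circ_full[of \<psi>] by metis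
 show ?thesis
  by (rule circulation_support_recurrent[of p]) (use p vw in \<open>auto simp: max_circ_def\<close>)
qed

lemma circ_val_linear:
 "circ_val V (%v. a * \<psi> v + b * \<psi>' v) p = a * circ_val V \<psi> p + b * circ_val V \<psi>' p"
 unfolding circ_val_def sum_distrib_left sum.distrib[symmetric]
 by (intro sum.cong refl) (simp add: algebra_simps)

lemma max_edges_scale:
 assumes "t > 0" shows "max_edges V E (%v. t * \<psi> v) = max_edges V E \<psi>"
proof -
 have "circ_val V (%v. t * \<psi> v) p = t * circ_val V \<psi> p" for p
  using circ_val_linear[of t \<psi> 0 \<psi> p] by simp
 then show ?thesis using assms by (simp add: max_edges_def max_circ_def)
qed

text \<open>The two potentials have a common maximizer \<open>p0\<close>. A circulation that is
  optimal for the combination cannot fall short of \<open>p0\<close> for one potential, as it would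
  have to beat it for the other.\<close>

lemma max_edges_convex:
 assumes F: "max_edges V E \<psi> = F" "max_edges V E \<psi>' = F" and ab: "0 \<le> a" "0 \<le> b" "a + b = 1"
 shows "max_edges V E (%v. a * \<psi> v + b * \<psi>' v) = F"
proof (cases "a = 0 \<or> b = 0")
 case True
 then have "(a = 0 \<and> b = 1) \<or> (a = 1 \<and> b = 0)" using ab(3) by auto
 then show ?thesis by (elim disjE conjE) (simp_all add: F)
next
 case False
 then have pos: "a > 0" "b > 0" using ab by auto
 obtain p0 where p0: "max_circ V E \<psi> p0" by (rule max_circ_exists)
 have p0': "max_circ V E \<psi>' p0" using p0 F by (simp add: max_circ_iff)
 have "max_circ V E (%v. a * \<psi> v + b * \<psi>' v) p \<longleftrightarrow> max_circ V E \<psi> p" for p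
 proof
  assume p: "max_circ V E \<psi> p"
  then have p': "max_circ V E \<psi>' p" using F by (simp add: max_circ_iff)
  show "max_circ V E (%v. a * \<psi> v + b * \<psi>' v) p"
   using p p' ab unfolding max_circ_def circ_val_linear
   by (auto intro!: add_mono mult_left_mono)
 next
  assume p: "max_circ V E (%v. a * \<psi> v + b * \<psi>' v) p"
  have c: "circulation V E p" "circulation V E p0" using p p0 by (auto simp: max_circ_def)
  have "a * circ_val V \<psi> p0 + b * circ_val V \<psi>' p0 \<le> a * circ_val V \<psi> p + b * circ_val V \<psi>' p"
   using p c unfolding max_circ_def circ_val_linear by blast
  moreover have "b * circ_val V \<psi>' p \<le> b * circ_val V \<psi>' p0"
   using p0' c pos by (intro mult_left_mono) (auto simp: max_circ_def)
  ultimately have "a * circ_val V \<psi> p0 \<le> a * circ_val V \<psi> p" by linarith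
  then have "circ_val V \<psi> p0 \<le> circ_val V \<psi> p" using pos by simp
  then show "max_circ V E \<psi> p" using p0 c unfolding max_circ_def by force
 qed
 then show ?thesis using F(1) by (simp add: max_edges_def)
qed

text \<open>A chordless cycle \<open>S\<close> in \<open>max_edges V E \<psi>\<close> is singled out by adding \<open>\<delta> 1\<^sub>S\<close>.\<close>
lemma max_edges_perturb:
 obtains S s where "S \<subseteq> V" "S ~= {}" "bij_betw s S S"
  "!!S'. S' \<subseteq> S ==> S' ~= {} ==> s ` S' \<subseteq> S' ==> S' = S"
  "!!\<delta>. \<delta> > 0 ==> max_edges V E (%v. \<psi> v + \<delta> * indicator S v) \<subseteq> max_edges V E \<psi> ==>
   max_edges V E (%v. \<psi> v + \<delta> * indicator S v) = (%v. (v, s v)) ` S"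
proof -
 let ?F = "max_edges V E \<psi>"
 have FV: "Domain ?F \<subseteq> V" using max_edges_subset D(3) by blast
 have closed: "\<exists>w\<in>Domain ?F. (v, w) \<in> ?F" if "v \<in> Domain ?F" for v
 proof -
  obtain w where w: "(v, w) \<in> ?F" using \<open>v \<in> Domain ?F\<close> by blast
  have "(w, v) \<in> ?F\<^sup>*" using max_edges_recurrent[OF w] .
  then have "w \<in> Domain ?F" using w by (cases rule: converse_rtranclE) auto
  then show ?thesis using w by blast
 qed
 obtain S where S: "S \<subseteq> Domain ?F" "S ~= {}" "!!v. v \<in> S ==> \<exists>w\<in>S. (v, w) \<in> ?F"
  "!!S'. S' \<subseteq> S ==> S' ~= {} ==> (!!v. v \<in> S' ==> \<exists>w\<in>S'. (v, w) \<in> ?F) ==> S' = S"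
  by (rule minimal_closed_set[OF finite_subset[OF FV D(1)] _ closed])
   (use max_edges_nonempty[of \<psi>] in auto)
 have SV: "S \<subseteq> V" using S(1) FV by (rule subset_trans)
 have "finite S" using SV D(1) by (rule finite_subset)
 note SV = SV this
 obtain s where s: "bij_betw s S S" "?F \<inter> S \<times> S = (%v. (v, s v)) ` S"
  by (rule minimal_closed_cycle[OF SV(2) S(3,4)]) auto
 have sF: "(v, s v) \<in> ?F" "s v \<in> S" if "v \<in> S" for v
 proof -
  show "(v, s v) \<in> ?F" using s(2) that by blast
  show "s v \<in> S" using s(1) that by (auto simp: bij_betw_def)
 qed
 show ?thesis
 proof (rule that[OF SV(1) S(2) s(1)])
  fix S' assume S': "S' \<subseteq> S" "S' ~= {}" "s ` S' \<subseteq> S'"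
  then show "S' = S" using sF by (intro S(4)) blast+
 next
  fix \<delta> :: real assume \<delta>: "\<delta> > 0"
  let ?\<psi> = "%v. \<psi> v + \<delta> * indicator S v"
  \<comment> \<open>This excludes chords of \<open>S\<close> that are edges of \<open>E\<close> but
    not maximizing for \<psi>; for small \<delta> it is supplied by
    \<open>max_edges_stable\<close>.\<close>
  assume sub: "max_edges V E ?\<psi> \<subseteq> ?F"
  let ?c = "cycle_circulation S s"
  have cc: "circulation V E ?c"
   by (rule circulation_cycle[OF D(1) SV(1) S(2) s(1)]) (use sF max_edges_subset in auto)
  have cm: "max_circ V E \<psi> ?c" unfolding max_circ_iff
   using cc sF by (auto simp: cycle_circulation_def split: if_splits)
  have lin: "circ_val V ?\<psi> p = circ_val V \<psi> p + \<delta> * circ_val V (indicator S) p" for p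
   using circ_val_linear[of 1 \<psi> \<delta> "indicator S" p] by simp
  \<comment> \<open>A circulation has total mass 1, and the indicator measures its mass on edges
    that start in \<open>S\<close>. So a circulation charging an edge that starts outside loses
    strictly against the cycle.\<close>
  have ind: "circ_val V (indicator S) p = 1 - (\<Sum>v\<in>V - S. \<Sum>w\<in>V. p v w)" if "circulation V E p" for p
  proof -
   have "circ_val V (indicator S) p = (\<Sum>v\<in>S. \<Sum>w\<in>V. p v w)"
    unfolding circ_val_def using SV D(1)
    by (intro sum.mono_neutral_cong_right) (auto simp: indicator_def)
   then show ?thesis using sum.subset_diff[OF SV(1) D(1), of "%v. \<Sum>w\<in>V. p v w"]
    circulationD(4)[OF that] by simp
  qed
  have c1: "circ_val V (indicator S) ?c = 1"
   unfolding ind[OF cc] by (simp add: cycle_circulation_def)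
  have supp: "v \<in> S" if p: "max_circ V E ?\<psi> p" "p v w > 0" for p v w
  proof (rule ccontr)
   assume "v \<notin> S"
   have pc: "circulation V E p" using p by (simp add: max_circ_def)
   have nn: "p x y \<ge> 0" for x y using pc by (auto simp: circulation_def)
   have vw: "v \<in> V" "w \<in> V" using circulation_support[OF pc p(2)] D(3) by auto
   have "p v w \<le> (\<Sum>w\<in>V. p v w)" by (rule member_le_sum) (use vw nn D(1) in auto)
   also have "\<dots> \<le> (\<Sum>v\<in>V - S. \<Sum>w\<in>V. p v w)"
    using vw \<open>v \<notin> S\<close> nn D(1) by (intro member_le_sum[of v "V - S" "%v. \<Sum>w\<in>V. p v w"]) (auto intro: sum_nonneg)
   finally have "circ_val V (indicator S) p < 1" using ind[OF pc] p(2) by linarith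
   moreover have "circ_val V \<psi> p \<le> circ_val V \<psi> ?c" using cm pc by (auto simp: max_circ_def)
   ultimately have "circ_val V ?\<psi> p < circ_val V ?\<psi> ?c"
    unfolding lin c1 using \<delta> by (intro add_le_less_mono) auto
   then show False using p(1) cc by (force simp: max_circ_def)
  qed
  have "max_circ V E ?\<psi> ?c"
  proof -
   have "circ_val V ?\<psi> p \<le> circ_val V ?\<psi> ?c" if pc: "circulation V E p" for p
   proof -
    have "circ_val V (indicator S) p \<le> 1"
     unfolding ind[OF pc] using pc by (auto intro!: sum_nonneg simp: circulation_def)
    moreover have "circ_val V \<psi> p \<le> circ_val V \<psi> ?c" using cm pc by (auto simp: max_circ_def)
    ultimately show ?thesis unfolding lin c1 using \<delta> by (intro add_mono) auto
   qed
   then show ?thesis using cc by (simp add: max_circ_def)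
  qed
  then have "(%v. (v, s v)) ` S \<subseteq> max_edges V E ?\<psi>"
   using SV S(2) by (auto simp: max_edges_def cycle_circulation_def card_gt_0_iff intro!: exI[of _ ?c])
  moreover have "max_edges V E ?\<psi> \<subseteq> (%v. (v, s v)) ` S"
  proof (rule subrelI)
   fix v w assume vw: "(v, w) \<in> max_edges V E ?\<psi>"
   then have "(w, v) \<in> (max_edges V E ?\<psi>)\<^sup>*" by (rule max_edges_recurrent)
   then have "w \<in> Domain (max_edges V E ?\<psi>)" using vw by (cases rule: converse_rtranclE) auto
   moreover have "x \<in> S" if xy: "(x, y) \<in> max_edges V E ?\<psi>" for x y
   proof -
    obtain p where "max_circ V E ?\<psi> p" "p x y > 0"
     using xy unfolding max_edges_def by blast
    then show ?thesis by (rule supp)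
   qed
   ultimately have "v \<in> S" "w \<in> S" using vw by blast+
   then have "(v, w) \<in> ?F \<inter> S \<times> S" using vw sub by blast
   then show "(v, w) \<in> (%v. (v, s v)) ` S" unfolding s(2) .
  qed
  ultimately show "max_edges V E ?\<psi> = (%v. (v, s v)) ` S" by blast
 qed
qed

text \<open>A recurrent set of edges inside a simple cycle is the whole cycle. For cycles,
  semicontinuity of the edge set thereby improves to local constancy.\<close>

lemma max_edges_minimal:
 assumes F: "max_edges V E \<psi> = (%v. (v, s v)) ` S" and sub: "max_edges V E \<psi>' \<subseteq> max_edges V E \<psi>"
  and min: "!!S'. S' \<subseteq> S ==> S' ~= {} ==> s ` S' \<subseteq> S' ==> S' = S"
 shows "max_edges V E \<psi>' = max_edges V E \<psi>"
proof -
 let ?F' = "max_edges V E \<psi>'"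
 have "Domain ?F' = S"
 proof (rule min)
  show "Domain ?F' \<subseteq> S" using sub F by auto
  show "Domain ?F' ~= {}" using max_edges_nonempty[of \<psi>'] by (simp add: Domain_empty_iff)
  show "s ` Domain ?F' \<subseteq> Domain ?F'"
  proof
   fix w assume "w \<in> s ` Domain ?F'"
   then obtain v w' where v: "(v, w') \<in> ?F'" "w = s v" by blast
   then have vw: "(v, w) \<in> ?F'" using sub F by auto
   then have "(w, v) \<in> ?F'\<^sup>*" by (rule max_edges_recurrent)
   then show "w \<in> Domain ?F'" using vw by (cases rule: converse_rtranclE) auto
  qed
 qed
 then have dom: "v \<in> Domain ?F'" if "v \<in> S" for v using that by simp
 have "(v, s v) \<in> ?F'" if v: "v \<in> S" for v
 proof -
  obtain w where w: "(v, w) \<in> ?F'" using dom[OF v] by blast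
  then have "(v, w) \<in> (%v. (v, s v)) ` S" using sub unfolding F by (rule subsetD[rotated])
  then show ?thesis using w by auto
 qed
 then have "max_edges V E \<psi> \<subseteq> ?F'" unfolding F by auto
 then show ?thesis using sub by (rule antisym[rotated])
qed

end

section \<open>Components of recurrent edge sets\<close>

definition recurrent :: "('v \<times> 'v) set => bool" where
 "recurrent F \<longleftrightarrow> finite F \<and> F ~= {} \<and> (\<forall>(v, w)\<in>F. (w, v) \<in> F\<^sup>*)"

text \<open>Reachability classes. For recurrent \<open>F\<close> reachability is symmetric, so these
  are the strongly connected components.\<close>

definition components :: "('v \<times> 'v) set => 'v set set" where
 "components F = (%v. F\<^sup>* `` {v}) ` Domain F"

definition restrict_edges :: "('v \<times> 'v) set => 'v set => ('v \<times> 'v) set" where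
 "restrict_edges F K = F \<inter> K \<times> K"

lemma recurrent_sym:
 assumes F: "recurrent F" and vw: "(v, w) \<in> F\<^sup>*" shows "(w, v) \<in> F\<^sup>*"
 using vw
proof (induction rule: rtrancl_induct)
 case (step y z)
 have "(z, y) \<in> F\<^sup>*" using step(2) F unfolding recurrent_def by blast
 then show ?case using step(3) by (rule rtrancl_trans)
qed simp

lemma recurrent_Range: "recurrent F ==> (v, w) \<in> F ==> w \<in> Domain F"
proof -
 assume "recurrent F" "(v, w) \<in> F"
 then have "(w, v) \<in> F\<^sup>*" by (auto simp: recurrent_def)
 then show ?thesis using \<open>(v, w) \<in> F\<close> by (cases rule: converse_rtranclE) auto
qed

lemma components_disjoint:
 assumes F: "recurrent F" and K: "K \<in> components F" "v \<in> K"
 shows "K = F\<^sup>* `` {v}"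
proof -
 obtain u where "u \<in> Domain F" "K = F\<^sup>* `` {u}" using K(1) by (auto simp: components_def)
 then show ?thesis using K(2) recurrent_sym[OF F] by (auto intro: rtrancl_trans)
qed

lemma components_subset:
 assumes F: "recurrent F" and K: "K \<in> components F" shows "K \<subseteq> Domain F"
proof
 fix w assume "w \<in> K"
 then obtain v where v: "v \<in> Domain F" "(v, w) \<in> F\<^sup>*" using K by (auto simp: components_def)
 from v(2) show "w \<in> Domain F"
 proof (cases rule: rtranclE)
  case (step y)
  then show ?thesis using recurrent_Range[OF F] by blast
 qed (use v in simp)
qed

lemma finite_components: "recurrent F ==> finite (components F)"
 by (auto simp: components_def recurrent_def intro: finite_Domain)

lemma components_edge:
 assumes F: "recurrent F" and K: "K \<in> components F" and vw: "(v, w) \<in> F"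
 shows "v \<in> K \<longleftrightarrow> w \<in> K"
proof -
 obtain u where "u \<in> Domain F" "K = F\<^sup>* `` {u}" using K(1) by (auto simp: components_def)
 moreover have "(w, v) \<in> F\<^sup>*" using F vw by (auto simp: recurrent_def)
 ultimately show ?thesis using vw by (auto intro: rtrancl_trans rtrancl_into_rtrancl)
qed

lemma restrict_edges_component:
 assumes F: "recurrent F" and K: "K \<in> components F" and v: "v \<in> K"
 shows "(v, w) \<in> restrict_edges F K \<longleftrightarrow> (v, w) \<in> F"
 using components_edge[OF F K] v by (auto simp: restrict_edges_def)

lemma strongly_connected_component:
 assumes F: "recurrent F" and K: "K \<in> components F"
 shows "strongly_connected K (restrict_edges F K)"
 unfolding strongly_connected_def
proof (intro conjI ballI)
 have KD: "K \<subseteq> Domain F" by (rule components_subset[OF F K])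
 show "finite K" using KD F finite_subset finite_Domain unfolding recurrent_def by blast
 show "K ~= {}" using K by (auto simp: components_def)
 show "restrict_edges F K \<subseteq> K \<times> K" by (auto simp: restrict_edges_def)
 have path: "(v, w) \<in> (restrict_edges F K)\<^sup>*" if "(v, w) \<in> F\<^sup>*" "v \<in> K" for v w
  using that
 proof (induction rule: rtrancl_induct)
  case (step y z)
  have "(v, y) \<in> F\<^sup>*" "K = F\<^sup>* `` {v}" using step components_disjoint[OF F K] by auto
  then have "y \<in> K" by auto
  then have "(y, z) \<in> restrict_edges F K" using restrict_edges_component[OF F K] step(2) by simp
  then show ?case using step by auto
 qed auto
 fix v w assume vw: "v \<in> K" "w \<in> K"
 obtain x where x: "(v, x) \<in> F" using KD vw by blast
 then have xK: "(v, x) \<in> restrict_edges F K" "x \<in> K"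
  using restrict_edges_component[OF F K vw(1)] by (auto simp: restrict_edges_def)
 have "(x, w) \<in> F\<^sup>*" using components_disjoint[OF F K xK(2)] vw by auto
 then show "(v, w) \<in> (restrict_edges F K)\<^sup>+" using path[OF _ xK(2)] xK(1) by (meson rtrancl_into_trancl2)
qed

section \<open>Entropy\<close>

lemma gibbs_term:
 fixes p q :: real
 assumes "0 \<le> p" "0 \<le> q" "p > 0 ==> q > 0"
 shows "p * ln q - p * ln p \<le> q - p" "p * ln q - p * ln p = q - p ==> p > 0 ==> p = q"
proof -
 have le: "p * ln q - p * ln p \<le> q - p" and eq: "p * ln q - p * ln p = q - p ==> p = q" if p: "p > 0"
 proof -
  have q: "q > 0" using assms p by simp
  have *: "p * ln q - p * ln p = p * ln (q / p)" using p q by (simp add: ln_div right_diff_distrib)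
  have "p * ln (q / p) \<le> p * (q / p - 1)" using p q by (intro mult_left_mono ln_le_minus_one) auto
  also have "\<dots> = q - p" using p by (simp add: field_simps)
  finally show "p * ln q - p * ln p \<le> q - p" unfolding * .
  assume e: "p * ln q - p * ln p = q - p"
  then have "p * ln (q / p) = p * (q / p - 1)" using p unfolding * by (simp add: right_diff_distrib)
  then have "ln (q / p) = q / p - 1" using p by simp
  then have "q / p = 1" using p q by (intro ln_eq_minus_one) auto
  then show "p = q" using p by simp
 qed
 show "p * ln q - p * ln p \<le> q - p" using le assms by (cases "p > 0") auto
 show "p * ln q - p * ln p = q - p ==> p > 0 ==> p = q" using eq by blast
qed

text \<open>The termwise estimate of \<open>ln\<close> is summed; a deficit in the mass of
  \<open>q\<close> only helps. In case of equality the slack vanishes in every term, and where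
  \<open>p i = 0\<close> that slack is \<open>q i\<close>, so the functions agree there as
  well.\<close>

lemma gibbs:
 fixes p q :: "'i => real"
 assumes "finite I" "!!i. i \<in> I ==> 0 \<le> p i" "!!i. i \<in> I ==> 0 \<le> q i"
  "!!i. i \<in> I ==> p i > 0 ==> q i > 0" "(\<Sum>i\<in>I. q i) \<le> (\<Sum>i\<in>I. p i)"
 shows "(\<Sum>i\<in>I. p i * ln (q i)) \<le> (\<Sum>i\<in>I. p i * ln (p i))"
  "(\<Sum>i\<in>I. p i * ln (q i)) = (\<Sum>i\<in>I. p i * ln (p i)) ==> i \<in> I ==> p i = q i"
proof -
 have t: "p i * ln (q i) - p i * ln (p i) \<le> q i - p i" if "i \<in> I" for i
  by (rule gibbs_term) (use assms that in auto)
 have "(\<Sum>i\<in>I. p i * ln (q i) - p i * ln (p i)) \<le> (\<Sum>i\<in>I. q i - p i)"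
  by (intro sum_mono t)
 then show "(\<Sum>i\<in>I. p i * ln (q i)) \<le> (\<Sum>i\<in>I. p i * ln (p i))"
  using assms(5) by (simp add: sum_subtractf)
 assume eq: "(\<Sum>i\<in>I. p i * ln (q i)) = (\<Sum>i\<in>I. p i * ln (p i))" and i: "i \<in> I"
 have "(\<Sum>i\<in>I. (q i - p i) - (p i * ln (q i) - p i * ln (p i))) \<le> 0"
  using assms(5) eq by (simp add: sum_subtractf)
 moreover have "(\<Sum>i\<in>I. (q i - p i) - (p i * ln (q i) - p i * ln (p i))) \<ge> 0"
  using t by (intro sum_nonneg) simp
 ultimately have "(\<Sum>i\<in>I. (q i - p i) - (p i * ln (q i) - p i * ln (p i))) = 0" by linarith
 then have z: "(q i - p i) - (p i * ln (q i) - p i * ln (p i)) = 0" if "i \<in> I" for i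
  using assms(1) t that by (subst (asm) sum_nonneg_eq_0_iff) auto
 show "p i = q i"
 proof (cases "p i > 0")
  case True
  have e: "p i * ln (q i) - p i * ln (p i) = q i - p i" using z[OF i] by linarith
  show ?thesis by (rule gibbs_term(2)[OF _ _ _ e True]) (use assms i in auto)
 next
  case False
  then have "p i = 0" using assms(2)[OF i] by linarith
  then show ?thesis using z[OF i] by simp
 qed
qed

text \<open>The entropies are defined through \<open>lim\<close>, which carries information only
  once convergence is known.\<close>

lemma fekete:
 fixes a :: "nat => real"
 assumes sub: "!!m n. a (m + n) \<le> a m + a n" and nn: "!!n. a n \<ge> 0"
 shows "convergent (%n. a n / real n)"
proof -
 define L where "L = (INF n\<in>{1..}. a n / real n)"
 have bdd: "bdd_below ((%n. a n / real n) ` {1..})"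
  using nn by (auto simp: bdd_below_def intro!: exI[of _ 0])
 have mult: "a (q * m + r) \<le> real q * a m + a r" for q m r
 proof (induction q)
  case (Suc q)
  have "a (Suc q * m + r) \<le> a m + a (q * m + r)" using sub[of m "q * m + r"] by (simp add: add.assoc)
  then show ?case using Suc by (simp add: algebra_simps)
 qed simp
 have "(%n. a n / real n) \<longlonglongrightarrow> L"
 proof (rule order_tendstoI)
  fix y assume "y < L"
  have "y < a n / real n" if "n \<ge> 1" for n
   using \<open>y < L\<close> cINF_lower[OF bdd, of n] that by (simp add: L_def)
  then show "\<forall>\<^sub>F n in sequentially. y < a n / real n"
   by (auto simp: eventually_sequentially)
 next
  fix y assume "L < y"
  then obtain m where m: "m \<ge> 1" "a m / real m < y"
   unfolding L_def by (subst (asm) cINF_less_iff) (use bdd in auto)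
  define C where "C = (\<Sum>r<m. a r)"
  have C: "a r \<le> C" if "r < m" for r
   unfolding C_def by (rule member_le_sum) (use that nn in auto)
  have le: "a n / real n \<le> a m / real m + C / real n" if n: "n \<ge> 1" for n
  proof -
   have "a n \<le> real (n div m) * a m + a (n mod m)" using mult[of "n div m" m "n mod m"] by simp
   also have "\<dots> \<le> (real n / real m) * a m + C"
    using m nn C[of "n mod m"] by (intro add_mono mult_right_mono) (auto simp: of_nat_div_le_of_nat)
   finally have "a n / real n \<le> ((real n / real m) * a m + C) / real n"
    by (intro divide_right_mono) auto
   also have "\<dots> = a m / real m + C / real n" using n by (simp add: add_divide_distrib)
   finally show ?thesis .
  qed
  have "(%n. a m / real m + C / real n) \<longlonglongrightarrow> a m / real m + 0"
   by (intro tendsto_add tendsto_const lim_const_over_n)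
  then have "\<forall>\<^sub>F n in sequentially. a m / real m + C / real n < y"
   using m(2) by (intro order_tendstoD(2)) auto
  then show "\<forall>\<^sub>F n in sequentially. a n / real n < y"
   using eventually_ge_at_top[of 1] by eventually_elim (use le in force)
 qed
 then show ?thesis by (auto simp: convergent_def)
qed

subsection \<open>Words\<close>

definition words :: "'v set => nat => 'v list set" where
 "words V n = {u. set u \<subseteq> V \<and> length u = n}"

lemma finite_words: "finite V ==> finite (words V n)"
 unfolding words_def by (rule finite_lists_length_eq)

lemma words_0: "words V 0 = {[]}"
 by (auto simp: words_def)

lemma sum_words_Suc: "(\<Sum>u\<in>words V (Suc n). f u) = (\<Sum>u\<in>words V n. \<Sum>v\<in>V. f (u @ [v]))"
proof -
 have "words V (Suc n) = (%(u, v). u @ [v]) ` (words V n \<times> V)"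
 proof (intro equalityI subsetI)
  fix w assume "w \<in> words V (Suc n)"
  then have "w = butlast w @ [last w]" "butlast w \<in> words V n" "last w \<in> V"
   by (cases w rule: rev_cases; auto simp: words_def)+
  then show "w \<in> (%(u, v). u @ [v]) ` (words V n \<times> V)"
   by (intro image_eqI[of _ _ "(butlast w, last w)"]) auto
 qed (auto simp: words_def)
 moreover have "inj_on (%(u, v). u @ [v]) (words V n \<times> V)" by (auto simp: inj_on_def)
 ultimately show ?thesis by (simp only: sum.reindex sum.cartesian_product) (auto intro!: sum.cong)
qed

lemma sum_words_Suc': "(\<Sum>u\<in>words V (Suc n). f u) = (\<Sum>v\<in>V. \<Sum>u\<in>words V n. f (v # u))"
proof -
 have "words V (Suc n) = (%(v, u). v # u) ` (V \<times> words V n)"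
  by (auto simp: words_def length_Suc_conv)
 moreover have "inj_on (%(v, u). v # u) (V \<times> words V n)" by (auto simp: inj_on_def)
 ultimately show ?thesis by (simp only: sum.reindex sum.cartesian_product) (auto intro!: sum.cong)
qed

lemma sum_words_prod_le:
 assumes "!!i r. r \<in> R ==> i < n ==> 0 \<le> k i r" "!!i. i < n ==> (\<Sum>r\<in>R. k i r) \<le> (1::real)"
 shows "(\<Sum>a\<in>words R n. \<Prod>i<n. k i (a ! i)) \<le> 1"
 using assms
proof (induction n)
 case (Suc n)
 have nn: "0 \<le> (\<Prod>i<n. k i (a ! i))" if "a \<in> words R n" for a
 proof (rule prod_nonneg, rule Suc.prems(1))
  fix i assume "i \<in> {..<n}"
  then show "a ! i \<in> R" "i < Suc n" using that by (auto simp: words_def)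
 qed
 have "(\<Sum>a\<in>words R (Suc n). \<Prod>i<Suc n. k i (a ! i))
   = (\<Sum>a\<in>words R n. \<Sum>r\<in>R. (\<Prod>i<n. k i (a ! i)) * k n r)"
  unfolding sum_words_Suc
  by (intro sum.cong refl) (auto simp: words_def nth_append)
 also have "\<dots> = (\<Sum>a\<in>words R n. (\<Prod>i<n. k i (a ! i)) * (\<Sum>r\<in>R. k n r))"
  by (simp add: sum_distrib_left)
 also have "\<dots> \<le> (\<Sum>a\<in>words R n. (\<Prod>i<n. k i (a ! i)) * 1)"
  by (intro sum_mono mult_left_mono Suc.prems nn) auto
 also have "\<dots> \<le> 1" using Suc by simp
 finally show ?case .
qed (simp add: words_0)

text \<open>The weight of a word of length \<open>n + N\<close> under a chain with memory
  \<open>n\<close>: \<open>p\<close> weighs the initial word and \<open>g\<close> each window of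
  length \<open>n + 1\<close>. Total mass at most 1 suffices for its use as a code.\<close>

definition chain_weight :: "nat => ('v list => real) => ('v list => real) => nat => 'v list => real" where
 "chain_weight n p g N b = p (take n b) * (\<Prod>i<N. g (take (Suc n) (drop i b)))"

lemma chain_weight_append:
 assumes "length b = n + N"
 shows "chain_weight n p g (Suc N) (b @ [v]) = chain_weight n p g N b * g (drop N b @ [v])"
proof -
 have "take (Suc n) (drop i (b @ [v])) = take (Suc n) (drop i b)" if "i < N" for i
  using assms that by simp
 moreover have "take (Suc n) (drop N (b @ [v])) = drop N b @ [v]" using assms by simp
 ultimately show ?thesis using assms by (simp add: chain_weight_def)
qed

lemma sum_chain_weight_le:
 assumes V: "finite V" and p: "!!u. u \<in> words V n ==> 0 \<le> p u" "(\<Sum>u\<in>words V n. p u) \<le> 1"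
  and g: "!!u. u \<in> words V (Suc n) ==> 0 \<le> g u" "!!u. u \<in> words V n ==> (\<Sum>v\<in>V. g (u @ [v])) \<le> 1"
 shows "(\<Sum>b\<in>words V (n + N). chain_weight n p g N b) \<le> 1"
  "!!b. b \<in> words V (n + N) ==> 0 \<le> chain_weight n p g N b"
proof -
 have sub: "drop i b \<in> words V (length b - i)" "take j b \<in> words V (min (length b) j)"
  if "set b \<subseteq> V" for b i j
  using that set_drop_subset[of i b] set_take_subset[of j b] by (auto simp: words_def)
 show nn: "0 \<le> chain_weight n p g N b" if b: "b \<in> words V (n + N)" for b N
  unfolding chain_weight_def
 proof (intro mult_nonneg_nonneg prod_nonneg ballI p(1) g(1))
  show "take n b \<in> words V n" using b sub(2)[of b n] by (auto simp: words_def)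
  fix i assume "i \<in> {..<N}"
  moreover have "set (take (Suc n) (drop i b)) \<subseteq> V"
   using b set_take_subset[of "Suc n" "drop i b"] set_drop_subset[of i b] by (auto simp: words_def)
  ultimately show "take (Suc n) (drop i b) \<in> words V (Suc n)" using b by (auto simp: words_def)
 qed
 show "(\<Sum>b\<in>words V (n + N). chain_weight n p g N b) \<le> 1"
 proof (induction N)
  case 0
  have "(\<Sum>b\<in>words V (n + 0). chain_weight n p g 0 b) = (\<Sum>u\<in>words V n. p u)"
   by (intro sum.cong) (auto simp: chain_weight_def words_def)
  then show ?case using p by simp
 next
  case (Suc N)
  have "(\<Sum>b\<in>words V (n + Suc N). chain_weight n p g (Suc N) b)
    = (\<Sum>b\<in>words V (n + N). \<Sum>v\<in>V. chain_weight n p g N b * g (drop N b @ [v]))"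
   unfolding add_Suc_right sum_words_Suc
   by (intro sum.cong refl chain_weight_append) (auto simp: words_def)
  also have "\<dots> = (\<Sum>b\<in>words V (n + N). chain_weight n p g N b * (\<Sum>v\<in>V. g (drop N b @ [v])))"
   by (simp add: sum_distrib_left)
  also have "\<dots> \<le> (\<Sum>b\<in>words V (n + N). chain_weight n p g N b * 1)"
  proof (intro sum_mono mult_left_mono g(2) nn)
   fix b assume "b \<in> words V (n + N)"
   then show "drop N b \<in> words V n" using sub(1)[of b N] by (auto simp: words_def)
  qed
  also have "\<dots> \<le> 1" using Suc by simp
  finally show ?case .
 qed
qed

subsection \<open>Entropy of simple functions\<close>

definition itinerary :: "('a => 'a) => ('a => 'b) => nat => 'a => 'b list" where
 "itinerary T c n x = map (%i. c ((T ^^ i) x)) [0..<n]"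

lemma length_itinerary [simp]: "length (itinerary T c n x) = n"
 by (simp add: itinerary_def)

lemma itinerary_0 [simp]: "itinerary T c 0 x = []"
 by (simp add: itinerary_def)

lemma itinerary_Suc: "itinerary T c (Suc n) x = itinerary T c n x @ [c ((T ^^ n) x)]"
 by (simp add: itinerary_def)

lemma nth_itinerary: "i < n ==> itinerary T c n x ! i = c ((T ^^ i) x)"
 by (simp add: itinerary_def)

lemma take_itinerary: "m \<le> n ==> take m (itinerary T c n x) = itinerary T c m x"
 by (simp add: itinerary_def take_map)

lemma drop_itinerary: "drop m (itinerary T c n x) = itinerary T c (n - m) ((T ^^ m) x)"
 by (rule nth_equalityI) (auto simp: nth_itinerary funpow_add add.commute)

lemma window_itinerary:
 "i + m \<le> n ==> take m (drop i (itinerary T c n x)) = itinerary T c m ((T ^^ i) x)"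
 by (simp add: drop_itinerary take_itinerary)

context prob_space
begin

definition fibre_prob :: "('a => 'b) => 'b => real" where
 "fibre_prob f y = measure M (f -` {y} \<inter> space M)"

text \<open>Shannon entropy of the partition into fibres. With functions instead of families of
  sets, common refinements are pairs and entropies are integrals.\<close>

definition ent :: "('a => 'b) => real" where
 "ent f = - (\<Sum>y\<in>f ` space M. fibre_prob f y * ln (fibre_prob f y))"

lemma simple_integral_eq:
 fixes g :: "'b => real"
 assumes f: "simple_function M f" and I: "finite I" "f ` space M \<subseteq> I"
 shows "integrable M (%x. g (f x))" "(\<integral>x. g (f x) \<partial>M) = (\<Sum>y\<in>I. fibre_prob f y * g y)"
proof -
 have fib: "f -` {y} \<inter> space M \<in> sets M" for y
  using f by (rule simple_functionD(2))
 have eq: "g (f x) = (\<Sum>y\<in>I. g y * indicator (f -` {y} \<inter> space M) x)" if "x \<in> space M" for x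
 proof -
  have "(\<Sum>y\<in>I. g y * indicator (f -` {y} \<inter> space M) x) = (\<Sum>y\<in>I. if y = f x then g y else 0)"
   using that by (intro sum.cong) (auto simp: indicator_def)
  then show ?thesis using that I by auto
 qed
 have int: "integrable M (%x. g y * indicator (f -` {y} \<inter> space M) x)" for y
  using fib by (intro integrable_mult_right integrable_real_indicator) (auto simp: emeasure_eq_measure)
 have "integrable M (%x. \<Sum>y\<in>I. g y * indicator (f -` {y} \<inter> space M) x)"
  by (intro Bochner_Integration.integrable_sum int)
 then show "integrable M (%x. g (f x))"
  by (subst Bochner_Integration.integrable_cong[OF refl eq]) auto
 have "(\<integral>x. g (f x) \<partial>M) = (\<integral>x. (\<Sum>y\<in>I. g y * indicator (f -` {y} \<inter> space M) x) \<partial>M)"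
  by (intro Bochner_Integration.integral_cong refl eq)
 also have "\<dots> = (\<Sum>y\<in>I. \<integral>x. g y * indicator (f -` {y} \<inter> space M) x \<partial>M)"
  by (intro Bochner_Integration.integral_sum int)
 also have "\<dots> = (\<Sum>y\<in>I. fibre_prob f y * g y)"
  using fib by (intro sum.cong refl) (simp add: fibre_prob_def mult.commute)
 finally show "(\<integral>x. g (f x) \<partial>M) = (\<Sum>y\<in>I. fibre_prob f y * g y)" .
qed

lemma fibre_prob_nonneg [simp]: "0 \<le> fibre_prob f y" by (simp add: fibre_prob_def)

lemma fibre_prob_outside: "y \<notin> f ` space M ==> fibre_prob f y = 0"
proof -
 assume "y \<notin> f ` space M"
 then have "f -` {y} \<inter> space M = {}" by blast
 then show ?thesis by (simp add: fibre_prob_def)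
qed

lemma ent_eq:
 assumes "finite I" "f ` space M \<subseteq> I"
 shows "ent f = - (\<Sum>y\<in>I. fibre_prob f y * ln (fibre_prob f y))"
 unfolding ent_def using assms fibre_prob_outside[of _ f]
 by (intro arg_cong[where f = uminus] sum.mono_neutral_left) auto

lemma sum_fibre_prob:
 assumes "simple_function M f" "finite I" "f ` space M \<subseteq> I"
 shows "(\<Sum>y\<in>I. fibre_prob f y) = 1"
 using simple_integral_eq(2)[OF assms, of "%_. 1"] by (simp add: prob_space)

lemma ent_nonneg: "0 \<le> ent f"
proof -
 have "fibre_prob f y * ln (fibre_prob f y) \<le> 0" for y
  by (cases "fibre_prob f y = 0")
   (auto simp: fibre_prob_def mult_le_0_iff measure_nonneg intro!: disjI1 ln_le_zero_iff[THEN iffD2] simp: less_le)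
 then show ?thesis by (auto simp: ent_def intro: sum_nonpos)
qed

lemma ent_integral: "simple_function M f ==> ent f = (\<integral>x. - ln (fibre_prob f (f x)) \<partial>M)"
 using simple_integral_eq(2)[of f "f ` space M" "%y. - ln (fibre_prob f y)"]
 by (simp add: ent_def sum_negf simple_functionD(1))

lemma fibre_prob_mono:
 assumes g: "simple_function M g" and h: "!!x. x \<in> space M ==> g x = h (f x)"
 shows "fibre_prob f y \<le> fibre_prob g (h y)"
 unfolding fibre_prob_def
proof (rule finite_measure_mono)
 show "f -` {y} \<inter> space M \<subseteq> g -` {h y} \<inter> space M" using h by auto
qed (rule simple_functionD(2)[OF g])

lemma ent_mono:
 assumes f: "simple_function M f" and g: "simple_function M g" and h: "!!x. x \<in> space M ==> g x = h (f x)"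
 shows "ent g \<le> ent f"
proof -
 have fin: "finite (f ` space M)" using f by (rule simple_functionD(1))
 have "ent g = (\<integral>x. - ln (fibre_prob g (g x)) \<partial>M)" by (rule ent_integral[OF g])
 also have "\<dots> = (\<integral>x. - ln (fibre_prob g (h (f x))) \<partial>M)"
  by (intro Bochner_Integration.integral_cong refl) (simp add: h)
 also have "\<dots> = (\<Sum>y\<in>f ` space M. fibre_prob f y * - ln (fibre_prob g (h y)))"
  by (rule simple_integral_eq(2)[OF f fin]) auto
 also have "\<dots> \<le> (\<Sum>y\<in>f ` space M. fibre_prob f y * - ln (fibre_prob f y))"
 proof (rule sum_mono)
  fix y
  show "fibre_prob f y * - ln (fibre_prob g (h y)) \<le> fibre_prob f y * - ln (fibre_prob f y)"
  proof (cases "fibre_prob f y = 0")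
   case False
   then have "0 < fibre_prob f y" using fibre_prob_nonneg[of f y] by linarith
   then show ?thesis using fibre_prob_mono[of g h f y, OF g h] by (intro mult_left_mono) auto
  qed simp
 qed
 also have "\<dots> = ent f" by (simp add: ent_def sum_negf)
 finally show ?thesis .
qed

text \<open>Gibbs' inequality in coding form: no code given by weights \<open>q\<close> of total
  mass at most 1 has expected cost below the entropy.\<close>

lemma ent_le:
 fixes q :: "'b => real"
 assumes f: "simple_function M f" and I: "finite I" "f ` space M \<subseteq> I"
  and q: "!!y. y \<in> I ==> 0 \<le> q y" "(\<Sum>y\<in>I. q y) \<le> 1" "!!y. y \<in> I ==> fibre_prob f y > 0 ==> q y > 0"
 shows "ent f \<le> (\<integral>x. - ln (q (f x)) \<partial>M)"
proof -
 have "(\<Sum>y\<in>I. fibre_prob f y * ln (q y)) \<le> (\<Sum>y\<in>I. fibre_prob f y * ln (fibre_prob f y))"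
  by (rule gibbs(1)) (use I q sum_fibre_prob[OF f I] in auto)
 then show ?thesis
  using simple_integral_eq(2)[OF f I, of "%y. - ln (q y)"] ent_eq[OF I] by (simp add: sum_negf)
qed

end

subsection \<open>Kolmogorov--Sinai entropy\<close>

locale measure_preserving = prob_space M for M :: "'a measure" +
 fixes T :: "'a => 'a"
 assumes T_measurable: "T \<in> measurable M M" and T_invariant: "distr M M T = M"
begin

lemma Tn_measurable: "T ^^ i \<in> measurable M M"
 by (rule measurable_compose_n[OF T_measurable])

lemma Tn_space: "x \<in> space M ==> (T ^^ i) x \<in> space M"
 using measurable_space[OF Tn_measurable] .

lemma Tn_invariant: "distr M M (T ^^ i) = M"
proof (induction i)
 case 0
 then show ?case by (simp add: distr_id2)
next
 case (Suc i)
 have "distr M M (T ^^ Suc i) = distr (distr M M (T ^^ i)) M T"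
  using distr_distr[OF T_measurable Tn_measurable[of i]] by simp
 then show ?case unfolding Suc T_invariant .
qed

lemma measure_Tn: "A \<in> sets M ==> measure M ((T ^^ i) -` A \<inter> space M) = measure M A"
 using measure_distr[OF Tn_measurable, of A i] by (simp add: Tn_invariant)

lemma integral_Tn:
 fixes g :: "'a => real"
 assumes "g \<in> borel_measurable M"
 shows "(\<integral>x. g ((T ^^ i) x) \<partial>M) = (\<integral>x. g x \<partial>M)"
 using integral_distr[OF Tn_measurable assms, of i] by (simp add: Tn_invariant)

lemma simple_Tn: "simple_function M f ==> simple_function M (%x. f ((T ^^ i) x))"
 by (rule simple_function_comp[OF Tn_measurable])

lemma simple_itinerary:
 assumes "simple_function M f" shows "simple_function M (itinerary T f n)"
proof (induction n)
 case 0
 then show ?case by (simp add: itinerary_def)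
next
 case (Suc n)
 have "simple_function M (%x. itinerary T f n x @ [f ((T ^^ n) x)])"
  by (rule simple_function_compose2[OF Suc simple_Tn[OF assms]])
 then show ?case by (simp add: itinerary_Suc[abs_def])
qed

lemma integrable_simple: "simple_function M f ==> integrable M (%x. g (f x) :: real)"
 by (rule simple_integral_eq(1)[where I = "f ` space M"]) (auto dest: simple_functionD)

lemma integral_simple_Tn:
 "simple_function M f ==> (\<integral>x. g (f ((T ^^ i) x)) \<partial>M) = (\<integral>x. (g (f x) :: real) \<partial>M)"
 by (rule integral_Tn) (rule borel_measurable_integrable[OF integrable_simple])

lemma itinerary_range: "itinerary T f n ` space M \<subseteq> words (f ` space M) n"
 using Tn_space by (auto simp: words_def itinerary_def)

lemma fibre_prob_Tn: "simple_function M f ==> fibre_prob (%x. f ((T ^^ i) x)) y = fibre_prob f y"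
proof -
 assume f: "simple_function M f"
 have "(%x. f ((T ^^ i) x)) -` {y} \<inter> space M = (T ^^ i) -` (f -` {y} \<inter> space M) \<inter> space M"
  using Tn_space by auto
 then show ?thesis
  unfolding fibre_prob_def using measure_Tn[OF simple_functionD(2)[OF f]] by simp
qed

text \<open>A word of length \<open>m + n\<close> is coded by the product of the distributions of
  its two parts; by invariance the second part is distributed like an initial word of length
  \<open>n\<close>.\<close>

lemma ent_itinerary_subadditive:
 assumes f: "simple_function M f"
 shows "ent (itinerary T f (m + n)) \<le> ent (itinerary T f m) + ent (itinerary T f n)"
proof -
 let ?R = "f ` space M"
 let ?P = "%n. fibre_prob (itinerary T f n)"
 define Q where "Q u = ?P m (take m u) * ?P n (drop m u)" for u
 note si = simple_itinerary[OF f]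
 have finR: "finite ?R" using f by (rule simple_functionD(1))
 have fw: "finite (words ?R k)" for k by (rule finite_words[OF finR])
 have tot: "(\<Sum>u\<in>words ?R k. ?P k u) = 1" for k
  by (rule sum_fibre_prob[OF si fw itinerary_range])
 have "(\<Sum>u\<in>words ?R (m + n). Q u) \<le> 1"
 proof -
  have inj: "inj_on (%u. (take m u, drop m u)) (words ?R (m + n))"
   by (auto simp: inj_on_def) (metis append_take_drop_id)
  have sub: "(%u. (take m u, drop m u)) ` words ?R (m + n) \<subseteq> words ?R m \<times> words ?R n"
   by (auto simp: words_def dest!: in_set_takeD in_set_dropD)
  have "(\<Sum>u\<in>words ?R (m + n). Q u)
    = (\<Sum>(a, b)\<in>(%u. (take m u, drop m u)) ` words ?R (m + n). ?P m a * ?P n b)"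
   by (subst sum.reindex[OF inj]) (simp add: Q_def)
  also have "\<dots> \<le> (\<Sum>(a, b)\<in>words ?R m \<times> words ?R n. ?P m a * ?P n b)"
   by (rule sum_mono2[OF _ sub]) (auto simp: fw)
  also have "\<dots> = (\<Sum>a\<in>words ?R m. ?P m a) * (\<Sum>b\<in>words ?R n. ?P n b)"
   by (simp only: sum_product sum.cartesian_product)
  also have "\<dots> = 1" unfolding tot by simp
  finally show ?thesis .
 qed
 moreover have "0 < Q u" if "0 < ?P (m + n) u" for u
 proof -
  have "?P (m + n) u \<le> ?P m (take m u)"
   by (rule fibre_prob_mono[OF si]) (simp add: take_itinerary)
  moreover have "?P (m + n) u \<le> fibre_prob (%x. itinerary T f n ((T ^^ m) x)) (drop m u)"
   by (rule fibre_prob_mono[OF simple_Tn[OF si]]) (simp add: drop_itinerary)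
  ultimately show ?thesis using that unfolding Q_def fibre_prob_Tn[OF si]
   by (intro mult_pos_pos) linarith+
 qed
 ultimately have "ent (itinerary T f (m + n)) \<le> (\<integral>x. - ln (Q (itinerary T f (m + n) x)) \<partial>M)"
  by (intro ent_le[OF si fw itinerary_range]) (auto simp: Q_def)
 also have "\<dots> \<le> (\<integral>x. - ln (?P m (itinerary T f m x)) + - ln (?P n (itinerary T f n ((T ^^ m) x))) \<partial>M)"
 proof (rule integral_mono)
  show "integrable M (%x. - ln (Q (itinerary T f (m + n) x)))"
   by (rule integrable_simple[OF si])
  show "integrable M (%x. - ln (?P m (itinerary T f m x)) + - ln (?P n (itinerary T f n ((T ^^ m) x))))"
   by (intro Bochner_Integration.integrable_add integrable_simple[OF si] integrable_simple[OF simple_Tn[OF si]])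
  fix x
  have p: "?P k y = 0 \<or> ?P k y > 0" "?P k y \<le> 1" for k y
   by (auto simp: less_le fibre_prob_def)
  then have "ln (?P k y) \<le> 0" for k y by (metis le_numeral_extra(3) ln_0 ln_le_zero_iff)
  \<comment> \<open>With \<open>ln 0 = 0\<close> additivity may fail when a factor vanishes, but the
    other logarithm is nonpositive, so the inequality survives.\<close>
  then have nz: "ln (a * b) \<ge> ln a + ln b" if "a = ?P m y" "b = ?P n z" for a b y z
   using that p[of m y] p[of n z]
   by (cases "a = 0 \<or> b = 0") (auto simp: ln_mult intro: add_nonpos_nonpos)
  show "- ln (Q (itinerary T f (m + n) x)) \<le> - ln (?P m (itinerary T f m x)) + - ln (?P n (itinerary T f n ((T ^^ m) x)))"
   using nz[OF refl refl, of "itinerary T f m x" "itinerary T f n ((T ^^ m) x)"]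
   by (simp add: Q_def take_itinerary drop_itinerary)
 qed
 also have "\<dots> = ent (itinerary T f m) + ent (itinerary T f n)"
 proof -
  have "integrable M (%x. - ln (?P m (itinerary T f m x)))" by (rule integrable_simple[OF si])
  moreover have "integrable M (%x. - ln (?P n (itinerary T f n ((T ^^ m) x))))"
   by (rule integrable_simple[OF simple_Tn[OF si]])
  ultimately show ?thesis
   using integral_simple_Tn[OF si, of "%y. - ln (?P n y)"] by (simp add: ent_integral[OF si])
 qed
 finally show ?thesis .
qed

lemma convergent_ent: "simple_function M f ==> convergent (%n. ent (itinerary T f n) / real n)"
 by (rule fekete[OF ent_itinerary_subadditive ent_nonneg])

definition fibres :: "('a => 'b) => 'a set set" where
 "fibres f = (%y. f -` {y} \<inter> space M) ` f ` space M"

text \<open>Distinct words have disjoint fibres, so two of them give the same set only if it is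
  empty, where the term is 0. This reconciles the sum over a family of sets with the sum over
  words.\<close>

lemma partition_entropy_fibres:
 assumes f: "simple_function M f"
 shows "partition_entropy M (iterated_join T (space M) (fibres f) n) = ent (itinerary T f n)"
proof -
 let ?R = "f ` space M" and ?S = "space M"
 define J where "J u = itinerary T f n -` {u} \<inter> ?S" for u
 have J: "x \<in> J u \<longleftrightarrow> x \<in> ?S \<and> (\<forall>i<n. f ((T ^^ i) x) = u ! i)" if "length u = n" for x u
  using that by (auto simp: J_def list_eq_iff_nth_eq nth_itinerary)
 have "iterated_join T ?S (fibres f) n = J ` words ?R n"
 proof (intro equalityI subsetI)
  fix B assume "B \<in> iterated_join T ?S (fibres f) n"
  then obtain Q where Q: "B = {x \<in> ?S. \<forall>i<n. (T ^^ i) x \<in> Q i}" "!!i. i < n ==> Q i \<in> fibres f"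
   by (auto simp: iterated_join_def)
  have "\<forall>i. \<exists>y. i < n --> y \<in> ?R \<and> Q i = f -` {y} \<inter> ?S" using Q(2) unfolding fibres_def by blast
  then obtain y where y: "!!i. i < n ==> y i \<in> ?R \<and> Q i = f -` {y i} \<inter> ?S" by metis
  have "B = J (map y [0..<n])"
   using y Tn_space by (auto simp: J Q(1))
  moreover have "map y [0..<n] \<in> words ?R n" using y by (auto simp: words_def)
  ultimately show "B \<in> J ` words ?R n" by blast
 next
  fix B assume "B \<in> J ` words ?R n"
  then obtain u where u: "u \<in> words ?R n" "B = J u" by blast
  have len: "length u = n" using u by (simp add: words_def)
  define Q where "Q i = (if i < n then f -` {u ! i} \<inter> ?S else {})" for i
  have "B = {x \<in> ?S. \<forall>i<n. (T ^^ i) x \<in> Q i}"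
   using Tn_space by (auto simp: u(2) J[OF len] Q_def)
  moreover have "Q \<in> {..<n} \<rightarrow> fibres f"
  proof
   fix i assume "i \<in> {..<n}"
   then have "u ! i \<in> ?R" using u nth_mem[of i u] by (auto simp: words_def)
   then show "Q i \<in> fibres f" using \<open>i \<in> {..<n}\<close> unfolding Q_def fibres_def by auto
  qed
  ultimately show "B \<in> iterated_join T ?S (fibres f) n" unfolding iterated_join_def by blast
 qed
 moreover have "(\<Sum>B\<in>J ` words ?R n. measure M B * ln (measure M B))
   = (\<Sum>u\<in>words ?R n. measure M (J u) * ln (measure M (J u)))"
 proof (subst sum.reindex_nontrivial)
  show "finite (words ?R n)" using f by (intro finite_words simple_functionD(1))
  fix u v assume "u ~= v" "J u = J v"
  then have "J u = {}" by (auto simp: J_def)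
  then show "measure M (J u) * ln (measure M (J u)) = 0" by simp
 qed simp
 ultimately show ?thesis
  using ent_eq[OF finite_words itinerary_range, of f n] f
  by (simp add: partition_entropy_def fibre_prob_def J_def simple_functionD(1))
qed

lemma fibres_partition:
 assumes f: "simple_function M f"
 shows "finite (fibres f)" "fibres f \<subseteq> sets M" "partition_on (space M) (fibres f)"
 using simple_functionD[OF f] by (auto simp: fibres_def partition_on_def disjoint_def)

lemma partition_eq_fibres:
 assumes "finite P" "P \<subseteq> sets M" "partition_on (space M) P"
 obtains f :: "'a => 'a set" where "simple_function M f" "fibres f = P"
proof -
 define f where "f x = (THE B. B \<in> P \<and> x \<in> B)" for x
 have f: "f x = B" if "B \<in> P" "x \<in> B" for x B
  unfolding f_def using that assms(3)
  by (intro the_equality) (auto simp: partition_on_def disjoint_def)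
 have img: "f ` space M = P"
 proof (intro equalityI subsetI)
  fix B assume "B \<in> f ` space M"
  then obtain x where x: "x \<in> space M" "B = f x" by blast
  then obtain C where "C \<in> P" "x \<in> C" using assms(3) by (auto simp: partition_on_def)
  then show "B \<in> P" using f x by simp
 next
  fix B assume B: "B \<in> P"
  then obtain x where "x \<in> B" using assms(3) by (metis all_not_in_conv partition_on_def)
  moreover have "B \<subseteq> space M" using B assms(2) sets.sets_into_space by blast
  ultimately show "B \<in> f ` space M" using f[OF B, of x] by blast
 qed
 have fib: "f -` {B} \<inter> space M = B" if B: "B \<in> P" for B
 proof (intro equalityI subsetI)
  fix x assume x: "x \<in> f -` {B} \<inter> space M"
  then obtain C where "C \<in> P" "x \<in> C" using assms(3) by (auto simp: partition_on_def)
  then show "x \<in> B" using f x by auto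
 next
  fix x assume "x \<in> B"
  moreover have "B \<subseteq> space M" using B assms(2) sets.sets_into_space by blast
  ultimately show "x \<in> f -` {B} \<inter> space M" using f[OF B, of x] by blast
 qed
 have "simple_function M f" unfolding simple_function_def img using assms fib by auto
 moreover have "fibres f = P" unfolding fibres_def img using fib by simp
 ultimately show ?thesis using that by blast
qed

lemma measure_entropy_ge:
 assumes "simple_function M f"
 shows "ereal (lim (%n. ent (itinerary T f n) / real n)) \<le> measure_entropy T M"
 unfolding measure_entropy_def
 by (rule SUP_upper2[of "fibres f"])
  (use fibres_partition[OF assms] partition_entropy_fibres[OF assms] in auto)

lemma measure_entropy_le:
 assumes "!!f :: 'a => 'a set. simple_function M f ==> lim (%n. ent (itinerary T f n) / real n) \<le> s"
 shows "measure_entropy T M \<le> ereal s"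
 unfolding measure_entropy_def
proof (rule SUP_least)
 fix P assume "P \<in> {P. finite P \<and> P \<subseteq> sets M \<and> partition_on (space M) P}"
 then obtain f :: "'a => 'a set" where f: "simple_function M f" "fibres f = P"
  using partition_eq_fibres[of P] by auto
 show "ereal (lim (%n. partition_entropy M (iterated_join T (space M) P n) / real n)) \<le> ereal s"
  using partition_entropy_fibres[OF f(1)] assms[OF f(1)] by (simp add: f(2))
qed

lemma measure_entropy_nonneg: "0 \<le> measure_entropy T M"
proof -
 have f: "simple_function M (%_::'a. 0::nat)" by simp
 have "0 \<le> lim (%n. ent (itinerary T (%_. 0::nat) n) / real n)"
  by (rule LIMSEQ_le_const[OF convergent_LIMSEQ_iff[THEN iffD1, OF convergent_ent[OF f]]])
   (simp add: ent_nonneg)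
 then show ?thesis using measure_entropy_ge[OF f] by (metis ereal_less_eq(5) order_trans)
qed

end

subsection \<open>Entropy with respect to a generating partition\<close>

locale gen_system = measure_preserving M T for M :: "'a measure" and T +
 fixes c :: "'a => 'v"
 assumes simple_c: "simple_function M c"
  and generated: "sets M = sigma_sets (space M)
   (range (%u. {x \<in> space M. itinerary T c (length u) x = u}))"
begin

abbreviation "alphabet \<equiv> c ` space M"

definition prw :: "'v list => real" where
 "prw u = fibre_prob (itinerary T c (length u)) u"

lemma finite_alphabet: "finite alphabet"
 using simple_c by (rule simple_functionD(1))

lemma prw_nonneg [simp]: "0 \<le> prw u"
 by (simp add: prw_def)

lemmas simple_word = simple_itinerary[OF simple_c]

lemma integral_words:
 fixes g :: "'v list => real"
 shows "(\<integral>x. g (itinerary T c n x) \<partial>M) = (\<Sum>u\<in>words alphabet n. prw u * g u)"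
proof -
 have "(\<integral>x. g (itinerary T c n x) \<partial>M)
   = (\<Sum>u\<in>words alphabet n. fibre_prob (itinerary T c n) u * g u)"
  by (rule simple_integral_eq(2)[OF simple_word finite_words[OF finite_alphabet] itinerary_range])
 then show ?thesis by (simp add: prw_def words_def)
qed

lemma prw_outside: "u \<notin> words alphabet (length u) ==> prw u = 0"
 unfolding prw_def using itinerary_range[of c "length u"] by (intro fibre_prob_outside) blast

lemma sum_prw: "(\<Sum>u\<in>words alphabet n. prw u) = 1"
 using integral_words[of "%_. 1" n] by (simp add: prob_space)

lemma ent_words: "ent (itinerary T c n) = - (\<Sum>u\<in>words alphabet n. prw u * ln (prw u))"
proof -
 have "(\<Sum>y\<in>words alphabet n. fibre_prob (itinerary T c n) y * ln (fibre_prob (itinerary T c n) y))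
   = (\<Sum>u\<in>words alphabet n. prw u * ln (prw u))"
  by (intro sum.cong) (auto simp: prw_def words_def)
 then show ?thesis
  using ent_eq[OF finite_words[OF finite_alphabet] itinerary_range] by simp
qed

lemma prw_append: "prw u = (\<Sum>v\<in>alphabet. prw (u @ [v]))"
proof -
 let ?n = "length u"
 have "prw u = (\<integral>x. (if itinerary T c ?n x = u then 1 else 0) \<partial>M)"
 proof (cases "u \<in> words alphabet ?n")
  case True
  have "(\<integral>x. (if itinerary T c ?n x = u then 1 else 0) \<partial>M)
    = (\<Sum>w\<in>words alphabet ?n. prw w * (if w = u then 1 else 0))"
   by (rule integral_words)
  also have "\<dots> = (\<Sum>w\<in>words alphabet ?n. if w = u then prw u else 0)"
   by (intro sum.cong) auto
  also have "\<dots> = prw u" using True finite_words[OF finite_alphabet, of ?n] by simp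
  finally show ?thesis by simp
 next
  case False
  have "\<forall>x\<in>space M. itinerary T c ?n x ~= u" using False itinerary_range[of c ?n] by auto
  moreover from this have "(\<integral>x. (if itinerary T c ?n x = u then 1 else 0) \<partial>M) = (\<integral>x. (0::real) \<partial>M)"
   by (intro Bochner_Integration.integral_cong) auto
  moreover have "prw u = 0" using calculation(1) unfolding prw_def by (intro fibre_prob_outside) auto
  ultimately show ?thesis by simp
 qed
 also have "\<dots> = (\<integral>x. (%w. if butlast w = u then 1 else 0) (itinerary T c (Suc ?n) x) \<partial>M)"
  by (simp add: itinerary_Suc)
 also have "\<dots> = (\<Sum>w\<in>words alphabet (Suc ?n). prw w * (if butlast w = u then 1 else 0))"
  by (rule integral_words)
 also have "\<dots> = (\<Sum>u'\<in>words alphabet ?n. \<Sum>v\<in>alphabet. prw (u' @ [v]) * (if u' = u then 1 else 0))"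
  by (simp add: sum_words_Suc)
 also have "\<dots> = (\<Sum>u'\<in>words alphabet ?n. if u' = u then (\<Sum>v\<in>alphabet. prw (u @ [v])) else 0)"
  by (intro sum.cong) auto
 also have "\<dots> = (\<Sum>v\<in>alphabet. prw (u @ [v]))"
 proof (cases "u \<in> words alphabet ?n")
  case True
  then show ?thesis using finite_words[OF finite_alphabet, of ?n] by simp
 next
  case False
  have "prw (u @ [v]) = 0" for v
   using False by (intro prw_outside) (auto simp: words_def)
  then have z: "(\<Sum>v\<in>alphabet. prw (u @ [v])) = 0" by simp
  show ?thesis unfolding z by (intro sum.neutral) auto
 qed
 finally show ?thesis .
qed

text \<open>The sets that can be approximated in measure by sets depending on finitely many letters
  are closed under complements and countable unions.\<close>

lemma cylinder_approx:
 assumes "A \<in> sets M" "\<delta> > 0"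
 obtains m H where "measure M (sym_diff A {x \<in> space M. itinerary T c m x \<in> H}) < \<delta>"
proof -
 define cy where "cy m H = {x \<in> space M. itinerary T c m x \<in> H}" for m H
 have cy: "cy m H \<in> sets M" for m H
 proof -
  have "cy m H = (\<Union>u\<in>H \<inter> itinerary T c m ` space M. itinerary T c m -` {u} \<inter> space M)"
   by (auto simp: cy_def)
  also have "\<dots> \<in> sets M"
   using simple_functionD[OF simple_word] by (intro sets.finite_UN) auto
  finally show ?thesis .
 qed
 have refine: "\<exists>H'. cy m H = cy m' H'" if "m \<le> m'" for m m' H
  using that by (intro exI[of _ "{u. take m u \<in> H}"]) (auto simp: cy_def take_itinerary)
 have "A \<in> sigma_sets (space M) (range (%u. {x \<in> space M. itinerary T c (length u) x = u}))"
  using assms(1) generated by simp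
 then have "\<forall>\<delta>>0. \<exists>m H. measure M (sym_diff A (cy m H)) < \<delta>"
 proof (induction rule: sigma_sets.induct)
  case (Basic a)
  then obtain u where "a = {x \<in> space M. itinerary T c (length u) x = u}" by auto
  then have "a = cy (length u) {u}" by (auto simp: cy_def)
  then have "measure M (sym_diff a (cy (length u) {u})) < \<delta>" if "\<delta> > 0" for \<delta> using that by simp
  then show ?case by blast
 next
  case Empty
  have "{} = cy 0 {}" by (auto simp: cy_def)
  then have "measure M (sym_diff {} (cy 0 {})) < \<delta>" if "\<delta> > 0" for \<delta> using that by simp
  then show ?case by blast
 next
  case (Compl a)
  have "a \<in> sets M" using Compl(1) generated by simp
  then have "sym_diff (space M - a) (cy m (- H)) = sym_diff a (cy m H)" for m H
   using sets.sets_into_space by (auto simp: cy_def)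
  then show ?case using Compl.IH by metis
 next
  case (Union a)
  have a: "a i \<in> sets M" for i using Union(1) generated by simp
  show ?case
  proof (intro allI impI)
   fix \<delta> :: real assume \<delta>: "\<delta> > 0"
   have "(%n. measure M (\<Union>i<n. a i)) \<longlonglongrightarrow> measure M (\<Union>n. \<Union>i<n. a i)"
    using a by (intro finite_Lim_measure_incseq) (fastforce simp: incseq_def)+
   moreover have "(\<Union>n. \<Union>i<n. a i) = (\<Union>i. a i)" by auto
   ultimately have lim: "(%n. measure M (\<Union>i<n. a i)) \<longlonglongrightarrow> measure M (\<Union>i. a i)" by simp
   have "\<forall>\<^sub>F n in sequentially. measure M (\<Union>i. a i) - \<delta> / 2 < measure M (\<Union>i<n. a i)"
    using lim \<delta> by (intro order_tendstoD(1)) auto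
   then obtain N where N: "measure M (\<Union>i. a i) - \<delta> / 2 < measure M (\<Union>i<N. a i)"
    by (auto simp: eventually_sequentially)
   \<comment> \<open>Half of \<delta> pays for truncating the union to \<open>N\<close> sets, the
     other half is shared by their approximations.\<close>
   define d where "d = \<delta> / (2 * (real N + 1))"
   have d: "d > 0" "real N * d \<le> \<delta> / 2"
    using \<delta> by (auto simp: d_def field_simps)
   have "\<forall>i. \<exists>m H. measure M (sym_diff (a i) (cy m H)) < d" using Union(2) d(1) by blast
   then obtain m H where mH: "!!i. measure M (sym_diff (a i) (cy (m i) (H i))) < d" by metis
   define m' where "m' = (\<Sum>i<N. m i)"
   have "m i \<le> m'" if "i < N" for i unfolding m'_def by (rule member_le_sum) (use that in auto)
   then have "\<forall>i. \<exists>H'. i < N --> cy (m i) (H i) = cy m' H'" using refine by blast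
   then obtain H' where H': "!!i. i < N ==> cy (m i) (H i) = cy m' (H' i)" by metis
   let ?C = "cy m' (\<Union>i<N. H' i)"
   have C: "?C = (\<Union>i<N. cy m' (H' i))" by (auto simp: cy_def)
   have sd: "sym_diff (a i) (cy m' (H' i)) \<in> sets M" for i using a cy by auto
   have sub: "sym_diff (\<Union>i. a i) ?C \<subseteq> ((\<Union>i. a i) - (\<Union>i<N. a i)) \<union> (\<Union>i<N. sym_diff (a i) (cy m' (H' i)))"
    unfolding C by blast
   have "measure M (sym_diff (\<Union>i. a i) ?C)
     \<le> measure M (((\<Union>i. a i) - (\<Union>i<N. a i)) \<union> (\<Union>i<N. sym_diff (a i) (cy m' (H' i))))"
    using a sd by (intro finite_measure_mono sub) auto
   also have "\<dots> \<le> measure M ((\<Union>i. a i) - (\<Union>i<N. a i)) + measure M (\<Union>i<N. sym_diff (a i) (cy m' (H' i)))"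
    using a sd by (intro measure_Un_le) auto
   also have "\<dots> \<le> measure M ((\<Union>i. a i) - (\<Union>i<N. a i)) + (\<Sum>i<N. measure M (sym_diff (a i) (cy m' (H' i))))"
    using sd by (intro add_left_mono measure_UNION_le) auto
   also have "measure M ((\<Union>i. a i) - (\<Union>i<N. a i)) = measure M (\<Union>i. a i) - measure M (\<Union>i<N. a i)"
    using a by (intro finite_measure_Diff) auto
   also have "(\<Sum>i<N. measure M (sym_diff (a i) (cy m' (H' i)))) \<le> (\<Sum>i<N. d)"
    by (intro sum_mono) (metis H' lessThan_iff less_imp_le mH)
   finally have "measure M (sym_diff (\<Union>i. a i) ?C) < \<delta>" using N d by simp
   then show "\<exists>m H. measure M (sym_diff (\<Union>i. a i) (cy m H)) < \<delta>" by blast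
  qed
 qed
 then show ?thesis using assms(2) that by (auto simp: cy_def)
qed

text \<open>Each fibre of \<open>l\<close> is approximated by a set depending on \<open>m'\<close>
  letters. A word lying in several or in none of these sets is given some value; every wrong guess
  still lies in one of the symmetric differences.\<close>

lemma guess_function:
 fixes l :: "'a => 'b"
 assumes l: "simple_function M l" and \<delta>: "\<delta> > 0"
 obtains m g where "!!u. g u \<in> l ` space M" "measure M {x \<in> space M. l x ~= g (itinerary T c m x)} < \<delta>"
proof -
 let ?R = "l ` space M"
 have fin: "finite ?R" using l by (rule simple_functionD(1))
 have ne: "?R ~= {}" using not_empty by simp
 define A where "A y = l -` {y} \<inter> space M" for y
 have A: "A y \<in> sets M" for y unfolding A_def using l by (rule simple_functionD(2))
 define d where "d = \<delta> / (real (card ?R) + 1)"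
 have d: "d > 0" "real (card ?R) * d < \<delta>" using \<delta> by (auto simp: d_def field_simps)
 define close where "close y m H \<longleftrightarrow> measure M (sym_diff (A y) {x \<in> space M. itinerary T c m x \<in> H}) < d" for y m H
 have "\<exists>m H. close y m H" for y
  using cylinder_approx[OF A d(1), of y] unfolding close_def by blast
 then obtain m H where mH: "!!y. close y (m y) (H y)" by metis
 define m' where "m' = (\<Sum>y\<in>?R. m y)"
 have m': "m y \<le> m'" if "y \<in> ?R" for y unfolding m'_def by (rule member_le_sum) (use that fin in auto)
 define B where "B y = {x \<in> space M. take (m y) (itinerary T c m' x) \<in> H y}" for y
 have B: "measure M (sym_diff (A y) (B y)) < d" if "y \<in> ?R" for y
  using mH[of y] by (simp add: close_def B_def take_itinerary[OF m'[OF that]])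
 have simp_cond: "{x \<in> space M. h (itinerary T c m' x)} \<in> sets M" for h
 proof -
  have "{x \<in> space M. h (itinerary T c m' x)}
    = (\<Union>u\<in>{u \<in> itinerary T c m' ` space M. h u}. itinerary T c m' -` {u} \<inter> space M)" by auto
  also have "\<dots> \<in> sets M"
   using simple_functionD[OF simple_word] by (intro sets.finite_UN) auto
  finally show ?thesis .
 qed
 have Bs: "B y \<in> sets M" for y unfolding B_def by (rule simp_cond)
 define g where "g u = (if \<exists>y\<in>?R. take (m y) u \<in> H y then SOME y. y \<in> ?R \<and> take (m y) u \<in> H y
  else (SOME y. y \<in> ?R))" for u
 have g1: "g u \<in> ?R" for u
 proof (cases "\<exists>y\<in>?R. take (m y) u \<in> H y")
  case True
  then have "\<exists>y. y \<in> ?R \<and> take (m y) u \<in> H y" by blast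
  from someI_ex[OF this] show ?thesis using True by (simp add: g_def)
 next
  case False
  have "\<exists>y. y \<in> ?R" using ne by blast
  from someI_ex[OF this] show ?thesis using False by (simp add: g_def)
 qed
 have g2: "take (m (g u)) u \<in> H (g u)" if "y \<in> ?R" "take (m y) u \<in> H y" for y u
 proof -
  have ex: "\<exists>y. y \<in> ?R \<and> take (m y) u \<in> H y" using that by blast
  then have "g u = (SOME y. y \<in> ?R \<and> take (m y) u \<in> H y)" by (auto simp: g_def)
  then show ?thesis using someI_ex[OF ex] by simp
 qed
 have sub: "{x \<in> space M. l x ~= g (itinerary T c m' x)} \<subseteq> (\<Union>y\<in>?R. sym_diff (A y) (B y))"
 proof
  fix x assume "x \<in> {x \<in> space M. l x ~= g (itinerary T c m' x)}"
  then have x: "x \<in> space M" "l x ~= g (itinerary T c m' x)" by auto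
  let ?w = "itinerary T c m' x"
  show "x \<in> (\<Union>y\<in>?R. sym_diff (A y) (B y))"
  proof (cases "x \<in> B (l x)")
   case True
   then have "take (m (l x)) ?w \<in> H (l x)" by (simp add: B_def)
   then have "x \<in> B (g ?w)" using g2[of "l x" ?w] x by (simp add: B_def)
   moreover have "x \<notin> A (g ?w)" using x by (simp add: A_def)
   ultimately show ?thesis using g1[of ?w] by blast
  next
   case False
   moreover have "x \<in> A (l x)" using x by (simp add: A_def)
   ultimately show ?thesis using x by blast
  qed
 qed
 have sd: "sym_diff (A y) (B y) \<in> sets M" for y using A Bs by auto
 have "measure M {x \<in> space M. l x ~= g (itinerary T c m' x)} \<le> measure M (\<Union>y\<in>?R. sym_diff (A y) (B y))"
  using fin sd by (intro finite_measure_mono sub sets.finite_UN) auto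
 also have "\<dots> \<le> (\<Sum>y\<in>?R. measure M (sym_diff (A y) (B y)))"
  using fin sd by (intro measure_UNION_le) auto
 also have "\<dots> \<le> (\<Sum>y\<in>?R. d)" by (intro sum_mono less_imp_le B)
 also have "\<dots> < \<delta>" using d by simp
 finally show ?thesis using that g1 by blast
qed

end

context gen_system
begin

lemma prw_window_le: "i + j \<le> length w ==> prw w \<le> prw (take j (drop i w))"
proof -
 assume ij: "i + j \<le> length w"
 have "fibre_prob (itinerary T c (length w)) w \<le> fibre_prob (%x. itinerary T c j ((T ^^ i) x)) (take j (drop i w))"
  by (rule fibre_prob_mono[OF simple_Tn[OF simple_word]]) (use ij in \<open>simp add: window_itinerary\<close>)
 then show ?thesis using ij unfolding fibre_prob_Tn[OF simple_word] by (simp add: prw_def)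
qed

lemma prw_butlast_le: "prw w \<le> prw (butlast w)"
 using prw_window_le[of 0 "length w - 1" w] by (simp add: butlast_conv_take)

lemma sum_window:
 fixes g :: "'v list => real"
 assumes "i + j \<le> n"
 shows "(\<Sum>w\<in>words alphabet n. prw w * g (take j (drop i w))) = (\<Sum>u\<in>words alphabet j. prw u * g u)"
proof -
 have "(\<Sum>w\<in>words alphabet n. prw w * g (take j (drop i w))) = (\<integral>x. g (take j (drop i (itinerary T c n x))) \<partial>M)"
  using integral_words[of "%w. g (take j (drop i w))" n] by simp
 also have "\<dots> = (\<integral>x. g (itinerary T c j ((T ^^ i) x)) \<partial>M)"
  using assms by (simp add: window_itinerary)
 also have "\<dots> = (\<integral>x. g (itinerary T c j x) \<partial>M)"
  by (rule integral_simple_Tn[OF simple_word])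
 also have "\<dots> = (\<Sum>u\<in>words alphabet j. prw u * g u)" by (rule integral_words)
 finally show ?thesis .
qed

text \<open>Gibbs' inequality for the joint itinerary of an arbitrary partition and the generating one. An
 element of the former is guessed from \<open>m\<close> letters of the latter, at an arbitrarily small cost.\<close>
lemma ent_itinerary_le_chain:
 fixes f :: "'a => 'b"
 assumes f: "simple_function M f"
  and g: "!!u. u \<in> words alphabet (Suc n) ==> 0 \<le> g u"
   "!!u. u \<in> words alphabet n ==> (\<Sum>v\<in>alphabet. g (u @ [v])) \<le> 1"
   "!!u. u \<in> words alphabet (Suc n) ==> prw u > 0 ==> g u > 0"
  and k: "!!a b. a \<in> f ` space M ==> 0 < k a b" "!!b. (\<Sum>a\<in>f ` space M. k a b) \<le> (1::real)"
 shows "ent (itinerary T f N) \<le> (\<Sum>u\<in>words alphabet n. prw u * - ln (prw u))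
  + real (N + m) * (\<Sum>u\<in>words alphabet (Suc n). prw u * - ln (g u))
  + real N * (\<integral>x. - ln (k (f x) (itinerary T c m x)) \<partial>M)"
proof -
 let ?R = "f ` space M"
 let ?A = "words ?R N" and ?B = "words alphabet (n + (N + m))"
 define F where "F x = (itinerary T f N x, itinerary T c (n + (N + m)) x)" for x
 \<comment> \<open>A joint code: the word \<open>b\<close> is coded by the chain, and each label
   \<open>a ! i\<close> by \<open>k\<close> given the \<open>m\<close> letters of \<open>b\<close>
   from position \<open>i\<close> on. The extra length \<open>m\<close> of \<open>b\<close> makes
   these windows available for all \<open>i < N\<close>.\<close>
 define Q where "Q = (%(a, b). chain_weight n prw g (N + m) b * (\<Prod>i<N. k (a ! i) (take m (drop i b))))"
 define G where "G = (%(a, b). - ln (prw (take n b))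
  + (\<Sum>i<N + m. - ln (g (take (Suc n) (drop i b)))) + (\<Sum>i<N. - ln (k (a ! i) (take m (drop i b)))))"
 have sF: "simple_function M F" unfolding F_def
  by (intro simple_function_Pair simple_itinerary f simple_c)
 have finR: "finite ?R" using f by (rule simple_functionD(1))
 have fin: "finite (?A \<times> ?B)" by (intro finite_cartesian_product finite_words finR finite_alphabet)
 have rF: "F ` space M \<subseteq> ?A \<times> ?B"
  unfolding F_def using itinerary_range[of f N] itinerary_range[of c "n + (N + m)"] by auto
 have cw: "(\<Sum>b\<in>?B. chain_weight n prw g (N + m) b) \<le> 1"
   "!!b. b \<in> ?B ==> 0 \<le> chain_weight n prw g (N + m) b"
  by (rule sum_chain_weight_le[OF finite_alphabet _ _ g(1,2)]; simp add: sum_prw)+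
 have nn: "0 \<le> (\<Prod>i<N. k (a ! i) (take m (drop i b)))" if "a \<in> ?A" for a b
 proof (rule prod_nonneg, rule less_imp_le, rule k(1))
  fix i assume "i \<in> {..<N}"
  then show "a ! i \<in> ?R" using that nth_mem[of i a] by (auto simp: words_def)
 qed
 have Q1: "(\<Sum>y\<in>?A \<times> ?B. Q y) \<le> 1"
 proof -
  have "(\<Sum>y\<in>?A \<times> ?B. Q y) = (\<Sum>a\<in>?A. \<Sum>b\<in>?B. chain_weight n prw g (N + m) b
    * (\<Prod>i<N. k (a ! i) (take m (drop i b))))"
   by (simp add: sum.cartesian_product Q_def)
  also have "\<dots> = (\<Sum>b\<in>?B. \<Sum>a\<in>?A. chain_weight n prw g (N + m) b
    * (\<Prod>i<N. k (a ! i) (take m (drop i b))))" by (rule sum.swap)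
  also have "\<dots> = (\<Sum>b\<in>?B. chain_weight n prw g (N + m) b
    * (\<Sum>a\<in>?A. \<Prod>i<N. k (a ! i) (take m (drop i b))))"
   by (simp add: sum_distrib_left)
  also have "\<dots> \<le> (\<Sum>b\<in>?B. chain_weight n prw g (N + m) b * 1)"
  proof (intro sum_mono mult_left_mono cw(2))
   fix b
   show "(\<Sum>a\<in>?A. \<Prod>i<N. k (a ! i) (take m (drop i b))) \<le> 1"
    by (rule sum_words_prod_le[where k = "%i r. k r (take m (drop i b))"])
     (use k in \<open>auto simp: less_imp_le\<close>)
  qed
  also have "\<dots> \<le> 1" using cw by simp
  finally show ?thesis .
 qed
 have pos: "0 < prw (take n b)" "!!i. i < N + m ==> 0 < g (take (Suc n) (drop i b))"
  "!!i. i < N ==> 0 < k (a ! i) (take m (drop i b))"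
  if ab: "a \<in> ?A" "b \<in> ?B" "fibre_prob F (a, b) > 0" for a b
 proof -
  have len: "length b = n + (N + m)" using ab(2) by (simp add: words_def)
  have "fibre_prob F (a, b) \<le> fibre_prob (itinerary T c (n + (N + m))) (snd (a, b))"
   by (rule fibre_prob_mono[OF simple_word]) (simp add: F_def)
  then have b: "0 < prw b" using ab(3) len by (simp add: prw_def)
  then show "0 < prw (take n b)" using prw_window_le[of 0 n b] len by simp
  show "0 < g (take (Suc n) (drop i b))" if i: "i < N + m" for i
  proof (rule g(3))
   show "0 < prw (take (Suc n) (drop i b))" using b prw_window_le[of i "Suc n" b] len i by simp
   have "set (take (Suc n) (drop i b)) \<subseteq> alphabet"
    using ab(2) set_take_subset[of "Suc n" "drop i b"] set_drop_subset[of i b] by (auto simp: words_def)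
   then show "take (Suc n) (drop i b) \<in> words alphabet (Suc n)" using len i by (simp add: words_def)
  qed
  show "0 < k (a ! i) (take m (drop i b))" if "i < N" for i
   by (rule k(1)) (use ab(1) that nth_mem[of i a] in \<open>auto simp: words_def\<close>)
 qed
 have Qpos: "0 < Q y" if y: "y \<in> ?A \<times> ?B" "fibre_prob F y > 0" for y
 proof -
  obtain a b where ab: "y = (a, b)" "a \<in> ?A" "b \<in> ?B" using y by blast
  show ?thesis unfolding ab(1) Q_def chain_weight_def prod.case
   by (intro mult_pos_pos prod_pos ballI) (use pos[OF ab(2,3)] y ab in auto)
 qed
 have lnQ: "- ln (Q y) = G y" if y: "y \<in> ?A \<times> ?B" "fibre_prob F y > 0" for y
 proof -
  obtain a b where ab: "y = (a, b)" "a \<in> ?A" "b \<in> ?B" using y by blast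
  note p = pos[OF ab(2,3) y(2)[unfolded ab(1)]]
  have P1: "0 < (\<Prod>i<N + m. g (take (Suc n) (drop i b)))" by (rule prod_pos) (use p in auto)
  have P2: "0 < (\<Prod>i<N. k (a ! i) (take m (drop i b)))" by (rule prod_pos) (use p in auto)
  have "ln (Q y) = ln (prw (take n b)) + ln (\<Prod>i<N + m. g (take (Suc n) (drop i b)))
    + ln (\<Prod>i<N. k (a ! i) (take m (drop i b)))"
   using p(1) P1 P2 by (simp add: ab(1) Q_def chain_weight_def ln_mult_pos)
  also have "ln (\<Prod>i<N + m. g (take (Suc n) (drop i b))) = (\<Sum>i<N + m. ln (g (take (Suc n) (drop i b))))"
  proof (rule ln_prod)
   fix i assume "i \<in> {..<N + m}"
   then have "0 < g (take (Suc n) (drop i b))" using p(2) by simp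
   then show "g (take (Suc n) (drop i b)) ~= 0" by simp
  qed simp
  also have "ln (\<Prod>i<N. k (a ! i) (take m (drop i b))) = (\<Sum>i<N. ln (k (a ! i) (take m (drop i b))))"
  proof (rule ln_prod)
   fix i assume "i \<in> {..<N}"
   then have "0 < k (a ! i) (take m (drop i b))" using p(3) by simp
   then show "k (a ! i) (take m (drop i b)) ~= 0" by simp
  qed simp
  finally show ?thesis by (simp add: ab(1) G_def sum_negf)
 qed
 have "ent (itinerary T f N) \<le> ent F"
  by (rule ent_mono[OF sF simple_itinerary[OF f], of _ fst]) (simp add: F_def)
 also have "\<dots> \<le> (\<integral>x. - ln (Q (F x)) \<partial>M)"
  by (rule ent_le[OF sF fin rF _ Q1 Qpos])
   (use cw nn in \<open>auto simp: Q_def intro!: mult_nonneg_nonneg\<close>)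
 also have "\<dots> = (\<Sum>y\<in>?A \<times> ?B. fibre_prob F y * - ln (Q y))"
  by (rule simple_integral_eq(2)[OF sF fin rF])
 also have "\<dots> = (\<Sum>y\<in>?A \<times> ?B. fibre_prob F y * G y)"
 proof (rule sum.cong[OF refl])
  fix y assume "y \<in> ?A \<times> ?B"
  then show "fibre_prob F y * - ln (Q y) = fibre_prob F y * G y"
   using lnQ[of y] fibre_prob_nonneg[of F y] by (cases "fibre_prob F y = 0") (auto simp: less_le)
 qed
 also have "\<dots> = (\<integral>x. G (F x) \<partial>M)"
  by (rule simple_integral_eq(2)[OF sF fin rF, symmetric])
 also have "\<dots> = (\<integral>x. - ln (prw (itinerary T c n x))
   + (\<Sum>i<N + m. - ln (g (itinerary T c (Suc n) ((T ^^ i) x))))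
   + (\<Sum>i<N. - ln (k (f ((T ^^ i) x)) (itinerary T c m ((T ^^ i) x)))) \<partial>M)"
  by (intro Bochner_Integration.integral_cong refl)
   (simp add: F_def G_def window_itinerary take_itinerary nth_itinerary)
 also have "\<dots> = (\<integral>x. - ln (prw (itinerary T c n x)) \<partial>M)
   + (\<Sum>i<N + m. \<integral>x. - ln (g (itinerary T c (Suc n) ((T ^^ i) x))) \<partial>M)
   + (\<Sum>i<N. \<integral>x. - ln (k (f ((T ^^ i) x)) (itinerary T c m ((T ^^ i) x))) \<partial>M)"
 proof -
  have i1: "integrable M (%x. - ln (prw (itinerary T c n x)))"
   by (rule integrable_simple[OF simple_word])
  have i2: "integrable M (%x. - ln (g (itinerary T c (Suc n) ((T ^^ i) x))))" for i
   by (rule integrable_simple[OF simple_Tn[OF simple_word]])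
  have i3: "integrable M (%x. - ln (k (f ((T ^^ i) x)) (itinerary T c m ((T ^^ i) x))))" for i
   using integrable_simple[OF simple_function_Pair[OF simple_Tn[OF f, of i] simple_Tn[OF simple_word, of m i]],
    of "%(a, b). - ln (k a b)"] by simp
  have i2': "integrable M (%x. \<Sum>i<N + m. - ln (g (itinerary T c (Suc n) ((T ^^ i) x))))"
   by (intro Bochner_Integration.integrable_sum i2)
  have i3': "integrable M (%x. \<Sum>i<N. - ln (k (f ((T ^^ i) x)) (itinerary T c m ((T ^^ i) x))))"
   by (intro Bochner_Integration.integrable_sum i3)
  show ?thesis
   unfolding Bochner_Integration.integral_add[OF Bochner_Integration.integrable_add[OF i1 i2'] i3']
    Bochner_Integration.integral_add[OF i1 i2'] Bochner_Integration.integral_sum[OF i2]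
    Bochner_Integration.integral_sum[OF i3] ..
 qed
 also have "(\<integral>x. - ln (prw (itinerary T c n x)) \<partial>M) = (\<Sum>u\<in>words alphabet n. prw u * - ln (prw u))"
  by (rule integral_words)
 also have "(\<Sum>i<N + m. \<integral>x. - ln (g (itinerary T c (Suc n) ((T ^^ i) x))) \<partial>M)
   = real (N + m) * (\<Sum>u\<in>words alphabet (Suc n). prw u * - ln (g u))"
 proof -
  have "(\<integral>x. - ln (g (itinerary T c (Suc n) ((T ^^ i) x))) \<partial>M)
    = (\<Sum>u\<in>words alphabet (Suc n). prw u * - ln (g u))" for i
   by (rule trans[OF integral_simple_Tn[OF simple_word] integral_words])
  then show ?thesis by (simp only:) simp
 qed
 also have "(\<Sum>i<N. \<integral>x. - ln (k (f ((T ^^ i) x)) (itinerary T c m ((T ^^ i) x))) \<partial>M)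
   = real N * (\<integral>x. - ln (k (f x) (itinerary T c m x)) \<partial>M)"
 proof -
  have "(\<integral>x. - ln (k (f ((T ^^ i) x)) (itinerary T c m ((T ^^ i) x))) \<partial>M)
    = (\<integral>x. - ln (k (f x) (itinerary T c m x)) \<partial>M)" for i
   using integral_simple_Tn[OF simple_function_Pair[OF f simple_word[of m]], of "%(a, b). - ln (k a b)" i]
   by simp
  then show ?thesis by (simp only:) simp
 qed
 finally show ?thesis .
qed

text \<open>This contains the generator theorem: the labels of an arbitrary partition can be guessed
  from the generating one at a cost of at most \<open>e\<close> per step, and the cost of the
  initial word and of the extra \<open>m\<close> steps vanishes after division by
  \<open>N\<close>.\<close>

lemma measure_entropy_le_chain:
 assumes g: "!!u. u \<in> words alphabet (Suc n) ==> 0 \<le> g u"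
   "!!u. u \<in> words alphabet n ==> (\<Sum>v\<in>alphabet. g (u @ [v])) \<le> 1"
   "!!u. u \<in> words alphabet (Suc n) ==> prw u > 0 ==> g u > 0"
 shows "measure_entropy T M \<le> ereal (\<Sum>u\<in>words alphabet (Suc n). prw u * - ln (g u))"
  (is "_ \<le> ereal ?s")
proof (rule measure_entropy_le)
 fix f :: "'a => 'a set" assume f: "simple_function M f"
 let ?R = "f ` space M"
 have finR: "finite ?R" using f by (rule simple_functionD(1))
 show "lim (%N. ent (itinerary T f N) / real N) \<le> ?s"
 proof (rule field_le_epsilon)
  fix e :: real assume e: "e > 0"
  \<comment> \<open>Constants for the cost of guessing: a right guess costs \<open>e / 2\<close>, a
    wrong one \<open>C\<close>, with the weight \<eta> spread evenly over all \<open>K\<close>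
    labels. The choice of \<delta> keeps the expected cost of wrong guesses below
    \<open>e / 2\<close>.\<close>
  define \<eta> where "\<eta> = 1 - exp (- (e / 2))"
  define K where "K = real (card ?R)"
  have K: "K \<ge> 1" using finR not_empty by (simp add: K_def Suc_le_eq card_gt_0_iff)
  have \<eta>: "0 < \<eta>" "\<eta> < 1" "- ln (1 - \<eta>) = e / 2" using e by (auto simp: \<eta>_def)
  define C where "C = - ln (\<eta> / K)"
  have C: "C \<ge> 0" using \<eta> K by (simp add: C_def ln_le_zero_iff divide_le_eq)
  define \<delta> where "\<delta> = e / 2 / (C + 1)"
  have \<delta>: "\<delta> > 0" "\<delta> * C \<le> e / 2" using e C by (auto simp: \<delta>_def field_simps)
  obtain m h where h: "!!u. h u \<in> ?R" "measure M {x \<in> space M. f x ~= h (itinerary T c m x)} < \<delta>"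
   using guess_function[OF f \<delta>(1)] by metis
  define k where "k a b = (if a = h b then 1 - \<eta> else \<eta> / K)" for a b
  have k1: "0 < k a b" for a b using \<eta> K by (simp add: k_def)
  have k2: "(\<Sum>a\<in>?R. k a b) \<le> 1" for b
  proof -
   have "(\<Sum>a\<in>?R. k a b) = (1 - \<eta>) + (\<Sum>a\<in>?R - {h b}. \<eta> / K)"
    using finR h(1)[of b] by (subst sum.remove[of _ "h b"]) (auto simp: k_def intro!: sum.cong)
   also have "\<dots> \<le> (1 - \<eta>) + (\<Sum>a\<in>?R. \<eta> / K)"
    using finR \<eta> K by (intro add_left_mono sum_mono2) auto
   also have "\<dots> = 1" using K by (simp add: K_def)
   finally show ?thesis .
  qed
  define good where "good x \<longleftrightarrow> f x = h (itinerary T c m x)" for x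
  have sg: "simple_function M good" unfolding good_def
   by (rule simple_function_compose2[OF f simple_word, of "%a b. a = h b"])
  have int1: "(\<integral>x. - ln (k (f x) (itinerary T c m x)) \<partial>M) = (\<integral>x. (if good x then e / 2 else C) \<partial>M)"
   by (intro Bochner_Integration.integral_cong refl) (auto simp: k_def good_def \<eta>(3) C_def)
  have int2: "(\<integral>x. (if good x then e / 2 else C) \<partial>M) = (\<Sum>b\<in>UNIV. fibre_prob good b * (if b then e / 2 else C))"
   using simple_integral_eq(2)[OF sg finite subset_UNIV, of "%b. if b then e / 2 else C"] .
  have "(\<Sum>b\<in>UNIV. fibre_prob good b * (if b then e / 2 else C)) \<le> 1 * (e / 2) + \<delta> * C"
  proof -
   have "good -` {False} \<inter> space M = {x \<in> space M. f x ~= h (itinerary T c m x)}"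
    by (intro equalityI subsetI; simp add: good_def)
   then have "fibre_prob good False \<le> \<delta>" using h(2) by (simp add: fibre_prob_def)
   moreover have "fibre_prob good True \<le> 1" by (simp add: fibre_prob_def)
   ultimately have "fibre_prob good True * (e / 2) \<le> 1 * (e / 2)" "fibre_prob good False * C \<le> \<delta> * C"
    using e C by (auto simp del: mult_1 intro!: mult_right_mono)
   then show ?thesis by (simp add: UNIV_bool)
  qed
  then have kint: "(\<integral>x. - ln (k (f x) (itinerary T c m x)) \<partial>M) \<le> e"
   unfolding int1 int2 using \<delta> by linarith
  define D where "D = (\<Sum>u\<in>words alphabet n. prw u * - ln (prw u)) + real m * ?s"
  have bound: "ent (itinerary T f N) / real N \<le> D / real N + (?s + e)" if N: "N \<ge> 1" for N
  proof -
   have "ent (itinerary T f N) \<le> (\<Sum>u\<in>words alphabet n. prw u * - ln (prw u))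
     + real (N + m) * ?s + real N * (\<integral>x. - ln (k (f x) (itinerary T c m x)) \<partial>M)"
    by (rule ent_itinerary_le_chain[OF f g k1 k2])
   also have "\<dots> \<le> (\<Sum>u\<in>words alphabet n. prw u * - ln (prw u)) + real (N + m) * ?s + real N * e"
    by (intro add_left_mono mult_left_mono kint) auto
   also have "\<dots> = D + real N * (?s + e)" by (simp add: D_def algebra_simps)
   finally have "ent (itinerary T f N) / real N \<le> (D + real N * (?s + e)) / real N"
    by (rule divide_right_mono) simp
   then show ?thesis using N by (simp add: add_divide_distrib)
  qed
  have l1: "(%N. ent (itinerary T f N) / real N) \<longlonglongrightarrow> lim (%N. ent (itinerary T f N) / real N)"
   using convergent_ent[OF f] by (simp add: convergent_LIMSEQ_iff)
  have l2: "(%N. D / real N + (?s + e)) \<longlonglongrightarrow> 0 + (?s + e)"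
   by (intro tendsto_add tendsto_const lim_const_over_n)
  have "lim (%N. ent (itinerary T f N) / real N) \<le> 0 + (?s + e)"
   by (rule LIMSEQ_le[OF l1 l2]) (use bound in blast)
  then show "lim (%N. ent (itinerary T f N) / real N) \<le> ?s + e" by simp
 qed
qed

text \<open>Expected cost per letter when transitions are coded by the kernel
  \<open>q\<close>.\<close>

definition cross_entropy :: "('v => 'v => real) => real" where
 "cross_entropy q = (\<Sum>v\<in>alphabet. \<Sum>w\<in>alphabet. prw [v, w] * - ln (q v w))"

lemma last_words: "u \<in> words V (Suc n) ==> last u = u ! n"
 by (cases u rule: rev_cases) (auto simp: words_def nth_append)

lemma sum_words_2: "(\<Sum>u\<in>words V 2. f u) = (\<Sum>v\<in>V. \<Sum>w\<in>V. f [v, w])"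
 by (simp add: numeral_2_eq_2 sum_words_Suc' words_0)

lemma sum_last_transition:
 "(\<Sum>u\<in>words alphabet (Suc (Suc n)). prw u * - ln (q (u ! n) (u ! Suc n))) = cross_entropy q"
proof -
 have "(\<Sum>u\<in>words alphabet (Suc (Suc n)). prw u * - ln (q (u ! n) (u ! Suc n)))
   = (\<Sum>u\<in>words alphabet (Suc (Suc n)). prw u * - ln (q (take 2 (drop n u) ! 0) (take 2 (drop n u) ! 1)))"
  by (intro sum.cong) (auto simp: words_def)
 also have "\<dots> = (\<Sum>u\<in>words alphabet 2. prw u * - ln (q (u ! 0) (u ! 1)))"
  by (rule sum_window[where g = "%u. - ln (q (u ! 0) (u ! 1))"]) simp
 finally show ?thesis by (simp add: cross_entropy_def sum_words_2)
qed

lemma measure_entropy_le_cross: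
 assumes q: "!!v w. v \<in> alphabet ==> w \<in> alphabet ==> 0 \<le> q v w"
  "!!v. v \<in> alphabet ==> (\<Sum>w\<in>alphabet. q v w) \<le> 1"
  "!!v w. v \<in> alphabet ==> w \<in> alphabet ==> prw [v, w] > 0 ==> q v w > 0"
 shows "measure_entropy T M \<le> ereal (cross_entropy q)"
proof -
 have "measure_entropy T M \<le> ereal (\<Sum>u\<in>words alphabet (Suc 1). prw u * - ln (q (u ! 0) (u ! 1)))"
  by (rule measure_entropy_le_chain) (use q in \<open>auto simp: words_def length_Suc_conv\<close>)
 then show ?thesis using sum_last_transition[where n = 0 and q = q] by simp
qed

text \<open>For a Markov measure each further letter adds exactly \<open>cross_entropy q\<close> to
  the entropy of the words, and the generating partition itself attains this rate.\<close>

lemma measure_entropy_markov_ge: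
 assumes markov: "!!n u v. u \<in> words alphabet (Suc n) ==> v \<in> alphabet ==> prw (u @ [v]) = prw u * q (last u) v"
 shows "ereal (cross_entropy q) \<le> measure_entropy T M"
proof -
 let ?H = "%n. ent (itinerary T c n)"
 have step: "?H (Suc (Suc n)) = ?H (Suc n) + cross_entropy q" for n
 proof -
  have t: "prw (u @ [v]) * ln (prw (u @ [v])) = prw (u @ [v]) * ln (prw u) + prw (u @ [v]) * ln (q (last u) v)"
   if u: "u \<in> words alphabet (Suc n)" "v \<in> alphabet" for u v
  proof (cases "prw (u @ [v]) = 0")
   case False
   then have "prw u ~= 0" "q (last u) v ~= 0" using markov[OF u] by auto
   moreover have "prw u > 0" using \<open>prw u ~= 0\<close> prw_nonneg[of u] by linarith
   moreover have "prw (u @ [v]) > 0" using False prw_nonneg[of "u @ [v]"] by linarith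
   then have "q (last u) v > 0" using markov[OF u] \<open>prw u > 0\<close> by (simp add: zero_less_mult_iff)
   ultimately have "ln (prw (u @ [v])) = ln (prw u) + ln (q (last u) v)"
    unfolding markov[OF u] by (simp add: ln_mult_pos)
   then show ?thesis by (simp add: distrib_left)
  qed simp
  have "?H (Suc (Suc n)) = - (\<Sum>u\<in>words alphabet (Suc n). \<Sum>v\<in>alphabet. prw (u @ [v]) * ln (prw (u @ [v])))"
   unfolding ent_words by (simp add: sum_words_Suc[of _ _ "Suc n"])
  also have "\<dots> = - (\<Sum>u\<in>words alphabet (Suc n). \<Sum>v\<in>alphabet. prw (u @ [v]) * ln (prw u) + prw (u @ [v]) * ln (q (last u) v))"
   by (intro arg_cong[where f = uminus] sum.cong refl t)
  also have "\<dots> = - (\<Sum>u\<in>words alphabet (Suc n). (\<Sum>v\<in>alphabet. prw (u @ [v])) * ln (prw u))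
    + - (\<Sum>u\<in>words alphabet (Suc n). \<Sum>v\<in>alphabet. prw (u @ [v]) * ln (q (last u) v))"
   by (simp add: sum.distrib sum_distrib_right)
  also have "- (\<Sum>u\<in>words alphabet (Suc n). (\<Sum>v\<in>alphabet. prw (u @ [v])) * ln (prw u)) = ?H (Suc n)"
   unfolding ent_words prw_append[symmetric] ..
  also have "- (\<Sum>u\<in>words alphabet (Suc n). \<Sum>v\<in>alphabet. prw (u @ [v]) * ln (q (last u) v))
    = (\<Sum>u\<in>words alphabet (Suc n). \<Sum>v\<in>alphabet. prw (u @ [v]) * - ln (q ((u @ [v]) ! n) ((u @ [v]) ! Suc n)))"
   unfolding sum_negf[symmetric]
   by (intro sum.cong refl) (auto simp: last_words words_def nth_append)
  also have "\<dots> = cross_entropy q"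
   using sum_last_transition[where n = n and q = q] by (simp add: sum_words_Suc[of _ _ "Suc n"])
  finally show ?thesis .
 qed
 have H: "?H (Suc n) = ?H 1 + real n * cross_entropy q" for n
  by (induction n) (simp_all add: step algebra_simps)
 have "(%n. ?H n / real n) \<longlonglongrightarrow> cross_entropy q"
 proof -
  have "(%n. (?H 1 - cross_entropy q) / real n + cross_entropy q) \<longlonglongrightarrow> 0 + cross_entropy q"
   by (intro tendsto_add tendsto_const lim_const_over_n)
  moreover have "\<forall>\<^sub>F n in sequentially. (?H 1 - cross_entropy q) / real n + cross_entropy q = ?H n / real n"
   using eventually_ge_at_top[of 1]
  proof eventually_elim
   case (elim n)
   then obtain n' where n': "n = Suc n'" by (cases n) auto
   have "?H n = (?H 1 - cross_entropy q) + real n * cross_entropy q"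
    unfolding n' H by (simp add: algebra_simps)
   then show ?case using elim by (simp add: add_divide_distrib)
  qed
  ultimately show ?thesis using Lim_transform_eventually by fastforce
 qed
 then have "lim (%n. ?H n / real n) = cross_entropy q" by (rule limI)
 then show ?thesis using measure_entropy_ge[OF simple_c] by simp
qed

text \<open>Equality in \<open>measure_entropy_le_cross\<close>: the entropy is at most the conditional entropy of a letter
 given any number of predecessors, which forces equality in Gibbs' inequality.\<close>
lemma markov_if_entropy_eq:
 assumes q: "!!v w. v \<in> alphabet ==> w \<in> alphabet ==> 0 \<le> q v w"
  "!!v. v \<in> alphabet ==> (\<Sum>w\<in>alphabet. q v w) \<le> 1"
  "!!v w. v \<in> alphabet ==> w \<in> alphabet ==> prw [v, w] > 0 ==> q v w > 0"
  and ent: "ereal (cross_entropy q) \<le> measure_entropy T M"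
  and u: "u \<in> words alphabet (Suc n)" "v \<in> alphabet"
 shows "prw (u @ [v]) = prw u * q (last u) v"
proof -
 let ?W = "words alphabet (Suc (Suc n))"
 \<comment> \<open>What the probability of \<open>w\<close> would be if its last letter were chosen
   by \<open>q\<close>; the aim is equality with \<open>prw\<close>.\<close>
 define Q where "Q w = prw (butlast w) * q (w ! n) (w ! Suc n)" for w
 have pos: "0 < prw (butlast w)" "0 < q (w ! n) (w ! Suc n)" if w: "w \<in> ?W" "prw w > 0" for w
 proof -
  show "0 < prw (butlast w)" using prw_butlast_le[of w] w(2) by linarith
  have len: "length w = Suc (Suc n)" "set w \<subseteq> alphabet" using w(1) by (auto simp: words_def)
  have "prw w \<le> prw (take 2 (drop n w))" using len by (intro prw_window_le) simp
  moreover have "take 2 (drop n w) = [w ! n, w ! Suc n]"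
   using len by (intro nth_equalityI) (auto simp: less_Suc_eq numeral_2_eq_2)
  ultimately have "0 < prw [w ! n, w ! Suc n]" using w(2) by simp
  then show "0 < q (w ! n) (w ! Suc n)" using len nth_mem[of n w] nth_mem[of "Suc n" w] by (intro q(3)) auto
 qed
 \<comment> \<open>The code here consists of the true conditional probabilities given
   \<open>n + 1\<close> letters. Together with \<open>ent\<close> it gives the inequality opposite
   to the one that Gibbs' inequality yields for \<open>Q\<close>.\<close>
 have "measure_entropy T M \<le> ereal (\<Sum>w\<in>?W. prw w * - ln (prw w / prw (butlast w)))"
 proof (rule measure_entropy_le_chain)
  fix u assume "u \<in> words alphabet (Suc n)"
  have "(\<Sum>v\<in>alphabet. prw (u @ [v]) / prw (butlast (u @ [v]))) = prw u / prw u"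
   by (simp add: prw_append[of u] flip: sum_divide_distrib)
  then show "(\<Sum>v\<in>alphabet. prw (u @ [v]) / prw (butlast (u @ [v]))) \<le> 1" by simp
 qed (use pos(1) in auto)
 from order_trans[OF ent this]
 have "cross_entropy q \<le> (\<Sum>w\<in>?W. prw w * - ln (prw w / prw (butlast w)))" by simp
 also have "\<dots> = (\<Sum>w\<in>?W. prw w * ln (prw (butlast w)) - prw w * ln (prw w))"
 proof (rule sum.cong[OF refl])
  fix w assume w: "w \<in> ?W"
  show "prw w * - ln (prw w / prw (butlast w)) = prw w * ln (prw (butlast w)) - prw w * ln (prw w)"
  proof (cases "prw w = 0")
   case False
   then have "prw w > 0" using prw_nonneg[of w] by linarith
   then show ?thesis using pos(1)[OF w] by (simp add: ln_div right_diff_distrib)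
  qed simp
 qed
 finally have 1: "(\<Sum>w\<in>?W. prw w * ln (prw w)) \<le> (\<Sum>w\<in>?W. prw w * ln (prw (butlast w))) - cross_entropy q"
  by (simp add: sum_subtractf)
 have 2: "(\<Sum>w\<in>?W. prw w * ln (Q w)) = (\<Sum>w\<in>?W. prw w * ln (prw (butlast w))) - cross_entropy q"
 proof -
  have "(\<Sum>w\<in>?W. prw w * ln (Q w)) = (\<Sum>w\<in>?W. prw w * ln (prw (butlast w)) - prw w * - ln (q (w ! n) (w ! Suc n)))"
  proof (rule sum.cong[OF refl])
   fix w assume w: "w \<in> ?W"
   show "prw w * ln (Q w) = prw w * ln (prw (butlast w)) - prw w * - ln (q (w ! n) (w ! Suc n))"
   proof (cases "prw w = 0")
    case False
    then have "prw w > 0" using prw_nonneg[of w] by linarith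
    then show ?thesis using pos[OF w] by (simp add: Q_def ln_mult_pos distrib_left)
   qed simp
  qed
  then show ?thesis by (simp only: sum_subtractf sum_last_transition)
 qed
 have nn: "0 \<le> Q w" if "w \<in> ?W" for w
  using that nth_mem[of n w] nth_mem[of "Suc n" w]
  by (auto simp: Q_def words_def intro!: mult_nonneg_nonneg q(1))
 have le: "(\<Sum>w\<in>?W. Q w) \<le> (\<Sum>w\<in>?W. prw w)"
 proof -
  have "(\<Sum>w\<in>?W. Q w) = (\<Sum>u\<in>words alphabet (Suc n). prw u * (\<Sum>v\<in>alphabet. q (last u) v))"
   unfolding sum_words_Suc[of _ _ "Suc n"] sum_distrib_left
   by (intro sum.cong refl) (auto simp: last_words Q_def words_def nth_append)
  also have "\<dots> \<le> (\<Sum>u\<in>words alphabet (Suc n). prw u * 1)"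
  proof (intro sum_mono mult_left_mono q(2))
   fix u assume "u \<in> words alphabet (Suc n)"
   then show "last u \<in> alphabet" using last_words[of u alphabet n] nth_mem[of n u] by (auto simp: words_def)
  qed simp
  finally show ?thesis by (simp add: sum_prw)
 qed
 have "prw w = Q w" if w: "w \<in> ?W" for w
 proof (rule gibbs(2)[where I = ?W])
  show "(\<Sum>w\<in>?W. prw w * ln (Q w)) = (\<Sum>w\<in>?W. prw w * ln (prw w))"
  proof (rule antisym)
   show "(\<Sum>w\<in>?W. prw w * ln (Q w)) \<le> (\<Sum>w\<in>?W. prw w * ln (prw w))"
    by (rule gibbs(1)) (use finite_words[OF finite_alphabet] nn le pos in \<open>auto simp: Q_def\<close>)
  qed (use 1 2 in simp)
 qed (use finite_words[OF finite_alphabet] nn le pos w in \<open>auto simp: Q_def\<close>)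
 moreover have "u @ [v] \<in> ?W" using u by (auto simp: words_def)
 ultimately show ?thesis using u last_words[OF u(1)] by (auto simp: Q_def words_def nth_append)
qed

end

section \<open>Invariant measures of coded shifts\<close>

text \<open>A subshift \<open>X\<close> whose points correspond, through a locally constant coding \<open>c\<close>, to the infinite
 paths in a finite graph \<open>(V, E)\<close>.\<close>
locale coded_shift =
 fixes X :: "(nat => nat) set" and V :: "'v set" and E :: "('v \<times> 'v) set"
  and c :: "(nat => nat) => 'v"
 assumes compact_X: "compact X" and shift_X: "!!x. x \<in> X ==> shift_map x \<in> X"
  and c_image: "c ` X = V" and finite_V: "finite V" and V_nonempty: "V ~= {}"
  and E_eq: "E = (%x. (c x, c (shift_map x))) ` X"
  and path_point: "!!s. (!!i. (s i, s (Suc i)) \<in> E) ==> \<exists>x\<in>X. \<forall>i. c ((shift_map ^^ i) x) = s i"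
  and c_first: "!!x y. x \<in> X ==> y \<in> X ==> c x = c y ==> x 0 = y 0"
  and c_local: "\<exists>k. \<forall>x\<in>X. \<forall>y\<in>X. (\<forall>i<k. x i = y i) --> c x = c y"

lemma shift_funpow: "(shift_map ^^ i) x n = x (i + n)"
 by (induction i arbitrary: x n) (simp_all add: shift_map_def)

lemma continuous_shift: "continuous_on S shift_map"
 unfolding shift_map_def
 by (intro continuous_on_coordinatewise_then_product) (rule continuous_on_subset[OF continuous_on_product_coordinates], simp)

lemma open_prefix: "open {y :: nat => nat. \<forall>i<n. y i = x i}"
proof -
 have "open {y :: nat => nat. \<forall>i\<in>{..<n}. y (id i) \<in> {x i}}"
  by (rule product_topology_basis') (auto intro: discrete_topology_class.open_discrete)
 then show ?thesis by (simp add: Ball_def)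
qed

lemma open_contains_prefix:
 assumes "open O'" "x \<in> O'"
 obtains n where "!!y :: nat => nat. (\<forall>i<n. y i = x i) ==> y \<in> O'"
proof -
 have "openin (product_topology (%i. euclidean) UNIV) O'" using assms(1) by (simp add: open_fun_def)
 from product_topology_open_contains_basis[OF this assms(2)] obtain B where B:
  "x \<in> (\<Pi>\<^sub>E i\<in>UNIV. B i)" "finite {i. B i ~= topspace euclidean}" "(\<Pi>\<^sub>E i\<in>UNIV. B i) \<subseteq> O'" by blast
 obtain n where n: "!!i. B i ~= UNIV ==> i < n"
  using B(2) unfolding finite_nat_set_iff_bounded topspace_euclidean by blast
 show ?thesis
 proof (rule that[of n])
  fix y :: "nat => nat" assume y: "\<forall>i<n. y i = x i"
  have "y i \<in> B i" for i
  proof (cases "B i = UNIV")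
   case False
   then have "y i = x i" using n y by blast
   then show ?thesis using B(1) by (simp add: PiE_iff)
  qed simp
  then show "y \<in> O'" using B(3) by (auto simp: PiE_iff)
 qed
qed

section \<open>Cylinders and the sigma-algebra of a coded shift\<close>

context coded_shift
begin

abbreviation "borel_sets \<equiv> sets (restrict_space borel X)"

lemma X_nonempty: "X ~= {}" using c_image V_nonempty by blast

lemma funpow_X: "x \<in> X ==> (shift_map ^^ i) x \<in> X"
 by (induction i) (auto simp: shift_X)

lemma E_subset: "E \<subseteq> V \<times> V"
proof
 fix e assume "e \<in> E"
 then obtain x where "x \<in> X" "e = (c x, c (shift_map x))" using E_eq by auto
 then show "e \<in> V \<times> V" using c_image shift_X by auto
qed

lemma edge:
 assumes "x \<in> X" shows "(c ((shift_map ^^ i) x), c ((shift_map ^^ Suc i) x)) \<in> E"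
proof -
 have "(c ((shift_map ^^ i) x), c (shift_map ((shift_map ^^ i) x))) \<in> (%x. (c x, c (shift_map x))) ` X"
  using funpow_X[OF assms] by (rule imageI)
 then show ?thesis using E_eq by simp
qed

abbreviation "itin \<equiv> itinerary shift_map c"

definition cyl :: "'v list => (nat => nat) set" where
 "cyl u = {x \<in> X. itin (length u) x = u}"

lemma itin_words: "x \<in> X ==> itin n x \<in> words V n"
 using funpow_X c_image by (auto simp: words_def itinerary_def)

lemma itin_prefix: "x \<in> X ==> y \<in> X ==> itin n x = itin n y ==> i < n ==> x i = y i"
proof -
 assume xy: "x \<in> X" "y \<in> X" "itin n x = itin n y" "i < n"
 then have "c ((shift_map ^^ i) x) = c ((shift_map ^^ i) y)" by (metis nth_itinerary)
 then have "((shift_map ^^ i) x) 0 = ((shift_map ^^ i) y) 0" using xy funpow_X c_first by blast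
 then show ?thesis by (simp add: shift_funpow)
qed

lemma open_contains_cyl:
 assumes "open O'" "x \<in> O'" "x \<in> X"
 obtains n where "cyl (itin n x) \<subseteq> O'"
proof -
 obtain n where n: "!!y. (\<forall>i<n. y i = x i) ==> y \<in> O'"
  using open_contains_prefix[OF assms(1,2)] by blast
 have "cyl (itin n x) \<subseteq> O'"
  using itin_prefix[OF _ assms(3)] by (auto simp: cyl_def intro!: n)
 then show ?thesis by (rule that)
qed

lemma openin_cyl: "openin (top_of_set X) (cyl u)"
proof -
 obtain k where k: "!!x y. x \<in> X ==> y \<in> X ==> (!!i. i < k ==> x i = y i) ==> c x = c y"
  using c_local by meson
 define O' where "O' = (\<Union>x\<in>cyl u. {y. \<forall>i<length u + k. y i = x i})"
 have "open O'" unfolding O'_def by (intro open_UN ballI open_prefix)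
 moreover have "cyl u = X \<inter> O'"
 proof (intro equalityI subsetI)
  fix y assume "y \<in> X \<inter> O'"
  then obtain x where x: "y \<in> X" "x \<in> cyl u" "!!i. i < length u + k ==> y i = x i"
   by (auto simp: O'_def)
  have "c ((shift_map ^^ i) y) = c ((shift_map ^^ i) x)" if "i < length u" for i
   by (rule k) (use x that in \<open>auto simp: cyl_def shift_funpow intro!: funpow_X\<close>)
  then have "itin (length u) y = itin (length u) x" by (simp add: itinerary_def)
  then show "y \<in> cyl u" using x by (simp add: cyl_def)
 qed (auto simp: O'_def cyl_def)
 ultimately show ?thesis by (metis openin_open_Int)
qed

lemma sets_cyl: "cyl u \<in> borel_sets"
proof -
 obtain O' where "open O'" "cyl u = X \<inter> O'" using openin_cyl[of u] unfolding openin_open by blast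
 then have "X \<inter> O' \<in> (\<inter>) X ` sets borel" by (intro imageI borel_open)
 then show ?thesis unfolding sets_restrict_space \<open>cyl u = X \<inter> O'\<close> .
qed

lemma cyl_Nil: "cyl [] = X" by (simp add: cyl_def)

lemma sets_X_eq: "borel_sets = sigma_sets X (range cyl)"
proof (intro equalityI subsetI)
 have "finite V" by (rule finite_V)
 then have cV: "countable (lists V)" by (simp add: countable_finite)
 fix B assume "B \<in> borel_sets"
 then obtain A where A: "A \<in> sets borel" "B = X \<inter> A" unfolding sets_restrict_space by blast
 have "A \<in> sigma_sets UNIV {S. open S}" using A(1) by (simp add: borel_def)
 then have "X \<inter> A \<in> sigma_sets X (range cyl)"
 proof (induction rule: sigma_sets.induct)
  case (Basic S)
  have "X \<inter> S = \<Union> (cyl ` {u \<in> lists V. cyl u \<subseteq> S})"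
  proof (intro equalityI subsetI)
   fix x assume x: "x \<in> X \<inter> S"
   then obtain n where n: "cyl (itin n x) \<subseteq> S" using open_contains_cyl[of S x] Basic by auto
   moreover have "itin n x \<in> lists V" using itin_words[of x n] x by (auto simp: words_def in_lists_conv_set)
   moreover have "x \<in> cyl (itin n x)" using x by (simp add: cyl_def)
   ultimately show "x \<in> \<Union> (cyl ` {u \<in> lists V. cyl u \<subseteq> S})" by blast
  qed (auto simp: cyl_def)
  also have "\<dots> \<in> sigma_sets X (range cyl)"
   by (rule sigma_sets_UNION) (use cV in \<open>auto intro: countable_subset[OF _ cV] sigma_sets.Basic\<close>)
  finally show ?case .
 next
  case Empty
  then show ?case by (simp add: sigma_sets.Empty)
 next
  case (Compl a)
  have "X \<inter> (UNIV - a) = X - X \<inter> a" by blast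
  then show ?case using sigma_sets.Compl[OF Compl.IH] by simp
 next
  case (Union a)
  have "X \<inter> (\<Union>i. a i) = (\<Union>i. X \<inter> a i)" by blast
  then show ?case using sigma_sets.Union[of "%i. X \<inter> a i"] Union by simp
 qed
 then show "B \<in> sigma_sets X (range cyl)" using A by simp
next
 fix B assume "B \<in> sigma_sets X (range cyl)"
 then show "B \<in> borel_sets"
 proof (induction rule: sigma_sets.induct)
  case (Compl a)
  then show ?case using sets.compl_sets[OF Compl.IH] by (simp add: space_restrict_space)
 qed (auto simp: sets_cyl)
qed

lemma cyl_prefix: "x \<in> cyl w ==> length u \<le> length w ==> x \<in> cyl u \<longleftrightarrow> take (length u) w = u"
proof -
 assume x: "x \<in> cyl w" and le: "length u \<le> length w"
 have "itin (length w) x = w" "x \<in> X" using x unfolding cyl_def by blast+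
 moreover have "take (length u) (itin (length w) x) = itin (length u) x" by (rule take_itinerary[OF le])
 ultimately show ?thesis unfolding cyl_def by simp
qed

lemma cyl_Int: "cyl u \<inter> cyl w \<in> insert {} (range cyl)"
proof -
 have *: "cyl u \<inter> cyl w \<in> insert {} (range cyl)" if le: "length u \<le> length w" for u w
 proof (cases "take (length u) w = u")
  case True
  have "cyl u \<inter> cyl w = cyl w" using cyl_prefix[OF _ le] True by blast
  then show ?thesis by simp
 next
  case False
  have "cyl u \<inter> cyl w = {}" using cyl_prefix[OF _ le] False by blast
  then show ?thesis by simp
 qed
 show ?thesis
 proof (cases "length u \<le> length w")
  case False
  then have "cyl w \<inter> cyl u \<in> insert {} (range cyl)" by (intro *) simp
  then show ?thesis by (simp only: Int_commute)
 qed (rule *)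
qed

lemma measure_eq_cyl:
 assumes "sets M = borel_sets" "sets N = borel_sets"
  and fin: "emeasure M X ~= \<infinity>" and eq: "!!u. emeasure M (cyl u) = emeasure N (cyl u)"
 shows "M = N"
proof (rule measure_eqI_generator_eq[where \<Omega> = X and E = "insert {} (range cyl)" and A = "%_. X"])
 have "sigma_sets X (insert {} (range cyl)) = sigma_sets X (range cyl)"
  by (rule sigma_sets_eqI) (auto intro: sigma_sets.Basic sigma_sets.Empty)
 then show "sets M = sigma_sets X (insert {} (range cyl))" "sets N = sigma_sets X (insert {} (range cyl))"
  unfolding assms(1,2) sets_X_eq by simp_all
 show "Int_stable (insert {} (range cyl))"
  unfolding Int_stable_def
 proof (intro ballI)
  fix a b assume "a \<in> insert {} (range cyl)" "b \<in> insert {} (range cyl)"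
  then consider "a = {} \<or> b = {}" | u w where "a = cyl u" "b = cyl w" by blast
  then show "a \<inter> b \<in> insert {} (range cyl)" using cyl_Int by cases auto
 qed
 have "X \<in> range cyl" using cyl_Nil by (metis rangeI)
 then show "range (%_. X) \<subseteq> insert {} (range cyl)" by auto
 show "insert {} (range cyl) \<subseteq> Pow X" by (auto simp: cyl_def)
 show "emeasure M A = emeasure N A" if "A \<in> insert {} (range cyl)" for A using that eq by auto
qed (use fin in auto)

lemma shift_measurable: "shift_map \<in> measurable (restrict_space borel X) (restrict_space borel X)"
proof (rule measurable_restrict_space3)
 show "shift_map \<in> borel_measurable borel"
  by (rule borel_measurable_continuous_onI[OF continuous_shift])
 show "shift_map \<in> X \<rightarrow> X" using shift_X by simp
qed

section \<open>Invariant measures in terms of word probabilities\<close>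

abbreviation "inv_measures \<equiv> invariant_measures X"

lemma invD:
 assumes "\<mu> \<in> inv_measures"
 shows "sets \<mu> = borel_sets" "prob_space \<mu>" "distr \<mu> \<mu> shift_map = \<mu>" "space \<mu> = X"
proof -
 have "sets \<mu> = borel_sets \<and> prob_space \<mu> \<and> distr \<mu> \<mu> shift_map = \<mu>"
  using assms unfolding invariant_measures_def by (rule CollectD)
 then show s: "sets \<mu> = borel_sets" and "prob_space \<mu>" "distr \<mu> \<mu> shift_map = \<mu>"
  by simp_all
 from sets_eq_imp_space_eq[OF s] show "space \<mu> = X" by (simp add: space_restrict_space)
qed

lemma gen_system:
 assumes \<mu>: "\<mu> \<in> inv_measures" shows "gen_system \<mu> shift_map c"
proof -
 note I = invD[OF \<mu>]
 interpret prob_space \<mu> by (rule I(2))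
 show ?thesis
 proof
  show "shift_map \<in> measurable \<mu> \<mu>" using shift_measurable I(1) by (simp cong: measurable_cong_sets)
  show "distr \<mu> \<mu> shift_map = \<mu>" by (rule I(3))
  show "simple_function \<mu> c"
   unfolding simple_function_def I(4)
  proof (intro conjI ballI)
   show "finite (c ` X)" using finite_V c_image by simp
   fix v assume "v \<in> c ` X"
   have "c -` {v} \<inter> X = cyl [v]" by (auto simp: cyl_def itinerary_def)
   then show "c -` {v} \<inter> X \<in> sets \<mu>" using sets_cyl I(1) by simp
  qed
  show "sets \<mu> = sigma_sets (space \<mu>) (range (%u. {x \<in> space \<mu>. itin (length u) x = u}))"
   using sets_X_eq I(1) by (simp add: I(4) cyl_def[abs_def])
 qed
qed

definition wm :: "(nat => nat) measure => 'v list => real" where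
 "wm \<mu> u = measure \<mu> (cyl u)"

lemma prw_eq_wm:
 assumes \<mu>: "\<mu> \<in> inv_measures" shows "gen_system.prw \<mu> shift_map c = wm \<mu>"
proof
 interpret gen_system \<mu> shift_map c by (rule gen_system[OF \<mu>])
 fix u
 have "itin (length u) -` {u} \<inter> space \<mu> = cyl u" by (auto simp: cyl_def invD(4)[OF \<mu>])
 then show "prw u = wm \<mu> u" by (simp add: prw_def fibre_prob_def wm_def)
qed

lemma alphabet_eq: "\<mu> \<in> inv_measures ==> c ` space \<mu> = V"
 by (simp add: invD(4) c_image)

lemma wm_nonneg [simp]: "0 \<le> wm \<mu> u" by (simp add: wm_def)

lemma inv_measure_eqI:
 assumes "\<mu> \<in> inv_measures" "\<nu> \<in> inv_measures" "!!u. u ~= [] ==> wm \<mu> u = wm \<nu> u"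
 shows "\<mu> = \<nu>"
proof -
 interpret M: prob_space \<mu> by (rule invD(2)[OF assms(1)])
 interpret N: prob_space \<nu> by (rule invD(2)[OF assms(2)])
 have "wm \<mu> [] = wm \<nu> []"
  using M.prob_space N.prob_space by (simp add: wm_def cyl_Nil invD(4)[OF assms(1)] invD(4)[OF assms(2)])
 then have "wm \<mu> u = wm \<nu> u" for u using assms(3) by (cases "u = []") auto
 then show ?thesis
  using invD[OF assms(1)] invD[OF assms(2)] M.emeasure_finite
  by (intro measure_eq_cyl) (auto simp: wm_def M.emeasure_eq_measure N.emeasure_eq_measure)
qed

lemma wm_append: "\<mu> \<in> inv_measures ==> wm \<mu> u = (\<Sum>v\<in>V. wm \<mu> (u @ [v]))"
 using gen_system.prw_append[OF gen_system, of \<mu> u]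
 by (simp add: prw_eq_wm alphabet_eq)

lemma wm_sum: "\<mu> \<in> inv_measures ==> (\<Sum>u\<in>words V n. wm \<mu> u) = 1"
 using gen_system.sum_prw[OF gen_system, of \<mu> n]
 by (simp add: prw_eq_wm alphabet_eq)

lemma wm_outside: "\<mu> \<in> inv_measures ==> u \<notin> words V (length u) ==> wm \<mu> u = 0"
 using gen_system.prw_outside[OF gen_system, of \<mu> u]
 by (simp add: prw_eq_wm alphabet_eq)

lemma wm_window_le: "\<mu> \<in> inv_measures ==> i + j \<le> length u ==> wm \<mu> u \<le> wm \<mu> (take j (drop i u))"
 using gen_system.prw_window_le[OF gen_system, of \<mu> i j u]
 by (simp add: prw_eq_wm)

lemma wm_not_edge: "(v, w) \<notin> E ==> wm \<mu> [v, w] = 0"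
proof -
 assume "(v, w) \<notin> E"
 then have "cyl [v, w] = {}" using edge[of _ 0] by (auto simp: cyl_def itinerary_def)
 then show ?thesis by (simp add: wm_def)
qed

lemma wm_single: "\<mu> \<in> inv_measures ==> wm \<mu> [v] = (\<Sum>w\<in>V. wm \<mu> [v, w])"
 using wm_append[of \<mu> "[v]"] by simp

lemma wm_total: "\<mu> \<in> inv_measures ==> (\<Sum>v\<in>V. wm \<mu> [v]) = 1"
 using wm_sum[of \<mu> "Suc 0"] by (simp add: sum_words_Suc words_0)

lemma wm_single_in:
 assumes \<mu>: "\<mu> \<in> inv_measures" and w: "w \<in> V" shows "wm \<mu> [w] = (\<Sum>v\<in>V. wm \<mu> [v, w])"
proof -
 interpret gen_system \<mu> shift_map c by (rule gen_system[OF \<mu>])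
 note P = prw_eq_wm[OF \<mu>] and A = alphabet_eq[OF \<mu>]
 have "(\<Sum>u\<in>words V 2. wm \<mu> u * (if take 1 (drop 1 u) = [w] then 1 else 0))
   = (\<Sum>u\<in>words V 1. wm \<mu> u * (if u = [w] then 1 else 0))"
  using sum_window[of 1 1 2 "%u. if u = [w] then 1 else 0"] unfolding P A by simp
 also have "\<dots> = (\<Sum>v\<in>V. if v = w then wm \<mu> [w] else 0)"
  by (simp add: sum_words_Suc words_0) (intro sum.cong; simp)
 also have "\<dots> = wm \<mu> [w]" using w finite_V by simp
 also have "(\<Sum>u\<in>words V 2. wm \<mu> u * (if take 1 (drop 1 u) = [w] then 1 else 0))
   = (\<Sum>v\<in>V. \<Sum>w'\<in>V. if w' = w then wm \<mu> [v, w] else 0)"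
  unfolding sum_words_2 by (intro sum.cong refl) auto
 also have "\<dots> = (\<Sum>v\<in>V. wm \<mu> [v, w])" using w finite_V by simp
 finally show ?thesis ..
qed

lemma circulation_measure:
 assumes \<mu>: "\<mu> \<in> inv_measures" shows "circulation V E (%v w. wm \<mu> [v, w])"
 unfolding circulation_def
 using wm_not_edge wm_single[OF \<mu>] wm_single_in[OF \<mu>] wm_total[OF \<mu>] by auto

lemma integral_coded:
 assumes \<mu>: "\<mu> \<in> inv_measures" and \<phi>: "!!x. x \<in> X ==> \<phi> x = \<psi> (c x)"
 shows "integral\<^sup>L \<mu> \<phi> = (\<Sum>v\<in>V. wm \<mu> [v] * \<psi> v)"
proof -
 interpret gen_system \<mu> shift_map c by (rule gen_system[OF \<mu>])
 have "integral\<^sup>L \<mu> \<phi> = (\<integral>x. \<psi> (hd (itin 1 x)) \<partial>\<mu>)"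
  by (intro Bochner_Integration.integral_cong refl) (simp add: \<phi> invD(4)[OF \<mu>] itinerary_def)
 also have "\<dots> = (\<Sum>u\<in>words V 1. wm \<mu> u * \<psi> (hd u))"
  using integral_words[of "%u. \<psi> (hd u)" 1] by (simp add: prw_eq_wm[OF \<mu>] alphabet_eq[OF \<mu>])
 finally show ?thesis by (simp add: sum_words_Suc words_0)
qed

lemma integral_circ_val:
 assumes \<mu>: "\<mu> \<in> inv_measures" and \<phi>: "!!x. x \<in> X ==> \<phi> x = \<psi> (c x)"
 shows "integral\<^sup>L \<mu> \<phi> = circ_val V \<psi> (%v w. wm \<mu> [v, w])"
 using integral_coded[of \<mu> \<phi> \<psi>, OF \<mu> \<phi>] wm_single[OF \<mu>]
 by (simp add: circ_val_def sum_distrib_right)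

text \<open>A Lebesgue number, expressed as a word length: compactness leaves finitely many
  cylinders, and the sum of their lengths bounds them all.\<close>

lemma lebesgue_cyl:
 assumes U: "!!B. B \<in> U ==> openin (top_of_set X) B" "X \<subseteq> \<Union>U"
 obtains n0 where "!!x. x \<in> X ==> \<exists>B\<in>U. cyl (itin n0 x) \<subseteq> B"
proof -
 have "\<exists>n. \<exists>B\<in>U. cyl (itin n x) \<subseteq> B" if x: "x \<in> X" for x
 proof -
  obtain B where B: "B \<in> U" "x \<in> B" using U(2) x by blast
  obtain O' where O': "open O'" "B = X \<inter> O'" using U(1)[OF B(1)] unfolding openin_open by blast
  obtain n where "cyl (itin n x) \<subseteq> O'" by (rule open_contains_cyl[of O' x]) (use O' B x in auto)
  then have "cyl (itin n x) \<subseteq> B" using O' by (auto simp: cyl_def)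
  then show ?thesis using B by blast
 qed
 then obtain N where N: "!!x. x \<in> X ==> \<exists>B\<in>U. cyl (itin (N x) x) \<subseteq> B" by metis
 have "\<forall>u. \<exists>O'. open O' \<and> cyl u = X \<inter> O'" using openin_cyl by (simp add: openin_open)
 then obtain Op where Op: "!!u. open (Op u)" "!!u. cyl u = X \<inter> Op u" by metis
 have cov: "X \<subseteq> (\<Union>x\<in>X. Op (itin (N x) x))"
 proof
  fix x assume x: "x \<in> X"
  then have "x \<in> cyl (itin (N x) x)" by (simp add: cyl_def)
  then show "x \<in> (\<Union>x\<in>X. Op (itin (N x) x))" using x Op(2) by blast
 qed
 obtain D where D: "D \<subseteq> X" "finite D" "X \<subseteq> (\<Union>x\<in>D. Op (itin (N x) x))"
  by (rule compactE_image[OF compact_X _ cov]) (auto simp: Op)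
 define n where "n = (\<Sum>x\<in>D. N x)"
 show ?thesis
 proof (rule that[of n])
  fix x assume x: "x \<in> X"
  obtain z where z: "z \<in> D" "x \<in> Op (itin (N z) z)" using D(3) x by blast
  have xz: "x \<in> cyl (itin (N z) z)" using z Op(2) x by blast
  have le: "N z \<le> n" unfolding n_def by (rule member_le_sum) (use z D in auto)
  have "cyl (itin n x) \<subseteq> cyl (itin (N z) z)"
  proof
   fix y assume "y \<in> cyl (itin n x)"
   then have "y \<in> X" "itin n y = itin n x" by (auto simp: cyl_def)
   then have "itin (N z) y = itin (N z) x" using le by (metis take_itinerary)
   then show "y \<in> cyl (itin (N z) z)" using xz \<open>y \<in> X\<close> by (simp add: cyl_def)
  qed
  then show "\<exists>B\<in>U. cyl (itin n x) \<subseteq> B" using N[of z] z D(1) by blast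
 qed
qed

lemma uniform_cyl:
 fixes g :: "(nat => nat) => real"
 assumes g: "continuous_on X g" and e: "e > 0"
 obtains n where "!!x y. x \<in> X ==> y \<in> X ==> itin n x = itin n y ==> \<bar>g x - g y\<bar> \<le> e"
proof -
 let ?U = "range (%a. X \<inter> g -` ball a (e / 2))"
 have "X \<subseteq> \<Union>?U"
 proof
  fix x assume "x \<in> X"
  then have "x \<in> X \<inter> g -` ball (g x) (e / 2)" using e by simp
  then show "x \<in> \<Union>?U" by blast
 qed
 moreover have "openin (top_of_set X) B" if "B \<in> ?U" for B
  using that continuous_openin_preimage_gen[OF g open_ball] by blast
 ultimately obtain n where n: "!!x. x \<in> X ==> \<exists>B\<in>?U. cyl (itin n x) \<subseteq> B"
  using lebesgue_cyl[of ?U] by blast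
 show ?thesis
 proof (rule that[of n])
  fix x y assume xy: "x \<in> X" "y \<in> X" "itin n x = itin n y"
  obtain a where "cyl (itin n x) \<subseteq> X \<inter> g -` ball a (e / 2)" using n[OF xy(1)] by blast
  moreover have "x \<in> cyl (itin n x)" "y \<in> cyl (itin n x)" using xy by (simp_all add: cyl_def)
  ultimately have "dist a (g x) < e / 2" "dist a (g y) < e / 2" by auto
  then show "\<bar>g x - g y\<bar> \<le> e" unfolding dist_real_def by linarith
 qed
qed

text \<open>On the compact space \<open>X\<close> a continuous function is uniformly close to a
  function of finitely many letters, whose integral is a finite combination of word
  probabilities.\<close>

lemma weak_star_limitI:
 assumes \<mu>: "!!t. m t \<in> inv_measures" "\<mu> \<in> inv_measures"
  and lim: "!!u. u ~= [] ==> ((%t. wm (m t) u) \<longlongrightarrow> wm \<mu> u) F"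
 shows "weak_star_limit X m \<mu> F"
 unfolding weak_star_limit_def
proof (intro allI impI)
 fix g :: "(nat => nat) => real" assume g: "continuous_on X g"
 show "((%t. integral\<^sup>L (m t) g) \<longlongrightarrow> integral\<^sup>L \<mu> g) F"
 proof (rule tendstoI)
  fix e :: real assume e: "e > 0"
  obtain n0 where n0: "!!x y. x \<in> X ==> y \<in> X ==> itin n0 x = itin n0 y ==> \<bar>g x - g y\<bar> \<le> e / 4"
   by (rule uniform_cyl[OF g, of "e / 4"]) (use e in auto)
  \<comment> \<open>A positive length, as convergence is assumed for nonempty words only.\<close>
  define n where "n = Suc n0"
  have n: "\<bar>g x - g y\<bar> \<le> e / 4" if "x \<in> X" "y \<in> X" "itin n x = itin n y" for x y
   using n0 that by (simp add: n_def itinerary_Suc)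
  define G where "G u = g (SOME x. x \<in> X \<and> itin n x = u)" for u
  have G: "\<bar>g x - G (itin n x)\<bar> \<le> e / 4" if x: "x \<in> X" for x
  proof -
   have "\<exists>y. y \<in> X \<and> itin n y = itin n x" using x by blast
   from someI_ex[OF this] show ?thesis using n x by (simp add: G_def)
  qed
  obtain C where C: "!!x. x \<in> X ==> \<bar>g x\<bar> \<le> C"
   using compact_imp_bounded[OF compact_continuous_image[OF g compact_X]] by (auto simp: bounded_iff)
  have approx: "\<bar>integral\<^sup>L \<nu> g - (\<Sum>u\<in>words V n. wm \<nu> u * G u)\<bar> \<le> e / 4" if \<nu>: "\<nu> \<in> inv_measures" for \<nu>
  proof -
   interpret gen_system \<nu> shift_map c by (rule gen_system[OF \<nu>])
   have gm: "g \<in> borel_measurable \<nu>"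
    using borel_measurable_continuous_on_restrict[OF g] invD(1)[OF \<nu>] by (simp cong: measurable_cong_sets)
   have i1: "integrable \<nu> g"
    by (rule integrable_const_bound[of _ C]) (use C gm in \<open>auto simp: invD(4)[OF \<nu>]\<close>)
   have i2: "integrable \<nu> (%x. G (itin n x))" by (rule integrable_simple[OF simple_word])
   have eq: "(\<integral>x. G (itin n x) \<partial>\<nu>) = (\<Sum>u\<in>words V n. wm \<nu> u * G u)"
    using integral_words[of G n] by (simp add: prw_eq_wm[OF \<nu>] alphabet_eq[OF \<nu>])
   have "\<bar>integral\<^sup>L \<nu> g - (\<integral>x. G (itin n x) \<partial>\<nu>)\<bar> = \<bar>\<integral>x. g x - G (itin n x) \<partial>\<nu>\<bar>"
    using i1 i2 by simp
   also have "\<dots> \<le> (\<integral>x. \<bar>g x - G (itin n x)\<bar> \<partial>\<nu>)"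
    by (rule integral_abs_bound)
   also have "\<dots> \<le> (\<integral>x. e / 4 \<partial>\<nu>)"
    by (rule integral_mono) (use i1 i2 G in \<open>auto simp: invD(4)[OF \<nu>]\<close>)
   finally show ?thesis by (simp add: eq prob_space)
  qed
  have "((%t. \<Sum>u\<in>words V n. wm (m t) u * G u) \<longlongrightarrow> (\<Sum>u\<in>words V n. wm \<mu> u * G u)) F"
   by (intro tendsto_sum tendsto_mult lim tendsto_const) (auto simp: words_def n_def)
  then have "\<forall>\<^sub>F t in F. dist (\<Sum>u\<in>words V n. wm (m t) u * G u) (\<Sum>u\<in>words V n. wm \<mu> u * G u) < e / 4"
   by (rule tendstoD) (use e in auto)
  then show "\<forall>\<^sub>F t in F. dist (integral\<^sup>L (m t) g) (integral\<^sup>L \<mu> g) < e"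
  proof eventually_elim
   case (elim t)
   then show ?case using approx[OF \<mu>(1)[of t]] approx[OF \<mu>(2)] e
    unfolding dist_real_def by linarith
  qed
 qed
qed

end

subsection \<open>Markov measures\<close>

lemma pmf_embed_finite:
 fixes f :: "'v => real"
 assumes "finite K" "!!v. v \<in> K ==> 0 \<le> f v" "(\<Sum>v\<in>K. f v) = 1"
 shows "pmf (embed_pmf (%v. if v \<in> K then f v else 0)) v = (if v \<in> K then f v else 0)"
proof (rule pmf_embed_pmf)
 have "(\<integral>\<^sup>+v. ennreal (if v \<in> K then f v else 0) \<partial>count_space UNIV) = (\<Sum>v\<in>K. ennreal (if v \<in> K then f v else 0))"
  using assms by (intro nn_integral_count_space') auto
 also have "\<dots> = (\<Sum>v\<in>K. ennreal (f v))" by simp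
 also have "\<dots> = ennreal (\<Sum>v\<in>K. f v)" using assms by (intro sum_ennreal) auto
 finally show "(\<integral>\<^sup>+v. ennreal (if v \<in> K then f v else 0) \<partial>count_space UNIV) = 1" using assms by simp
qed (use assms in auto)

context coded_shift
begin

lemma sets_X_space: "sets M = borel_sets ==> space M = X"
 using sets_eq_imp_space_eq[of M "restrict_space borel X"] by (simp add: space_restrict_space)

lemma shift_vimage_cyl: "shift_map -` cyl u \<inter> X = (\<Union>v\<in>V. cyl (v # u))"
proof -
 have *: "itin (Suc n) x = c x # itin n (shift_map x)" for n x
 proof (rule nth_equalityI)
  fix i assume i: "i < length (itin (Suc n) x)"
  show "itin (Suc n) x ! i = (c x # itin n (shift_map x)) ! i"
  proof (cases i)
   case (Suc j)
   have "(shift_map ^^ Suc j) x = (shift_map ^^ j) (shift_map x)" by (simp only: funpow_Suc_right o_apply)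
   then show ?thesis using i Suc by (simp add: nth_itinerary del: funpow.simps)
  qed (simp add: nth_itinerary)
 qed simp
 show ?thesis
  unfolding cyl_def using shift_X c_image by (auto simp: *)
qed

text \<open>The chain is driven by independent random maps \<open>\<omega> i\<close>, the next state being \<open>\<omega> (i + 1) v\<close> if the
 current one is \<open>v\<close>. The function \<open>G\<close> redirects the null set of forbidden transitions.\<close>
lemma markov_measure_exists:
 assumes K: "K \<subseteq> V" and p: "!!v. v \<in> K ==> 0 \<le> p v" "(\<Sum>v\<in>K. p v) = 1"
  and q: "!!v w. v \<in> K ==> w \<in> K ==> 0 \<le> q v w" "!!v. v \<in> K ==> (\<Sum>w\<in>K. q v w) = 1"
   "!!v w. v \<in> K ==> w \<in> K ==> 0 < q v w ==> (v, w) \<in> E"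
  and stat: "!!w. w \<in> K ==> (\<Sum>v\<in>K. p v * q v w) = p w"
 obtains \<mu> where "\<mu> \<in> inv_measures"
  "!!n u. u \<in> words K (Suc n) ==> wm \<mu> u = p (u ! 0) * (\<Prod>i<n. q (u ! i) (u ! Suc i))"
  "!!u. \<not> set u \<subseteq> K ==> wm \<mu> u = 0"
proof -
 have finK: "finite K" using K finite_V finite_subset by blast
 obtain v0 where v0: "v0 \<in> K" using p(2) by (metis equals0I sum.empty zero_neq_one)
 define pp where "pp = embed_pmf (%v. if v \<in> K then p v else 0)"
 define pk where "pk v = embed_pmf (%w. if w \<in> K then q v w else 0)" for v
 have pp: "pmf pp v = (if v \<in> K then p v else 0)" for v
  unfolding pp_def by (rule pmf_embed_finite[OF finK p])
 have pk: "pmf (pk v) w = (if w \<in> K then q v w else 0)" if "v \<in> K" for v w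
  unfolding pk_def by (rule pmf_embed_finite[OF finK]) (use q that in auto)
 have "\<exists>w\<in>K. (v, w) \<in> E" if v: "v \<in> K" for v
 proof (rule ccontr)
  assume "\<not> ?thesis"
  then have "q v w = 0" if "w \<in> K" for w using q(1)[OF v that] q(3)[OF v that] that by force
  then show False using q(2)[OF v] by simp
 qed
 then obtain d where d: "!!v. v \<in> K ==> d v \<in> K \<and> (v, d v) \<in> E" by metis
 define G where "G v w = (if w \<in> K \<and> (v, w) \<in> E then w else d v)" for v w
 define G0 where "G0 w = (if w \<in> K then w else v0)" for w
 have G: "G v w \<in> K" "(v, G v w) \<in> E" if "v \<in> K" for v w using d[OF that] by (auto simp: G_def)
 have pkG: "map_pmf (G v) (pk v) = pk v" if v: "v \<in> K" for v
 proof -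
  have "G v w = w" if "w \<in> set_pmf (pk v)" for w
  proof -
   have "pmf (pk v) w > 0" using that by (simp add: pmf_positive)
   then have "w \<in> K" "0 < q v w" using pk[OF v, of w] by (auto split: if_splits)
   then show ?thesis using q(3)[OF v] by (simp add: G_def)
  qed
  then have "map_pmf (G v) (pk v) = map_pmf (%w. w) (pk v)" by (intro map_pmf_cong) auto
  then show ?thesis by (simp add: map_pmf_ident)
 qed
 have ppG: "map_pmf G0 pp = pp"
 proof -
  have "G0 w = w" if "w \<in> set_pmf pp" for w
  proof -
   have "pmf pp w > 0" using that by (simp add: pmf_positive)
   then show ?thesis using pp[of w] by (auto simp: G0_def split: if_splits)
  qed
  then have "map_pmf G0 pp = map_pmf (%w. w) pp" by (intro map_pmf_cong) auto
  then show ?thesis by (simp add: map_pmf_ident)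
 qed
 \<comment> \<open>Coordinate 0 is a constant map whose value has the initial distribution, so it
   may be evaluated anywhere; each later coordinate assigns to every state an independent
   successor.\<close>
 define R where "R i = (if i = 0 then map_pmf (%v _. v) pp else Pi_pmf K undefined pk)" for i :: nat
 define \<Omega> where "\<Omega> = PiM UNIV (%i. measure_pmf (R i))"
 interpret P: product_prob_space "%i. measure_pmf (R i)" "UNIV :: nat set"
  by unfold_locales
 define Y where "Y \<omega> = rec_nat (G0 (\<omega> 0 undefined)) (%n v. G v (\<omega> (Suc n) v))" for \<omega> :: "nat => 'v => 'v"
 have Y0: "Y \<omega> 0 = G0 (\<omega> 0 undefined)" and YS: "Y \<omega> (Suc n) = G (Y \<omega> n) (\<omega> (Suc n) (Y \<omega> n))" for \<omega> n
  by (simp_all add: Y_def)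
 have YK: "Y \<omega> n \<in> K" for \<omega> n
  by (induction n) (use v0 G in \<open>auto simp: Y0 YS G0_def\<close>)
 have YE: "(Y \<omega> n, Y \<omega> (Suc n)) \<in> E" for \<omega> n
  unfolding YS by (rule G(2)[OF YK])
 have "\<exists>x\<in>X. \<forall>i. c ((shift_map ^^ i) x) = Y \<omega> i" for \<omega> by (rule path_point) (rule YE)
 then obtain pt where pt: "!!\<omega>. pt \<omega> \<in> X" "!!\<omega> i. c ((shift_map ^^ i) (pt \<omega>)) = Y \<omega> i" by metis
 have pt_cyl: "pt \<omega> \<in> cyl u \<longleftrightarrow> (\<forall>i<length u. Y \<omega> i = u ! i)" for \<omega> u
  using pt by (auto simp: cyl_def list_eq_iff_nth_eq nth_itinerary)
 define A where "A u i = (case i of 0 => {f. G0 (f undefined) = u ! 0}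
  | Suc j => {f. G (u ! j) (f (u ! j)) = u ! Suc j})" for u :: "'v list" and i
 have iff: "(\<forall>i<Suc n. Y \<omega> i = u ! i) \<longleftrightarrow> (\<forall>i\<in>{..n}. \<omega> i \<in> A u i)" for \<omega> u n
 proof (induction n)
  case 0
  then show ?case by (simp add: A_def Y0)
 next
  case (Suc n)
  have "(\<forall>i<Suc (Suc n). Y \<omega> i = u ! i) \<longleftrightarrow> (\<forall>i<Suc n. Y \<omega> i = u ! i) \<and> Y \<omega> (Suc n) = u ! Suc n"
   by (auto simp: less_Suc_eq)
  also have "\<dots> \<longleftrightarrow> (\<forall>i<Suc n. Y \<omega> i = u ! i) \<and> \<omega> (Suc n) \<in> A u (Suc n)"
   by (auto simp: A_def YS)
  also have "\<dots> \<longleftrightarrow> (\<forall>i\<in>{..Suc n}. \<omega> i \<in> A u i)" unfolding Suc by (auto simp: le_Suc_eq)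
  finally show ?case .
 qed
 have sp: "space \<Omega> = UNIV" by (simp add: \<Omega>_def space_PiM)
 have ev: "{\<omega> \<in> space \<Omega>. \<forall>i\<in>{..n}. \<omega> i \<in> A u i} \<in> sets \<Omega>" for n u
 proof -
  have "{\<omega> \<in> space \<Omega>. \<forall>i\<in>{..n}. \<omega> i \<in> A u i} = (\<Inter>i\<in>{..n}. (%\<omega>. \<omega> i) -` A u i \<inter> space \<Omega>)" by auto
  also have "\<dots> \<in> sets \<Omega>"
  proof (intro sets.finite_INT)
   fix i assume "i \<in> {..n}"
   have "(%\<omega>. \<omega> i) \<in> measurable \<Omega> (measure_pmf (R i))"
    unfolding \<Omega>_def by (rule measurable_component_singleton) simp
   then show "(%\<omega>. \<omega> i) -` A u i \<inter> space \<Omega> \<in> sets \<Omega>" by (rule measurable_sets) simp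
  qed auto
  finally show ?thesis .
 qed
 have pre: "pt -` cyl u \<inter> space \<Omega> = (case u of [] => space \<Omega>
   | _ => {\<omega> \<in> space \<Omega>. \<forall>i\<in>{..length u - 1}. \<omega> i \<in> A u i})" for u
  using iff[of "length u - 1"] by (auto simp: pt_cyl split: list.splits)
 have ptm: "pt \<in> measurable \<Omega> (restrict_space borel X)"
 proof (rule measurableI)
  fix B assume "B \<in> borel_sets"
  then have "B \<in> sigma_sets X (range cyl)" by (simp add: sets_X_eq)
  then show "pt -` B \<inter> space \<Omega> \<in> sets \<Omega>"
  proof (induction rule: sigma_sets.induct)
   case (Basic a)
   then obtain u where "a = cyl u" by blast
   then show ?case using pre[of u] ev by (auto split: list.splits)
  next
   case (Compl a)
   have "pt -` (X - a) \<inter> space \<Omega> = space \<Omega> - (pt -` a \<inter> space \<Omega>)" using pt(1) by auto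
   then show ?case using sets.compl_sets[OF Compl.IH] by simp
  next
   case (Union a)
   have "pt -` (\<Union>i. a i) \<inter> space \<Omega> = (\<Union>i. pt -` a i \<inter> space \<Omega>)" by auto
   moreover have "(\<Union>i. pt -` a i \<inter> space \<Omega>) \<in> sets \<Omega>"
    using Union.IH by (intro sets.countable_UN) auto
   ultimately show ?case by simp
  qed simp
 qed (simp add: space_restrict_space pt)
 define \<mu> where "\<mu> = distr \<Omega> (restrict_space borel X) pt"
 have sets\<mu>: "sets \<mu> = borel_sets" by (simp add: \<mu>_def)
 have space\<mu>: "space \<mu> = X" by (rule sets_X_space[OF sets\<mu>])
 interpret \<mu>: prob_space \<mu>
  unfolding \<mu>_def \<Omega>_def by (rule P.prob_space_distr) (use ptm in \<open>simp add: \<Omega>_def\<close>)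
 have wm\<mu>: "wm \<mu> u = measure \<Omega> (pt -` cyl u \<inter> space \<Omega>)" for u
  unfolding wm_def \<mu>_def by (rule measure_distr[OF ptm sets_cyl])
 have words: "wm \<mu> u = p (u ! 0) * (\<Prod>i<n. q (u ! i) (u ! Suc i))" if u: "u \<in> words K (Suc n)" for n u
 proof -
  have len: "length u = Suc n" and uK: "!!i. i < Suc n ==> u ! i \<in> K" using u nth_mem by (auto simp: words_def)
  have "emeasure \<Omega> (pt -` cyl u \<inter> space \<Omega>) = emeasure \<Omega> {\<omega> \<in> space \<Omega>. \<forall>i\<in>{..n}. \<omega> i \<in> A u i}"
   using pre[of u] len by (cases u) auto
  also have "\<dots> = (\<Prod>i\<in>{..n}. emeasure (measure_pmf (R i)) (A u i))"
   unfolding \<Omega>_def by (rule P.emeasure_PiM_Collect) auto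
  also have "\<dots> = emeasure (measure_pmf (R 0)) (A u 0) * (\<Prod>i<n. emeasure (measure_pmf (R (Suc i))) (A u (Suc i)))"
   by (simp add: prod.atMost_shift)
  also have "emeasure (measure_pmf (R 0)) (A u 0) = ennreal (p (u ! 0))"
  proof -
   have "emeasure (measure_pmf (R 0)) (A u 0) = emeasure (measure_pmf (map_pmf G0 pp)) {u ! 0}"
    by (simp add: R_def A_def vimage_def)
   also have "\<dots> = ennreal (pmf pp (u ! 0))" unfolding ppG by (rule emeasure_pmf_single)
   finally show ?thesis using pp uK[of 0] by simp
  qed
  also have "(\<Prod>i<n. emeasure (measure_pmf (R (Suc i))) (A u (Suc i))) = (\<Prod>i<n. ennreal (q (u ! i) (u ! Suc i)))"
  proof (rule prod.cong[OF refl])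
   fix i assume "i \<in> {..<n}"
   then have i: "u ! i \<in> K" "u ! Suc i \<in> K" using uK by auto
   have "emeasure (measure_pmf (R (Suc i))) (A u (Suc i))
     = emeasure (measure_pmf (map_pmf (G (u ! i)) (map_pmf (%f. f (u ! i)) (Pi_pmf K undefined pk)))) {u ! Suc i}"
    by (simp add: R_def A_def vimage_def)
   also have "\<dots> = ennreal (pmf (pk (u ! i)) (u ! Suc i))"
    unfolding Pi_pmf_component[OF finK] using i pkG by (simp add: emeasure_pmf_single)
   finally show "emeasure (measure_pmf (R (Suc i))) (A u (Suc i)) = ennreal (q (u ! i) (u ! Suc i))"
    using pk[OF i(1)] i by simp
  qed
  also have "(\<Prod>i<n. ennreal (q (u ! i) (u ! Suc i))) = ennreal (\<Prod>i<n. q (u ! i) (u ! Suc i))"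
   by (rule prod_ennreal) (use uK q(1) in auto)
  also have "ennreal (p (u ! 0)) * \<dots> = ennreal (p (u ! 0) * (\<Prod>i<n. q (u ! i) (u ! Suc i)))"
   using p(1) uK by (intro ennreal_mult[symmetric] prod_nonneg) (auto intro!: q(1))
  finally have "emeasure \<Omega> (pt -` cyl u \<inter> space \<Omega>) = ennreal (p (u ! 0) * (\<Prod>i<n. q (u ! i) (u ! Suc i)))" .
  moreover have "0 \<le> p (u ! 0) * (\<Prod>i<n. q (u ! i) (u ! Suc i))"
   using p(1) uK by (intro mult_nonneg_nonneg prod_nonneg) (auto intro!: q(1))
  ultimately show ?thesis unfolding wm\<mu> by (simp add: measure_def)
 qed
 have outside: "wm \<mu> u = 0" if u: "\<not> set u \<subseteq> K" for u
 proof -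
  obtain i where "i < length u" "u ! i \<notin> K" using u by (metis in_set_conv_nth subsetI)
  then have "pt \<omega> \<notin> cyl u" for \<omega> unfolding pt_cyl using YK[of \<omega> i] by auto
  then have "pt -` cyl u \<inter> space \<Omega> = {}" by auto
  then show ?thesis unfolding wm\<mu> by simp
 qed
 have shift_wm: "(\<Sum>v\<in>V. wm \<mu> (v # u)) = wm \<mu> u" if u: "u ~= []" for u
 proof (cases "set u \<subseteq> K")
  case False
  then have "wm \<mu> (v # u) = 0" for v by (intro outside) auto
  moreover have "wm \<mu> u = 0" using False by (rule outside)
  ultimately show ?thesis by simp
 next
  case True
  then obtain n where n: "u \<in> words K (Suc n)" using u by (cases u) (auto simp: words_def)
  have "(\<Sum>v\<in>V. wm \<mu> (v # u)) = (\<Sum>v\<in>K. wm \<mu> (v # u))"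
   by (rule sum.mono_neutral_right[OF finite_V K]) (use outside in auto)
  also have "\<dots> = (\<Sum>v\<in>K. p v * q v (u ! 0) * (\<Prod>i<n. q (u ! i) (u ! Suc i)))"
  proof (rule sum.cong[OF refl])
   fix v assume "v \<in> K"
   then have "v # u \<in> words K (Suc (Suc n))" using n by (auto simp: words_def)
   from words[OF this] show "wm \<mu> (v # u) = p v * q v (u ! 0) * (\<Prod>i<n. q (u ! i) (u ! Suc i))"
    by (simp add: prod.lessThan_Suc_shift mult.assoc del: prod.lessThan_Suc)
  qed
  also have "\<dots> = (\<Sum>v\<in>K. p v * q v (u ! 0)) * (\<Prod>i<n. q (u ! i) (u ! Suc i))"
   by (simp add: sum_distrib_right)
  also have "(\<Sum>v\<in>K. p v * q v (u ! 0)) = p (u ! 0)"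
   using n nth_mem[of 0 u] by (intro stat) (auto simp: words_def)
  also have "p (u ! 0) * (\<Prod>i<n. q (u ! i) (u ! Suc i)) = wm \<mu> u" using words[OF n] by simp
  finally show ?thesis .
 qed
 have shm: "shift_map \<in> measurable \<mu> \<mu>" using shift_measurable sets\<mu> by (simp cong: measurable_cong_sets)
 have "distr \<mu> \<mu> shift_map = \<mu>"
 proof (rule measure_eq_cyl)
  fix u
  have cs: "cyl w \<in> sets \<mu>" for w using sets_cyl sets\<mu> by simp
  show "emeasure (distr \<mu> \<mu> shift_map) (cyl u) = emeasure \<mu> (cyl u)"
  proof (cases "u = []")
   case True
   have "shift_map -` X \<inter> X = X" using shift_X by auto
   then show ?thesis using True emeasure_distr[OF shm cs[of "[]"]] by (simp add: cyl_Nil space\<mu>)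
  next
   case False
   have "emeasure (distr \<mu> \<mu> shift_map) (cyl u) = emeasure \<mu> (\<Union>v\<in>V. cyl (v # u))"
    using emeasure_distr[OF shm cs] by (simp add: space\<mu> shift_vimage_cyl)
   also have "\<dots> = ennreal (measure \<mu> (\<Union>v\<in>V. cyl (v # u)))" by (rule \<mu>.emeasure_eq_measure)
   also have "measure \<mu> (\<Union>v\<in>V. cyl (v # u)) = (\<Sum>v\<in>V. measure \<mu> (cyl (v # u)))"
   proof (rule \<mu>.finite_measure_finite_Union[OF finite_V])
    show "(%v. cyl (v # u)) ` V \<subseteq> sets \<mu>" using cs by blast
    show "disjoint_family_on (%v. cyl (v # u)) V" by (auto simp: disjoint_family_on_def cyl_def)
   qed
   also have "\<dots> = measure \<mu> (cyl u)" using shift_wm[OF False] by (simp add: wm_def)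
   finally show ?thesis by (simp add: \<mu>.emeasure_eq_measure)
  qed
 next
  interpret D: prob_space "distr \<mu> \<mu> shift_map" by (rule \<mu>.prob_space_distr[OF shm])
  show "emeasure (distr \<mu> \<mu> shift_map) X ~= \<infinity>" using D.emeasure_finite[of X] by simp
 qed (use sets\<mu> in simp_all)
 then have "\<mu> \<in> inv_measures" using sets\<mu> \<mu>.prob_space_axioms by (simp add: invariant_measures_def)
 then show ?thesis using that words outside by blast
qed

end

subsection \<open>Gibbs measures of strongly connected subgraphs\<close>

text \<open>The subgraph stays embedded in the ambient shift, so that all measures live on
  \<open>X\<close> and can be compared. The choice \<open>K = V\<close> gives the equilibrium
  states, a component with potential 0 gives a measure of maximal entropy.\<close>

locale gibbs_graph = coded_shift X V E c
 for X :: "(nat => nat) set" and V :: "'v set" and E and c +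
 fixes K :: "'v set" and EK :: "('v \<times> 'v) set" and \<psi> :: "'v => real"
 assumes G: "strongly_connected K EK" and EK: "EK \<subseteq> E"
begin

lemma KD: "finite K" "K ~= {}" "EK \<subseteq> K \<times> K"
 using strongly_connectedD[OF G] by auto

lemma KV: "K \<subseteq> V"
 using strongly_connectedD(5)[OF G] EK E_subset by blast

definition "wt = edge_weight EK \<psi>"
definition "lam = pf_val K wt"
definition "rv = pf_vec K wt"
definition "lv = pf_left K wt"

lemma irr: "irreducible K wt"
 unfolding wt_def by (rule irreducible_edge_weight[OF G])

lemma wt_edge: "(v, w) \<in> EK ==> wt v w = exp (\<psi> v)" "(v, w) \<notin> EK ==> wt v w = 0"
 by (auto simp: wt_def edge_weight_def)

lemma lam_pos: "lam > 0" unfolding lam_def by (rule pf_val_pos[OF irr])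

lemma rv_pos: "v \<in> K ==> rv v > 0" unfolding rv_def by (rule pf_vec_pos[OF irr])

lemma lv_pos: "v \<in> K ==> lv v > 0" unfolding lv_def by (rule pf_left_pos[OF irr])

lemma rv_eq: "v \<in> K ==> (\<Sum>w\<in>K. wt v w * rv w) = lam * rv v"
 unfolding rv_def lam_def by (rule pf_vec_eq[OF irr])

lemma lv_eq: "w \<in> K ==> (\<Sum>v\<in>K. lv v * wt v w) = lam * lv w"
 unfolding lv_def lam_def by (rule pf_left_eq[OF irr])

definition "tot = (\<Sum>v\<in>K. lv v * rv v)"

lemma tot_pos: "tot > 0"
 unfolding tot_def using KD by (intro sum_pos mult_pos_pos lv_pos rv_pos) auto

text \<open>Parry's construction: the right Perron eigenvector normalizes the weights to a
  stochastic matrix, whose stationary vector is the normalized product of the two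
  eigenvectors.\<close>

definition "tr v w = (if v \<in> K \<and> w \<in> K then wt v w * rv w / (lam * rv v) else 0)"

definition "st v = lv v * rv v / tot"

lemma st_pos: "v \<in> K ==> st v > 0"
 unfolding st_def using lv_pos rv_pos tot_pos by simp

lemma st_sum: "(\<Sum>v\<in>K. st v) = 1"
 using tot_pos by (simp add: st_def tot_def flip: sum_divide_distrib)

lemma tr_pos_iff: "0 < tr v w \<longleftrightarrow> (v, w) \<in> EK"
proof (cases "(v, w) \<in> EK")
 case True
 then have "v \<in> K" "w \<in> K" using KD(3) by auto
 then show ?thesis using True rv_pos lam_pos by (simp add: tr_def wt_edge)
qed (simp add: tr_def wt_edge)

lemma tr_nonneg: "0 \<le> tr v w"
proof (cases "(v, w) \<in> EK")
 case True
 then show ?thesis using tr_pos_iff[of v w] by simp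
qed (simp add: tr_def wt_edge)

lemma tr_row: "v \<in> K ==> (\<Sum>w\<in>K. tr v w) = 1"
proof -
 assume v: "v \<in> K"
 have "(\<Sum>w\<in>K. tr v w) = (\<Sum>w\<in>K. wt v w * rv w) / (lam * rv v)"
  using v by (simp add: tr_def sum_divide_distrib)
 then show ?thesis using rv_eq[OF v] rv_pos[OF v] lam_pos by simp
qed

lemma st_stationary: "w \<in> K ==> (\<Sum>v\<in>K. st v * tr v w) = st w"
proof -
 assume w: "w \<in> K"
 have "(\<Sum>v\<in>K. st v * tr v w) = (\<Sum>v\<in>K. lv v * wt v w * (rv w / (lam * tot)))"
 proof (rule sum.cong[OF refl])
  fix v assume "v \<in> K"
  then show "st v * tr v w = lv v * wt v w * (rv w / (lam * tot))"
   using w rv_pos[of v] lam_pos tot_pos by (simp add: st_def tr_def field_simps)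
 qed
 also have "\<dots> = (lam * lv w) * (rv w / (lam * tot))" by (simp only: sum_distrib_right[symmetric] lv_eq[OF w])
 finally show ?thesis using lam_pos by (simp add: st_def)
qed

lemma irr_tr: "irreducible K tr"
 by (rule irreducibleI[OF G]) (auto simp: tr_nonneg tr_pos_iff)

definition gibbs :: "(nat => nat) measure" where
 "gibbs = (SOME \<mu>. \<mu> \<in> inv_measures
  \<and> (\<forall>n. \<forall>u\<in>words K (Suc n). wm \<mu> u = st (u ! 0) * (\<Prod>i<n. tr (u ! i) (u ! Suc i)))
  \<and> (\<forall>u. \<not> set u \<subseteq> K --> wm \<mu> u = 0))"

lemma gibbs_props: "gibbs \<in> inv_measures
  \<and> (\<forall>n. \<forall>u\<in>words K (Suc n). wm gibbs u = st (u ! 0) * (\<Prod>i<n. tr (u ! i) (u ! Suc i)))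
  \<and> (\<forall>u. \<not> set u \<subseteq> K --> wm gibbs u = 0)"
 unfolding gibbs_def
proof (rule someI_ex)
 obtain \<mu> where \<mu>: "\<mu> \<in> inv_measures"
  "!!n u. u \<in> words K (Suc n) ==> wm \<mu> u = st (u ! 0) * (\<Prod>i<n. tr (u ! i) (u ! Suc i))"
  "!!u. \<not> set u \<subseteq> K ==> wm \<mu> u = 0"
 proof (rule markov_measure_exists[OF KV, of st tr])
  show "0 \<le> st v" if "v \<in> K" for v using st_pos[OF that] by simp
  show "(v, w) \<in> E" if "0 < tr v w" for v w using that EK by (auto simp: tr_pos_iff)
 qed (auto simp: st_sum tr_nonneg tr_row st_stationary)
 then show "\<exists>\<mu>. \<mu> \<in> inv_measures
  \<and> (\<forall>n. \<forall>u\<in>words K (Suc n). wm \<mu> u = st (u ! 0) * (\<Prod>i<n. tr (u ! i) (u ! Suc i)))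
  \<and> (\<forall>u. \<not> set u \<subseteq> K --> wm \<mu> u = 0)" by blast
qed

lemma gibbs_inv: "gibbs \<in> inv_measures" using gibbs_props by (rule conjunct1)

lemma gibbs_words: "u \<in> words K (Suc n) ==> wm gibbs u = st (u ! 0) * (\<Prod>i<n. tr (u ! i) (u ! Suc i))"
 using gibbs_props by simp

lemma gibbs_outside: "\<not> set u \<subseteq> K ==> wm gibbs u = 0"
 using gibbs_props by simp

lemma gibbs_single: "wm gibbs [v] = (if v \<in> K then st v else 0)"
 using gibbs_words[of "[v]" 0] gibbs_outside[of "[v]"] by (auto simp: words_def)

lemma gibbs_markov: "u ~= [] ==> wm gibbs (u @ [v]) = wm gibbs u * tr (last u) v"
proof (cases "set (u @ [v]) \<subseteq> K")
 case True
 assume "u ~= []"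
 then obtain n where n: "u \<in> words K (Suc n)" using True by (cases u) (auto simp: words_def)
 then have "u @ [v] \<in> words K (Suc (Suc n))" using True by (auto simp: words_def)
 from gibbs_words[OF this] gibbs_words[OF n] n show ?thesis
  by (simp add: words_def nth_append last_conv_nth[OF \<open>u ~= []\<close>] \<open>u ~= []\<close>)
next
 case False
 then have "wm gibbs u = 0 \<or> tr (last u) v = 0"
  using gibbs_outside[of u] by (auto simp: tr_def)
 then show ?thesis using gibbs_outside[OF False] by auto
qed

lemma gibbs_pair: "wm gibbs [v, w] = (if v \<in> K then st v * tr v w else 0)"
 using gibbs_markov[of "[v]" w] by (simp add: gibbs_single)

definition "supported \<nu> \<longleftrightarrow> (\<forall>v w. 0 < wm \<nu> [v, w] --> (v, w) \<in> EK)"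

lemma gibbs_supported: "supported gibbs"
proof -
 have "(v, w) \<in> EK" if "0 < wm gibbs [v, w]" for v w
  using that tr_pos_iff[of v w] st_pos[of v] tr_nonneg[of v w]
  by (auto simp: gibbs_pair zero_less_mult_iff split: if_splits)
 then show ?thesis by (simp add: supported_def)
qed

lemma wm_pair_pos: "wm \<nu> [v, w] ~= 0 ==> 0 < wm \<nu> [v, w]"
 using wm_nonneg[of \<nu> "[v, w]"] by linarith

text \<open>The logarithm of \<open>tr v w\<close> is \<open>\<psi> v - ln lam\<close> plus a
  coboundary of \<open>ln rv\<close>, and the coboundary integrates to 0.\<close>

lemma cross_entropy_eq:
 assumes \<nu>: "\<nu> \<in> inv_measures" "supported \<nu>"
 shows "gen_system.cross_entropy \<nu> shift_map c tr = ln lam - (\<Sum>v\<in>V. wm \<nu> [v] * \<psi> v)"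
proof -
 interpret gen_system \<nu> shift_map c by (rule gen_system[OF \<nu>(1)])
 let ?p = "%v w. wm \<nu> [v, w]"
 have "cross_entropy tr = (\<Sum>v\<in>V. \<Sum>w\<in>V. ?p v w * - ln (tr v w))"
  by (simp add: cross_entropy_def prw_eq_wm[OF \<nu>(1)] alphabet_eq[OF \<nu>(1)])
 also have "\<dots> = (\<Sum>v\<in>V. \<Sum>w\<in>V. ?p v w * ln lam - ?p v w * \<psi> v + (?p v w * ln (rv v) - ?p v w * ln (rv w)))"
 proof (intro sum.cong refl)
  fix v w
  show "?p v w * - ln (tr v w) = ?p v w * ln lam - ?p v w * \<psi> v + (?p v w * ln (rv v) - ?p v w * ln (rv w))"
  proof (cases "?p v w = 0")
   case False
   then have vw: "(v, w) \<in> EK" using \<nu>(2) wm_pair_pos by (simp add: supported_def)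
   then have K: "v \<in> K" "w \<in> K" using KD(3) by auto
   have "ln (tr v w) = \<psi> v + ln (rv w) - (ln lam + ln (rv v))"
    using K vw rv_pos[OF K(1)] rv_pos[OF K(2)] lam_pos by (simp add: tr_def wt_edge ln_div ln_mult_pos)
   then show ?thesis by (simp only:) (simp add: algebra_simps)
  qed simp
 qed
 also have "\<dots> = ln lam * (\<Sum>v\<in>V. \<Sum>w\<in>V. ?p v w) - (\<Sum>v\<in>V. \<Sum>w\<in>V. ?p v w * \<psi> v)
   + ((\<Sum>v\<in>V. \<Sum>w\<in>V. ?p v w * ln (rv v)) - (\<Sum>v\<in>V. \<Sum>w\<in>V. ?p v w * ln (rv w)))"
  by (simp add: sum.distrib sum_subtractf sum_distrib_left mult.commute[of "ln lam"])
 also have "(\<Sum>v\<in>V. \<Sum>w\<in>V. ?p v w * ln (rv v)) = (\<Sum>v\<in>V. \<Sum>w\<in>V. ?p v w * ln (rv w))"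
  by (rule circulation_coboundary[OF finite_V circulation_measure[OF \<nu>(1)]])
 also have "(\<Sum>v\<in>V. \<Sum>w\<in>V. ?p v w) = 1"
  using circulationD(4)[OF circulation_measure[OF \<nu>(1)]] .
 also have "(\<Sum>v\<in>V. \<Sum>w\<in>V. ?p v w * \<psi> v) = (\<Sum>v\<in>V. wm \<nu> [v] * \<psi> v)"
  using wm_single[OF \<nu>(1)] by (simp add: sum_distrib_right)
 finally show ?thesis by simp
qed

lemma tr_conditions:
 assumes \<nu>: "\<nu> \<in> inv_measures" "supported \<nu>"
 shows "v \<in> V ==> (\<Sum>w\<in>V. tr v w) \<le> 1" "0 < wm \<nu> [v, w] ==> 0 < tr v w"
proof -
 have "(\<Sum>w\<in>V. tr v w) = (\<Sum>w\<in>K. tr v w)"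
  by (rule sum.mono_neutral_right[OF finite_V KV]) (auto simp: tr_def)
 moreover have "(\<Sum>w\<in>K. tr v w) \<le> 1" using tr_row[of v] by (cases "v \<in> K") (simp_all add: tr_def)
 ultimately show "(\<Sum>w\<in>V. tr v w) \<le> 1" by simp
 show "0 < tr v w" if "0 < wm \<nu> [v, w]" using \<nu>(2) that by (simp add: supported_def tr_pos_iff)
qed

lemma variational_le:
 assumes \<nu>: "\<nu> \<in> inv_measures" "supported \<nu>"
 shows "measure_entropy shift_map \<nu> \<le> ereal (ln lam - (\<Sum>v\<in>V. wm \<nu> [v] * \<psi> v))"
proof -
 interpret gen_system \<nu> shift_map c by (rule gen_system[OF \<nu>(1)])
 have "measure_entropy shift_map \<nu> \<le> ereal (cross_entropy tr)"
  by (rule measure_entropy_le_cross)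
   (use tr_conditions[OF \<nu>] tr_nonneg in \<open>auto simp: prw_eq_wm[OF \<nu>(1)] alphabet_eq[OF \<nu>(1)]\<close>)
 then show ?thesis by (simp add: cross_entropy_eq[OF \<nu>])
qed

lemma variational_gibbs:
 "measure_entropy shift_map gibbs = ereal (ln lam - (\<Sum>v\<in>V. wm gibbs [v] * \<psi> v))"
proof (rule antisym)
 show "measure_entropy shift_map gibbs \<le> ereal (ln lam - (\<Sum>v\<in>V. wm gibbs [v] * \<psi> v))"
  by (rule variational_le[OF gibbs_inv gibbs_supported])
 interpret gen_system gibbs shift_map c by (rule gen_system[OF gibbs_inv])
 have "ereal (cross_entropy tr) \<le> measure_entropy shift_map gibbs"
 proof (rule measure_entropy_markov_ge)
  fix n u v assume "u \<in> words alphabet (Suc n)"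
  then have "u ~= []" by (auto simp: words_def)
  from gibbs_markov[OF this] show "prw (u @ [v]) = prw u * tr (last u) v"
   by (simp add: prw_eq_wm[OF gibbs_inv])
 qed
 then show "ereal (ln lam - (\<Sum>v\<in>V. wm gibbs [v] * \<psi> v)) \<le> measure_entropy shift_map gibbs"
  by (simp add: cross_entropy_eq[OF gibbs_inv gibbs_supported])
qed

lemma stationary_unique:
 assumes x: "!!w. w \<in> K ==> (\<Sum>v\<in>K. x v * tr v w) = x w"
 shows "v \<in> K ==> x v = (\<Sum>v\<in>K. x v) * st v"
proof -
 obtain d where d: "!!v. v \<in> K ==> x v = d * st v"
  by (rule left_eigen_unique[OF irr_tr, of 1 st x]) (use st_pos st_stationary x in auto)
 have "(\<Sum>v\<in>K. x v) = d" using d st_sum by (simp flip: sum_distrib_left)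
 then show "v \<in> K ==> x v = (\<Sum>v\<in>K. x v) * st v" using d by simp
qed

text \<open>Equality makes \<nu> a Markov measure with transition matrix \<open>tr\<close>, and an
  irreducible matrix has only one stationary distribution.\<close>

lemma variational_unique:
 assumes \<nu>: "\<nu> \<in> inv_measures" "supported \<nu>"
  and ge: "ereal (ln lam - (\<Sum>v\<in>V. wm \<nu> [v] * \<psi> v)) \<le> measure_entropy shift_map \<nu>"
 shows "\<nu> = gibbs"
proof -
 interpret gen_system \<nu> shift_map c by (rule gen_system[OF \<nu>(1)])
 have markov: "wm \<nu> (u @ [v]) = wm \<nu> u * tr (last u) v" if u: "u \<in> words V (Suc n)" "v \<in> V" for n u v
 proof -
  have "prw (u @ [v]) = prw u * tr (last u) v"
   by (rule markov_if_entropy_eq[of tr u n v])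
    (use tr_conditions[OF \<nu>] tr_nonneg ge u in
     \<open>auto simp: prw_eq_wm[OF \<nu>(1)] alphabet_eq[OF \<nu>(1)] cross_entropy_eq[OF \<nu>]\<close>)
  then show ?thesis by (simp add: prw_eq_wm[OF \<nu>(1)])
 qed
 have pair: "wm \<nu> [v, w] = wm \<nu> [v] * tr v w" if "v \<in> V" "w \<in> V" for v w
  using markov[of "[v]" 0 w] that by (simp add: words_def)
 have out: "wm \<nu> [v] = 0" if "v \<notin> K" for v
 proof (cases "v \<in> V")
  case True
  then show ?thesis using wm_single[OF \<nu>(1), of v] pair[OF True] that by (simp add: tr_def)
 next
  case False
  then show ?thesis using wm_outside[OF \<nu>(1), of "[v]"] by (simp add: words_def)
 qed
 have sumK: "(\<Sum>v\<in>K. f v) = (\<Sum>v\<in>V. f v)" if "!!v. v \<notin> K ==> f v = 0" for f :: "'v => real"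
  using that by (intro sum.mono_neutral_left[OF finite_V KV]) auto
 have "(\<Sum>v\<in>K. wm \<nu> [v] * tr v w) = wm \<nu> [w]" if w: "w \<in> K" for w
 proof -
  have "(\<Sum>v\<in>K. wm \<nu> [v] * tr v w) = (\<Sum>v\<in>V. wm \<nu> [v] * tr v w)" by (rule sumK) (simp add: out)
  also have "\<dots> = (\<Sum>v\<in>V. wm \<nu> [v, w])" using w KV pair by (intro sum.cong) auto
  also have "\<dots> = wm \<nu> [w]" using wm_single_in[OF \<nu>(1), of w] w KV by auto
  finally show ?thesis .
 qed
 then have "wm \<nu> [v] = (\<Sum>v\<in>K. wm \<nu> [v]) * st v" if "v \<in> K" for v
  by (rule stationary_unique[where x = "%v. wm \<nu> [v]"]) (use that in auto)
 moreover have "(\<Sum>v\<in>K. wm \<nu> [v]) = 1" using sumK[of "%v. wm \<nu> [v]"] out wm_total[OF \<nu>(1)] by simp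
 ultimately have single: "wm \<nu> [v] = wm gibbs [v]" for v using out[of v] by (auto simp: gibbs_single)
 have "wm \<nu> u = wm gibbs u" if "u ~= []" for u
 proof (cases "set u \<subseteq> V")
  case True
  then show ?thesis using that
  proof (induction u rule: rev_induct)
   case (snoc v u)
   show ?case
   proof (cases "u = []")
    case True
    then show ?thesis using single by simp
   next
    case False
    then obtain n where n: "u \<in> words V (Suc n)" using snoc.prems by (cases u) (auto simp: words_def)
    then show ?thesis using markov[OF n] gibbs_markov[OF False] snoc False by simp
   qed
  qed simp
 next
  case False
  then show ?thesis using wm_outside[OF \<nu>(1), of u] wm_outside[OF gibbs_inv, of u] by (simp add: words_def)
 qed
 then show ?thesis using inv_measure_eqI[OF \<nu>(1) gibbs_inv] by blast
qed

end

section \<open>Ergodicity of the Gibbs measures\<close>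

lemma itinerary_append: "itinerary T f (m + n) x = itinerary T f m x @ itinerary T f n ((T ^^ m) x)"
 using append_take_drop_id[of m "itinerary T f (m + n) x"] by (simp add: take_itinerary drop_itinerary)

context coded_shift
begin

lemma cyl_append: "cyl (u @ w) = cyl u \<inter> (shift_map ^^ length u) -` cyl w"
 unfolding cyl_def using funpow_X by (auto simp: itinerary_append)

lemma cyl_Int_Cons: "cyl [v] \<inter> cyl (a # w) = (if a = v then cyl (a # w) else {})"
 using cyl_append[of "[a]" w] by (auto simp: cyl_def)

lemma funpow_measurable: "sets M = borel_sets ==> shift_map ^^ n \<in> measurable M M"
 using measurable_compose_n[of shift_map M n] shift_measurable
 by (simp cong: measurable_cong_sets)

end

context gibbs_graph
begin

text \<open>The Markov property for an arbitrary measurable future: both sides are finite measures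
  of \<open>D\<close> that agree on cylinders. The shift by \<open>length u - 1\<close> keeps the
  last letter of \<open>u\<close> as the first letter of the future, and multiplying out avoids
  conditioning on null sets.\<close>

lemma gibbs_shift_independent:
 assumes u: "u ~= []" and D: "D \<in> sets gibbs"
 shows "wm gibbs [last u] * measure gibbs (cyl u \<inter> (shift_map ^^ (length u - 1)) -` D)
  = wm gibbs u * measure gibbs (cyl [last u] \<inter> D)"
proof -
 note I = invD[OF gibbs_inv]
 interpret prob_space gibbs by (rule I(2))
 define v T where "v = last u" and "T = shift_map ^^ (length u - 1)"
 have cs: "cyl w \<in> sets gibbs" for w using sets_cyl I(1) by simp
 have Tm: "T \<in> measurable gibbs gibbs" unfolding T_def by (rule funpow_measurable[OF I(1)])
 have uv: "u = butlast u @ [v]" using u by (simp add: v_def)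
 have cu: "cyl u \<inter> T -` cyl w = cyl (butlast u) \<inter> T -` (cyl [v] \<inter> cyl w)" for w
  using cyl_append[of "butlast u" "[v]"] uv by (auto simp: T_def)
 have app: "wm gibbs (u @ w) * wm gibbs [v] = wm gibbs u * wm gibbs (v # w)" for w
 proof (induction w rule: rev_induct)
  case (snoc a w)
  have "last (u @ w) = last (v # w)" using u by (simp add: v_def)
  then show ?case
   using gibbs_markov[of "u @ w" a] gibbs_markov[of "v # w" a] snoc u by simp
 qed simp
 define N1 N2 where "N1 = scale_measure (ennreal (wm gibbs [v])) (distr (density gibbs (indicator (cyl u))) gibbs T)"
  and "N2 = scale_measure (ennreal (wm gibbs u)) (density gibbs (indicator (cyl [v])))"
 have N1: "emeasure N1 B = ennreal (wm gibbs [v] * measure gibbs (cyl u \<inter> T -` B))" if "B \<in> sets gibbs" for B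
 proof -
  have "T -` B \<inter> X \<in> sets gibbs" using measurable_sets[OF Tm that] by (simp add: I(4))
  moreover have "cyl u \<inter> (T -` B \<inter> X) = cyl u \<inter> T -` B" by (auto simp: cyl_def)
  ultimately show ?thesis
   using that Tm unfolding N1_def
   by (simp add: emeasure_distr emeasure_restricted cs I(4) emeasure_eq_measure ennreal_mult)
 qed
 have N2: "emeasure N2 B = ennreal (wm gibbs u * measure gibbs (cyl [v] \<inter> B))" if "B \<in> sets gibbs" for B
  using that unfolding N2_def by (simp add: emeasure_restricted cs emeasure_eq_measure ennreal_mult)
 have "N1 = N2"
 proof (rule measure_eq_cyl)
  show "sets N1 = borel_sets" "sets N2 = borel_sets"
   by (simp_all add: N1_def N2_def I(1))
  show "emeasure N1 X ~= \<infinity>" using N1[of X] cs[of "[]"] by (simp add: cyl_Nil)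
  fix w
  have "wm gibbs [v] * measure gibbs (cyl u \<inter> T -` cyl w) = wm gibbs u * measure gibbs (cyl [v] \<inter> cyl w)"
  proof (cases w)
   case Nil
   then have "cyl u \<inter> T -` cyl w = cyl u" "cyl [v] \<inter> cyl w = cyl [v]"
    using funpow_X by (auto simp: cyl_def T_def)
   then show ?thesis by (simp add: wm_def)
  next
   case (Cons a w')
   show ?thesis
   proof (cases "a = v")
    case True
    have "cyl u \<inter> T -` cyl w = cyl (butlast u @ w)"
     unfolding cu Cons cyl_Int_Cons using True cyl_append[of "butlast u" w] Cons by (simp add: T_def)
    also have "butlast u @ w = u @ w'" using True Cons uv by (metis append.assoc append_Cons append_Nil)
    finally have "cyl u \<inter> T -` cyl w = cyl (u @ w')" .
    moreover have "cyl [v] \<inter> cyl w = cyl (v # w')" using True Cons cyl_Int_Cons by simp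
    ultimately show ?thesis using app[of w'] by (simp add: wm_def mult.commute)
   next
    case False
    then show ?thesis unfolding cu Cons cyl_Int_Cons by simp
   qed
  qed
  then show "emeasure N1 (cyl w) = emeasure N2 (cyl w)" using N1 N2 cs by simp
 qed
 then have "ennreal (wm gibbs [v] * measure gibbs (cyl u \<inter> T -` D)) = ennreal (wm gibbs u * measure gibbs (cyl [v] \<inter> D))"
  using N1[OF D] N2[OF D] by simp
 then show ?thesis by (simp add: v_def T_def)
qed

text \<open>For an invariant set, the conditional probabilities given the first letter form a harmonic
 function of the transition matrix, hence are constant.\<close>
lemma gibbs_ergodic: "ergodic_measure X gibbs"
proof -
 note I = invD[OF gibbs_inv]
 interpret prob_space gibbs by (rule I(2))
 have cs: "cyl w \<in> sets gibbs" for w using sets_cyl I(1) by simp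
 have "measure gibbs B = 0 \<or> measure gibbs B = 1" if B: "B \<in> sets gibbs" "shift_map -` B \<inter> X = B" for B
 proof -
  have inv: "(shift_map ^^ n) -` B \<inter> X = B" for n
  proof (induction n)
   case 0
   then show ?case using sets.sets_into_space[OF B(1)] by (auto simp: I(4))
  next
   case (Suc n)
   have "(shift_map ^^ Suc n) -` B \<inter> X = (shift_map ^^ n) -` (shift_map -` B \<inter> X) \<inter> X"
    using funpow_X by auto
   also have "\<dots> = B" unfolding B(2) by (rule Suc)
   finally show ?case .
  qed
  have cylB: "cyl u \<inter> (shift_map ^^ n) -` B = cyl u \<inter> B" for u n
   using inv[of n] by (auto simp: cyl_def)
  define g where "g u = measure gibbs (cyl u \<inter> B)" for u
  have g: "wm gibbs [last u] * g u = wm gibbs u * g [last u]" if "u ~= []" for u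
   using gibbs_shift_independent[OF that B(1)] unfolding cylB g_def .
  have st0: "st v ~= 0" if "v \<in> K" for v using st_pos[OF that] by simp
  have out: "g u = 0" if "\<not> set u \<subseteq> K" for u
  proof -
   have "g u \<le> wm gibbs u" unfolding g_def wm_def by (rule finite_measure_mono) (use cs in auto)
   then show ?thesis using gibbs_outside[OF that] by (simp add: g_def measure_le_0_iff)
  qed
  have split: "g [v] = (\<Sum>w\<in>V. g [v, w])" for v
  proof -
   have eq: "cyl [v] \<inter> B = (\<Union>w\<in>V. cyl [v, w] \<inter> B)"
   proof -
    have "cyl [v] = (\<Union>w\<in>V. cyl [v, w])"
     using shift_X c_image by (auto simp: cyl_def itinerary_def)
    then show ?thesis by auto
   qed
   show ?thesis unfolding g_def eq
   proof (rule finite_measure_finite_Union[OF finite_V])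
    show "(%w. cyl [v, w] \<inter> B) ` V \<subseteq> sets gibbs" using cs B(1) by blast
    show "disjoint_family_on (%w. cyl [v, w] \<inter> B) V" by (auto simp: disjoint_family_on_def cyl_def)
   qed
  qed
  define f where "f v = g [v] / st v" for v
  have harm: "(\<Sum>w\<in>K. f w * tr v w) = f v" if v: "v \<in> K" for v
  proof -
   have "g [v] = (\<Sum>w\<in>K. g [v, w])"
    unfolding split by (rule sum.mono_neutral_right[OF finite_V KV]) (use out in auto)
   also have "\<dots> = (\<Sum>w\<in>K. st v * (f w * tr v w))"
   proof (rule sum.cong[OF refl])
    fix w assume w: "w \<in> K"
    have "st w * g [v, w] = st v * tr v w * g [w]"
     using g[of "[v, w]"] v w by (simp add: gibbs_single gibbs_pair)
    then show "g [v, w] = st v * (f w * tr v w)"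
     using st0[OF w] by (simp add: f_def field_simps)
   qed
   finally have "g [v] = st v * (\<Sum>w\<in>K. f w * tr v w)" by (simp only: sum_distrib_left)
   then show ?thesis using st0[OF v] by (simp add: f_def)
  qed
  obtain d where d: "!!v. v \<in> K ==> f v = d"
   by (rule left_eigen_unique[OF irreducible_transpose[OF irr_tr], of 1 "%_. 1" f])
    (use harm tr_row in \<open>simp_all\<close>)
  have gd: "g u = d * wm gibbs u" if u: "u ~= []" for u
  proof (cases "set u \<subseteq> K")
   case True
   then have l: "last u \<in> K" using u by (meson last_in_set subsetD)
   have "st (last u) * g u = wm gibbs u * g [last u]" using g[OF u] l by (simp add: gibbs_single)
   moreover have "g [last u] = d * st (last u)" using d[OF l] st0[OF l] by (simp add: f_def field_simps)
   ultimately show ?thesis using st0[OF l] by simp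
  qed (use out gibbs_outside in simp)
  have tot: "measure gibbs B = d"
  proof -
   have eq: "B = (\<Union>v\<in>V. cyl [v] \<inter> B)"
    using sets.sets_into_space[OF B(1)] c_image by (auto simp: cyl_def itinerary_def I(4))
   have "measure gibbs B = measure gibbs (\<Union>v\<in>V. cyl [v] \<inter> B)" using eq by simp
   also have "\<dots> = (\<Sum>v\<in>V. g [v])" unfolding g_def
   proof (rule finite_measure_finite_Union[OF finite_V])
    show "(%v. cyl [v] \<inter> B) ` V \<subseteq> sets gibbs" using cs B(1) by blast
    show "disjoint_family_on (%v. cyl [v] \<inter> B) V" by (auto simp: disjoint_family_on_def cyl_def)
   qed
   also have "\<dots> = d" using gd wm_total[OF gibbs_inv] by (simp flip: sum_distrib_left)
   finally show ?thesis .
  qed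
  have d0: "d \<ge> 0" using tot measure_nonneg[of gibbs B] by simp
  \<comment> \<open>The restriction of the measure to \<open>B\<close> agrees with \<open>d\<close>
    times the measure on all cylinders; evaluated at \<open>B\<close> itself this reads
    \<open>d = d * d\<close>.\<close>
  have "density gibbs (indicator B) = scale_measure (ennreal d) gibbs"
  proof (rule measure_eq_cyl)
   show "emeasure (density gibbs (indicator B)) X ~= \<infinity>"
    using B(1) cs[of "[]"] by (simp add: emeasure_restricted cyl_Nil emeasure_eq_measure)
   fix u
   have "measure gibbs (B \<inter> cyl u) = d * wm gibbs u"
   proof (cases "u = []")
    case True
    then have "B \<inter> cyl u = B" using sets.sets_into_space[OF B(1)] by (auto simp: cyl_Nil I(4))
    then show ?thesis using tot True prob_space by (simp add: wm_def cyl_Nil I(4))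
   qed (use gd in \<open>simp add: g_def Int_commute\<close>)
   then show "emeasure (density gibbs (indicator B)) (cyl u) = emeasure (scale_measure (ennreal d) gibbs) (cyl u)"
    using B(1) cs d0 by (simp add: emeasure_restricted emeasure_eq_measure wm_def ennreal_mult)
  qed (simp_all add: I(1))
  then have "emeasure (density gibbs (indicator B)) B = emeasure (scale_measure (ennreal d) gibbs) B" by simp
  then have "ennreal d = ennreal (d * d)"
   using B(1) d0 by (simp add: emeasure_restricted emeasure_eq_measure tot ennreal_mult)
  then have "d = d * d" using d0 by simp
  then show ?thesis using tot by simp
 qed
 then show ?thesis using gibbs_inv unfolding ergodic_measure_def by blast
qed

end

subsection \<open>Topological entropy\<close>

lemma min_subcover_le:
 "V \<subseteq> U ==> finite V ==> S \<subseteq> \<Union>V ==> min_subcover_card S U \<le> card V"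
 unfolding min_subcover_card_def by (rule Least_le) blast

lemma min_subcover_obtain:
 assumes "\<exists>V\<subseteq>U. finite V \<and> S \<subseteq> \<Union>V"
 obtains V where "V \<subseteq> U" "finite V" "S \<subseteq> \<Union>V" "card V = min_subcover_card S U"
proof -
 have "\<exists>n. \<exists>V\<subseteq>U. finite V \<and> card V = n \<and> S \<subseteq> \<Union>V" using assms by blast
 from LeastI_ex[OF this] show ?thesis using that unfolding min_subcover_card_def by blast
qed

lemma iterated_join_Int:
 assumes T: "!!x. x \<in> S ==> T x \<in> S" and A: "A \<in> iterated_join T S U m" and B: "B \<in> iterated_join T S U n"
 shows "A \<inter> (T ^^ m) -` B \<in> iterated_join T S U (m + n)"
proof -
 obtain P Q where P: "A = {x \<in> S. \<forall>i<m. (T ^^ i) x \<in> P i}" "P \<in> {..<m} \<rightarrow> U"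
  and Q: "B = {x \<in> S. \<forall>i<n. (T ^^ i) x \<in> Q i}" "Q \<in> {..<n} \<rightarrow> U"
  using A B unfolding iterated_join_def by blast
 define R where "R i = (if i < m then P i else Q (i - m))" for i
 have S: "(T ^^ i) x \<in> S" if "x \<in> S" for i x using that by (induction i) (auto simp: T)
 have f: "(T ^^ i) ((T ^^ m) x) = (T ^^ (i + m)) x" for i x by (simp add: funpow_add)
 have "A \<inter> (T ^^ m) -` B = {x \<in> S. \<forall>i<m+n. (T ^^ i) x \<in> R i}"
 proof (intro equalityI subsetI)
  fix x assume x: "x \<in> A \<inter> (T ^^ m) -` B"
  have "(T ^^ i) x \<in> R i" if "i < m + n" for i
  proof (cases "i < m")
   case False
   then have "(T ^^ (i - m)) ((T ^^ m) x) \<in> Q (i - m)" using x that by (auto simp: Q)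
   then show ?thesis using False by (simp add: R_def f)
  qed (use x in \<open>auto simp: R_def P\<close>)
  then show "x \<in> {x \<in> S. \<forall>i<m+n. (T ^^ i) x \<in> R i}" using x by (auto simp: P)
 next
  fix x assume x: "x \<in> {x \<in> S. \<forall>i<m+n. (T ^^ i) x \<in> R i}"
  have "(T ^^ i) x \<in> P i" if "i < m" for i
   using x that by (auto simp: R_def dest!: spec[of _ i])
  moreover have "(T ^^ i) ((T ^^ m) x) \<in> Q i" if "i < n" for i
   using x that unfolding f by (auto simp: R_def dest!: spec[of _ "i + m"])
  ultimately show "x \<in> A \<inter> (T ^^ m) -` B" using x S by (auto simp: P Q)
 qed
 moreover have "R \<in> {..<m+n} \<rightarrow> U" using P(2) Q(2) by (auto simp: R_def Pi_iff)
 ultimately show ?thesis unfolding iterated_join_def by blast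
qed

lemma min_subcover_mult:
 assumes T: "!!x. x \<in> S ==> T x \<in> S"
  and ex: "!!n. \<exists>V\<subseteq>iterated_join T S U n. finite V \<and> S \<subseteq> \<Union>V"
 shows "min_subcover_card S (iterated_join T S U (m + n))
  \<le> min_subcover_card S (iterated_join T S U m) * min_subcover_card S (iterated_join T S U n)"
proof -
 have S: "(T ^^ i) x \<in> S" if "x \<in> S" for i x using that by (induction i) (auto simp: T)
 obtain V where V: "V \<subseteq> iterated_join T S U m" "finite V" "S \<subseteq> \<Union>V"
  "card V = min_subcover_card S (iterated_join T S U m)" by (rule min_subcover_obtain[OF ex])
 obtain W where W: "W \<subseteq> iterated_join T S U n" "finite W" "S \<subseteq> \<Union>W"
  "card W = min_subcover_card S (iterated_join T S U n)" by (rule min_subcover_obtain[OF ex])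
 let ?f = "%(A, B). A \<inter> (T ^^ m) -` B"
 have "min_subcover_card S (iterated_join T S U (m + n)) \<le> card (?f ` (V \<times> W))"
 proof (rule min_subcover_le)
  show "?f ` (V \<times> W) \<subseteq> iterated_join T S U (m + n)"
   using V(1) W(1) by (auto intro!: iterated_join_Int[of S T, OF T])
  show "S \<subseteq> \<Union> (?f ` (V \<times> W))"
  proof
   fix x assume x: "x \<in> S"
   then obtain A B where "A \<in> V" "x \<in> A" "B \<in> W" "(T ^^ m) x \<in> B" using V(3) W(3) S by blast
   then show "x \<in> \<Union> (?f ` (V \<times> W))" by auto
  qed
 qed (use V W in auto)
 also have "\<dots> \<le> card (V \<times> W)" by (rule card_image_le) (use V W in auto)
 finally show ?thesis using V W by (simp add: card_cartesian_product)
qed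

context coded_shift
begin

definition "realized n = {u \<in> words V n. cyl u ~= {}}"

lemma finite_realized: "finite (realized n)"
 unfolding realized_def using finite_words[OF finite_V] by simp

lemma itin_realized: "x \<in> X ==> itin n x \<in> realized n"
 unfolding realized_def using itin_words by (auto simp: cyl_def)

text \<open>A word of length \<open>n + n0\<close> determines, at each time below \<open>n\<close>,
  a member of the cover that contains the orbit point.\<close>

lemma join_subcover:
 assumes n0: "!!x. x \<in> X ==> \<exists>B\<in>U. cyl (itin n0 x) \<subseteq> B"
 obtains W where "W \<subseteq> iterated_join shift_map X U n" "finite W" "X \<subseteq> \<Union>W" "card W \<le> card (realized (n + n0))"
proof -
 obtain B where B: "!!x. x \<in> X ==> B (itin n0 x) \<in> U \<and> cyl (itin n0 x) \<subseteq> B (itin n0 x)"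
 proof -
  define B where "B u = (SOME B. B \<in> U \<and> cyl u \<subseteq> B)" for u
  have "B (itin n0 x) \<in> U \<and> cyl (itin n0 x) \<subseteq> B (itin n0 x)" if "x \<in> X" for x
   unfolding B_def by (rule someI_ex) (use n0[OF that] in blast)
  then show ?thesis by (rule that)
 qed
 define F where "F u = {x \<in> X. \<forall>i<n. (shift_map ^^ i) x \<in> B (take n0 (drop i u))}" for u
 have window: "take n0 (drop i (itin (n + n0) x)) = itin n0 ((shift_map ^^ i) x)" if "i < n" for i x
  by (rule window_itinerary) (use that in simp)
 show ?thesis
 proof (rule that[of "F ` realized (n + n0)"])
  show "F ` realized (n + n0) \<subseteq> iterated_join shift_map X U n"
  proof
   fix S assume "S \<in> F ` realized (n + n0)"
   then obtain x where x: "x \<in> X" "S = F (itin (n + n0) x)"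
    by (auto simp: realized_def cyl_def words_def)
   define Q where "Q i = B (take n0 (drop i (itin (n + n0) x)))" for i
   have "Q \<in> {..<n} \<rightarrow> U" using B[OF funpow_X[OF x(1)]] by (simp add: Pi_iff Q_def window)
   moreover have "S = {x \<in> X. \<forall>i<n. (shift_map ^^ i) x \<in> Q i}" by (simp add: x(2) F_def Q_def)
   ultimately show "S \<in> iterated_join shift_map X U n" unfolding iterated_join_def by blast
  qed
  show "X \<subseteq> \<Union> (F ` realized (n + n0))"
  proof
   fix x assume x: "x \<in> X"
   have "(shift_map ^^ i) x \<in> B (itin n0 ((shift_map ^^ i) x))" for i
   proof -
    have X: "(shift_map ^^ i) x \<in> X" by (rule funpow_X[OF x])
    then have "(shift_map ^^ i) x \<in> cyl (itin n0 ((shift_map ^^ i) x))" by (simp add: cyl_def)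
    then show ?thesis using B[OF X] by blast
   qed
   then have "x \<in> F (itin (n + n0) x)" using x by (simp add: F_def window)
   then show "x \<in> \<Union> (F ` realized (n + n0))" using itin_realized[OF x] by blast
  qed
  show "card (F ` realized (n + n0)) \<le> card (realized (n + n0))"
   by (rule card_image_le[OF finite_realized])
 qed (simp add: finite_realized)
qed

text \<open>For the cover by cylinders of length 1, members of the join that contain a point are
  cylinders. These are disjoint, so a subcover must contain every nonempty one.\<close>

lemma join_vertex_cover:
 assumes W: "W \<subseteq> iterated_join shift_map X ((%v. cyl [v]) ` V) n" "finite W" "X \<subseteq> \<Union>W"
 shows "card (realized n) \<le> card W"
proof -
 have *: "\<exists>A\<in>W. A = cyl u" if u: "u \<in> realized n" for u
 proof -
  obtain x where x: "x \<in> X" "itin n x = u" using u by (auto simp: realized_def cyl_def words_def)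
  then obtain A where A: "A \<in> W" "x \<in> A" using W(3) by blast
  obtain Q where Q: "A = {x \<in> X. \<forall>i<n. (shift_map ^^ i) x \<in> Q i}" "Q \<in> {..<n} \<rightarrow> (%v. cyl [v]) ` V"
   using W(1) A(1) unfolding iterated_join_def by blast
  have Qi: "Q i = cyl [c ((shift_map ^^ i) x)]" if "i < n" for i
  proof -
   have "Q i \<in> (%v. cyl [v]) ` V" using Q(2) that by (simp add: Pi_iff)
   then obtain v where v: "Q i = cyl [v]" by blast
   have "(shift_map ^^ i) x \<in> Q i" using A(2) that Q(1) by simp
   then show ?thesis unfolding v by (simp add: cyl_def itinerary_def)
  qed
  have "y \<in> A \<longleftrightarrow> y \<in> cyl u" for y
  proof -
   have "y \<in> A \<longleftrightarrow> y \<in> X \<and> (\<forall>i<n. c ((shift_map ^^ i) y) = c ((shift_map ^^ i) x))"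
    by (simp add: Q(1) Qi cyl_def itinerary_def funpow_X cong: conj_cong)
   also have "\<dots> \<longleftrightarrow> y \<in> X \<and> itin n y = itin n x" by (simp add: itinerary_def atLeast0LessThan Ball_def)
   also have "\<dots> \<longleftrightarrow> y \<in> cyl u" using x(2) u by (simp add: cyl_def realized_def words_def)
   finally show ?thesis .
  qed
  then show ?thesis using A(1) by blast
 qed
 have "cyl ` realized n \<subseteq> W" using * by blast
 then have "card (cyl ` realized n) \<le> card W" by (rule card_mono[OF W(2)])
 moreover have "inj_on cyl (realized n)"
 proof (rule inj_onI)
  fix u w assume u: "u \<in> realized n" and w: "w \<in> realized n" and eq: "cyl u = cyl w"
  obtain x where "x \<in> cyl u" using u by (auto simp: realized_def)
  then show "u = w" using eq u w by (auto simp: cyl_def realized_def words_def)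
 qed
 ultimately show ?thesis by (simp add: card_image)
qed

text \<open>For every cover the words lengthened by a constant give an upper bound, and the constant
  disappears in the rate; the cover by cylinders of length 1 attains it. A word of length
  \<open>Suc n\<close> has \<open>n\<close> transitions, whence the exponent.\<close>

lemma top_entropy_eq:
 assumes r: "r > 0" and C: "C > 0" "D > 0"
  and le: "!!n. C * real (card (realized (Suc n))) \<le> r ^ n"
  and ge: "!!n. r ^ n \<le> D * real (card (realized (Suc n)))"
 shows "top_entropy shift_map X = ereal (ln r)"
proof -
 define N where "N U n = min_subcover_card X (iterated_join shift_map X U n)" for U n
 define cov where "cov U \<longleftrightarrow> (\<forall>B\<in>U. openin (top_of_set X) B) \<and> X \<subseteq> \<Union>U" for U
 have up: "\<exists>n0. \<forall>n. N U n \<le> card (realized (n + n0))" and ex: "\<exists>V\<subseteq>iterated_join shift_map X U n. finite V \<and> X \<subseteq> \<Union>V"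
  if U: "cov U" for U n
 proof -
  obtain n0 where n0: "!!x. x \<in> X ==> \<exists>B\<in>U. cyl (itin n0 x) \<subseteq> B"
   by (rule lebesgue_cyl[of U]) (use U in \<open>auto simp: cov_def\<close>)
  have *: "\<exists>V\<subseteq>iterated_join shift_map X U n. finite V \<and> X \<subseteq> \<Union>V \<and> card V \<le> card (realized (n + n0))" for n
  proof -
   obtain W where "W \<subseteq> iterated_join shift_map X U n" "finite W" "X \<subseteq> \<Union>W" "card W \<le> card (realized (n + n0))"
    by (rule join_subcover[OF n0])
   then show ?thesis by blast
  qed
  show "\<exists>V\<subseteq>iterated_join shift_map X U n. finite V \<and> X \<subseteq> \<Union>V" using *[of n] by (elim exE conjE) (intro exI conjI)
  have "N U n \<le> card (realized (n + n0))" for n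
  proof -
   obtain W where W: "W \<subseteq> iterated_join shift_map X U n" "finite W" "X \<subseteq> \<Union>W" "card W \<le> card (realized (n + n0))"
    using *[of n] by (elim exE conjE)
   show ?thesis using min_subcover_le[OF W(1-3)] W(4) unfolding N_def by linarith
  qed
  then show "\<exists>n0. \<forall>n. N U n \<le> card (realized (n + n0))" by blast
 qed
 have pos: "N U n \<ge> 1" if U: "cov U" for U n
 proof -
  obtain V where V: "V \<subseteq> iterated_join shift_map X U n" "finite V" "X \<subseteq> \<Union>V" "card V = N U n"
   unfolding N_def by (rule min_subcover_obtain[OF ex[OF U]])
  have "V ~= {}" using V(3) X_nonempty by blast
  then show ?thesis using V by (simp add: Suc_le_eq card_gt_0_iff flip: V(4))
 qed
 have conv: "convergent (%n. ln (real (N U n)) / real n)" if U: "cov U" for U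
 proof (rule fekete)
  fix m n
  have "N U (m + n) \<le> N U m * N U n" unfolding N_def
   by (rule min_subcover_mult[OF shift_X ex[OF U]])
  then have "real (N U (m + n)) \<le> real (N U m) * real (N U n)" by (simp flip: of_nat_mult)
  then have "ln (real (N U (m + n))) \<le> ln (real (N U m) * real (N U n))"
   using pos[OF U, of "m + n"] by (intro ln_mono) auto
  also have "\<dots> = ln (real (N U m)) + ln (real (N U n))"
   using pos[OF U, of m] pos[OF U, of n] by (intro ln_mult_pos) auto
  finally show "ln (real (N U (m + n))) \<le> ln (real (N U m)) + ln (real (N U n))" .
 next
  fix n show "0 \<le> ln (real (N U n))" using pos[OF U, of n] by simp
 qed
 have lim_aff: "(%n. (a + (real n + b) * ln r) / real n) \<longlonglongrightarrow> ln r" for a b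
 proof -
  have "(%n. (a + b * ln r) / real n + ln r) \<longlonglongrightarrow> 0 + ln r"
   by (intro tendsto_add tendsto_const tendsto_divide_0[OF tendsto_const] filterlim_at_top_imp_at_infinity filterlim_real_sequentially)
  moreover have "\<forall>\<^sub>F n in sequentially. (a + b * ln r) / real n + ln r = (a + (real n + b) * ln r) / real n"
   using eventually_gt_at_top[of 0] by eventually_elim (simp add: field_simps)
  ultimately show ?thesis by (simp add: filterlim_cong[OF refl refl])
 qed
 have upper: "lim (%n. ln (real (N U n)) / real n) \<le> ln r" if U: "cov U" for U
 proof -
  obtain n0 where n0: "!!n. N U n \<le> card (realized (n + n0))" using up[OF U] by blast
  define b where "b = real n0 - 1"
  have "ln (real (N U n)) / real n \<le> (- ln C + (real n + b) * ln r) / real n" if n: "n \<ge> 1" for n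
  proof -
   have "C * real (N U n) \<le> C * real (card (realized (Suc (n + n0 - 1))))"
    using n0[of n] n C by simp
   also have "\<dots> \<le> r ^ (n + n0 - 1)" by (rule le)
   finally have "ln (C * real (N U n)) \<le> ln (r ^ (n + n0 - 1))"
    using pos[OF U, of n] C by (intro ln_mono) auto
   moreover have "ln (C * real (N U n)) = ln C + ln (real (N U n))"
    using pos[OF U, of n] C by (intro ln_mult_pos) auto
   moreover have "ln (r ^ (n + n0 - 1)) = (real n + b) * ln r"
    using r n by (simp add: ln_realpow b_def of_nat_diff)
   ultimately show ?thesis using n by (intro divide_right_mono) auto
  qed
  then show ?thesis
   by (intro LIMSEQ_le[OF convergent_LIMSEQ_iff[THEN iffD1, OF conv[OF U]] lim_aff]) blast
 qed
 let ?U = "(%v. cyl [v]) ` V"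
 have covU: "cov ?U"
 proof -
  have "X \<subseteq> \<Union>?U" using c_image by (auto simp: cyl_def itinerary_def)
  then show ?thesis using openin_cyl unfolding cov_def by blast
 qed
 have lower: "ln r \<le> lim (%n. ln (real (N ?U n)) / real n)"
 proof (rule LIMSEQ_le[OF lim_aff[of "- ln D" "- 1"] convergent_LIMSEQ_iff[THEN iffD1, OF conv[OF covU]]], intro exI allI impI)
  fix n :: nat assume n: "1 \<le> n"
  obtain W where W: "W \<subseteq> iterated_join shift_map X ?U n" "finite W" "X \<subseteq> \<Union>W" "card W = N ?U n"
   unfolding N_def by (rule min_subcover_obtain[OF ex[OF covU]])
  have "r ^ (n - 1) \<le> D * real (card (realized n))" using ge[of "n - 1"] n by simp
  also have "\<dots> \<le> D * real (N ?U n)" using join_vertex_cover[OF W(1-3)] W(4) C by simp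
  finally have "ln (r ^ (n - 1)) \<le> ln (D * real (N ?U n))" using r by (intro ln_mono) auto
  moreover have "ln (D * real (N ?U n)) = ln D + ln (real (N ?U n))"
   using pos[OF covU, of n] C by (intro ln_mult_pos) auto
  moreover have "ln (r ^ (n - 1)) = (real n + - 1) * ln r" using r n by (simp add: ln_realpow of_nat_diff)
  ultimately show "(- ln D + (real n + - 1) * ln r) / real n \<le> ln (real (N ?U n)) / real n"
   using n by (intro divide_right_mono) auto
 qed
 have "top_entropy shift_map X = (SUP U\<in>{U. cov U}. ereal (lim (%n. ln (real (N U n)) / real n)))"
  by (simp add: top_entropy_def cov_def N_def)
 also have "\<dots> = ereal (ln r)"
 proof (rule antisym)
  show "(SUP U\<in>{U. cov U}. ereal (lim (%n. ln (real (N U n)) / real n))) \<le> ereal (ln r)"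
   by (rule SUP_least) (use upper in simp)
  have "ereal (ln r) \<le> ereal (lim (%n. ln (real (N ?U n)) / real n))" using lower by simp
  also have "\<dots> \<le> (SUP U\<in>{U. cov U}. ereal (lim (%n. ln (real (N U n)) / real n)))"
   by (rule SUP_upper) (use covU in simp)
  finally show "ereal (ln r) \<le> (SUP U\<in>{U. cov U}. ereal (lim (%n. ln (real (N U n)) / real n)))" .
 qed
 finally show ?thesis .
qed

text \<open>A compact discrete space is finite, so its number of words stays bounded; positive
  growth will contradict this.\<close>

lemma discrete_realized_bounded:
 assumes "topological_space_class.discrete X"
 obtains B where "!!n. card (realized n) \<le> B"
proof -
 have iso: "\<exists>T. open T \<and> X \<inter> T = {x}" if "x \<in> X" for x
  using assms that unfolding discrete_def isolated_in_def by (metis Int_commute)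
 then have "\<exists>T. \<forall>x\<in>X. open (T x) \<and> X \<inter> T x = {x}" by (intro bchoice) blast
 then obtain T where T: "!!x. x \<in> X ==> open (T x) \<and> X \<inter> T x = {x}" by blast
 obtain D where D: "D \<subseteq> X" "finite D" "X \<subseteq> (\<Union>x\<in>D. T x)"
  by (rule compactE_image[OF compact_X, of X T]) (use T in blast)+
 have "X \<subseteq> D"
 proof
  fix x assume x: "x \<in> X"
  then obtain z where z: "z \<in> D" "x \<in> T z" using D(3) by blast
  then have "x \<in> X \<inter> T z" using x by simp
  moreover have "X \<inter> T z = {z}" using T z(1) D(1) by blast
  ultimately show "x \<in> D" using z(1) by simp
 qed
 then have fin: "finite X" using D(2) finite_subset by blast
 have "card (realized n) \<le> card X" for n
 proof -
  have "realized n \<subseteq> itin n ` X"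
  proof
   fix u assume "u \<in> realized n"
   then obtain x where "x \<in> X" "itin n x = u" by (auto simp: realized_def cyl_def words_def)
   then show "u \<in> itin n ` X" by blast
  qed
  then have "card (realized n) \<le> card (itin n ` X)" using fin by (intro card_mono) auto
  also have "\<dots> \<le> card X" using fin by (rule card_image_le)
  finally show ?thesis .
 qed
 then show ?thesis by (rule that)
qed

end

subsection \<open>Convex combinations and orbit measures\<close>

lemma emeasure_measure_comb:
 assumes m: "!!j. j \<in> J ==> sets (m j) = sets (restrict_space borel X)"
  and B: "B \<in> sets (restrict_space borel X)"
 shows "emeasure (measure_comb X J a m) B = (\<Sum>j\<in>J. ennreal (a j) * emeasure (m j) B)"
 unfolding measure_comb_def
proof (rule emeasure_measure_of_sigma[OF _ _ _ B])
 show "sigma_algebra X (sets (restrict_space borel X))"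
  using sets.sigma_algebra_axioms[of "restrict_space borel X"] by (simp add: space_restrict_space)
 show "positive (sets (restrict_space borel X)) (%B. \<Sum>j\<in>J. ennreal (a j) * emeasure (m j) B)"
  by (simp add: positive_def)
 show "countably_additive (sets (restrict_space borel X)) (%B. \<Sum>j\<in>J. ennreal (a j) * emeasure (m j) B)"
 proof (rule countably_additiveI)
  fix A :: "nat => _" assume A: "range A \<subseteq> sets (restrict_space borel X)" "disjoint_family A"
  have "(\<Sum>i. \<Sum>j\<in>J. ennreal (a j) * emeasure (m j) (A i)) = (\<Sum>j\<in>J. \<Sum>i. ennreal (a j) * emeasure (m j) (A i))"
   by (rule suminf_sum) simp
  also have "\<dots> = (\<Sum>j\<in>J. ennreal (a j) * emeasure (m j) (\<Union>i. A i))"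
   using A m by (intro sum.cong refl) (simp add: suminf_emeasure)
  finally show "(\<Sum>i. \<Sum>j\<in>J. ennreal (a j) * emeasure (m j) (A i)) = (\<Sum>j\<in>J. ennreal (a j) * emeasure (m j) (\<Union>i. A i))" .
 qed
qed

lemma sets_measure_comb: "sets (measure_comb X J a m) = sets (restrict_space borel X)"
 unfolding measure_comb_def
 using sets.sigma_sets_eq[of "restrict_space borel X"] sets.space_closed[of "restrict_space borel X"]
 by (simp add: space_restrict_space)

context coded_shift
begin

lemma X_sets: "X \<in> borel_sets" using sets_cyl[of "[]"] by (simp add: cyl_Nil)

text \<open>Invariance is asked of the combination only, so that orbit measures are covered: they
  average point masses that individually may fail to be invariant.\<close>

lemma measure_comb_invariant:
 assumes m: "!!j. j \<in> J ==> sets (m j) = borel_sets" "!!j. j \<in> J ==> prob_space (m j)"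
  and a: "!!j. j \<in> J ==> a j \<ge> 0" "(\<Sum>j\<in>J. a j) = 1"
  and inv: "!!B. B \<in> borel_sets ==>
   (\<Sum>j\<in>J. a j * measure (m j) (shift_map -` B \<inter> X)) = (\<Sum>j\<in>J. a j * measure (m j) B)"
 shows "measure_comb X J a m \<in> inv_measures"
  "!!B. B \<in> borel_sets ==> measure (measure_comb X J a m) B = (\<Sum>j\<in>J. a j * measure (m j) B)"
proof -
 let ?M = "measure_comb X J a m"
 note sM = sets_measure_comb[of X J a m]
 have sp: "space ?M = X" by (rule sets_X_space[OF sM])
 have em: "emeasure ?M B = ennreal (\<Sum>j\<in>J. a j * measure (m j) B)" if B: "B \<in> borel_sets" for B
 proof -
  have "emeasure ?M B = (\<Sum>j\<in>J. ennreal (a j) * emeasure (m j) B)" by (rule emeasure_measure_comb[OF m(1) B])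
  also have "\<dots> = (\<Sum>j\<in>J. ennreal (a j * measure (m j) B))"
  proof (rule sum.cong[OF refl])
   fix j assume j: "j \<in> J"
   interpret prob_space "m j" by (rule m(2)[OF j])
   show "ennreal (a j) * emeasure (m j) B = ennreal (a j * measure (m j) B)"
    using a(1)[OF j] by (simp add: emeasure_eq_measure ennreal_mult)
  qed
  also have "\<dots> = ennreal (\<Sum>j\<in>J. a j * measure (m j) B)" using a(1) by (intro sum_ennreal) simp
  finally show ?thesis .
 qed
 show "measure ?M B = (\<Sum>j\<in>J. a j * measure (m j) B)" if "B \<in> borel_sets" for B
  using em[OF that] a(1) by (simp add: measure_def sum_nonneg)
 have "measure (m j) X = 1" if "j \<in> J" for j
  using prob_space.prob_space[OF m(2)[OF that]] sets_X_space[OF m(1)[OF that]] by simp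
 then have "emeasure ?M X = 1" using em[OF X_sets] a(2) by simp
 then have "prob_space ?M" by (intro prob_spaceI) (simp add: sp)
 moreover have shm: "shift_map \<in> measurable ?M ?M"
  using shift_measurable sM by (simp cong: measurable_cong_sets)
 have "distr ?M ?M shift_map = ?M"
 proof (rule measure_eqI)
  fix B assume "B \<in> sets (distr ?M ?M shift_map)"
  then have B: "B \<in> sets ?M" by simp
  then have "shift_map -` B \<inter> X \<in> borel_sets"
   using measurable_sets[OF shm B] sM by (simp add: sp)
  then show "emeasure (distr ?M ?M shift_map) B = emeasure ?M B"
   using emeasure_distr[OF shm B] em inv[of B] B sM by (simp add: sp)
 qed simp
 ultimately show "?M \<in> inv_measures" using sM by (simp add: invariant_measures_def)
qed

lemma measure_comb_inv:
 assumes m: "!!j. j \<in> J ==> m j \<in> inv_measures" and a: "!!j. j \<in> J ==> a j \<ge> 0" "(\<Sum>j\<in>J. a j) = 1"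
 shows "measure_comb X J a m \<in> inv_measures" "wm (measure_comb X J a m) u = (\<Sum>j\<in>J. a j * wm (m j) u)"
proof -
 have eq: "measure (m j) (shift_map -` B \<inter> X) = measure (m j) B"
  if "j \<in> J" "B \<in> borel_sets" for j B
 proof -
  note I = invD[OF m[OF that(1)]]
  have "shift_map \<in> measurable (m j) (m j)" using shift_measurable I(1) by (simp cong: measurable_cong_sets)
  then have "measure (distr (m j) (m j) shift_map) B = measure (m j) (shift_map -` B \<inter> X)"
   using that(2) I(1) by (simp add: measure_distr I(4))
  then show ?thesis using I(3) by simp
 qed
 have *: "measure_comb X J a m \<in> inv_measures"
  "measure (measure_comb X J a m) B = (\<Sum>j\<in>J. a j * measure (m j) B)" if "B \<in> borel_sets" for B
  by (rule measure_comb_invariant; use m a eq that invD in simp)+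
 show "measure_comb X J a m \<in> inv_measures" by (rule *(1)[OF X_sets])
 show "wm (measure_comb X J a m) u = (\<Sum>j\<in>J. a j * wm (m j) u)" unfolding wm_def by (rule *(2)[OF sets_cyl])
qed

lemma prime_periodD:
 assumes "periodic_point x"
 shows "prime_period x > 0" "(shift_map ^^ prime_period x) x = x"
  "!!n. 0 < n ==> n < prime_period x ==> (shift_map ^^ n) x ~= x"
proof -
 have "\<exists>n. n > 0 \<and> (shift_map ^^ n) x = x" using assms by (simp add: periodic_point_def)
 from LeastI_ex[OF this] show "prime_period x > 0" "(shift_map ^^ prime_period x) x = x"
  unfolding prime_period_def by simp_all
 show "(shift_map ^^ n) x ~= x" if "0 < n" "n < prime_period x" for n
  using not_less_Least[OF that(2)[unfolded prime_period_def]] that(1) by simp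
qed

lemma orbit_measure_inv:
 assumes x: "x \<in> X" "periodic_point x"
 shows "orbit_measure X x \<in> inv_measures"
  "wm (orbit_measure X x) u > 0 ==> \<exists>i. (shift_map ^^ i) x \<in> cyl u"
proof -
 let ?n = "prime_period x" and ?R = "%i. return (restrict_space borel X) ((shift_map ^^ i) x)"
 note P = prime_periodD[OF x(2)]
 have mR: "measure (?R i) B = indicator B ((shift_map ^^ i) x)" if "B \<in> borel_sets" for i B
  using that by (simp add: measure_def indicator_def)
 have inv: "(\<Sum>i<?n. 1 / real ?n * measure (?R i) (shift_map -` B \<inter> X)) = (\<Sum>i<?n. 1 / real ?n * measure (?R i) B)"
  if B: "B \<in> borel_sets" for B
 proof -
  have sv: "shift_map -` B \<inter> X \<in> borel_sets"
   using measurable_sets[OF shift_measurable B] by (simp add: space_restrict_space)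
  define g where "g i = (indicator B ((shift_map ^^ i) x) :: real)" for i
  have "measure (?R i) (shift_map -` B \<inter> X) = g (Suc i)" for i
   unfolding mR[OF sv] using funpow_X[OF x(1), of i] by (simp add: indicator_def g_def)
  moreover have "(\<Sum>i<?n. g (Suc i)) = (\<Sum>i<?n. g i)"
   using sum.lessThan_Suc[of g ?n] sum.lessThan_Suc_shift[of g ?n] P(2) by (simp add: g_def)
  ultimately show ?thesis unfolding mR[OF B] by (simp add: g_def flip: sum_divide_distrib)
 qed
 have *: "orbit_measure X x \<in> inv_measures"
  "measure (orbit_measure X x) B = (\<Sum>i<?n. 1 / real ?n * measure (?R i) B)" if "B \<in> borel_sets" for B
  unfolding orbit_measure_def
  by (rule measure_comb_invariant;
    use inv P(1) that funpow_X[OF x(1)] in \<open>auto intro!: prob_space_return simp: space_restrict_space\<close>)+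
 show "orbit_measure X x \<in> inv_measures" by (rule *(1)[OF X_sets])
 assume pos: "wm (orbit_measure X x) u > 0"
 show "\<exists>i. (shift_map ^^ i) x \<in> cyl u"
 proof (rule ccontr)
  assume "\<not> ?thesis"
  then have "measure (?R i) (cyl u) = 0" for i unfolding mR[OF sets_cyl] by simp
  then show False using pos by (simp add: wm_def *(2)[OF sets_cyl])
 qed
qed

lemma eq_if_itin: "x \<in> X ==> y \<in> X ==> (!!i. c ((shift_map ^^ i) x) = c ((shift_map ^^ i) y)) ==> x = y"
proof (rule ext)
 fix i assume "x \<in> X" "y \<in> X" and eq: "!!i. c ((shift_map ^^ i) x) = c ((shift_map ^^ i) y)"
 moreover have "itin (Suc i) x = itin (Suc i) y" using eq by (simp add: itinerary_def)
 ultimately show "x i = y i" using itin_prefix by blast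
qed

end

subsection \<open>Subsystems\<close>

context gibbs_graph
begin

definition "subsystem = {x \<in> X. \<forall>i. (c ((shift_map ^^ i) x), c ((shift_map ^^ Suc i) x)) \<in> EK}"

definition "bad = {u \<in> lists V. \<exists>i. Suc i < length u \<and> (u ! i, u ! Suc i) \<notin> EK}"

lemma X_Diff_subsystem: "X - subsystem = \<Union> (cyl ` bad)"
proof (intro equalityI subsetI)
 fix x assume "x \<in> X - subsystem"
 then obtain i where x: "x \<in> X" "(c ((shift_map ^^ i) x), c ((shift_map ^^ Suc i) x)) \<notin> EK"
  by (auto simp: subsystem_def)
 have "itin (Suc (Suc i)) x \<in> lists V" using itin_words[OF x(1), of "Suc (Suc i)"] by (auto simp: words_def in_lists_conv_set)
 then have "itin (Suc (Suc i)) x \<in> bad" unfolding bad_def using x(2) by (auto simp: nth_itinerary simp del: funpow.simps intro!: exI[of _ i])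
 moreover have "x \<in> cyl (itin (Suc (Suc i)) x)" using x(1) by (simp add: cyl_def)
 ultimately show "x \<in> \<Union> (cyl ` bad)" by blast
next
 fix x assume "x \<in> \<Union> (cyl ` bad)"
 then obtain u i where u: "x \<in> cyl u" "Suc i < length u" "(u ! i, u ! Suc i) \<notin> EK" by (auto simp: bad_def)
 then have "x \<in> X" "itin (length u) x = u" by (auto simp: cyl_def)
 then show "x \<in> X - subsystem"
  using u(2,3) nth_itinerary[of i "length u" shift_map c x] nth_itinerary[of "Suc i" "length u" shift_map c x]
  by (auto simp: subsystem_def simp del: funpow.simps)
qed

lemma subsystem_subset: "subsystem \<subseteq> X" by (auto simp: subsystem_def)

lemma closedin_subsystem: "closedin (top_of_set X) subsystem"
proof -
 have "openin (top_of_set X) (X - subsystem)"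
  unfolding X_Diff_subsystem using openin_cyl by blast
 then show ?thesis using subsystem_subset by (simp add: closedin_def)
qed

text \<open>The complement of the subsystem is a countable union of cylinders with a forbidden
  transition, so full measure can be read off from the words of length 2.\<close>

lemma subsystem_full:
 assumes \<nu>: "\<nu> \<in> inv_measures" shows "emeasure \<nu> subsystem = 1 \<longleftrightarrow> supported \<nu>"
proof
 note I = invD[OF \<nu>]
 interpret prob_space \<nu> by (rule I(2))
 have cs: "cyl u \<in> sets \<nu>" for u using sets_cyl I(1) by simp
 have cb: "countable bad"
  by (rule countable_subset[of _ "lists V"]) (use finite_V in \<open>auto simp: bad_def countable_finite\<close>)
 have "X - subsystem \<in> sets \<nu>" unfolding X_Diff_subsystem using cb cs by (intro sets.countable_UN') auto
 then have ss: "subsystem \<in> sets \<nu>"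
  using sets.compl_sets[of "X - subsystem" \<nu>] subsystem_subset by (simp add: I(4) double_diff)
 {
  assume s: "supported \<nu>"
  have "\<Union> (cyl ` bad) \<in> null_sets \<nu>"
  proof (rule null_sets_UN'[OF cb])
   fix u assume "u \<in> bad"
   then obtain i where i: "Suc i < length u" "(u ! i, u ! Suc i) \<notin> EK" by (auto simp: bad_def)
   have "take 2 (drop i u) = [u ! i, u ! Suc i]"
    using i(1) by (simp add: numeral_2_eq_2 take_Suc_conv_app_nth Cons_nth_drop_Suc[symmetric])
   then have "wm \<nu> u \<le> wm \<nu> [u ! i, u ! Suc i]" using wm_window_le[OF \<nu>, of i 2 u] i(1) by simp
   moreover have "wm \<nu> [u ! i, u ! Suc i] = 0" using s i(2) wm_pair_pos[of \<nu>] unfolding supported_def by blast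
   ultimately have "wm \<nu> u = 0" using wm_nonneg[of \<nu> u] by linarith
   then show "cyl u \<in> null_sets \<nu>" using cs by (simp add: null_sets_def wm_def emeasure_eq_measure)
  qed
  then have "emeasure \<nu> (X - (X - subsystem)) = emeasure \<nu> X"
   unfolding X_Diff_subsystem using cs[of "[]"] by (intro emeasure_Diff_null_set) (simp_all add: cyl_Nil)
  then show "emeasure \<nu> subsystem = 1" using subsystem_subset emeasure_space_1 by (simp add: I(4) double_diff)
 next
  assume one: "emeasure \<nu> subsystem = 1"
  show "supported \<nu>" unfolding supported_def
  proof (intro allI impI)
   fix v w assume pos: "0 < wm \<nu> [v, w]"
   show "(v, w) \<in> EK"
   proof (rule ccontr)
    assume bad: "(v, w) \<notin> EK"
    have "cyl [v, w] \<inter> subsystem = {}"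
     using bad by (force simp: cyl_def itinerary_def subsystem_def dest: spec[of _ 0])
    then have "measure \<nu> (cyl [v, w] \<union> subsystem) = wm \<nu> [v, w] + measure \<nu> subsystem"
     unfolding wm_def using cs ss by (intro finite_measure_Union) auto
    moreover have "measure \<nu> subsystem = 1" using one by (simp add: measure_def)
    moreover have "measure \<nu> (cyl [v, w] \<union> subsystem) \<le> 1" by (rule prob_le_1)
    ultimately show False using pos by simp
   qed
  qed
 }
qed

lemma subsystem_path:
 assumes "(v, w) \<in> EK" obtains x where "x \<in> subsystem" "c x = v" "c (shift_map x) = w"
proof -
 have "\<forall>v\<in>K. \<exists>w. (v, w) \<in> EK" using strongly_connectedD(5)[OF G] by blast
 then obtain d where d: "!!v. v \<in> K ==> (v, d v) \<in> EK" by metis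
 define s where "s i = (case i of 0 => v | Suc j => (d ^^ j) w)" for i
 have dK: "(d ^^ j) w \<in> K" for j
  using assms KD(3) d by (induction j) auto
 have s: "(s i, s (Suc i)) \<in> EK" for i
  using assms d[OF dK] by (cases i) (auto simp: s_def)
 then have "(s i, s (Suc i)) \<in> E" for i using EK by blast
 from path_point[of s, OF this] obtain x where x: "x \<in> X" "!!i. c ((shift_map ^^ i) x) = s i" by blast
 show ?thesis
 proof (rule that)
  show "x \<in> subsystem" by (simp add: subsystem_def x s del: funpow.simps)
  show "c x = v" "c (shift_map x) = w" using x(2)[of 0] x(2)[of 1] by (simp_all add: s_def)
 qed
qed

lemma subsystem_edge: "x \<in> subsystem ==> (c x, c (shift_map x)) \<in> EK"
 by (auto simp: subsystem_def dest: spec[of _ 0])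

lemma shift_subsystem: "x \<in> subsystem ==> shift_map x \<in> subsystem"
 unfolding subsystem_def using shift_X by (auto simp: funpow_swap1[symmetric] dest: spec[of _ "Suc _"])

text \<open>As a coded shift in its own right the subsystem has \<open>EK\<close> as its full edge
  set, so its topological entropy can be computed by counting words.\<close>

lemma coded_shift_subsystem: "coded_shift subsystem K EK c"
proof
 show "compact subsystem" by (rule closedin_compact[OF compact_X closedin_subsystem])
 show "c ` subsystem = K"
 proof (intro equalityI subsetI)
  fix v assume "v \<in> K"
  then obtain w where "(v, w) \<in> EK" using strongly_connectedD(5)[OF G] by blast
  then obtain x where "x \<in> subsystem" "c x = v" by (rule subsystem_path)
  then show "v \<in> c ` subsystem" by blast
 qed (use subsystem_edge KD(3) in blast)
 show "EK = (%x. (c x, c (shift_map x))) ` subsystem"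
 proof (intro equalityI subsetI)
  fix e assume e: "e \<in> EK"
  obtain x where "x \<in> subsystem" "c x = fst e" "c (shift_map x) = snd e"
   by (rule subsystem_path[of "fst e" "snd e"]) (use e in auto)
  then show "e \<in> (%x. (c x, c (shift_map x))) ` subsystem" by (intro image_eqI[of _ _ x]) auto
 qed (use subsystem_edge in blast)
 show "\<exists>x\<in>subsystem. \<forall>i. c ((shift_map ^^ i) x) = s i" if s: "!!i. (s i, s (Suc i)) \<in> EK" for s
 proof -
  have "(s i, s (Suc i)) \<in> E" for i using s EK by blast
  from path_point[of s, OF this] obtain x where x: "x \<in> X" "!!i. c ((shift_map ^^ i) x) = s i" by blast
  have "x \<in> subsystem" by (simp add: subsystem_def x s del: funpow.simps)
  then show ?thesis using x(2) by blast
 qed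
 show "\<exists>k. \<forall>x\<in>subsystem. \<forall>y\<in>subsystem. (\<forall>i<k. x i = y i) --> c x = c y"
  using c_local subsystem_subset by (meson subsetD)
qed (use KD shift_subsystem c_first subsystem_subset in blast)+

end

section \<open>Measures of maximal entropy of subgraphs\<close>

locale entropy_graph = gibbs_graph X V E c K EK "%_. 0" for X V E c K EK
begin

lemma entropy_gibbs: "measure_entropy shift_map gibbs = ereal (ln lam)"
 using variational_gibbs by simp

lemma lam_ge_1: "lam \<ge> 1"
proof -
 interpret gen_system gibbs shift_map c by (rule gen_system[OF gibbs_inv])
 have "0 \<le> ln lam" using measure_entropy_nonneg entropy_gibbs by simp
 then show ?thesis using lam_pos by simp
qed

text \<open>With potential 0 the eigenvector ratios telescope along a word, and only its end letters
  and its length matter.\<close>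

lemma gibbs_path_weight:
 "u ~= [] ==> 0 < wm gibbs u ==> wm gibbs u * (tot * lam ^ (length u - 1)) = lv (hd u) * rv (last u)"
proof (induction u rule: rev_induct)
 case (snoc v u)
 show ?case
 proof (cases "u = []")
  case True
  then show ?thesis using snoc.prems tot_pos by (auto simp: gibbs_single st_def split: if_splits)
 next
  case False
  note eq = gibbs_markov[OF False, of v]
  have "0 < wm gibbs u * tr (last u) v" using snoc.prems(2) unfolding eq .
  then have pos: "0 < wm gibbs u" "0 < tr (last u) v"
   using wm_nonneg[of gibbs u] tr_nonneg[of "last u" v] by (auto simp: zero_less_mult_iff)
  then have e: "(last u, v) \<in> EK" by (simp add: tr_pos_iff)
  then have K: "last u \<in> K" "v \<in> K" using KD(3) by auto
  have t: "tr (last u) v * lam * rv (last u) = rv v"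
   using K e rv_pos[OF K(1)] lam_pos by (simp add: tr_def wt_edge)
  obtain n where n: "length u = Suc n" using False by (cases u) auto
  have "wm gibbs (u @ [v]) * (tot * lam ^ Suc n) * rv (last u)
    = (wm gibbs u * (tot * lam ^ n)) * (tr (last u) v * lam * rv (last u))"
   by (simp add: eq)
  also have "\<dots> = (lv (hd u) * rv (last u)) * rv v" unfolding t using snoc.IH[OF False pos(1)] n by simp
  finally show ?thesis using rv_pos[OF K(1)] n False by simp
 qed
qed simp

text \<open>The probabilities of all words of one length add up to 1, and each is \<open>lam\<close>
  to a negative power up to a factor from a finite set of positive numbers.\<close>

lemma full_word_counts:
 assumes full: "K = V" "EK = E"
 obtains C D where "C > 0" "D > 0" "!!n. C * real (card (realized (Suc n))) \<le> lam ^ n"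
  "!!n. lam ^ n \<le> D * real (card (realized (Suc n)))"
proof -
 define S where "S = (%(v, w). lv v * rv w / tot) ` (V \<times> V)"
 have S: "finite S" "S ~= {}" using finite_V V_nonempty by (simp_all add: S_def)
 have Spos: "x > 0" if "x \<in> S" for x using that lv_pos rv_pos tot_pos full by (auto simp: S_def)
 have r: "wm gibbs u > 0" if u: "u \<in> realized (Suc n)" for u n
 proof -
  obtain x where x: "x \<in> X" "itin (Suc n) x = u" and w: "u \<in> words K (Suc n)"
   using u full by (auto simp: realized_def cyl_def words_def)
  have "0 < tr (u ! i) (u ! Suc i)" if "i < n" for i
  proof -
   have "u ! i = c ((shift_map ^^ i) x)" "u ! Suc i = c ((shift_map ^^ Suc i) x)"
    using that by (simp_all add: nth_itinerary flip: x(2) del: funpow.simps)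
   then show ?thesis unfolding tr_pos_iff using edge[OF x(1), of i] full(2) by simp
  qed
  moreover have "u ! 0 \<in> K" using w nth_mem[of 0 u] by (auto simp: words_def)
  then have "0 < st (u ! 0)" by (rule st_pos)
  ultimately show ?thesis unfolding gibbs_words[OF w] by (intro mult_pos_pos prod_pos) auto
 qed
 have lam: "lam ^ n = (\<Sum>u\<in>realized (Suc n). lv (hd u) * rv (last u) / tot)" for n
 proof -
  have "(\<Sum>u\<in>realized (Suc n). wm gibbs u) = (\<Sum>u\<in>words V (Suc n). wm gibbs u)"
   by (rule sum.mono_neutral_left[OF finite_words[OF finite_V]])
    (auto simp: realized_def wm_def)
  then have "lam ^ n = (\<Sum>u\<in>realized (Suc n). wm gibbs u * lam ^ n)"
   using wm_sum[OF gibbs_inv, of "Suc n"] by (simp flip: sum_distrib_right)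
  also have "\<dots> = (\<Sum>u\<in>realized (Suc n). lv (hd u) * rv (last u) / tot)"
  proof (rule sum.cong[OF refl])
   fix u assume u: "u \<in> realized (Suc n)"
   then have l: "length u = Suc n" "u ~= []" by (auto simp: realized_def words_def)
   show "wm gibbs u * lam ^ n = lv (hd u) * rv (last u) / tot"
    using gibbs_path_weight[OF l(2) r[OF u]] l tot_pos by (simp add: field_simps)
  qed
  finally show ?thesis .
 qed
 have inS: "lv (hd u) * rv (last u) / tot \<in> S" if "u \<in> realized (Suc n)" for u n
 proof -
  have "u ~= []" "set u \<subseteq> V" using that by (auto simp: realized_def words_def)
  then have "(hd u, last u) \<in> V \<times> V" by (auto intro: subsetD)
  then show ?thesis unfolding S_def by (intro image_eqI[of _ _ "(hd u, last u)"]) auto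
 qed
 show ?thesis
 proof (rule that)
  show "Min S > 0" "Max S > 0" using S Spos by simp_all
  fix n
  show "Min S * real (card (realized (Suc n))) \<le> lam ^ n"
   unfolding lam using sum_bounded_below[of "realized (Suc n)" "Min S" "%u. lv (hd u) * rv (last u) / tot"] S inS
   by (simp add: mult.commute)
  show "lam ^ n \<le> Max S * real (card (realized (Suc n)))"
   unfolding lam using sum_bounded_above[of "realized (Suc n)" "%u. lv (hd u) * rv (last u) / tot" "Max S"] S inS
   by (simp add: mult.commute)
 qed
qed

lemma entropy_graph_subsystem: "entropy_graph subsystem K EK c K EK"
 unfolding entropy_graph_def gibbs_graph_def gibbs_graph_axioms_def
 using coded_shift_subsystem G by simp

lemma top_entropy_subsystem: "top_entropy shift_map subsystem = ereal (ln lam)"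
proof -
 interpret S: entropy_graph subsystem K EK c K EK by (rule entropy_graph_subsystem)
 obtain C D where "C > 0" "D > 0" "!!n. C * real (card (S.realized (Suc n))) \<le> lam ^ n"
  "!!n. lam ^ n \<le> D * real (card (S.realized (Suc n)))"
  by (rule S.full_word_counts) auto
 then show ?thesis by (rule S.top_entropy_eq[OF lam_pos])
qed

lemma not_discrete_subsystem: "lam > 1 ==> \<not> topological_space_class.discrete subsystem"
proof
 assume l: "lam > 1" and disc: "topological_space_class.discrete subsystem"
 interpret S: entropy_graph subsystem K EK c K EK by (rule entropy_graph_subsystem)
 obtain B where B: "!!n. card (S.realized n) \<le> B"
  by (rule S.discrete_realized_bounded[OF disc]) blast
 obtain C D where D: "D > 0" "!!n. lam ^ n \<le> D * real (card (S.realized (Suc n)))"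
  by (rule S.full_word_counts) auto
 obtain n where "D * real B < lam ^ n" using real_arch_pow[OF l] by blast
 moreover have "lam ^ n \<le> D * real B"
  using D(2)[of n] B[of "Suc n"] D(1) by (meson mult_left_mono of_nat_mono order_trans less_imp_le)
 ultimately show False by simp
qed

lemma unique_max_entropy: "unique_max_entropy_measure X subsystem gibbs"
 unfolding unique_max_entropy_measure_def is_max_entropy_measure_def
proof (intro allI iffI)
 fix \<nu>
 assume \<nu>: "\<nu> \<in> inv_measures \<and> emeasure \<nu> subsystem = 1 \<and> measure_entropy shift_map \<nu> = top_entropy shift_map subsystem"
 then show "\<nu> = gibbs"
  using subsystem_full by (intro variational_unique) (auto simp: top_entropy_subsystem)
next
 fix \<nu> assume "\<nu> = gibbs"
 then show "\<nu> \<in> inv_measures \<and> emeasure \<nu> subsystem = 1 \<and> measure_entropy shift_map \<nu> = top_entropy shift_map subsystem"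
  using gibbs_inv subsystem_full[OF gibbs_inv] gibbs_supported entropy_gibbs top_entropy_subsystem by simp
qed

text \<open>Summing the left eigenvector equation with eigenvalue 1 shows that the out-degrees,
  weighted by the positive vector \<open>lv\<close>, have mean 1; none of them is below 1.\<close>

lemma out_degree_1:
 assumes "lam = 1" "(v, w) \<in> EK" "(v, w') \<in> EK" shows "w = w'"
proof (rule ccontr)
 assume ne: "w ~= w'"
 have wt: "wt a b = (if (a, b) \<in> EK then 1 else 0)" for a b by (auto simp: wt_edge)
 define d where "d a = (\<Sum>b\<in>K. wt a b)" for a
 have d1: "d a \<ge> 1" if a: "a \<in> K" for a
 proof -
  obtain b where b: "b \<in> K" "(a, b) \<in> EK" using strongly_connectedD(5)[OF G a] by blast
  then have "wt a b \<le> d a" unfolding d_def by (intro member_le_sum) (use KD in \<open>auto simp: wt\<close>)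
  then show ?thesis using b by (simp add: wt)
 qed
 have K: "v \<in> K" "w \<in> K" "w' \<in> K" using assms(2,3) KD(3) by auto
 have "(\<Sum>b\<in>{w, w'}. wt v b) \<le> d v" unfolding d_def by (rule sum_mono2) (use KD K in \<open>auto simp: wt\<close>)
 then have d2: "d v \<ge> 2" using ne assms by (simp add: wt)
 have "(\<Sum>a\<in>K. lv a * d a) = (\<Sum>b\<in>K. \<Sum>a\<in>K. lv a * wt a b)"
  unfolding d_def sum_distrib_left by (rule sum.swap)
 also have "\<dots> = (\<Sum>b\<in>K. lv b)" using lv_eq assms(1) by (intro sum.cong) auto
 finally have eq: "(\<Sum>a\<in>K. lv a * d a) = (\<Sum>b\<in>K. lv b)" .
 have "(\<Sum>b\<in>K. lv b) < (\<Sum>a\<in>K. lv a * d a)"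
 proof (rule sum_strict_mono_ex1[OF KD(1)])
  show "\<forall>a\<in>K. lv a \<le> lv a * d a"
  proof
   fix a assume a: "a \<in> K"
   show "lv a \<le> lv a * d a" using mult_left_mono[OF d1[OF a], of "lv a"] lv_pos[OF a] by simp
  qed
  have "lv v * 1 < lv v * d v" by (rule mult_strict_left_mono) (use lv_pos[OF K(1)] d2 in auto)
  then have "lv v < lv v * d v" by simp
  then show "\<exists>a\<in>K. lv a < lv a * d a" using K(1) by blast
 qed
 then show False using eq by simp
qed

text \<open>With out-degree 1 a point of the subsystem is determined by its first vertex, and strong
  connectivity makes it return. Its orbit measure has entropy at least \<open>0 = ln lam\<close>, so
  uniqueness in the variational principle identifies it.\<close>

lemma periodic_orbit:
 assumes lam: "lam = 1"
 obtains x where "x \<in> X" "periodic_point x" "inj_on (%i. c ((shift_map ^^ i) x)) {..<prime_period x}"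
  "orbit_measure X x = gibbs"
proof -
 obtain v0 where v0: "v0 \<in> K" using KD by blast
 obtain w0 where "(v0, w0) \<in> EK" using strongly_connectedD(5)[OF G v0] by blast
 then obtain x where x: "x \<in> subsystem" "c x = v0" by (rule subsystem_path)
 have xX: "x \<in> X" using x subsystem_subset by blast
 have xe: "(c ((shift_map ^^ i) x), c ((shift_map ^^ Suc i) x)) \<in> EK" for i using x(1) unfolding subsystem_def by blast
 have det: "(shift_map ^^ i) x = (shift_map ^^ j) x" if eq: "c ((shift_map ^^ i) x) = c ((shift_map ^^ j) x)" for i j
 proof (rule eq_if_itin[OF funpow_X[OF xX] funpow_X[OF xX]])
  fix n
  have "c ((shift_map ^^ (n + i)) x) = c ((shift_map ^^ (n + j)) x)"
  proof (induction n)
   case (Suc n)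
   then show ?case using out_degree_1[OF lam xe[of "n + i"], of "c ((shift_map ^^ Suc (n + j)) x)"] xe[of "n + j"] by simp
  qed (simp add: eq)
  then show "c ((shift_map ^^ n) ((shift_map ^^ i) x)) = c ((shift_map ^^ n) ((shift_map ^^ j) x))"
   by (simp add: funpow_add)
 qed
 have reach: "\<exists>n>0. c ((shift_map ^^ n) x) = w" if "(v0, w) \<in> EK\<^sup>+" for w
  using that
 proof (induction rule: trancl_induct)
  case (base w)
  then have "c ((shift_map ^^ 1) x) = w" using out_degree_1[OF lam xe[of 0], of w] x(2) by simp
  then show ?case by blast
 next
  case (step w z)
  then obtain n where "c ((shift_map ^^ n) x) = w" by blast
  then have "c ((shift_map ^^ Suc n) x) = z" using out_degree_1[OF lam xe[of n], of z] step(2) by simp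
  then show ?case by blast
 qed
 obtain n where n: "n > 0" "c ((shift_map ^^ n) x) = c ((shift_map ^^ 0) x)"
  using reach[of v0] strongly_connectedD(4)[OF G v0 v0] x(2) by auto
 then have per: "periodic_point x" using det[OF n(2)] by (auto simp: periodic_point_def)
 note P = prime_periodD[OF per]
 show ?thesis
 proof (rule that[OF xX per])
  \<comment> \<open>A repetition at times \<open>i < j\<close>, pushed forward to the end of the
    period, would give the smaller period \<open>j - i\<close>.\<close>
  have *: False if "i < j" "j < prime_period x" "c ((shift_map ^^ i) x) = c ((shift_map ^^ j) x)" for i j
  proof -
   let ?p = "prime_period x"
   have e: "?p - i + i = ?p" "?p - i + j = (j - i) + ?p" using that by auto
   have "(shift_map ^^ (?p - i + i)) x = (shift_map ^^ (?p - i + j)) x"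
    using det[OF that(3)] by (simp only: funpow_add o_apply)
   then have "x = (shift_map ^^ (j - i)) x" unfolding e using P(2) by (simp add: funpow_add)
   moreover have "0 < j - i" "j - i < ?p" using that by linarith+
   ultimately show False using P(3)[of "j - i"] by metis
  qed
  show "inj_on (%i. c ((shift_map ^^ i) x)) {..<prime_period x}"
  proof (rule inj_onI)
   fix i j assume "i \<in> {..<prime_period x}" "j \<in> {..<prime_period x}" "c ((shift_map ^^ i) x) = c ((shift_map ^^ j) x)"
   then show "i = j" using *[of i j] *[of j i] by (cases i j rule: linorder_cases) auto
  qed
  note O = orbit_measure_inv[OF xX per]
  have sup: "supported (orbit_measure X x)" unfolding supported_def
  proof (intro allI impI)
   fix v w assume "0 < wm (orbit_measure X x) [v, w]"
   then obtain i where "(shift_map ^^ i) x \<in> cyl [v, w]" using O(2) by blast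
   then show "(v, w) \<in> EK" using xe[of i] by (auto simp: cyl_def itinerary_def)
  qed
  interpret gen_system "orbit_measure X x" shift_map c by (rule gen_system[OF O(1)])
  show "orbit_measure X x = gibbs"
   using measure_entropy_nonneg lam O(1) sup by (intro variational_unique) (simp_all add: zero_ereal_def)
 qed
qed

end

subsection \<open>Convergence of the stationary and transition probabilities\<close>

text \<open>A pair \<open>(\<psi>, t)\<close> stands for the potential \<open>t \<psi>\<close>.\<close>
definition scaled_weight :: "('v \<times> 'v) set => ('v => real) \<times> real => 'v => 'v => real" where
 "scaled_weight E a = edge_weight E (%v. snd a * fst a v)"

context
 fixes V :: "'v set" and E :: "('v \<times> 'v) set"
 assumes SC: "strongly_connected V E"
begin

lemma scaled_irreducible: "irreducible V (scaled_weight E a)"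
 unfolding scaled_weight_def by (rule irreducible_edge_weight[OF SC])

lemma scaled_val_le:
 "pf_val V (scaled_weight E (\<psi>, s)) \<le> exp (\<bar>s - t\<bar> * (\<Sum>v\<in>V. \<bar>\<psi> v\<bar>)) * pf_val V (scaled_weight E (\<psi>, t))"
proof (rule pf_val_mono[OF scaled_irreducible scaled_irreducible])
 fix v w assume v: "v \<in> V" "w \<in> V"
 have "\<bar>\<psi> v\<bar> \<le> (\<Sum>v\<in>V. \<bar>\<psi> v\<bar>)"
  using strongly_connectedD(1)[OF SC] v by (intro member_le_sum) auto
 then have "\<bar>s - t\<bar> * \<bar>\<psi> v\<bar> \<le> \<bar>s - t\<bar> * (\<Sum>v\<in>V. \<bar>\<psi> v\<bar>)" by (intro mult_left_mono) auto
 moreover have "(s - t) * \<psi> v \<le> \<bar>s - t\<bar> * \<bar>\<psi> v\<bar>" by (metis abs_ge_self abs_mult)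
 ultimately have "s * \<psi> v \<le> \<bar>s - t\<bar> * (\<Sum>v\<in>V. \<bar>\<psi> v\<bar>) + t * \<psi> v" by (simp add: algebra_simps)
 then show "scaled_weight E (\<psi>, s) v w \<le> exp (\<bar>s - t\<bar> * (\<Sum>v\<in>V. \<bar>\<psi> v\<bar>)) * scaled_weight E (\<psi>, t) v w"
  by (simp add: scaled_weight_def edge_weight_def flip: exp_add)
qed

lemma continuous_scaled_val: "continuous_on UNIV (%t. pf_val V (scaled_weight E (\<psi>, t)))"
proof (rule continuous_at_imp_continuous_on, rule ballI)
 fix t :: real
 define C where "C = (\<Sum>v\<in>V. \<bar>\<psi> v\<bar>)"
 let ?f = "%s. pf_val V (scaled_weight E (\<psi>, s))"
 have lim: "((%s. exp (e * (\<bar>s - t\<bar> * C)) * ?f t) \<longlongrightarrow> exp (e * (\<bar>t - t\<bar> * C)) * ?f t) (at t)" for e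
  by (intro tendsto_intros)
 have "(?f \<longlongrightarrow> ?f t) (at t)"
 proof (rule tendsto_sandwich)
  show "\<forall>\<^sub>F s in at t. exp (- 1 * (\<bar>s - t\<bar> * C)) * ?f t \<le> ?f s"
  proof (intro always_eventually allI)
   fix s
   have "?f t \<le> exp (\<bar>s - t\<bar> * C) * ?f s" using scaled_val_le[of \<psi> t s] by (simp add: C_def abs_minus_commute)
   then have "exp (- (\<bar>s - t\<bar> * C)) * ?f t \<le> exp (- (\<bar>s - t\<bar> * C)) * (exp (\<bar>s - t\<bar> * C) * ?f s)"
    by (intro mult_left_mono) auto
   then show "exp (- 1 * (\<bar>s - t\<bar> * C)) * ?f t \<le> ?f s" by (simp add: mult.assoc[symmetric] flip: exp_add)
  qed
  show "\<forall>\<^sub>F s in at t. ?f s \<le> exp (1 * (\<bar>s - t\<bar> * C)) * ?f t"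
   using scaled_val_le[of \<psi> _ t] by (simp add: C_def)
 qed (use lim[of "- 1"] lim[of 1] in simp_all)
 then show "isCont ?f t" by (simp add: isCont_def)
qed

abbreviation "scaled_algebraic \<equiv> algebraic_families V (%a. pf_vec V (scaled_weight E a))"

text \<open>The eigenvectors are arbitrary choices at each parameter and need not depend regularly
  on \<open>t\<close>; only ratios of their entries are independent of the scaling.\<close>

lemma scaled_algebraic_ratios:
 shows "(%a. scaled_weight E a v w) \<in> scaled_algebraic"
  and "(%a. pf_val V (scaled_weight E a)) \<in> scaled_algebraic"
  and "u \<in> V ==> u' \<in> V ==> (%a. pf_vec V (scaled_weight E a) u / pf_vec V (scaled_weight E a) u') \<in> scaled_algebraic"
  and "u \<in> V ==> u' \<in> V ==> (%a. pf_left V (scaled_weight E a) u / pf_left V (scaled_weight E a) u') \<in> scaled_algebraic"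
proof -
 have V: "finite V" by (rule strongly_connectedD(1)[OF SC])
 have ef: "(%a. scaled_weight E a v w) \<in> exp_families" for v w
 proof (cases "(v, w) \<in> E")
  case True
  have "\<exists>B. \<forall>\<psi>. (%t. exp (t * \<psi> v)) \<in> exp_sums B"
   by (intro exI[of _ 1] allI exp_sums_exp)
  then show ?thesis using True by (simp add: exp_families_def scaled_weight_def edge_weight_def)
 qed (simp add: scaled_weight_def edge_weight_def exp_families_zero)
 show w: "(%a. scaled_weight E a v w) \<in> scaled_algebraic" for v w
 proof (rule algebraic_familiesI[OF V eigen_families_exp[OF V ef]])
  fix \<psi>
  show "continuous_on UNIV (%t. scaled_weight E (\<psi>, t) v w)"
   by (cases "(v, w) \<in> E") (auto simp: scaled_weight_def edge_weight_def intro!: continuous_intros)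
 qed
 have FC: "field_closed scaled_algebraic" by (rule field_closed_algebraic[OF V])
 show val: "(%a. pf_val V (scaled_weight E a)) \<in> scaled_algebraic"
 proof (rule algebraic_familiesI[OF V _ continuous_scaled_val])
  show "(%a. pf_val V (scaled_weight E a)) \<in> eigen_families V (%a. pf_vec V (scaled_weight E a))"
   unfolding eigen_families_def using ef pf_vec_eq[OF scaled_irreducible]
   by (intro CollectI exI[of _ "scaled_weight E"]) auto
 qed
 show "(%a. pf_vec V (scaled_weight E a) u / pf_vec V (scaled_weight E a) u') \<in> scaled_algebraic"
  if "u \<in> V" "u' \<in> V" for u u'
  by (rule eigen_ratio_closed[OF FC val scaled_irreducible w pf_vec[OF scaled_irreducible] that])
 show "(%a. pf_left V (scaled_weight E a) u / pf_left V (scaled_weight E a) u') \<in> scaled_algebraic"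
  if "u \<in> V" "u' \<in> V" for u u'
 \<comment> \<open>The same family serves the transposed matrix, since state elimination only needs
   the weights and the eigenvalue, which both matrices share.\<close>
 proof (rule eigen_ratio_closed[OF FC val _ w _ that])
  show "irreducible V (%v w. scaled_weight E a w v)" for a
   by (rule irreducible_transpose[OF scaled_irreducible])
  show "pos_eigen V (%v w. scaled_weight E a w v) (pf_val V (scaled_weight E a)) (pf_left V (scaled_weight E a))" for a
   using pf_vec[OF irreducible_transpose[OF scaled_irreducible]] pf_val_transpose[OF scaled_irreducible]
   by (simp add: pf_left_def)
 qed
qed

end

section \<open>Equilibrium states of the full graph\<close>

locale transitive_coding = coded_shift X V E c
 for X :: "(nat => nat) set" and V :: "'v set" and E and c +
 assumes SC: "strongly_connected V E"

sublocale transitive_coding \<subseteq> full: gibbs_graph X V E c V E \<psi> for \<psi>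
 by unfold_locales (simp_all add: SC)

context transitive_coding
begin

lemma full_tr_families:
 assumes vw: "v \<in> V" "w \<in> V"
 shows "(%a. full.tr (%v. snd a * fst a v) v w) \<in> scaled_algebraic V E"
  and "(%a. full.st (%v. snd a * fst a v) v) \<in> scaled_algebraic V E"
proof -
 let ?A = "scaled_algebraic V E"
 have FC: "field_closed ?A" by (rule field_closed_algebraic[OF finite_V])
 note C = field_closed[OF FC] and R = scaled_algebraic_ratios[OF SC]
 let ?lam = "%a. pf_val V (scaled_weight E a)" and ?r = "%a. pf_vec V (scaled_weight E a)"
  and ?l = "%a. pf_left V (scaled_weight E a)"
 have r: "?r a u > 0" and l: "?l a u > 0" if "u \<in> V" for a u
  using pf_vec_pos[OF scaled_irreducible[OF SC] that] pf_left_pos[OF scaled_irreducible[OF SC] that] by auto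
 have lam: "?lam a ~= 0" for a using pf_val_pos[OF scaled_irreducible[OF SC], of a] by simp
 have "(%a. scaled_weight E a v w * (?r a w / ?r a v) / ?lam a) \<in> ?A"
  by (rule C(4)[OF C(3)[OF R(1) R(3)[OF vw(2,1)]] R(2) lam])
 also have "(%a. scaled_weight E a v w * (?r a w / ?r a v) / ?lam a) = (%a. full.tr (%v. snd a * fst a v) v w)"
  using vw by (simp add: full.tr_def full.wt_def full.rv_def full.lam_def scaled_weight_def mult.commute)
 finally show "(%a. full.tr (%v. snd a * fst a v) v w) \<in> ?A" .
 \<comment> \<open>The reciprocal of the stationary probability of \<open>v\<close>, written with
   ratios of entries only, so that the arbitrary scalings of both eigenvectors cancel.\<close>
 let ?s = "%a. \<Sum>u\<in>V. (?l a u / ?l a v) * (?r a u / ?r a v)"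
 have s: "?s a > 0" for a
  using finite_V V_nonempty r l vw by (intro sum_pos mult_pos_pos divide_pos_pos) auto
 have "?s \<in> ?A" by (intro field_closed_sum[OF FC finite_V] C(3) R(3) R(4) vw)
 then have "(%a. of_int 1 / ?s a) \<in> ?A"
  using s by (intro C(4)[OF C(1)[of 1]]) (simp_all add: less_imp_neq[symmetric])
 also have "(%a. of_int 1 / ?s a) = (%a. full.st (%v. snd a * fst a v) v)"
 proof
  fix a
  have "?s a = (\<Sum>u\<in>V. ?l a u * ?r a u) / (?l a v * ?r a v)" by (simp add: sum_divide_distrib)
  then show "of_int 1 / ?s a = full.st (%v. snd a * fst a v) v"
   by (simp add: full.st_def full.tot_def full.lv_def full.rv_def full.wt_def scaled_weight_def)
 qed
 finally show "(%a. full.st (%v. snd a * fst a v) v) \<in> ?A" .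
qed

lemma wm_le_1: "\<mu> \<in> inv_measures ==> wm \<mu> u \<le> 1"
 unfolding wm_def by (rule prob_space.prob_le_1[OF invD(2)])

lemma wm_converges:
 obtains R where "finite R" "!!\<psi> v. \<exists>l\<in>R. ((%t. wm (full.gibbs (%v. t * \<psi> v)) [v]) \<longlongrightarrow> l) at_top"
  "!!\<psi> v w. \<exists>l\<in>R. ((%t. wm (full.gibbs (%v. t * \<psi> v)) [v, w]) \<longlongrightarrow> l) at_top"
proof -
 obtain v0 where v0: "v0 \<in> V" using V_nonempty by blast
 have r0: "pf_vec V (scaled_weight E a) v0 ~= 0" for a
  using pf_vec_pos[OF scaled_irreducible[OF SC] v0, of a] by simp
 have FC: "field_closed (scaled_algebraic V E)"
  by (rule field_closed_algebraic[OF finite_V])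
 define mt where "mt a = full.gibbs (%v. snd a * fst a v)" for a :: "('v => real) \<times> real"
 have mt: "mt a \<in> inv_measures" for a by (simp add: mt_def full.gibbs_inv)
 have *: "\<exists>R. finite R \<and> (\<forall>\<psi>. \<exists>l\<in>R. ((%t. wm (mt (\<psi>, t)) u) \<longlongrightarrow> l) at_top)"
  if u: "(%a. wm (mt a) u) \<in> scaled_algebraic V E" for u
 proof -
  obtain R where R: "finite R" "!!\<psi>. \<exists>l\<in>R. ((%t. wm (mt (\<psi>, t)) u) \<longlongrightarrow> l) at_top"
   by (rule algebraic_families_limit[OF finite_V v0 r0 u]) (use wm_le_1[OF mt] in auto)
  then show ?thesis by blast
 qed
 have "\<exists>R. finite R \<and> (\<forall>\<psi>. \<exists>l\<in>R. ((%t. wm (mt (\<psi>, t)) [v]) \<longlongrightarrow> l) at_top)" if "v \<in> V" for v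
  by (rule *) (use full_tr_families(2)[OF that that] that in \<open>simp add: mt_def full.gibbs_single\<close>)
 then obtain R1 where R1: "!!v. v \<in> V ==> finite (R1 v)"
  "!!v \<psi>. v \<in> V ==> \<exists>l\<in>R1 v. ((%t. wm (mt (\<psi>, t)) [v]) \<longlongrightarrow> l) at_top" by metis
 have "\<exists>R. finite R \<and> (\<forall>\<psi>. \<exists>l\<in>R. ((%t. wm (mt (\<psi>, t)) [v, w]) \<longlongrightarrow> l) at_top)" if "v \<in> V" "w \<in> V" for v w
  by (rule *) (use field_closed(3)[OF FC full_tr_families(2)[OF that] full_tr_families(1)[OF that]] that
   in \<open>simp add: mt_def full.gibbs_pair\<close>)
 then obtain R2 where R2: "!!v w. v \<in> V ==> w \<in> V ==> finite (R2 v w)"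
  "!!v w \<psi>. v \<in> V ==> w \<in> V ==> \<exists>l\<in>R2 v w. ((%t. wm (mt (\<psi>, t)) [v, w]) \<longlongrightarrow> l) at_top" by metis
 define R where "R = insert 0 ((\<Union>v\<in>V. R1 v) \<union> (\<Union>v\<in>V. \<Union>w\<in>V. R2 v w))"
 show ?thesis
 proof (rule that[of R])
  show "finite R" unfolding R_def using R1(1) R2(1) finite_V by auto
  show "\<exists>l\<in>R. ((%t. wm (full.gibbs (%v. t * \<psi> v)) [v]) \<longlongrightarrow> l) at_top" for \<psi> v
  proof (cases "v \<in> V")
   case True
   then show ?thesis using R1(2)[OF True, of \<psi>] unfolding R_def mt_def by auto
  qed (auto simp: full.gibbs_single R_def)
  show "\<exists>l\<in>R. ((%t. wm (full.gibbs (%v. t * \<psi> v)) [v, w]) \<longlongrightarrow> l) at_top" for \<psi> v w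
  proof (cases "v \<in> V \<and> w \<in> V")
   case True
   then show ?thesis using R2(2)[of v w \<psi>] unfolding R_def mt_def by auto
  next
   case False
   then have "wm (full.gibbs \<psi>) [v, w] = 0" for \<psi>
    using full.gibbs_outside[of "[v, w]" \<psi>] by auto
   then show ?thesis by (auto simp: R_def)
  qed
 qed
qed

end

subsection \<open>The zero-temperature limit\<close>

text \<open>Limiting probabilities may be 0, where \<open>ln\<close> is not continuous; near 0 the
  product is dominated by \<open>2 * sqrt x\<close>.\<close>

lemma tendsto_x_ln_x:
 fixes f :: "'a => real"
 assumes f: "(f \<longlongrightarrow> l) F" and nn: "!!t. f t \<ge> 0" and l: "l \<ge> 0"
 shows "((%t. f t * ln (f t)) \<longlongrightarrow> l * ln l) F"
proof (cases "l = 0")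
 case False
 then show ?thesis using f by (intro tendsto_mult tendsto_ln) auto
next
 case True
 have bound: "\<bar>x * ln x\<bar> \<le> 2 * sqrt x" if x: "0 \<le> x" "x < 1" for x :: real
 proof (cases "x = 0")
  case False
  then have s: "sqrt x > 0" using x by simp
  have "ln (1 / sqrt x) \<le> 1 / sqrt x - 1" using s by (intro ln_le_minus_one) simp
  then have "- ln x \<le> 2 / sqrt x" using x False s by (simp add: ln_div ln_sqrt)
  then have "x * - ln x \<le> x * (2 / sqrt x)" using x by (intro mult_left_mono) auto
  also have "\<dots> = 2 * (x / sqrt x)" by simp
  also have "\<dots> = 2 * sqrt x" using x by (simp only: real_div_sqrt)
  finally show ?thesis using x False by (simp add: abs_mult)
 qed simp
 have "((%t. 2 * sqrt (f t)) \<longlongrightarrow> 2 * sqrt l) F" by (intro tendsto_intros f)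
 then have "((%t. 2 * sqrt (f t)) \<longlongrightarrow> 0) F" using True by simp
 moreover have "\<forall>\<^sub>F t in F. norm (f t * ln (f t)) \<le> 2 * sqrt (f t)"
  using order_tendstoD(2)[OF f, of 1] True nn bound by (auto elim!: eventually_mono)
 ultimately have "((%t. f t * ln (f t)) \<longlongrightarrow> 0) F" by (rule Lim_null_comparison[rotated])
 then show ?thesis using True by simp
qed

lemma recurrent_max_edges:
 assumes "strongly_connected V E" shows "recurrent (max_edges V E \<psi>)"
proof -
 have "finite E" using strongly_connectedD(1,3)[OF assms] by (meson finite_SigmaI finite_subset)
 then show ?thesis
  unfolding recurrent_def
  using max_edges_subset[OF assms] max_edges_nonempty[OF assms] max_edges_recurrent[OF assms]
  by (auto intro: finite_subset)
qed

text \<open>The spectral radius of the adjacency matrix of a component; its logarithm is the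
  topological entropy of the corresponding subshift.\<close>

definition growth :: "('v \<times> 'v) set => 'v set => real" where
 "growth F K = pf_val K (edge_weight (restrict_edges F K) (%_. 0))"

definition top_components :: "('v \<times> 'v) set => 'v set set" where
 "top_components F = {K \<in> components F. \<forall>K'\<in>components F. growth F K' \<le> growth F K}"

lemma top_components_nonempty:
 assumes "recurrent F" shows "finite (top_components F)" "top_components F ~= {}"
proof -
 have fin: "finite (components F)" by (rule finite_components[OF assms])
 then show "finite (top_components F)" by (simp add: top_components_def)
 have ne: "components F ~= {}" using assms by (auto simp: components_def recurrent_def)
 have "Max (growth F ` components F) \<in> growth F ` components F" using fin ne by (intro Max_in) auto
 then obtain K where "K \<in> components F" "growth F K = Max (growth F ` components F)" by force
 then show "top_components F ~= {}" using fin by (auto simp: top_components_def)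
qed

section \<open>Maximal entropy on the components of a recurrent edge set\<close>

locale component_system = transitive_coding X V E c
 for X :: "(nat => nat) set" and V :: "'v set" and E and c +
 fixes F :: "('v \<times> 'v) set"
 assumes recF: "recurrent F" and FE: "F \<subseteq> E"
begin

abbreviation "cgibbs K \<equiv> gibbs_graph.gibbs X c K (restrict_edges F K) (%_. 0)"
abbreviation "ctr K \<equiv> gibbs_graph.tr K (restrict_edges F K) (%_. 0)"
abbreviation "cst K \<equiv> gibbs_graph.st K (restrict_edges F K) (%_. 0)"

definition comp :: "'v => 'v set" where "comp v = F\<^sup>* `` {v}"

lemma component_graph: "K \<in> components F ==> entropy_graph X V E c K (restrict_edges F K)"
proof (unfold_locales)
 assume "K \<in> components F"
 then show "strongly_connected K (restrict_edges F K)" by (rule strongly_connected_component[OF recF])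
 show "restrict_edges F K \<subseteq> E" using FE by (auto simp: restrict_edges_def)
qed

lemma growth_lam: "K \<in> components F ==> gibbs_graph.lam K (restrict_edges F K) (%_. 0) = growth F K"
proof -
 assume "K \<in> components F"
 then interpret K: entropy_graph X V E c K "restrict_edges F K" by (rule component_graph)
 show ?thesis by (simp add: K.lam_def K.wt_def growth_def)
qed

lemma growth_ge_1: "K \<in> components F ==> growth F K \<ge> 1"
 using entropy_graph.lam_ge_1[OF component_graph] growth_lam by simp

lemma comp_component: "v \<in> Domain F ==> comp v \<in> components F"
 by (auto simp: components_def comp_def)

lemma component_eq: "K \<in> components F ==> v \<in> K ==> comp v = K"
 using components_disjoint[OF recF] by (simp add: comp_def)

lemma component_Domain: "K \<in> components F ==> K \<subseteq> Domain F"
 by (rule components_subset[OF recF])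

lemma comp_self: "v \<in> comp v" by (simp add: comp_def)

lemma Domain_V: "Domain F \<subseteq> V" using FE E_subset by blast

lemma component_V: "K \<in> components F ==> K \<subseteq> V" using component_Domain Domain_V by blast

lemma sum_components:
 assumes "!!v. v \<in> V ==> v \<notin> Domain F ==> f v = 0"
 shows "(\<Sum>v\<in>V. f v) = (\<Sum>K\<in>components F. \<Sum>v\<in>K. f v)"
proof -
 have "(\<Sum>v\<in>V. f v) = (\<Sum>v\<in>Domain F. f v)"
  by (rule sum.mono_neutral_right[OF finite_V Domain_V]) (use assms in auto)
 also have "Domain F = \<Union> (components F)"
  using component_Domain comp_component comp_self by blast
 also have "(\<Sum>v\<in>\<Union> (components F). f v) = (\<Sum>K\<in>components F. \<Sum>v\<in>K. f v)"
 proof (rule sum.Union_disjoint[unfolded o_def])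
  show "\<forall>A\<in>components F. finite A" using component_V finite_V finite_subset by blast
  show "\<forall>A\<in>components F. \<forall>B\<in>components F. A ~= B --> A \<inter> B = {}" using component_eq by blast
 qed
 finally show ?thesis .
qed

lemma ctr_row:
 assumes v: "v \<in> Domain F" shows "(\<Sum>w\<in>V. ctr (comp v) v w) = 1" "0 < ctr (comp v) v w \<longleftrightarrow> (v, w) \<in> F"
proof -
 interpret K: entropy_graph X V E c "comp v" "restrict_edges F (comp v)"
  by (rule component_graph[OF comp_component[OF v]])
 have "(\<Sum>w\<in>V. ctr (comp v) v w) = (\<Sum>w\<in>comp v. ctr (comp v) v w)"
  by (rule sum.mono_neutral_right[OF finite_V K.KV]) (auto simp: K.tr_def)
 then show "(\<Sum>w\<in>V. ctr (comp v) v w) = 1" using K.tr_row comp_self by simp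
 show "0 < ctr (comp v) v w \<longleftrightarrow> (v, w) \<in> F"
  using K.tr_pos_iff restrict_edges_component[OF recF comp_component[OF v] comp_self] by simp
qed

text \<open>Gibbs' inequality against the transition probabilities of the components; the lower bound on
 the entropy forces equality.\<close>
lemma max_entropy_circulation:
 assumes p: "circulation V E p" and supp: "!!v w. p v w > 0 ==> (v, w) \<in> F"
  and P: "!!v. v \<in> V ==> (\<Sum>w\<in>V. p v w) = P v" and r: "r \<ge> 1" "!!K. K \<in> components F ==> growth F K \<le> r"
  and ent: "ln r \<le> (\<Sum>v\<in>V. \<Sum>w\<in>V. p v w * (ln (P v) - ln (p v w)))"
  and K: "K \<in> components F" and v: "v \<in> K"
 shows "p v w = P v * ctr K v w" "P v = (\<Sum>v\<in>K. P v) * cst K v" "P v ~= 0 ==> growth F K = r"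
proof -
 note c = circulationD[OF p]
 \<comment> \<open>The comparison keeps the vertex distribution \<open>P\<close> of \<open>p\<close>
   but replaces its transitions by those of the entropy-maximizing chain of each component.\<close>
 define q where "q v w = (if v \<in> Domain F then P v * ctr (comp v) v w else 0)" for v w
 have Pnn: "P v \<ge> 0" if "v \<in> V" for v unfolding P[OF that, symmetric] by (intro sum_nonneg c(1))
 have P_ge: "p v w \<le> P v" if "v \<in> V" "w \<in> V" for v w
  unfolding P[OF that(1), symmetric] using that finite_V c(1) by (intro member_le_sum) auto
 have P0: "P v = 0" if "v \<in> V" "v \<notin> Domain F" for v
 proof -
  have "p v w = 0" for w using supp[of v w] that(2) c(1)[of v w] by (cases "p v w = 0") auto
  then show ?thesis using P[OF that(1)] by simp
 qed
 have sumP: "(\<Sum>v\<in>V. P v) = 1" using c(4) P by simp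
 have qrow: "(\<Sum>w\<in>V. q v w) = P v" if "v \<in> V" for v
 proof (cases "v \<in> Domain F")
  case True
  then show ?thesis using ctr_row(1)[OF True] by (simp add: q_def flip: sum_distrib_left)
 qed (use P0[OF that] in \<open>simp add: q_def\<close>)
 have qnn: "q v w \<ge> 0" if "v \<in> V" for v w
 proof (cases "v \<in> Domain F")
  case True
  interpret K: entropy_graph X V E c "comp v" "restrict_edges F (comp v)"
   by (rule component_graph[OF comp_component[OF True]])
  show ?thesis using Pnn[OF that] K.tr_nonneg by (simp add: q_def)
 qed (simp add: q_def)
 have pos: "P v > 0" "(v, w) \<in> F" "v \<in> Domain F" "q v w > 0" if "v \<in> V" "w \<in> V" "p v w > 0" for v w
 proof -
  show e: "(v, w) \<in> F" "v \<in> Domain F" using supp[OF that(3)] by auto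
  show "P v > 0" using P_ge[OF that(1,2)] that(3) by simp
  then show "q v w > 0" using e ctr_row(2)[OF e(2)] by (simp add: q_def)
 qed
 \<comment> \<open>The logarithms of the eigenvectors of all components form one function on the
   vertices. Its coboundary is the right one on \<open>F\<close>, because edges of \<open>F\<close>
   stay within a component.\<close>
 define u where "u v = ln (gibbs_graph.rv (comp v) (restrict_edges F (comp v)) (%_. 0) v)" for v
 have trm: "p v w * (ln (P v) - ln (q v w)) = p v w * ln (growth F (comp v)) + (p v w * u v - p v w * u w)"
  if vw: "v \<in> V" "w \<in> V" for v w
 proof (cases "p v w = 0")
  case False
  then have pp: "p v w > 0" using c(1)[of v w] by simp
  note d = pos[OF vw pp]
  interpret K: entropy_graph X V E c "comp v" "restrict_edges F (comp v)"
   by (rule component_graph[OF comp_component[OF d(3)]])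
  have w: "w \<in> comp v" using d(2) by (auto simp: comp_def)
  then have kw: "comp w = comp v" using component_eq[OF comp_component[OF d(3)]] by simp
  have e: "(v, w) \<in> restrict_edges F (comp v)" using d(2) w comp_self by (simp add: restrict_edges_def)
  have rp: "K.rv v > 0" "K.rv w > 0" using K.rv_pos w comp_self by auto
  have "ctr (comp v) v w = K.rv w / (K.lam * K.rv v)"
   using w comp_self e by (simp add: K.tr_def K.wt_edge)
  then have "ln (q v w) = ln (P v) + ln (K.rv w) - (ln K.lam + ln (K.rv v))"
   using d rp K.lam_pos by (simp add: q_def ln_mult_pos ln_div)
  then have eq: "ln (P v) - ln (q v w) = ln (growth F (comp v)) + (u v - u w)"
   by (simp add: u_def kw growth_lam[OF comp_component[OF d(3)]])
  show ?thesis unfolding eq by (simp add: algebra_simps)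
 qed simp
 have cross: "(\<Sum>v\<in>V. \<Sum>w\<in>V. p v w * (ln (P v) - ln (q v w))) = (\<Sum>v\<in>V. P v * ln (growth F (comp v)))"
 proof -
  have "(\<Sum>v\<in>V. \<Sum>w\<in>V. p v w * (ln (P v) - ln (q v w)))
    = (\<Sum>v\<in>V. \<Sum>w\<in>V. p v w * ln (growth F (comp v))) + ((\<Sum>v\<in>V. \<Sum>w\<in>V. p v w * u v) - (\<Sum>v\<in>V. \<Sum>w\<in>V. p v w * u w))"
   by (simp add: trm sum.distrib sum_subtractf)
  also have "\<dots> = (\<Sum>v\<in>V. (\<Sum>w\<in>V. p v w) * ln (growth F (comp v)))"
   using circulation_coboundary[OF finite_V p, of u] by (simp add: sum_distrib_right)
  finally show ?thesis by (simp add: P)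
 qed
 let ?I = "V \<times> V"
 have gibbs_prems: "finite ?I" "!!i. i \<in> ?I ==> 0 \<le> case_prod p i" "!!i. i \<in> ?I ==> 0 \<le> case_prod q i"
  "!!i. i \<in> ?I ==> case_prod p i > 0 ==> case_prod q i > 0" "(\<Sum>i\<in>?I. case_prod q i) \<le> (\<Sum>i\<in>?I. case_prod p i)"
  using finite_V c(1) qnn pos(4) qrow P by (auto simp: sum.cartesian_product[symmetric])
 have g1: "(\<Sum>v\<in>V. \<Sum>w\<in>V. p v w * ln (q v w)) \<le> (\<Sum>v\<in>V. \<Sum>w\<in>V. p v w * ln (p v w))"
  using gibbs(1)[OF gibbs_prems] by (simp add: sum.cartesian_product split_beta)
 have lnle: "P v * ln (growth F (comp v)) \<le> P v * ln r" if "v \<in> V" for v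
 proof (cases "v \<in> Domain F")
  case True
  have "ln (growth F (comp v)) \<le> ln r"
   using r(2)[OF comp_component[OF True]] growth_ge_1[OF comp_component[OF True]] by simp
  then show ?thesis using Pnn[OF that] by (rule mult_left_mono)
 qed (use P0[OF that] in simp)
 have le_r: "(\<Sum>v\<in>V. P v * ln (growth F (comp v))) \<le> ln r"
 proof -
  have "(\<Sum>v\<in>V. P v * ln (growth F (comp v))) \<le> (\<Sum>v\<in>V. P v * ln r)" by (intro sum_mono lnle)
  then show ?thesis using sumP by (simp flip: sum_distrib_right)
 qed
 have diff: "(\<Sum>v\<in>V. \<Sum>w\<in>V. p v w * (ln (P v) - ln (p v w)))
   = (\<Sum>v\<in>V. P v * ln (growth F (comp v))) - ((\<Sum>v\<in>V. \<Sum>w\<in>V. p v w * ln (p v w)) - (\<Sum>v\<in>V. \<Sum>w\<in>V. p v w * ln (q v w)))"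
  unfolding cross[symmetric] by (simp add: right_diff_distrib sum_subtractf)
 \<comment> \<open>The entropy is at least \<open>ln r\<close> by assumption and at most the mean of
   the logarithmic growth rates, which is at most \<open>ln r\<close>; so both upper bounds are
   attained.\<close>
 have eq1: "(\<Sum>v\<in>V. \<Sum>w\<in>V. p v w * ln (q v w)) = (\<Sum>v\<in>V. \<Sum>w\<in>V. p v w * ln (p v w))"
  and eq2: "(\<Sum>v\<in>V. P v * ln (growth F (comp v))) = ln r"
  using ent g1 le_r diff by linarith+
 have pq: "p v w = q v w" if "v \<in> V" "w \<in> V" for v w
  using gibbs(2)[OF gibbs_prems, of "(v, w)"] eq1 that by (simp add: sum.cartesian_product split_beta)
 have Kv: "comp v = K" "v \<in> Domain F" "v \<in> V" if "v \<in> K" for v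
  using component_eq[OF K that] component_Domain[OF K] component_V[OF K] that by auto
 interpret K: entropy_graph X V E c K "restrict_edges F K" by (rule component_graph[OF K])
 have pK: "p v w = P v * ctr K v w" if v: "v \<in> K" for v w
 proof (cases "w \<in> V")
  case True
  then show ?thesis using pq[OF Kv(3)[OF v] True] Kv[OF v] by (simp add: q_def)
 next
  case False
  then have "(v, w) \<notin> E" "w \<notin> K" using E_subset component_V[OF K] by auto
  then show ?thesis using c(2) by (simp add: K.tr_def)
 qed
 then show "p v w = P v * ctr K v w" using v by blast
 have "(\<Sum>v\<in>K. P v * ctr K v w) = P w" if w: "w \<in> K" for w
 proof -
  have "(\<Sum>v\<in>K. P v * ctr K v w) = (\<Sum>v\<in>K. p v w)" using pK by simp
  also have "\<dots> = (\<Sum>v\<in>V. p v w)"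
  proof (rule sum.mono_neutral_left[OF finite_V component_V[OF K]], rule ballI)
   fix v assume v: "v \<in> V - K"
   then have "(v, w) \<notin> F" using components_edge[OF recF K] w by blast
   then show "p v w = 0" using supp[of v w] c(1)[of v w] by (cases "p v w = 0") auto
  qed
  also have "\<dots> = P w" using c(3)[OF Kv(3)[OF w]] P[OF Kv(3)[OF w]] by simp
  finally show ?thesis .
 qed
 from K.stationary_unique[of P, OF this v] show "P v = (\<Sum>v\<in>K. P v) * cst K v" by simp
 have "(\<Sum>v\<in>V. P v * ln r - P v * ln (growth F (comp v))) = 0"
  using eq2 sumP by (simp add: sum_subtractf flip: sum_distrib_right)
 then have "P v * ln r - P v * ln (growth F (comp v)) = 0"
  using lnle Kv(3)[OF v] finite_V by (subst (asm) sum_nonneg_eq_0_iff) auto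
 then show "P v ~= 0 ==> growth F K = r"
  using Kv(1)[OF v] r(1) growth_ge_1[OF K] by (simp flip: right_diff_distrib)
qed

end

text \<open>The entropy in terms of probabilities of words of length 1 and 2 only, a form in which
  it passes to the limit.\<close>

lemma (in gibbs_graph) gibbs_pair_entropy:
 "measure_entropy shift_map gibbs
  = ereal ((\<Sum>v\<in>V. wm gibbs [v] * ln (wm gibbs [v])) - (\<Sum>v\<in>V. \<Sum>w\<in>V. wm gibbs [v, w] * ln (wm gibbs [v, w])))"
proof -
 interpret gen_system gibbs shift_map c by (rule gen_system[OF gibbs_inv])
 have trm: "wm gibbs [v, w] * - ln (tr v w) = wm gibbs [v, w] * ln (wm gibbs [v]) - wm gibbs [v, w] * ln (wm gibbs [v, w])" for v w
 proof (cases "wm gibbs [v, w] = 0")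
  case False
  then have v: "v \<in> K" and t: "tr v w ~= 0" by (auto simp: gibbs_pair split: if_splits)
  have "ln (wm gibbs [v, w]) = ln (wm gibbs [v]) + ln (tr v w)"
   using v st_pos[OF v] t tr_nonneg[of v w] by (simp add: gibbs_pair gibbs_single ln_mult_pos)
  then show ?thesis by (simp add: algebra_simps)
 qed simp
 have "cross_entropy tr = (\<Sum>v\<in>V. \<Sum>w\<in>V. wm gibbs [v, w] * - ln (tr v w))"
  by (simp add: cross_entropy_def prw_eq_wm[OF gibbs_inv] alphabet_eq[OF gibbs_inv])
 also have "\<dots> = (\<Sum>v\<in>V. (\<Sum>w\<in>V. wm gibbs [v, w]) * ln (wm gibbs [v])) - (\<Sum>v\<in>V. \<Sum>w\<in>V. wm gibbs [v, w] * ln (wm gibbs [v, w]))"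
  unfolding trm by (simp add: sum_subtractf sum_distrib_right)
 finally show ?thesis
  using variational_gibbs cross_entropy_eq[OF gibbs_inv gibbs_supported] wm_single[OF gibbs_inv] by simp
qed

section \<open>Limits of the equilibrium states\<close>

context transitive_coding
begin

definition "limit_prob \<psi> v = Lim at_top (%t::real. wm (full.gibbs (%v. t * \<psi> v)) [v])"
definition "limit_pair \<psi> v w = Lim at_top (%t::real. wm (full.gibbs (%v. t * \<psi> v)) [v, w])"

lemma limit_prob: "((%t. wm (full.gibbs (%v. t * \<psi> v)) [v]) \<longlongrightarrow> limit_prob \<psi> v) at_top"
 and limit_pair: "((%t. wm (full.gibbs (%v. t * \<psi> v)) [v, w]) \<longlongrightarrow> limit_pair \<psi> v w) at_top"
proof -
 obtain R where R: "!!\<psi> v. \<exists>l\<in>R. ((%t. wm (full.gibbs (%v. t * \<psi> v)) [v]) \<longlongrightarrow> l) at_top"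
  "!!\<psi> v w. \<exists>l\<in>R. ((%t. wm (full.gibbs (%v. t * \<psi> v)) [v, w]) \<longlongrightarrow> l) at_top"
  by (rule wm_converges) blast
 show "((%t. wm (full.gibbs (%v. t * \<psi> v)) [v]) \<longlongrightarrow> limit_prob \<psi> v) at_top"
  using R(1)[of \<psi> v] tendsto_Lim[OF trivial_limit_at_top_linorder] unfolding limit_prob_def by blast
 show "((%t. wm (full.gibbs (%v. t * \<psi> v)) [v, w]) \<longlongrightarrow> limit_pair \<psi> v w) at_top"
  using R(2)[of \<psi> v w] tendsto_Lim[OF trivial_limit_at_top_linorder] unfolding limit_pair_def by blast
qed

lemma limit_prob_finite: obtains R where "finite R" "!!\<psi> v. limit_prob \<psi> v \<in> R"
proof -
 obtain R where R: "finite R" "!!\<psi> v. \<exists>l\<in>R. ((%t. wm (full.gibbs (%v. t * \<psi> v)) [v]) \<longlongrightarrow> l) at_top"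
  by (rule wm_converges) blast
 have "limit_prob \<psi> v \<in> R" for \<psi> v
  using R(2)[of \<psi> v] tendsto_unique[OF trivial_limit_at_top_linorder limit_prob] by blast
 then show ?thesis using R(1) that by blast
qed

lemma limit_circulation:
 shows "circulation V E (limit_pair \<psi>)" "(\<Sum>w\<in>V. limit_pair \<psi> v w) = limit_prob \<psi> v"
  "limit_prob \<psi> v \<ge> 0"
proof -
 show "circulation V E (limit_pair \<psi>)"
  by (rule circulation_tendsto[OF trivial_limit_at_top_linorder circulation_measure[OF full.gibbs_inv] limit_pair])
 have "((%t. \<Sum>w\<in>V. wm (full.gibbs (%v. t * \<psi> v)) [v, w]) \<longlongrightarrow> (\<Sum>w\<in>V. limit_pair \<psi> v w)) at_top"
  by (intro tendsto_sum limit_pair)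
 then show "(\<Sum>w\<in>V. limit_pair \<psi> v w) = limit_prob \<psi> v"
  using tendsto_unique[OF trivial_limit_at_top_linorder _ limit_prob] wm_single[OF full.gibbs_inv] by simp
 show "limit_prob \<psi> v \<ge> 0" by (rule tendsto_lowerbound[OF limit_prob]) auto
qed

lemma full_supported: "\<nu> \<in> inv_measures ==> full.supported \<nu>"
 unfolding full.supported_def using wm_not_edge by fastforce

lemma full_le: "\<nu> \<in> inv_measures ==> measure_entropy shift_map \<nu> \<le> ereal (ln (full.lam \<psi>) - (\<Sum>v\<in>V. wm \<nu> [v] * \<psi> v))"
 by (rule full.variational_le[OF _ full_supported])

lemma circ_val_wm: "\<nu> \<in> inv_measures ==> circ_val V \<psi> (%v w. wm \<nu> [v, w]) = (\<Sum>v\<in>V. wm \<nu> [v] * \<psi> v)"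
 by (simp add: circ_val_def wm_single sum_distrib_right)

lemma component_system_max: "component_system X V E c (max_edges V E \<psi>)"
 by unfold_locales (rule recurrent_max_edges[OF SC], rule max_edges_subset[OF SC])

text \<open>With \<open>\<nu>\<close> of entropy \<open>ln r\<close> and maximizing, the variational principle gives
 \<open>ln r \<le> h (\<mu>\<^sub>t) - t (max \<psi> - \<integral>\<psi> d\<mu>\<^sub>t)\<close>, and the entropies are bounded.\<close>
lemma limit_maximizing:
 assumes r: "r > 0" and \<nu>: "\<nu> \<in> inv_measures" "measure_entropy shift_map \<nu> = ereal (ln r)"
  and max: "max_circ V E \<psi> (%v w. wm \<nu> [v, w])"
 shows "max_circ V E \<psi> (limit_pair \<psi>)"
  "ln r \<le> (\<Sum>v\<in>V. \<Sum>w\<in>V. limit_pair \<psi> v w * (ln (limit_prob \<psi> v) - ln (limit_pair \<psi> v w)))"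
proof -
 let ?m = "%t. full.gibbs (%v. t * \<psi> v)"
 have m: "?m t \<in> inv_measures" for t by (rule full.gibbs_inv)
 define I where "I \<nu> = (\<Sum>v\<in>V. wm \<nu> [v] * \<psi> v)" for \<nu>
 define h where "h t = (\<Sum>v\<in>V. wm (?m t) [v] * ln (wm (?m t) [v])) - (\<Sum>v\<in>V. \<Sum>w\<in>V. wm (?m t) [v, w] * ln (wm (?m t) [v, w]))" for t
 have h: "measure_entropy shift_map (?m t) = ereal (h t)" for t
  unfolding h_def by (rule full.gibbs_pair_entropy)
 have I: "(\<Sum>v\<in>V. wm \<mu> [v] * (t * \<psi> v)) = t * I \<mu>" for \<mu> t
  by (simp add: I_def sum_distrib_left mult.left_commute)
 have low: "ln r + t * (I \<nu> - I (?m t)) \<le> h t" for t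
 proof -
  have "ln r \<le> ln (full.lam (%v. t * \<psi> v)) - t * I \<nu>"
   using full_le[OF \<nu>(1), of "%v. t * \<psi> v"] \<nu>(2) by (simp add: I)
  moreover have "h t = ln (full.lam (%v. t * \<psi> v)) - t * I (?m t)"
   using full.variational_gibbs[of "%v. t * \<psi> v"] h[of t] by (simp add: I)
  ultimately show ?thesis by (simp add: right_diff_distrib)
 qed
 \<comment> \<open>The variational principle with potential 0 bounds the entropies of all invariant
   measures.\<close>
 define H where "H = ln (full.lam (%_. 0))"
 have up: "h t \<le> H" for t using full_le[OF m, of t "%_. 0"] h[of t] by (simp add: H_def)
 have Im: "I (?m t) \<le> I \<nu>" for t
 proof -
  have "circ_val V \<psi> (%v w. wm (?m t) [v, w]) \<le> circ_val V \<psi> (%v w. wm \<nu> [v, w])"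
   using max circulation_measure[OF m[of t]] unfolding max_circ_def by blast
  then show ?thesis by (simp add: circ_val_wm \<nu>(1) m I_def)
 qed
 have limI: "((%t. I (?m t)) \<longlongrightarrow> (\<Sum>v\<in>V. limit_prob \<psi> v * \<psi> v)) at_top"
  unfolding I_def by (intro tendsto_intros limit_prob)
 have "I \<nu> \<le> (\<Sum>v\<in>V. limit_prob \<psi> v * \<psi> v)"
 proof (rule tendsto_le[OF trivial_limit_at_top_linorder limI])
  have "((%t. (H - ln r) / t) \<longlongrightarrow> 0) at_top"
   by (intro tendsto_divide_0[OF tendsto_const] filterlim_at_top_imp_at_infinity filterlim_ident)
  then have "((%t. I \<nu> - (H - ln r) / t) \<longlongrightarrow> I \<nu> - 0) at_top" by (intro tendsto_diff tendsto_const)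
  then show "((%t. I \<nu> - (H - ln r) / t) \<longlongrightarrow> I \<nu>) at_top" by simp
  show "\<forall>\<^sub>F t in at_top. I \<nu> - (H - ln r) / t \<le> I (?m t)"
   using eventually_gt_at_top[of 0]
  proof eventually_elim
   case (elim t)
   have "t * (I \<nu> - I (?m t)) \<le> H - ln r" using low[of t] up[of t] by linarith
   then show ?case using elim by (simp add: field_simps)
  qed
 qed
 moreover have "circ_val V \<psi> (limit_pair \<psi>) = (\<Sum>v\<in>V. limit_prob \<psi> v * \<psi> v)"
  using limit_circulation(2)[of \<psi>] by (simp add: circ_val_def flip: sum_distrib_right)
 ultimately have ge: "circ_val V \<psi> (%v w. wm \<nu> [v, w]) \<le> circ_val V \<psi> (limit_pair \<psi>)"
  by (simp add: circ_val_wm \<nu>(1) I_def)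
 then show "max_circ V E \<psi> (limit_pair \<psi>)"
  using max limit_circulation(1) unfolding max_circ_def by (meson order_trans)
 have "(h \<longlongrightarrow> (\<Sum>v\<in>V. limit_prob \<psi> v * ln (limit_prob \<psi> v)) - (\<Sum>v\<in>V. \<Sum>w\<in>V. limit_pair \<psi> v w * ln (limit_pair \<psi> v w))) at_top"
  unfolding h_def using limit_circulation(3) circulationD(1)[OF limit_circulation(1)]
  by (intro tendsto_diff tendsto_sum tendsto_x_ln_x limit_prob limit_pair) auto
 moreover have "\<forall>\<^sub>F t in at_top. ln r \<le> h t"
  using eventually_ge_at_top[of 0]
 proof eventually_elim
  case (elim t)
  then have "0 \<le> t * (I \<nu> - I (?m t))" using Im[of t] by simp
  then show ?case using low[of t] by linarith
 qed
 ultimately have "ln r \<le> (\<Sum>v\<in>V. limit_prob \<psi> v * ln (limit_prob \<psi> v)) - (\<Sum>v\<in>V. \<Sum>w\<in>V. limit_pair \<psi> v w * ln (limit_pair \<psi> v w))"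
  by (intro tendsto_lowerbound) auto
 also have "\<dots> = (\<Sum>v\<in>V. \<Sum>w\<in>V. limit_pair \<psi> v w * (ln (limit_prob \<psi> v) - ln (limit_pair \<psi> v w)))"
  using limit_circulation(2)[of \<psi>] by (simp add: right_diff_distrib sum_subtractf flip: sum_distrib_right)
 finally show "ln r \<le> (\<Sum>v\<in>V. \<Sum>w\<in>V. limit_pair \<psi> v w * (ln (limit_prob \<psi> v) - ln (limit_pair \<psi> v w)))" .
qed

definition "coef \<psi> K = (\<Sum>v\<in>K. limit_prob \<psi> v)"

abbreviation "comp_gibbs F K \<equiv> gibbs_graph.gibbs X c K (restrict_edges F K) (%_. 0)"

lemma comp_gibbs_max:
 assumes "K \<in> components (max_edges V E \<psi>)"
 shows "max_circ V E \<psi> (%v w. wm (comp_gibbs (max_edges V E \<psi>) K) [v, w])"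
proof -
 interpret component_system X V E c "max_edges V E \<psi>" by (rule component_system_max)
 interpret K: entropy_graph X V E c K "restrict_edges (max_edges V E \<psi>) K" by (rule component_graph[OF assms])
 have "(v, w) \<in> max_edges V E \<psi>" if "0 < wm K.gibbs [v, w]" for v w
 proof -
  have "(v, w) \<in> restrict_edges (max_edges V E \<psi>) K"
   using K.gibbs_supported that unfolding K.supported_def by blast
  then show ?thesis by (simp add: restrict_edges_def)
 qed
 then show ?thesis using max_circ_iff[OF SC] circulation_measure[OF K.gibbs_inv] by blast
qed

text \<open>The limiting pair distribution restricts to each component as a multiple of the
  entropy-maximizing chain and vanishes where the growth is not maximal. Longer words follow by
  induction, because the equilibrium states are Markov.\<close>

theorem zero_temperature_limit:
 fixes \<psi> :: "'v => real"
 defines "F \<equiv> max_edges V E \<psi>"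
 shows "!!K. K \<in> top_components F ==> 0 \<le> coef \<psi> K \<and> coef \<psi> K \<le> 1"
  and "(\<Sum>K\<in>top_components F. coef \<psi> K) = 1"
  and "!!u. u ~= [] ==> ((%t. wm (full.gibbs (%v. t * \<psi> v)) u)
     \<longlongrightarrow> (\<Sum>K\<in>top_components F. coef \<psi> K * wm (comp_gibbs F K) u)) at_top"
proof -
 interpret component_system X V E c F unfolding F_def by (rule component_system_max)
 let ?m = "%t. full.gibbs (%v. t * \<psi> v)"
 have m: "?m t \<in> inv_measures" for t by (rule full.gibbs_inv)
 let ?p = "limit_pair \<psi>" and ?P = "limit_prob \<psi>"
 obtain K0 where K0: "K0 \<in> top_components F" using top_components_nonempty[OF recF] by blast
 then have K0c: "K0 \<in> components F" by (simp add: top_components_def)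
 interpret K0: entropy_graph X V E c K0 "restrict_edges F K0" by (rule component_graph[OF K0c])
 define r where "r = growth F K0"
 have r1: "r \<ge> 1" unfolding r_def by (rule growth_ge_1[OF K0c])
 have rmax: "growth F K \<le> r" if "K \<in> components F" for K
  using K0 that by (simp add: top_components_def r_def)
 have top: "K \<in> top_components F \<longleftrightarrow> K \<in> components F \<and> growth F K = r" for K
  using rmax K0 by (auto simp: top_components_def r_def intro: antisym)
 have "measure_entropy shift_map K0.gibbs = ereal (ln r)"
  using K0.entropy_gibbs growth_lam[OF K0c] by (simp add: r_def)
 note lim = limit_maximizing[OF _ K0.gibbs_inv this comp_gibbs_max[OF K0c[unfolded F_def], folded F_def]]
 have mx: "max_circ V E \<psi> ?p"
  and ent: "ln r \<le> (\<Sum>v\<in>V. \<Sum>w\<in>V. ?p v w * (ln (?P v) - ln (?p v w)))"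
  using lim r1 by simp_all
 have circ: "circulation V E ?p" by (rule limit_circulation(1))
 have supp: "(v, w) \<in> F" if "?p v w > 0" for v w
  using mx that unfolding F_def max_edges_def by blast
 note M = max_entropy_circulation[OF circ supp limit_circulation(2) r1 rmax ent]
 have P_eq: "?P v = coef \<psi> K * cst K v" if "K \<in> components F" "v \<in> K" for K v
  unfolding coef_def by (rule M(2)[OF _ _ that])
 have P0: "?P v = 0" if "v \<notin> Domain F" for v
 proof (cases "v \<in> V")
  case True
  have "?p v w = 0" for w
   using supp[of v w] that circulationD(1)[OF circ, of v w] by (cases "?p v w = 0") auto
  then show ?thesis using limit_circulation(2)[of \<psi> v] by simp
 next
  case False
  then have "wm (?m t) [v] = 0" for t by (simp add: full.gibbs_single)
  then show ?thesis using limit_prob[of \<psi> v] by (simp add: tendsto_const_iff)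
 qed
 have coef0: "coef \<psi> K = 0" if "K \<in> components F" "K \<notin> top_components F" for K
  unfolding coef_def using M(3)[OF _ _ that(1)] that top by (intro sum.neutral) blast
 have coef_nn: "coef \<psi> K \<ge> 0" for K unfolding coef_def by (intro sum_nonneg limit_circulation(3))
 have fin: "finite (components F)" by (rule finite_components[OF recF])
 have top_sub: "top_components F \<subseteq> components F" by (auto simp: top_components_def)
 have sumtop: "(\<Sum>K\<in>top_components F. coef \<psi> K * g K) = (\<Sum>K\<in>components F. coef \<psi> K * g K)" for g
  by (rule sum.mono_neutral_left[OF fin top_sub]) (use coef0 in auto)
 have "(\<Sum>v\<in>V. ?P v) = 1" using circulationD(4)[OF circ] limit_circulation(2)[of \<psi>] by simp
 then have tot: "(\<Sum>K\<in>components F. coef \<psi> K) = 1"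
  using sum_components[of ?P] P0 by (simp add: coef_def)
 then show total: "(\<Sum>K\<in>top_components F. coef \<psi> K) = 1" using sumtop[of "%_. 1"] by simp
 show "0 \<le> coef \<psi> K \<and> coef \<psi> K \<le> 1" if "K \<in> top_components F" for K
  using coef_nn member_le_sum[of K "components F" "coef \<psi>"] tot that top_sub fin by auto
 have K_inv: "comp_gibbs F K \<in> inv_measures" if "K \<in> components F" for K
  by (rule gibbs_graph.gibbs_inv) (use component_graph[OF that] in \<open>simp add: entropy_graph_def\<close>)
 have out: "wm (comp_gibbs F K) u = 0" if "K \<in> components F" "\<not> set u \<subseteq> K" for K u
  using gibbs_graph.gibbs_outside[OF component_graph[OF that(1), unfolded entropy_graph_def] that(2)] .
 \<comment> \<open>A word containing \<open>v\<close> has probability 0 for every component other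
   than that of \<open>v\<close>.\<close>
 have single: "(\<Sum>K\<in>components F. coef \<psi> K * wm (comp_gibbs F K) u) = coef \<psi> (comp v) * wm (comp_gibbs F (comp v)) u"
  if "v \<in> Domain F" "v \<in> set u" for u v
 proof -
  have "(\<Sum>K\<in>components F. coef \<psi> K * wm (comp_gibbs F K) u)
    = (\<Sum>K\<in>{comp v}. coef \<psi> K * wm (comp_gibbs F K) u)"
  proof (rule sum.mono_neutral_right[OF fin])
   show "\<forall>K\<in>components F - {comp v}. coef \<psi> K * wm (comp_gibbs F K) u = 0"
   proof
    fix K assume K: "K \<in> components F - {comp v}"
    then have "v \<notin> K" using component_eq[of K v] by blast
    then show "coef \<psi> K * wm (comp_gibbs F K) u = 0" using out[of K u] K that(2) by auto
   qed
  qed (use comp_component[OF that(1)] in simp)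
  then show ?thesis by simp
 qed
 have single_P: "(\<Sum>K\<in>components F. coef \<psi> K * wm (comp_gibbs F K) [v]) = ?P v" for v
 proof (cases "v \<in> Domain F")
  case True
  note C = comp_component[OF True]
  interpret K: entropy_graph X V E c "comp v" "restrict_edges F (comp v)" by (rule component_graph[OF C])
  show ?thesis unfolding single[OF True, of "[v]", simplified] P_eq[OF C comp_self]
   using comp_self by (simp add: K.gibbs_single)
 next
  case False
  then have "wm (comp_gibbs F K) [v] = 0" if "K \<in> components F" for K
   using component_Domain[OF that] by (intro out[OF that]) auto
  then show ?thesis using P0[OF False] by simp
 qed
 have "((%t. wm (?m t) u) \<longlongrightarrow> (\<Sum>K\<in>components F. coef \<psi> K * wm (comp_gibbs F K) u)) at_top"
  if "u ~= []" for u
  using that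
 proof (induction u rule: rev_induct)
  case (snoc w u)
  show ?case
  proof (cases "u = []")
   case True
   then show ?thesis using limit_prob[of \<psi> w] single_P[of w] by simp
  next
   case False
   define v where "v = last u"
   have v: "v \<in> set u" using False by (simp add: v_def)
   show ?thesis
   \<comment> \<open>If the last letter has limit probability 0, the limiting transition probability
     is not a quotient of limits; instead both sides are squeezed to 0 by the probability of that
     letter.\<close>
   proof (cases "?P v = 0")
    case True
    have le: "wm \<mu> (u @ [w]) \<le> wm \<mu> [v]" if "\<mu> \<in> inv_measures" for \<mu>
    proof -
     have "take 1 (drop (length u - 1) (u @ [w])) = [v]"
      using False by (cases u rule: rev_cases) (auto simp: v_def)
     then show ?thesis using wm_window_le[OF that, of "length u - 1" 1 "u @ [w]"] False by simp
    qed
    have "((%t. wm (?m t) (u @ [w])) \<longlongrightarrow> 0) at_top"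
    proof (rule tendsto_sandwich[where f = "%_. 0" and h = "%t. wm (?m t) [v]"])
     show "\<forall>\<^sub>F t in at_top. wm (?m t) (u @ [w]) \<le> wm (?m t) [v]" using le[OF m] by simp
     show "((%t. wm (?m t) [v]) \<longlongrightarrow> 0) at_top" using limit_prob[of \<psi> v] unfolding True .
    qed simp_all
    moreover have "(\<Sum>K\<in>components F. coef \<psi> K * wm (comp_gibbs F K) (u @ [w])) = 0"
    proof (rule antisym)
     have "(\<Sum>K\<in>components F. coef \<psi> K * wm (comp_gibbs F K) (u @ [w]))
       \<le> (\<Sum>K\<in>components F. coef \<psi> K * wm (comp_gibbs F K) [v])"
      by (rule sum_mono) (rule mult_left_mono[OF le[OF K_inv] coef_nn])
     then show "(\<Sum>K\<in>components F. coef \<psi> K * wm (comp_gibbs F K) (u @ [w])) \<le> 0"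
      using single_P[of v] True by simp
     show "0 \<le> (\<Sum>K\<in>components F. coef \<psi> K * wm (comp_gibbs F K) (u @ [w]))"
      by (intro sum_nonneg mult_nonneg_nonneg coef_nn wm_nonneg)
    qed
    ultimately show ?thesis by simp
   next
    case nz: False
    then have D: "v \<in> Domain F" using P0 by blast
    note C = comp_component[OF D]
    interpret K: entropy_graph X V E c "comp v" "restrict_edges F (comp v)" by (rule component_graph[OF C])
    have vV: "v \<in> V" using D Domain_V by blast
    have tr: "wm (?m t) (u @ [w]) = wm (?m t) u * (wm (?m t) [v, w] / wm (?m t) [v])" for t
     using full.gibbs_markov[OF False, of "%v. t * \<psi> v" w] full.st_pos[OF vV, of "%v. t * \<psi> v"] vV
     by (simp add: v_def full.gibbs_single full.gibbs_pair)
    have "?p v w / ?P v = ctr (comp v) v w" using M(1)[OF _ _ C comp_self, of w] nz by simp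
    then have "((%t. wm (?m t) (u @ [w])) \<longlongrightarrow>
      (\<Sum>K\<in>components F. coef \<psi> K * wm (comp_gibbs F K) u) * ctr (comp v) v w) at_top"
     unfolding tr using tendsto_mult[OF snoc.IH[OF False] tendsto_divide[OF limit_pair[of \<psi> v w] limit_prob[of \<psi> v] nz]] by simp
    moreover have "(\<Sum>K\<in>components F. coef \<psi> K * wm (comp_gibbs F K) u) * ctr (comp v) v w
      = (\<Sum>K\<in>components F. coef \<psi> K * wm (comp_gibbs F K) (u @ [w]))"
     unfolding single[OF D v] single[OF D, of "u @ [w]", simplified, OF disjI2[OF v]]
     using K.gibbs_markov[OF False, of w] by (simp add: v_def)
    ultimately show ?thesis by simp
   qed
  qed
 qed simp
 then show "((%t. wm (?m t) u) \<longlongrightarrow> (\<Sum>K\<in>top_components F. coef \<psi> K * wm (comp_gibbs F K) u)) at_top" if "u ~= []" for u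
  unfolding sumtop using that .
qed

end

section \<open>Subshifts of finite type\<close>

definition word :: "nat => (nat => nat) => nat list" where "word k x = map x [0..<k]"

definition letter_edges :: "nat mat => (nat \<times> nat) set" where
 "letter_edges A = {(i, j). i < dim_row A \<and> j < dim_row A \<and> A $$ (i, j) > 0}"

lemma mat_power_pos_iff:
 assumes A: "A \<in> carrier_mat d d"
 shows "i < d ==> j < d ==> (A ^\<^sub>m n) $$ (i, j) > 0 \<longleftrightarrow> (i, j) \<in> letter_edges A ^^ n"
proof (induction n arbitrary: j)
 case 0
 then show ?case using A by simp
next
 case (Suc n)
 have An: "A ^\<^sub>m n \<in> carrier_mat d d" using A by simp
 have eq: "(A ^\<^sub>m Suc n) $$ (i, j) = (\<Sum>l<d. (A ^\<^sub>m n) $$ (i, l) * A $$ (l, j))"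
  using A An Suc.prems by (simp add: times_mat_def scalar_prod_def atLeast0LessThan)
 have "(\<Sum>l<d. f l) = 0 \<longleftrightarrow> (\<forall>l<d. f l = 0)" for f :: "nat => nat" by auto
 then have "(\<Sum>l<d. f l) > 0 \<longleftrightarrow> (\<exists>l<d. f l > 0)" for f :: "nat => nat" by (metis neq0_conv)
 then have "(A ^\<^sub>m Suc n) $$ (i, j) > 0 \<longleftrightarrow> (\<exists>l<d. (A ^\<^sub>m n) $$ (i, l) > 0 \<and> A $$ (l, j) > 0)"
  unfolding eq by simp
 also have "\<dots> \<longleftrightarrow> (\<exists>l<d. (i, l) \<in> letter_edges A ^^ n \<and> A $$ (l, j) > 0)"
  using Suc.IH Suc.prems(1) by auto
 also have "\<dots> \<longleftrightarrow> (i, j) \<in> letter_edges A ^^ Suc n"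
  using A Suc.prems by (auto simp: letter_edges_def)
 finally show ?case .
qed

lemma irreducible_mat_iff:
 assumes "square_mat A"
 shows "irreducible_mat A \<longleftrightarrow> (\<forall>i<dim_row A. \<forall>j<dim_row A. (i, j) \<in> (letter_edges A)\<^sup>+)"
proof -
 have A: "A \<in> carrier_mat (dim_row A) (dim_row A)" using assms by auto
 show ?thesis
  unfolding irreducible_mat_def trancl_power by (simp add: mat_power_pos_iff[OF A] Suc_le_eq)
qed

context
 fixes A :: "nat mat" and X :: "(nat => nat) set"
 assumes A: "sft_matrix A" and irrA: "irreducible_mat A"
 defines "X \<equiv> sft A"
begin

lemma sftD: "x \<in> X ==> x n < dim_row A" "x \<in> X ==> A $$ (x n, x (Suc n)) = 1"
 by (auto simp: X_def sft_def)

lemma shift_sft: "x \<in> X ==> shift_map x \<in> X"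
 by (auto simp: X_def sft_def shift_map_def)

lemma funpow_sft: "x \<in> X ==> (shift_map ^^ n) x \<in> X"
 by (induction n) (auto simp: shift_sft)

lemma sft_first:
 assumes "a < dim_row A" obtains x where "x \<in> X" "x 0 = a"
proof -
 obtain x n where "x \<in> X" "x n = a" using A assms unfolding sft_matrix_def X_def by blast
 then show ?thesis using that[of "(shift_map ^^ n) x"] funpow_sft by (simp add: shift_funpow)
qed

lemma sft_splice:
 assumes "p \<in> X" "q \<in> X" "p m = q 0" shows "(%i. if i \<le> m then p i else q (i - m)) \<in> X"
proof -
 let ?r = "%i. if i \<le> m then p i else q (i - m)"
 have "A $$ (?r i, ?r (Suc i)) = 1" for i
 proof (cases i m rule: linorder_cases)
  case greater
  then show ?thesis using sftD(2)[OF assms(2), of "i - m"] by (simp add: Suc_diff_le)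
 qed (use sftD(2)[OF assms(1)] sftD(2)[OF assms(2), of 0] assms(3) in auto)
 moreover have "?r i < dim_row A" for i using sftD(1) assms by simp
 ultimately show ?thesis unfolding X_def sft_def by blast
qed

lemma sft_connect:
 assumes "(a, b) \<in> (letter_edges A)\<^sup>+"
 obtains p m where "p \<in> X" "m \<ge> 1" "p 0 = a" "p m = b"
proof -
 have edge: "\<exists>q\<in>X. q 0 = a \<and> q 1 = b" if "(a, b) \<in> letter_edges A" for a b
 proof -
  have ab: "a < dim_row A" "b < dim_row A" "A $$ (a, b) > 0"
   using that by (auto simp: letter_edges_def)
  have A1: "A $$ (a, b) = 1" using A ab unfolding sft_matrix_def by force
  obtain q where q: "q \<in> X" "q 0 = b" by (rule sft_first[OF ab(2)])
  define r where "r i = (case i of 0 => a | Suc i => q i)" for i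
  have "A $$ (r i, r (Suc i)) = 1" "r i < dim_row A" for i
   using ab(1) A1 q sftD[OF q(1)] by (cases i; simp add: r_def)+
  then have "r \<in> X" by (simp add: X_def sft_def)
  then show ?thesis using q by (intro bexI[of _ r]) (simp_all add: r_def)
 qed
 have "\<exists>p\<in>X. \<exists>m\<ge>1. p 0 = a \<and> p m = b" using assms
 proof (induction rule: trancl_induct)
  case (base b)
  then show ?case using edge by blast
 next
  case (step b e)
  obtain p m where p: "p \<in> X" "m \<ge> 1" "p 0 = a" "p m = b" using step.IH by blast
  obtain q where q: "q \<in> X" "q 0 = b" "q 1 = e" using edge[OF step.hyps(2)] by blast
  show ?case
   by (rule bexI[OF _ sft_splice[OF p(1) q(1), of m]], rule exI[of _ "Suc m"]) (use p q in auto)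
 qed
 then show ?thesis using that by blast
qed

lemma compact_sft: "compact X"
proof -
 have "open (- X)"
 proof (subst open_subopen, intro ballI)
  fix x assume "x \<in> - X"
  then obtain n where n: "\<not> (x n < dim_row A \<and> A $$ (x n, x (Suc n)) = 1)" by (auto simp: X_def sft_def)
  have "{y. \<forall>i<Suc (Suc n). y i = x i} \<subseteq> - X"
  proof
   fix y assume "y \<in> {y. \<forall>i<Suc (Suc n). y i = x i}"
   then have "y n = x n" "y (Suc n) = x (Suc n)" by auto
   then show "y \<in> - X" using n sftD[of y n] by auto
  qed
  then show "\<exists>T. open T \<and> x \<in> T \<and> T \<subseteq> - X" using open_prefix[of "Suc (Suc n)" x] by blast
 qed
 then have "closed X" by (simp add: closed_def)
 moreover have "compact (\<Pi>\<^sub>E i\<in>UNIV. {..<dim_row A})"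
  using compactin_PiE[of "%_. euclidean" UNIV "%_. {..<dim_row A}"]
  by (simp add: euclidean_product_topology finite_imp_compact)
 moreover have "X = (\<Pi>\<^sub>E i\<in>UNIV. {..<dim_row A}) \<inter> X" using sftD(1) by (auto simp: PiE_iff)
 ultimately show ?thesis using compact_Int_closed by metis
qed

text \<open>The presentation by words of length \<open>k\<close>. Consecutive words overlap, so the
  first letters along a path spell a point that has all these words.\<close>

lemma transitive_coding_sft:
 assumes k: "k \<ge> 1"
 shows "transitive_coding X (word k ` X) ((%x. (word k x, word k (shift_map x))) ` X) (word k)"
  (is "transitive_coding X ?V ?E _")
proof
 have word_nth: "j < k ==> word k x ! j = x j" for x j by (simp add: word_def)
 show "compact X" by (rule compact_sft)
 show "shift_map x \<in> X" if "x \<in> X" for x by (rule shift_sft[OF that])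
 have "?V \<subseteq> {u. set u \<subseteq> {..<dim_row A} \<and> length u = k}" using sftD(1) by (auto simp: word_def)
 then show finV: "finite ?V" by (rule finite_subset) (rule finite_lists_length_eq[OF finite_lessThan])
 have "0 < dim_row A" using A by (simp add: sft_matrix_def)
 then obtain x0 where x0: "x0 \<in> X" by (rule sft_first)
 then show neV: "?V ~= {}" by blast
 show "x 0 = y 0" if "word k x = word k y" for x y
  using arg_cong[OF that, of "%u. u ! 0"] k by (simp add: word_nth)
 show "\<exists>k'. \<forall>x\<in>X. \<forall>y\<in>X. (\<forall>i<k'. x i = y i) --> word k x = word k y"
  by (intro exI[of _ k]) (auto simp: word_def)
 show "\<exists>x\<in>X. \<forall>i. word k ((shift_map ^^ i) x) = s i" if s: "!!i. (s i, s (Suc i)) \<in> ?E" for s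
 proof -
  have "\<forall>i. \<exists>y\<in>X. s i = word k y \<and> s (Suc i) = word k (shift_map y)" using s by auto
  then obtain y where y: "!!i. y i \<in> X" "!!i. s i = word k (y i)" "!!i. s (Suc i) = word k (shift_map (y i))"
   by metis
  define x where "x i = s i ! 0" for i
  have x: "x i = y i 0" "x (Suc i) = y i 1" for i
   using k y(2)[of i] y(3)[of i] by (simp_all add: x_def word_nth shift_map_def)
  have "A $$ (x i, x (Suc i)) = 1" "x i < dim_row A" for i
   using sftD[OF y(1)[of i], of 0] x by simp_all
  then have "x \<in> X" by (simp add: X_def sft_def)
  moreover have nth: "s i ! j = x (i + j)" if "j < k" for i j
   using that
  proof (induction j arbitrary: i)
   case (Suc j)
   then have "s i ! Suc j = s (Suc i) ! j" using y(2)[of i] y(3)[of i] by (simp add: word_nth shift_map_def)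
   then show ?case using Suc by simp
  qed (simp add: x_def)
  have "word k ((shift_map ^^ i) x) = s i" for i
  proof (rule nth_equalityI)
   show "length (word k ((shift_map ^^ i) x)) = length (s i)" using y(2)[of i] by (simp add: word_def)
   fix j assume "j < length (word k ((shift_map ^^ i) x))"
   then have "j < k" by (simp add: word_def)
   then show "word k ((shift_map ^^ i) x) ! j = s i ! j" by (simp add: nth word_nth shift_funpow)
  qed
  ultimately show ?thesis by blast
 qed
 have "(v, w) \<in> ?E\<^sup>+" if vw: "v \<in> ?V" "w \<in> ?V" for v w
 proof -
  obtain x y where xy: "x \<in> X" "y \<in> X" "v = word k x" "w = word k y" using vw by blast
  have "(x (k - 1), y 0) \<in> (letter_edges A)\<^sup>+"
   using irrA A sftD(1)[OF xy(1)] sftD(1)[OF xy(2)] by (simp add: irreducible_mat_iff sft_matrix_def)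
  then obtain p m where p: "p \<in> X" "m \<ge> 1" "p 0 = x (k - 1)" "p m = y 0" by (rule sft_connect)
  \<comment> \<open>The connecting point follows \<open>x\<close> up to its letter
    \<open>k - 1\<close>, then a letter path of length \<open>m\<close> to the first letter of
    \<open>y\<close>, then \<open>y\<close>. Position \<open>k - 1\<close> is the last letter of the
    word \<open>v\<close>, so \<open>v\<close> stays intact.\<close>
  define q where "q i = (if i \<le> k - 1 then x i else p (i - (k - 1)))" for i
  define r where "r i = (if i \<le> k - 1 + m then q i else y (i - (k - 1 + m)))" for i
  have qX: "q \<in> X" unfolding q_def by (rule sft_splice[OF xy(1) p(1)]) (simp add: p)
  have qm: "q (k - 1 + m) = y 0" using p by (simp add: q_def)
  then have rX: "r \<in> X" unfolding r_def by (intro sft_splice[OF qX xy(2)])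
  have v: "word k r = v" using k xy(3) by (auto simp: word_def r_def q_def)
  have "r (k - 1 + m + j) = y j" for j
  proof (cases j)
   case 0
   then show ?thesis using qm by (simp add: r_def)
  qed (simp add: r_def)
  then have "(shift_map ^^ (k - 1 + m)) r = y" by (intro ext) (simp only: shift_funpow)
  then have w: "word k ((shift_map ^^ (k - 1 + m)) r) = w" by (simp only: xy(4))
  have "(word k r, word k ((shift_map ^^ Suc n) r)) \<in> ?E\<^sup>+" for n
  proof (induction n)
   case 0
   then show ?case using rX by auto
  next
   case (Suc n)
   have "(word k ((shift_map ^^ Suc n) r), word k (shift_map ((shift_map ^^ Suc n) r))) \<in> ?E"
    using funpow_sft[OF rX] by blast
   then show ?case using trancl_into_trancl[OF Suc] by simp
  qed
  from this[of "k - 1 + m - 1"] show ?thesis using v w p(2) by simp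
 qed
 then show "strongly_connected ?V ?E"
  unfolding strongly_connected_def using finV neV shift_sft by auto
qed simp_all

end

section \<open>Subsystems as transitive subshifts of finite type\<close>

lemma continuous_locally_constant:
 fixes f :: "(nat => nat) => 'b::topological_space"
 assumes "!!x y. x \<in> S ==> y \<in> S ==> (\<forall>i<n. x i = y i) ==> f x = f y"
 shows "continuous_on S f"
 unfolding continuous_on_topological
proof (intro ballI allI impI)
 fix x B assume x: "x \<in> S" and B: "open B" "f x \<in> B"
 have "f y \<in> B" if "y \<in> S" "\<forall>i<n. y i = x i" for y
  using assms[OF that(1) x that(2)] B(2) by simp
 then show "\<exists>A. open A \<and> x \<in> A \<and> (\<forall>y\<in>S. y \<in> A --> f y \<in> B)"
  using open_prefix[of n x] by (intro exI[of _ "{y. \<forall>i<n. y i = x i}"]) simp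
qed

text \<open>The subsystem is conjugate to the shift on vertex sequences of \<open>(K, EK)\<close>.
  Numbering the vertices turns the graph into a matrix; the inverse conjugacy reads off the first
  letter of each vertex.\<close>

lemma (in gibbs_graph) transitive_sub_sft_subsystem: "transitive_sub_sft X subsystem"
proof -
 define n where "n = card K"
 obtain e where e: "bij_betw e {..<n} K"
  using ex_bij_betw_nat_finite[OF KD(1)] unfolding n_def atLeast0LessThan by blast
 define idx where "idx = inv_into {..<n} e"
 have idx: "idx v < n" "e (idx v) = v" if "v \<in> K" for v
 proof -
  have "v \<in> e ` {..<n}" using that e by (simp add: bij_betw_def)
  then show "idx v < n" "e (idx v) = v" using inv_into_into[of v e "{..<n}"] f_inv_into_f[of v e "{..<n}"]
   by (auto simp: idx_def)
 qed
 have eK: "e i \<in> K" and ie: "idx (e i) = i" if "i < n" for i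
  using that e by (auto simp: idx_def bij_betw_def inv_into_f_f)
 define B where "B = mat n n (%(i, j). if (e i, e j) \<in> EK then 1 else (0::nat))"
 have B: "dim_row B = n" "dim_col B = n" "i < n ==> j < n ==> B $$ (i, j) = (if (e i, e j) \<in> EK then 1 else 0)" for i j
  by (simp_all add: B_def)
 define h where "h y i = idx (c ((shift_map ^^ i) y))" for y i
 \<comment> \<open>By \<open>c_first\<close> all points with code \<open>v\<close> share their first
   letter, so the choice is immaterial.\<close>
 define letter where "letter v = (SOME x. x \<in> X \<and> c x = v) 0" for v
 define g where "g b i = letter (e (b i))" for b :: "nat => nat" and i
 have letter: "letter (c x) = x 0" if "x \<in> X" for x
  using someI_ex[of "%y. y \<in> X \<and> c y = c x"] that c_first unfolding letter_def by blast
 have ed: "(c ((shift_map ^^ i) y), c ((shift_map ^^ Suc i) y)) \<in> EK" if "y \<in> subsystem" for y i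
  using that unfolding subsystem_def by blast
 have cK: "c ((shift_map ^^ i) y) \<in> K" if "y \<in> subsystem" for y i using ed[OF that, of i] KD(3) by blast
 have h_sft: "h y \<in> sft B" if "y \<in> subsystem" for y
  using idx[OF cK[OF that]] ed[OF that] by (simp add: sft_def B h_def del: funpow.simps)
 have sftB: "b i < n" "(e (b i), e (b (Suc i))) \<in> EK" if "b \<in> sft B" for b i
 proof -
  show bn: "b i < n" for i using that by (simp add: sft_def B)
  have "B $$ (b i, b (Suc i)) = 1" using that by (simp add: sft_def)
  then show "(e (b i), e (b (Suc i))) \<in> EK" using bn by (simp add: B split: if_splits)
 qed
 have point: "\<exists>x\<in>subsystem. g b = x \<and> h x = b" if b: "b \<in> sft B" for b
 proof -
  have "(e (b i), e (b (Suc i))) \<in> E" for i using sftB(2)[OF b] EK by blast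
  from path_point[of "%i. e (b i)", OF this] obtain x where x: "x \<in> X" "!!i. c ((shift_map ^^ i) x) = e (b i)" by blast
  have "x \<in> subsystem" by (simp add: subsystem_def x sftB(2)[OF b] del: funpow.simps)
  moreover have "g b = x"
  proof
   fix i
   have "letter (c ((shift_map ^^ i) x)) = ((shift_map ^^ i) x) 0" by (rule letter[OF funpow_X[OF x(1)]])
   then show "g b i = x i" by (simp add: g_def x shift_funpow)
  qed
  moreover have "h x = b" using ie sftB(1)[OF b] by (auto simp: h_def x)
  ultimately show ?thesis by blast
 qed
 have gh: "g (h y) = y" if y: "y \<in> subsystem" for y
 proof
  fix i
  have X: "y \<in> X" using y subsystem_subset by blast
  show "g (h y) i = y i"
   using letter[OF funpow_X[OF X], of i] idx(2)[OF cK[OF y]] by (simp add: g_def h_def shift_funpow)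
 qed
 have homeo: "homeomorphism subsystem (sft B) h g"
 proof (rule homeomorphismI)
  obtain k where k: "!!x y. x \<in> X ==> y \<in> X ==> (!!i. i < k ==> x i = y i) ==> c x = c y"
   using c_local by meson
  show "continuous_on subsystem h"
  proof (rule continuous_on_coordinatewise_then_product)
   fix i
   show "continuous_on subsystem (%y. h y i)"
   proof (rule continuous_locally_constant[of _ "i + k"])
    fix x y assume xy: "x \<in> subsystem" "y \<in> subsystem" "\<forall>j<i + k. x j = y j"
    have "c ((shift_map ^^ i) x) = c ((shift_map ^^ i) y)"
     by (rule k) (use xy subsystem_subset in \<open>auto simp: shift_funpow intro!: funpow_X\<close>)
    then show "h x i = h y i" by (simp add: h_def)
   qed
  qed
  show "continuous_on (sft B) g"
  proof (rule continuous_on_coordinatewise_then_product)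
   show "continuous_on (sft B) (%b. g b i)" for i
    by (rule continuous_locally_constant[of _ "Suc i"]) (simp add: g_def)
  qed
 qed (use h_sft point gh in auto)
 have sB: "sft_matrix B"
  unfolding sft_matrix_def
 proof (intro conjI allI impI)
  show "dim_row B > 0" using KD by (simp add: B n_def card_gt_0_iff)
  fix a assume "a < dim_row B"
  then have a: "a < n" by (simp add: B)
  obtain w where "(e a, w) \<in> EK" using strongly_connectedD(5)[OF G eK[OF a]] by blast
  then obtain y where y: "y \<in> subsystem" "c y = e a" by (rule subsystem_path)
  have "h y 0 = a" using y ie[OF a] by (simp add: h_def)
  then show "\<exists>x\<in>sft B. \<exists>n. x n = a" using h_sft[OF y(1)] by blast
 qed (auto simp: B)
 have "(idx v, idx w) \<in> (letter_edges B)\<^sup>+" if "(v, w) \<in> EK\<^sup>+" for v w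
  using that
 proof (induction rule: trancl_induct)
  case (base w)
  then have "(idx v, idx w) \<in> letter_edges B" using idx KD(3) by (auto simp: letter_edges_def B)
  then show ?case by blast
 next
  case (step w z)
  then have "(idx w, idx z) \<in> letter_edges B" using idx KD(3) by (auto simp: letter_edges_def B)
  then show ?case using step.IH by (rule trancl_into_trancl[rotated])
 qed
 then have "(i, j) \<in> (letter_edges B)\<^sup>+" if "i < n" "j < n" for i j
  using strongly_connectedD(4)[OF G eK[OF that(1)] eK[OF that(2)]] ie that by metis
 then have irr: "irreducible_mat B"
  by (subst irreducible_mat_iff) (simp_all add: B)
 have "h (shift_map y) = shift_map (h y)" for y
  by (auto simp: h_def shift_map_def[of "h y"] funpow_swap1)
 then show ?thesis
  unfolding transitive_sub_sft_def
  using subsystem_subset closedin_subsystem shift_subsystem sB irr homeo by blast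
qed

subsection \<open>Stability of the maximizing edges\<close>

lemma max_edges_cong:
 assumes "!!v. v \<in> V ==> \<psi> v = \<psi>' v" shows "max_edges V E \<psi> = max_edges V E \<psi>'"
proof -
 have "circ_val V \<psi> = circ_val V \<psi>'"
  unfolding circ_val_def using assms by (intro ext sum.cong) auto
 then show ?thesis by (simp add: max_edges_def max_circ_def)
qed

lemma circ_val_diff:
 assumes p: "circulation V E p" and \<delta>: "!!v. v \<in> V ==> \<bar>\<psi>' v - \<psi> v\<bar> \<le> \<delta>"
 shows "\<bar>circ_val V \<psi>' p - circ_val V \<psi> p\<bar> \<le> \<delta>"
proof -
 note c = circulationD[OF p]
 have "\<bar>circ_val V \<psi>' p - circ_val V \<psi> p\<bar> = \<bar>\<Sum>v\<in>V. \<Sum>w\<in>V. p v w * (\<psi>' v - \<psi> v)\<bar>"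
  by (simp add: circ_val_def sum_subtractf right_diff_distrib)
 also have "\<dots> \<le> (\<Sum>v\<in>V. \<Sum>w\<in>V. \<bar>p v w * (\<psi>' v - \<psi> v)\<bar>)"
  by (rule order_trans[OF sum_abs sum_mono[OF sum_abs]])
 also have "\<dots> \<le> (\<Sum>v\<in>V. \<Sum>w\<in>V. p v w * \<delta>)"
  using \<delta> c(1) by (intro sum_mono) (simp add: abs_mult mult_left_mono)
 also have "\<dots> = \<delta>" using c(4) by (simp flip: sum_distrib_right)
 finally show ?thesis .
qed

text \<open>Upper semicontinuity, from the finiteness of the possible edge sets. Each set not
  contained in that of \<psi> supports a circulation that misses the maximum of \<psi> by a positive
  gap, and is excluded as long as the perturbation is small compared with the least gap.\<close>

lemma max_edges_stable:
 assumes G: "strongly_connected V E"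
 obtains \<delta> where "\<delta> > 0"
  "!!\<psi>'. (!!v. v \<in> V ==> \<bar>\<psi>' v - \<psi> v\<bar> \<le> \<delta>) ==> max_edges V E \<psi>' \<subseteq> max_edges V E \<psi>"
proof -
 have finE: "finite E" using strongly_connectedD(1,3)[OF G] by (meson finite_SigmaI finite_subset)
 have sub: "range (max_edges V E) \<subseteq> Pow E" using max_edges_subset[OF G] by blast
 have "\<forall>F\<in>range (max_edges V E). \<exists>p. circulation V E p \<and> (\<forall>v w. p v w > 0 \<longleftrightarrow> (v, w) \<in> F)"
 proof
  fix F assume "F \<in> range (max_edges V E)"
  then obtain \<psi>' where F: "F = max_edges V E \<psi>'" by blast
  obtain p where "max_circ V E \<psi>' p" "!!v w. p v w > 0 \<longleftrightarrow> (v, w) \<in> F"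
   unfolding F by (rule max_circ_full[OF G]) blast
  then show "\<exists>p. circulation V E p \<and> (\<forall>v w. p v w > 0 \<longleftrightarrow> (v, w) \<in> F)"
   unfolding max_circ_def by blast
 qed
 then obtain p where p: "!!F. F \<in> range (max_edges V E) ==> circulation V E (p F)"
  "!!F v w. F \<in> range (max_edges V E) ==> p F v w > 0 \<longleftrightarrow> (v, w) \<in> F" by metis
 obtain p0 where p0: "max_circ V E \<psi> p0" by (rule max_circ_full[OF G])
 then have c0: "circulation V E p0" by (simp add: max_circ_def)
 define bad where "bad = {F \<in> range (max_edges V E). \<not> F \<subseteq> max_edges V E \<psi>}"
 define gap where "gap F = circ_val V \<psi> p0 - circ_val V \<psi> (p F)" for F
 have gap: "gap F > 0" if F: "F \<in> bad" for F
 proof (rule ccontr)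
  assume "\<not> gap F > 0"
  then have "max_circ V E \<psi> (p F)"
   using p0 p(1) F unfolding max_circ_def bad_def gap_def by (auto intro: order_trans)
  then have "F \<subseteq> max_edges V E \<psi>" using p(2)[of F] F unfolding max_edges_def bad_def by blast
  then show False using F by (simp add: bad_def)
 qed
 have finb: "finite (insert 1 (gap ` bad))"
  using finite_subset[OF sub] finE by (simp add: bad_def)
 define e where "e = Min (insert 1 (gap ` bad))"
 have e: "e > 0" "!!F. F \<in> bad ==> e \<le> gap F"
  using finb gap by (auto simp: e_def)
 show ?thesis
 \<comment> \<open>Two values, each moved by at most \<open>e / 4\<close>, cannot make up a
   difference of \<open>e\<close>.\<close>
 proof (rule that[of "e / 4"])
  fix \<psi>' assume near: "!!v. v \<in> V ==> \<bar>\<psi>' v - \<psi> v\<bar> \<le> e / 4"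
  let ?F = "max_edges V E \<psi>'"
  show "?F \<subseteq> max_edges V E \<psi>"
  proof (rule ccontr)
   assume "\<not> ?F \<subseteq> max_edges V E \<psi>"
   then have F: "?F \<in> bad" by (simp add: bad_def)
   then have r: "?F \<in> range (max_edges V E)" by simp
   have "max_circ V E \<psi>' (p ?F)"
    using max_circ_iff[OF G] p(1)[OF r] p(2)[OF r] by blast
   then have "circ_val V \<psi>' p0 \<le> circ_val V \<psi>' (p ?F)" using c0 by (simp add: max_circ_def)
   moreover have "\<bar>circ_val V \<psi>' p0 - circ_val V \<psi> p0\<bar> \<le> e / 4" by (rule circ_val_diff[OF c0 near])
   moreover have "\<bar>circ_val V \<psi>' (p ?F) - circ_val V \<psi> (p ?F)\<bar> \<le> e / 4" by (rule circ_val_diff[OF p(1)[OF r] near])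
   ultimately show False using e(1) e(2)[OF F] unfolding gap_def by linarith
  qed
 qed (use e in simp)
qed

lemma cycle_components:
 assumes F: "F = (%v. (v, s v)) ` S" and S: "S ~= {}" "bij_betw s S S"
  and min: "!!S'. S' \<subseteq> S ==> S' ~= {} ==> s ` S' \<subseteq> S' ==> S' = S"
 shows "components F = {S}"
proof -
 have "F\<^sup>* `` {v} = S" if v: "v \<in> S" for v
 proof (rule min)
  have "(v, w) \<in> F\<^sup>* ==> w \<in> S" for w
   by (induction rule: rtrancl_induct) (use v S(2) F in \<open>auto simp: bij_betw_def\<close>)
  then show sub: "F\<^sup>* `` {v} \<subseteq> S" by auto
  show "F\<^sup>* `` {v} ~= {}" by auto
  show "s ` (F\<^sup>* `` {v}) \<subseteq> F\<^sup>* `` {v}"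
  proof
   fix w assume "w \<in> s ` (F\<^sup>* `` {v})"
   then obtain z where z: "(v, z) \<in> F\<^sup>*" "w = s z" by blast
   then have "(z, w) \<in> F" using sub F by auto
   then show "w \<in> F\<^sup>* `` {v}" using z(1) by auto
  qed
 qed
 moreover have "Domain F = S" using F by auto
 ultimately show ?thesis using S(1) by (auto simp: components_def)
qed

lemma cycle_growth:
 assumes F: "F = (%v. (v, s v)) ` S" and S: "S ~= {}" "bij_betw s S S" and rec: "recurrent F"
  and comp: "components F = {S}"
 shows "growth F S = 1"
 unfolding growth_def
proof (rule pf_val_eqI)
 have sc: "strongly_connected S (restrict_edges F S)" by (rule strongly_connected_component[OF rec]) (simp add: comp)
 then show "irreducible S (edge_weight (restrict_edges F S) (%_. 0))" by (rule irreducible_edge_weight)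
 show "pos_eigen S (edge_weight (restrict_edges F S) (%_. 0)) 1 (%_. 1)"
  unfolding pos_eigen_def
 proof (intro ballI conjI)
  fix v assume v: "v \<in> S"
  then have sv: "s v \<in> S" using S(2) by (auto simp: bij_betw_def)
  have "(\<Sum>w\<in>S. edge_weight (restrict_edges F S) (%_. 0) v w * 1) = (\<Sum>w\<in>S. if w = s v then 1 else 0)"
   using v sv by (intro sum.cong) (auto simp: edge_weight_def restrict_edges_def F)
  then show "(\<Sum>w\<in>S. edge_weight (restrict_edges F S) (%_. 0) v w * 1) = 1 * 1"
   using sv strongly_connectedD(1)[OF sc] by simp
 qed simp
qed

context component_system
begin

text \<open>Growth rates are at least 1, so if the largest is 1 every component is a top component.
  Uniqueness then leaves a single component, and out-degree 1 makes it a simple cycle that fills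
  \<open>F\<close>.\<close>

lemma unit_growth_cycle:
 assumes top: "top_components F = {K}" and g: "growth F K = 1"
 obtains s where "restrict_edges F K = F" "F = (%v. (v, s v)) ` K" "!!S'. S' \<subseteq> K ==> S' ~= {} ==> s ` S' \<subseteq> S' ==> S' = K"
proof -
 have K: "K \<in> components F" "!!K'. K' \<in> components F ==> growth F K' \<le> growth F K"
  using singletonI[of K] unfolding top[symmetric] top_components_def by auto
 have "components F \<subseteq> {K}"
 proof
  fix K' assume K': "K' \<in> components F"
  have "growth F K' = growth F K" using K(2)[OF K'] growth_ge_1[OF K'] g by simp
  then have "K' \<in> top_components F" using K' K(2) by (simp add: top_components_def)
  then show "K' \<in> {K}" using top by simp
 qed
 moreover note KC = K(1)
 ultimately have comps: "components F = {K}" by blast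
 have dom: "Domain F = K"
  using comps comp_component comp_self component_Domain[OF KC] by blast
 have "F \<subseteq> K \<times> K" using dom recurrent_Range[OF recF] by auto
 then have FK: "restrict_edges F K = F" by (auto simp: restrict_edges_def)
 interpret K: entropy_graph X V E c K F using component_graph[OF KC] by (simp add: FK)
 have lam: "K.lam = 1" using growth_lam[OF KC] g by (simp add: FK)
 have "\<forall>v\<in>K. \<exists>w. (v, w) \<in> F" using dom by blast
 then obtain s where s: "!!v. v \<in> K ==> (v, s v) \<in> F" by metis
 have F: "F = (%v. (v, s v)) ` K"
 proof (intro equalityI subsetI)
  fix e assume e: "e \<in> F"
  obtain v w where vw: "e = (v, w)" by (cases e)
  then have "v \<in> K" using e dom by auto
  then show "e \<in> (%v. (v, s v)) ` K" using K.out_degree_1[OF lam, of v w "s v"] s e vw by auto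
 qed (use s in auto)
 have "S' = K" if S': "S' \<subseteq> K" "S' ~= {}" "s ` S' \<subseteq> S'" for S'
 proof
  obtain v where v: "v \<in> S'" using S'(2) by blast
  show "K \<subseteq> S'"
  proof
   fix w assume "w \<in> K"
   then have "(v, w) \<in> F\<^sup>+" using strongly_connectedD(4)[OF K.G] v S'(1) by blast
   moreover have "y \<in> S'" if "x \<in> S'" "(x, y) \<in> F" for x y using that S'(3) F by auto
   ultimately show "w \<in> S'" using v closed_trancl[of v w F S'] by blast
  qed
 qed (rule S'(1))
 then show ?thesis using FK F that by blast
qed

end

section \<open>The partition of the space of locally constant functions\<close>

lemma (in component_system) component_subshift:
 assumes K: "K \<in> components F"
 shows "\<exists>Y. transitive_sub_sft X Y \<and> unique_max_entropy_measure X Y (cgibbs K)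
  \<and> (growth F K ~= 1 --> \<not> topological_space_class.discrete Y)"
  "ergodic_measure X (cgibbs K)" "measure_entropy shift_map (cgibbs K) = ereal (ln (growth F K))"
proof -
 interpret K: entropy_graph X V E c K "restrict_edges F K" by (rule component_graph[OF K])
 show "measure_entropy shift_map (cgibbs K) = ereal (ln (growth F K))"
  using K.entropy_gibbs growth_lam[OF K] by simp
 show "ergodic_measure X (cgibbs K)" by (rule K.gibbs_ergodic)
 show "\<exists>Y. transitive_sub_sft X Y \<and> unique_max_entropy_measure X Y (cgibbs K)
  \<and> (growth F K ~= 1 --> \<not> topological_space_class.discrete Y)"
  using K.transitive_sub_sft_subsystem K.unique_max_entropy K.not_discrete_subsystem K.lam_ge_1 growth_lam[OF K]
  by (intro exI[of _ K.subsystem]) auto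
qed

lemma (in component_system) inj_cgibbs: "inj_on cgibbs (components F)"
proof (rule inj_onI)
 fix K K' assume K: "K \<in> components F" "K' \<in> components F" and eq: "cgibbs K = cgibbs K'"
 interpret K: entropy_graph X V E c K "restrict_edges F K" by (rule component_graph[OF K(1)])
 interpret K': entropy_graph X V E c K' "restrict_edges F K'" by (rule component_graph[OF K(2)])
 obtain v where v: "v \<in> K" using K.KD by blast
 then have "wm (cgibbs K') [v] > 0" using K.st_pos[OF v] by (simp add: K.gibbs_single flip: eq)
 then have "v \<in> K'" by (simp add: K'.gibbs_single split: if_splits)
 then show "K = K'" using component_eq[OF K(1) v] component_eq[OF K(2)] by simp
qed

lemma top_components_single: "top_components F = {K} ==> K \<in> components F"
 using singletonI[of K] by (metis (no_types, lifting) mem_Collect_eq top_components_def)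

text \<open>Turns three disjoint finite classes into consecutive blocks of indices; injectivity
  follows by counting.\<close>

lemma enumerate_three:
 assumes "finite A" "finite B" "finite C" "A \<inter> B = {}" "A \<inter> C = {}" "B \<inter> C = {}"
 obtains f :: "nat => 'a" and l1 l2 N where "l1 = card A" "l1 \<le> l2" "l2 \<le> N" "bij_betw f {1..N} (A \<union> B \<union> C)"
  "f ` {1..l1} = A" "f ` {l1<..l2} = B" "f ` {l2<..N} = C"
proof -
 obtain a b c where abc: "bij_betw a {1..card A} A" "bij_betw b {1..card B} B" "bij_betw c {1..card C} C"
  using assms(1-3) ex_bij_betw_nat_finite_1 by metis
 define l1 l2 N where "l1 = card A" and "l2 = card A + card B" and "N = card A + card B + card C"
 define f where "f i = (if i \<le> l1 then a i else if i \<le> l2 then b (i - l1) else c (i - l2))" for i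
 have shift: "{a<..a + n} = (%i. i + a) ` {1..n}" for a n :: nat
  by (simp only: image_add_atLeastAtMost') auto
 have A: "f ` {1..l1} = A"
 proof -
  have "f ` {1..l1} = a ` {1..card A}" by (intro image_cong) (auto simp: f_def l1_def)
  then show ?thesis using abc(1) by (simp add: bij_betw_def)
 qed
 have B: "f ` {l1<..l2} = B"
 proof -
  have "{l1<..l2} = (%i. i + l1) ` {1..card B}" using shift[of l1 "card B"] by (simp add: l1_def l2_def)
  then have "f ` {l1<..l2} = (%i. f (i + l1)) ` {1..card B}" by (simp only: image_image)
  also have "\<dots> = b ` {1..card B}" by (intro image_cong) (auto simp: f_def l1_def l2_def)
  finally show ?thesis using abc(2) by (simp add: bij_betw_def)
 qed
 have C: "f ` {l2<..N} = C"
 proof -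
  have "{l2<..N} = (%i. i + l2) ` {1..card C}" using shift[of l2 "card C"] by (simp add: l2_def N_def)
  then have "f ` {l2<..N} = (%i. f (i + l2)) ` {1..card C}" by (simp only: image_image)
  also have "\<dots> = c ` {1..card C}" by (intro image_cong) (auto simp: f_def l1_def l2_def)
  finally show ?thesis using abc(3) by (simp add: bij_betw_def)
 qed
 have "{1..N} = {1..l1} \<union> {l1<..l2} \<union> {l2<..N}" by (auto simp: l1_def l2_def N_def)
 then have im: "f ` {1..N} = A \<union> B \<union> C" using A B C by (simp add: image_Un)
 moreover have "card (A \<union> B \<union> C) = card {1..N}"
  using assms by (simp add: card_Un_disjoint Int_Un_distrib2 N_def)
 ultimately have "inj_on f {1..N}" by (intro eq_card_imp_inj_on) auto
 then have "bij_betw f {1..N} (A \<union> B \<union> C)" using im by (simp add: bij_betw_def)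
 then show ?thesis using A B C by (intro that) (simp_all add: l1_def l2_def N_def)
qed

text \<open>This and the next two predicates are the conclusions for a single cone: \<open>F\<close>
  is a cycle, \<open>F\<close> has one top component without being a cycle, \<open>F\<close> has
  several top components.\<close>

definition unit_cell where
 "unit_cell X k U M \<longleftrightarrow> (\<exists>x. k_elementary X k x \<and> M = {orbit_measure X x}
  \<and> (\<forall>\<phi>\<in>U. zero_temperature_measure X \<phi> (orbit_measure X x)
     \<and> (\<forall>\<nu>. maximizing_measure X \<phi> \<nu> \<longleftrightarrow> \<nu> = orbit_measure X x)))"

definition uniform_cell where
 "uniform_cell X U M \<longleftrightarrow> (\<exists>\<mu> Y. M = {\<mu>} \<and> transitive_sub_sft X Y \<and> \<not> topological_space_class.discrete Y
  \<and> unique_max_entropy_measure X Y \<mu> \<and> (\<forall>\<phi>\<in>U. zero_temperature_measure X \<phi> \<mu>))"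

definition mixed_cell where
 "mixed_cell X U M \<longleftrightarrow> (\<exists>(n::nat) m Y. n \<ge> 2 \<and> bij_betw m {1..n} M
  \<and> (\<forall>j\<in>{1..n}. transitive_sub_sft X (Y j) \<and> unique_max_entropy_measure X (Y j) (m j))
  \<and> (\<forall>j1\<in>{1..n}. \<forall>j2\<in>{1..n}. measure_entropy shift_map (m j1) = measure_entropy shift_map (m j2))
  \<and> (\<exists>a :: ((nat => nat) => real) => nat => real.
     (\<forall>\<phi>\<in>U. (\<forall>j\<in>{1..n}. 0 \<le> a \<phi> j \<and> a \<phi> j \<le> 1) \<and> (\<Sum>j\<in>{1..n}. a \<phi> j) = 1
      \<and> zero_temperature_measure X \<phi> (measure_comb X {1..n} (a \<phi>) m))
     \<and> finite ((%\<phi>. restrict (a \<phi>) {1..n}) ` U)))"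

locale irreducible_sft =
 fixes A :: "nat mat" and k :: nat
 assumes A: "sft_matrix A" and irrA: "irreducible_mat A" and k: "k \<ge> 1"
begin

abbreviation "X \<equiv> sft A"
abbreviation "V \<equiv> word k ` X"
abbreviation "E \<equiv> (%x. (word k x, word k (shift_map x))) ` X"

sublocale transitive_coding X V E "word k"
 by (rule transitive_coding_sft[OF A irrA k])

definition vertex_pot :: "((nat => nat) => real) => nat list => real" where
 "vertex_pot \<phi> v = \<phi> (SOME x. x \<in> X \<and> word k x = v)"

definition edges :: "((nat => nat) => real) => (nat list \<times> nat list) set" where
 "edges \<phi> = max_edges V E (vertex_pot \<phi>)"

definition cone :: "(nat list \<times> nat list) set => ((nat => nat) => real) set" where
 "cone F = {\<phi> \<in> LC X k. edges \<phi> = F}"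

lemma cylinder_word: "cylinder X k x = {y \<in> X. word k y = word k x}"
 by (auto simp: cylinder_def word_def)

lemma vertex_pot:
 assumes "\<phi> \<in> LC X k" "x \<in> X" shows "\<phi> x = vertex_pot \<phi> (word k x)"
proof -
 have "\<exists>y. y \<in> X \<and> word k y = word k x" using assms(2) by blast
 from someI_ex[OF this] have "(SOME y. y \<in> X \<and> word k y = word k x) \<in> cylinder X k x"
  by (simp add: cylinder_word)
 then show ?thesis using assms unfolding LC_def vertex_pot_def by auto
qed

lemma component_system_edges: "component_system X V E (word k) (edges \<phi>)"
 unfolding edges_def by (rule component_system_max)

lemma LC_combination: "\<phi> \<in> LC X k ==> \<psi> \<in> LC X k ==> (%x. a * \<phi> x + b * \<psi> x) \<in> LC X k"
 unfolding LC_def by auto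

lemma cone_convex: "fun_convex_cone (cone F)"
 unfolding fun_convex_cone_def cone_def
proof (intro conjI ballI allI impI CollectI)
 fix \<phi> \<psi> :: "(nat => nat) => real" and u v :: real
 assume *: "\<phi> \<in> {\<phi> \<in> LC X k. edges \<phi> = F}" "\<psi> \<in> {\<phi> \<in> LC X k. edges \<phi> = F}" "u \<ge> 0" "v \<ge> 0" "u + v = 1"
 show "(%x. u * \<phi> x + v * \<psi> x) \<in> LC X k" using * by (intro LC_combination) auto
 have "max_edges V E (%w. u * vertex_pot \<phi> w + v * vertex_pot \<psi> w) = F"
  by (rule max_edges_convex[OF SC]) (use * in \<open>auto simp: edges_def\<close>)
 then show "edges (%x. u * \<phi> x + v * \<psi> x) = F" by (simp add: edges_def vertex_pot_def[abs_def])
next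
 fix \<phi> :: "(nat => nat) => real" and t :: real
 assume *: "\<phi> \<in> {\<phi> \<in> LC X k. edges \<phi> = F}" "t > 0"
 show "(%x. t * \<phi> x) \<in> LC X k" using LC_combination[of \<phi> \<phi> t 0] * by simp
 have "max_edges V E (%w. t * vertex_pot \<phi> w) = F"
  using max_edges_scale[OF SC *(2)] * by (simp add: edges_def)
 then show "edges (%x. t * \<phi> x) = F" by (simp add: edges_def vertex_pot_def[abs_def])
qed

text \<open>The bound in the variational principle is attained by \<open>full.gibbs\<close> and by
  no other measure, so the definite description denotes it.\<close>

lemma equilibrium_state_eq:
 assumes \<phi>: "\<phi> \<in> LC X k"
 shows "equilibrium_state X (%x. t * \<phi> x) = full.gibbs (%v. t * vertex_pot \<phi> v)"
proof -
 let ?\<psi> = "%v. t * vertex_pot \<phi> v"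
 have int: "integral\<^sup>L \<nu> (%x. t * \<phi> x) = (\<Sum>v\<in>V. wm \<nu> [v] * ?\<psi> v)" if "\<nu> \<in> inv_measures" for \<nu>
  by (rule integral_coded[OF that]) (simp add: vertex_pot[OF \<phi>])
 have le: "measure_entropy shift_map \<nu> + ereal (integral\<^sup>L \<nu> (%x. t * \<phi> x)) \<le> ereal (ln (full.lam ?\<psi>))"
  if "\<nu> \<in> inv_measures" for \<nu>
  using full_le[OF that, of ?\<psi>] unfolding int[OF that] by (cases "measure_entropy shift_map \<nu>") auto
 have eq: "measure_entropy shift_map (full.gibbs ?\<psi>) + ereal (integral\<^sup>L (full.gibbs ?\<psi>) (%x. t * \<phi> x)) = ereal (ln (full.lam ?\<psi>))"
  unfolding int[OF full.gibbs_inv] full.variational_gibbs by simp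
 have "\<nu> = full.gibbs ?\<psi>" if "is_equilibrium_state X (%x. t * \<phi> x) \<nu>" for \<nu>
 proof -
  have \<nu>: "\<nu> \<in> inv_measures" using that by (simp add: is_equilibrium_state_def)
  have "ereal (ln (full.lam ?\<psi>)) \<le> measure_entropy shift_map \<nu> + ereal (integral\<^sup>L \<nu> (%x. t * \<phi> x))"
   using that full.gibbs_inv[of ?\<psi>] unfolding is_equilibrium_state_def eq[symmetric] by blast
  then show ?thesis
   unfolding int[OF \<nu>]
   by (intro full.variational_unique[OF \<nu> full_supported[OF \<nu>]]) (cases "measure_entropy shift_map \<nu>"; auto)
 qed
 moreover have "is_equilibrium_state X (%x. t * \<phi> x) (full.gibbs ?\<psi>)"
  unfolding is_equilibrium_state_def using full.gibbs_inv le eq by simp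
 ultimately show ?thesis unfolding equilibrium_state_def by (rule the_equality[rotated])
qed

lemma zero_temperature_comb:
 assumes \<phi>: "\<phi> \<in> LC X k" and e: "bij_betw e J (top_components (edges \<phi>))"
 shows "zero_temperature_measure X \<phi>
  (measure_comb X J (%j. coef (vertex_pot \<phi>) (e j)) (%j. comp_gibbs (edges \<phi>) (e j)))"
  "j \<in> J ==> 0 \<le> coef (vertex_pot \<phi>) (e j) \<and> coef (vertex_pot \<phi>) (e j) \<le> 1"
  "(\<Sum>j\<in>J. coef (vertex_pot \<phi>) (e j)) = 1"
proof -
 interpret component_system X V E "word k" "edges \<phi>" by (rule component_system_edges)
 note Z = zero_temperature_limit[where \<psi> = "vertex_pot \<phi>", folded edges_def]
 have ec: "e j \<in> top_components (edges \<phi>)" if "j \<in> J" for j using e that by (auto simp: bij_betw_def)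
 then show a: "0 \<le> coef (vertex_pot \<phi>) (e j) \<and> coef (vertex_pot \<phi>) (e j) \<le> 1" if "j \<in> J" for j
  using Z(1) that by blast
 show s: "(\<Sum>j\<in>J. coef (vertex_pot \<phi>) (e j)) = 1"
  using sum.reindex_bij_betw[OF e, of "coef (vertex_pot \<phi>)"] Z(2) by simp
 have inv: "comp_gibbs (edges \<phi>) (e j) \<in> inv_measures" if "j \<in> J" for j
  using component_subshift(2)[of "e j"] ec[OF that] by (simp add: ergodic_measure_def top_components_def)
 note C = measure_comb_inv[of J "%j. comp_gibbs (edges \<phi>) (e j)" "%j. coef (vertex_pot \<phi>) (e j)", OF inv conjunct1[OF a] s]
 show "zero_temperature_measure X \<phi>
  (measure_comb X J (%j. coef (vertex_pot \<phi>) (e j)) (%j. comp_gibbs (edges \<phi>) (e j)))"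
  unfolding zero_temperature_measure_def equilibrium_state_eq[OF \<phi>]
 proof (intro conjI weak_star_limitI C(1) full.gibbs_inv)
  fix u :: "nat list list" assume u: "u ~= []"
  show "((%t. wm (full.gibbs (%v. t * vertex_pot \<phi> v)) u) \<longlongrightarrow>
    wm (measure_comb X J (%j. coef (vertex_pot \<phi>) (e j)) (%j. comp_gibbs (edges \<phi>) (e j))) u) at_top"
   using Z(3)[OF u] sum.reindex_bij_betw[OF e, of "%K. coef (vertex_pot \<phi>) K * wm (comp_gibbs (edges \<phi>) K) u"]
   by (simp add: C(2))
 qed
qed

lemma zero_temperature_single:
 assumes \<phi>: "\<phi> \<in> LC X k" and K: "top_components (edges \<phi>) = {K}"
 shows "zero_temperature_measure X \<phi> (comp_gibbs (edges \<phi>) K)"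
proof -
 interpret component_system X V E "word k" "edges \<phi>" by (rule component_system_edges)
 note Z = zero_temperature_limit[where \<psi> = "vertex_pot \<phi>", folded edges_def]
 have "K \<in> components (edges \<phi>)" by (rule top_components_single[OF K])
 then have "comp_gibbs (edges \<phi>) K \<in> inv_measures"
  using component_subshift(2) by (simp add: ergodic_measure_def)
 then show ?thesis
  unfolding zero_temperature_measure_def equilibrium_state_eq[OF \<phi>]
  using Z(2,3) K by (auto intro!: weak_star_limitI full.gibbs_inv)
qed

lemma unit_growth_orbit:
 assumes K: "top_components (edges \<phi>) = {K}" "growth (edges \<phi>) K = 1"
 obtains x where "k_elementary X k x" "comp_gibbs (edges \<phi>) K = orbit_measure X x"
proof -
 interpret component_system X V E "word k" "edges \<phi>" by (rule component_system_edges)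
 have KC: "K \<in> components (edges \<phi>)" by (rule top_components_single[OF K(1)])
 interpret K: entropy_graph X V E "word k" K "restrict_edges (edges \<phi>) K" by (rule component_graph[OF KC])
 obtain x where x: "x \<in> X" "periodic_point x" "inj_on (%i. word k ((shift_map ^^ i) x)) {..<prime_period x}"
  "orbit_measure X x = K.gibbs"
  by (rule K.periodic_orbit) (use growth_lam[OF KC] K in auto)
 have "k_elementary X k x" unfolding k_elementary_def
 proof (intro conjI allI impI x(1,2))
  fix i j assume ij: "i < prime_period x" "j < prime_period x" "i ~= j"
  have "(shift_map ^^ i) x \<in> cylinder X k ((shift_map ^^ i) x)"
   using funpow_X[OF x(1)] by (simp add: cylinder_def)
  moreover have "(shift_map ^^ i) x \<notin> cylinder X k ((shift_map ^^ j) x)"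
   using x(3) ij unfolding cylinder_word inj_on_def by blast
  ultimately show "cylinder X k ((shift_map ^^ i) x) ~= cylinder X k ((shift_map ^^ j) x)" by blast
 qed
 then show ?thesis using x(4) that by simp
qed

text \<open>A maximizing measure charges only edges of the cycle. Nonnegativity of its entropy
  already gives equality in the variational principle there, whose growth rate is 1.\<close>

lemma unit_growth_maximizing:
 assumes \<phi>: "\<phi> \<in> LC X k" and K: "top_components (edges \<phi>) = {K}" "growth (edges \<phi>) K = 1"
 shows "maximizing_measure X \<phi> \<nu> \<longleftrightarrow> \<nu> = comp_gibbs (edges \<phi>) K"
proof -
 interpret component_system X V E "word k" "edges \<phi>" by (rule component_system_edges)
 have KC: "K \<in> components (edges \<phi>)" by (rule top_components_single[OF K(1)])
 interpret K: entropy_graph X V E "word k" K "restrict_edges (edges \<phi>) K" by (rule component_graph[OF KC])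
 have FK: "restrict_edges (edges \<phi>) K = edges \<phi>" by (rule unit_growth_cycle[OF K])
 have int: "integral\<^sup>L \<nu> \<phi> = circ_val V (vertex_pot \<phi>) (%v w. wm \<nu> [v, w])" if "\<nu> \<in> inv_measures" for \<nu>
  by (rule integral_circ_val[of \<nu> \<phi> "vertex_pot \<phi>", OF that vertex_pot[OF \<phi>]])
 have max: "max_circ V E (vertex_pot \<phi>) (%v w. wm K.gibbs [v, w])"
  using comp_gibbs_max[of K "vertex_pot \<phi>"] KC by (simp add: edges_def)
 show ?thesis
 proof
  assume "\<nu> = comp_gibbs (edges \<phi>) K"
  then show "maximizing_measure X \<phi> \<nu>"
   using max circulation_measure unfolding maximizing_measure_def max_circ_def
   by (simp add: int K.gibbs_inv)
 next
  assume m: "maximizing_measure X \<phi> \<nu>"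
  then have \<nu>: "\<nu> \<in> inv_measures" by (simp add: maximizing_measure_def)
  have "circ_val V (vertex_pot \<phi>) (%v w. wm K.gibbs [v, w]) \<le> circ_val V (vertex_pot \<phi>) (%v w. wm \<nu> [v, w])"
  proof -
   have "integral\<^sup>L K.gibbs \<phi> \<le> integral\<^sup>L \<nu> \<phi>"
    using m K.gibbs_inv unfolding maximizing_measure_def by blast
   then show ?thesis by (simp only: int[OF K.gibbs_inv] int[OF \<nu>])
  qed
  then have "max_circ V E (vertex_pot \<phi>) (%v w. wm \<nu> [v, w])"
   using max circulation_measure[OF \<nu>] unfolding max_circ_def by (meson order_trans)
  then have "(v, w) \<in> edges \<phi>" if "0 < wm \<nu> [v, w]" for v w
   using that unfolding edges_def max_edges_def by blast
  then have sup: "K.supported \<nu>" unfolding K.supported_def by (simp add: FK)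
  interpret G: gen_system \<nu> shift_map "word k" by (rule gen_system[OF \<nu>])
  show "\<nu> = comp_gibbs (edges \<phi>) K"
   using G.measure_entropy_nonneg growth_lam[OF KC] K(2)
   by (intro K.variational_unique[OF \<nu> sup]) (simp add: zero_ereal_def)
 qed
qed

section \<open>Openness and density of the cones of simple cycles\<close>

interpretation LC: Metric_space "LC X k" "LC_dist X k" by (rule Metric_space_LC)

lemma LC_dist_ge:
 assumes "\<phi> \<in> LC X k" "\<psi> \<in> LC X k" "x \<in> X" shows "\<bar>\<phi> x - \<psi> x\<bar> \<le> LC_dist X k \<phi> \<psi>"
proof -
 have "cylinder X k x \<in> cylinders X k" using assms(3) by (simp add: cylinders_def)
 from member_le_L2_set[OF finite_cylinders this, of "%C. \<bar>the_elem (\<phi> ` C) - the_elem (\<psi> ` C)\<bar>"]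
 show ?thesis using assms by (simp add: LC_dist_def L2_set_def the_elem_LC)
qed

lemma LC_dist_le:
 assumes "\<phi> \<in> LC X k" "\<psi> \<in> LC X k" and d: "!!x. x \<in> X ==> \<bar>\<phi> x - \<psi> x\<bar> \<le> d"
 shows "LC_dist X k \<phi> \<psi> \<le> real (card (cylinders X k)) * d"
proof -
 have "LC_dist X k \<phi> \<psi> \<le> (\<Sum>C\<in>cylinders X k. \<bar>the_elem (\<phi> ` C) - the_elem (\<psi> ` C)\<bar>)"
  unfolding LC_dist_def by (rule L2_set_le_sum_abs)
 also have "\<dots> \<le> (\<Sum>C\<in>cylinders X k. d)"
  using assms by (intro sum_mono) (auto simp: cylinders_def the_elem_LC)
 finally show ?thesis by simp
qed

lemma vertex_pot_diff:
 assumes "\<phi> \<in> LC X k" "\<psi> \<in> LC X k" and d: "!!x. x \<in> X ==> \<bar>\<phi> x - \<psi> x\<bar> \<le> d" and v: "v \<in> V"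
 shows "\<bar>vertex_pot \<phi> v - vertex_pot \<psi> v\<bar> \<le> d"
proof -
 obtain x where "x \<in> X" "v = word k x" using v by blast
 then show ?thesis using d vertex_pot assms(1,2) by metis
qed

text \<open>Under small perturbations the set of maximizing edges can only shrink, and a simple
  cycle cannot shrink.\<close>

lemma unit_growth_open:
 assumes K: "top_components F = {K}" "growth F K = 1"
 shows "openin (LC_topology X k) (cone F)"
 unfolding LC_topology_def LC.openin_mtopology
proof (intro conjI allI impI)
 show "cone F \<subseteq> LC X k" by (auto simp: cone_def)
 fix \<phi> assume "\<phi> \<in> cone F"
 then have \<phi>: "\<phi> \<in> LC X k" "edges \<phi> = F" by (auto simp: cone_def)
 interpret component_system X V E "word k" F using component_system_edges[of \<phi>] \<phi>(2) by simp
 obtain s where s: "F = (%v. (v, s v)) ` K" "!!S'. S' \<subseteq> K ==> S' ~= {} ==> s ` S' \<subseteq> S' ==> S' = K"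
  by (rule unit_growth_cycle[OF K]) blast
 obtain \<delta> where \<delta>: "\<delta> > 0" "!!\<psi>'. (!!v. v \<in> V ==> \<bar>\<psi>' v - vertex_pot \<phi> v\<bar> \<le> \<delta>) ==>
   max_edges V E \<psi>' \<subseteq> max_edges V E (vertex_pot \<phi>)"
  by (rule max_edges_stable[OF SC, of "vertex_pot \<phi>"]) blast
 have "LC.mball \<phi> \<delta> \<subseteq> cone F"
 proof
  fix \<psi> assume "\<psi> \<in> LC.mball \<phi> \<delta>"
  then have \<psi>: "\<psi> \<in> LC X k" "LC_dist X k \<phi> \<psi> < \<delta>" by auto
  have near: "\<bar>\<psi> x - \<phi> x\<bar> \<le> \<delta>" if "x \<in> X" for x
   using LC_dist_ge[OF \<phi>(1) \<psi>(1) that] \<psi>(2) by linarith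
  have sub: "max_edges V E (vertex_pot \<psi>) \<subseteq> max_edges V E (vertex_pot \<phi>)"
   by (rule \<delta>(2)) (rule vertex_pot_diff[OF \<psi>(1) \<phi>(1) near])
  have "max_edges V E (vertex_pot \<psi>) = max_edges V E (vertex_pot \<phi>)"
   by (rule max_edges_minimal[OF SC _ sub s(2)]) (use \<phi>(2) s(1) in \<open>simp_all add: edges_def\<close>)
  then show "\<psi> \<in> cone F" using \<psi>(1) \<phi>(2) by (simp add: cone_def edges_def)
 qed
 then show "\<exists>r>0. LC.mball \<phi> r \<subseteq> cone F" using \<delta>(1) by blast
qed

definition unit_edges :: "(nat list \<times> nat list) set => bool" where
 "unit_edges F \<longleftrightarrow> (\<exists>K. top_components F = {K} \<and> growth F K = 1)"

lemma unit_edges_dense: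
 assumes \<phi>: "\<phi> \<in> LC X k" and r: "r > 0"
 obtains \<psi> where "\<psi> \<in> LC X k" "LC_dist X k \<phi> \<psi> < r" "unit_edges (edges \<psi>)"
proof -
 let ?p = "vertex_pot \<phi>"
 obtain S s where S: "S ~= {}" "bij_betw s S S"
  "!!S'. S' \<subseteq> S ==> S' ~= {} ==> s ` S' \<subseteq> S' ==> S' = S"
  "!!\<delta>. \<delta> > 0 ==> max_edges V E (%v. ?p v + \<delta> * indicator S v) \<subseteq> max_edges V E ?p ==>
   max_edges V E (%v. ?p v + \<delta> * indicator S v) = (%v. (v, s v)) ` S"
  by (rule max_edges_perturb[OF SC, of ?p]) blast
 obtain \<delta>0 where \<delta>0: "\<delta>0 > 0" "!!\<psi>'. (!!v. v \<in> V ==> \<bar>\<psi>' v - ?p v\<bar> \<le> \<delta>0) ==>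
   max_edges V E \<psi>' \<subseteq> max_edges V E ?p"
  by (rule max_edges_stable[OF SC, of ?p]) blast
 \<comment> \<open>The first bound secures semicontinuity, the second closeness: the distance is at
   most \<delta> times the number of cylinders, and the added 1 makes it less than
   \<open>r\<close>.\<close>
 define \<delta> where "\<delta> = min \<delta>0 (r / (real (card (cylinders X k)) + 1))"
 have "\<delta> \<le> r / (real (card (cylinders X k)) + 1)" by (simp add: \<delta>_def)
 then have "\<delta> * (real (card (cylinders X k)) + 1) \<le> r" by (simp add: pos_le_divide_eq)
 then have \<delta>: "\<delta> > 0" "\<delta> \<le> \<delta>0" "\<delta> * (real (card (cylinders X k)) + 1) \<le> r"
  using \<delta>0(1) r by (simp_all add: \<delta>_def)
 define \<psi> where "\<psi> x = (if x \<in> X then \<phi> x + \<delta> * indicator S (word k x) else 0)" for x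
 have \<psi>: "\<psi> \<in> LC X k"
 proof -
  have "\<psi> y = \<psi> x" if "x \<in> X" "y \<in> cylinder X k x" for x y
  proof -
   have "\<phi> y = \<phi> x" using \<phi> that unfolding LC_def by blast
   then show ?thesis using that unfolding cylinder_word by (simp add: \<psi>_def)
  qed
  moreover have "\<psi> x = 0" if "x \<notin> X" for x using that by (simp add: \<psi>_def)
  ultimately show ?thesis unfolding LC_def by blast
 qed
 have vp: "vertex_pot \<psi> v = ?p v + \<delta> * indicator S v" if "v \<in> V" for v
 proof -
  obtain x where x: "x \<in> X" "v = word k x" using \<open>v \<in> V\<close> by blast
  show ?thesis using vertex_pot[OF \<psi> x(1)] vertex_pot[OF \<phi> x(1)] x by (simp add: \<psi>_def)
 qed
 have "max_edges V E (%v. ?p v + \<delta> * indicator S v) \<subseteq> max_edges V E ?p"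
  by (rule \<delta>0(2)) (use \<delta> in \<open>auto simp: indicator_def\<close>)
 then have "max_edges V E (%v. ?p v + \<delta> * indicator S v) = (%v. (v, s v)) ` S" by (rule S(4)[OF \<delta>(1)])
 then have eF: "edges \<psi> = (%v. (v, s v)) ` S"
  unfolding edges_def using max_edges_cong[of V "vertex_pot \<psi>", OF vp] by simp
 interpret component_system X V E "word k" "edges \<psi>" by (rule component_system_edges)
 have comps: "components (edges \<psi>) = {S}" by (rule cycle_components[OF eF S(1-3)])
 have "growth (edges \<psi>) S = 1" by (rule cycle_growth[OF eF S(1,2) recF comps])
 then have unit: "unit_edges (edges \<psi>)" using comps by (auto simp: unit_edges_def top_components_def)
 have "LC_dist X k \<phi> \<psi> \<le> real (card (cylinders X k)) * \<delta>"
  by (rule LC_dist_le[OF \<phi> \<psi>]) (use \<delta>(1) in \<open>auto simp: \<psi>_def indicator_def\<close>)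
 then have "LC_dist X k \<phi> \<psi> < r" using \<delta>(1,3) by (simp add: algebra_simps)
 then show ?thesis using \<psi> unit that by blast
qed

text \<open>The coefficients are sums of limiting vertex probabilities, which for all potentials
  together take finitely many values.\<close>

lemma coef_finite:
 obtains Q where "finite Q" "!!\<phi> K. K \<subseteq> V ==> coef \<phi> K \<in> Q"
proof -
 obtain R where R: "finite R" "!!\<psi> v. limit_prob \<psi> v \<in> R" by (rule limit_prob_finite) blast
 let ?Q = "(%(K, g). \<Sum>v\<in>K. g v) ` (Pow V \<times> (V \<rightarrow>\<^sub>E R))"
 have "finite (Pow V)" using finite_V by (simp only: finite_Pow_iff)
 then have "finite ?Q"
  by (rule finite_imageI[OF finite_cartesian_product[OF _ finite_PiE[OF finite_V R(1)]]])
 moreover have "coef \<phi> K \<in> ?Q" if "K \<subseteq> V" for \<phi> K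
 proof -
  have "coef \<phi> K = (\<Sum>v\<in>K. restrict (limit_prob \<phi>) V v)"
   unfolding coef_def using that by (intro sum.cong) auto
  moreover have "restrict (limit_prob \<phi>) V \<in> V \<rightarrow>\<^sub>E R" using R(2) by auto
  ultimately show ?thesis using that by (intro image_eqI[of _ _ "(K, restrict (limit_prob \<phi>) V)"]) auto
 qed
 ultimately show ?thesis by (rule that)
qed

section \<open>Classification of the cones\<close>

lemma cone_edges: "\<phi> \<in> cone F ==> \<phi> \<in> LC X k \<and> edges \<phi> = F"
 by (simp add: cone_def)

lemma finite_edges: "finite (edges ` LC X k)"
proof (rule finite_subset)
 show "edges ` LC X k \<subseteq> Pow E" using max_edges_subset[OF SC] unfolding edges_def by blast
 show "finite (Pow E)" using E_subset finite_V by (meson finite_Pow_iff finite_SigmaI finite_subset)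
qed

lemma unit_edges_cone:
 assumes F: "unit_edges F" and ne: "cone F ~= {}"
 shows "openin (LC_topology X k) (cone F)"
  "unit_cell X k (cone F) (comp_gibbs F ` top_components F)"
proof -
 obtain K where K: "top_components F = {K}" "growth F K = 1" using F unfolding unit_edges_def by blast
 show "openin (LC_topology X k) (cone F)" by (rule unit_growth_open[OF K])
 obtain \<phi> where "\<phi> \<in> cone F" using ne by blast
 then have "edges \<phi> = F" by (simp add: cone_def)
 then obtain x where x: "k_elementary X k x" "comp_gibbs F K = orbit_measure X x"
  using unit_growth_orbit[of \<phi> K] K by metis
 have "zero_temperature_measure X \<phi> (orbit_measure X x)
   \<and> (\<forall>\<nu>. maximizing_measure X \<phi> \<nu> \<longleftrightarrow> \<nu> = orbit_measure X x)" if "\<phi> \<in> cone F" for \<phi>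
  using zero_temperature_single[of \<phi> K] unit_growth_maximizing[of \<phi> K] cone_edges[OF that] K x(2) by simp
 then show "unit_cell X k (cone F) (comp_gibbs F ` top_components F)"
  unfolding unit_cell_def using x K(1) by (intro exI[of _ x]) simp
qed

lemma single_component_cone:
 assumes sys: "component_system X V E (word k) F" and K: "top_components F = {K}" and F: "\<not> unit_edges F"
 shows "uniform_cell X (cone F) (comp_gibbs F ` top_components F)"
proof -
 interpret component_system X V E "word k" F by (rule sys)
 have g: "growth F K ~= 1" using F K unfolding unit_edges_def by blast
 obtain Y where "transitive_sub_sft X Y" "unique_max_entropy_measure X Y (comp_gibbs F K)"
  "\<not> topological_space_class.discrete Y"
  using component_subshift(1)[OF top_components_single[OF K]] g by blast
 moreover have "zero_temperature_measure X \<phi> (comp_gibbs F K)" if "\<phi> \<in> cone F" for \<phi>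
  using zero_temperature_single[of \<phi> K] cone_edges[OF that] K by simp
 ultimately show ?thesis
  unfolding uniform_cell_def using K by (intro exI[of _ "comp_gibbs F K"] exI[of _ Y]) simp
qed

lemma several_components_cone:
 assumes sys: "component_system X V E (word k) F" and F: "card (top_components F) \<ge> 2"
 shows "mixed_cell X (cone F) (comp_gibbs F ` top_components F)"
proof -
 interpret component_system X V E "word k" F by (rule sys)
 define n where "n = card (top_components F)"
 obtain e where e: "bij_betw e {1..n} (top_components F)"
  using ex_bij_betw_nat_finite_1[OF top_components_nonempty(1)[OF recF]] unfolding n_def by blast
 define m where "m j = comp_gibbs F (e j)" for j
 have et: "e j \<in> top_components F" if "j \<in> {1..n}" for j using e that by (auto simp: bij_betw_def)
 then have ec: "e j \<in> components F" if "j \<in> {1..n}" for j using that by (simp add: top_components_def)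
 have "bij_betw (comp_gibbs F) (top_components F) (comp_gibbs F ` top_components F)"
  by (rule inj_on_imp_bij_betw) (rule inj_on_subset[OF inj_cgibbs], auto simp: top_components_def)
 \<comment> \<open>Different components have different measures, so the number of measures is the
   number of top components.\<close>
 from bij_betw_trans[OF e this] have m: "bij_betw m {1..n} (comp_gibbs F ` top_components F)"
  by (simp add: m_def[abs_def] o_def)
 have "\<forall>j\<in>{1..n}. \<exists>Y. transitive_sub_sft X Y \<and> unique_max_entropy_measure X Y (m j)"
  using component_subshift(1)[OF ec] unfolding m_def by blast
 then obtain Y where Y: "!!j. j \<in> {1..n} ==> transitive_sub_sft X (Y j) \<and> unique_max_entropy_measure X (Y j) (m j)"
  by metis
 have ent: "measure_entropy shift_map (m j1) = measure_entropy shift_map (m j2)" if "j1 \<in> {1..n}" "j2 \<in> {1..n}" for j1 j2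
 proof -
  have "growth F (e j1) = growth F (e j2)"
   using et[OF that(1)] et[OF that(2)] by (auto simp: top_components_def intro: antisym)
  then show ?thesis unfolding m_def using component_subshift(3) ec that by simp
 qed
 define a where "a \<phi> j = coef (vertex_pot \<phi>) (e j)" for \<phi> j
 have a: "(\<forall>j\<in>{1..n}. 0 \<le> a \<phi> j \<and> a \<phi> j \<le> 1) \<and> (\<Sum>j\<in>{1..n}. a \<phi> j) = 1
   \<and> zero_temperature_measure X \<phi> (measure_comb X {1..n} (a \<phi>) m)" if "\<phi> \<in> cone F" for \<phi>
 proof -
  have \<phi>: "\<phi> \<in> LC X k" and e': "bij_betw e {1..n} (top_components (edges \<phi>))" and eF: "edges \<phi> = F"
   using cone_edges[OF that] e by auto
  show ?thesis
   using zero_temperature_comb[OF \<phi> e'] unfolding eF a_def[abs_def] m_def[abs_def] by blast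
 qed
 obtain Q where Q: "finite Q" "!!\<psi> K. K \<subseteq> V ==> coef \<psi> K \<in> Q" by (rule coef_finite) blast
 have "(%\<phi>. restrict (a \<phi>) {1..n}) ` cone F \<subseteq> {1..n} \<rightarrow>\<^sub>E Q"
  using Q(2)[OF component_V[OF ec]] by (auto simp: a_def)
 moreover have "finite ({1..n} \<rightarrow>\<^sub>E Q)" using Q(1) by (intro finite_PiE) auto
 ultimately have fin: "finite ((%\<phi>. restrict (a \<phi>) {1..n}) ` cone F)" by (rule finite_subset)
 show ?thesis
  unfolding mixed_cell_def
 proof (intro exI conjI)
  show "2 \<le> n" using F by (simp add: n_def)
  show "bij_betw m {1..n} (comp_gibbs F ` top_components F)" by (rule m)
  show "\<forall>j\<in>{1..n}. transitive_sub_sft X (Y j) \<and> unique_max_entropy_measure X (Y j) (m j)"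
   by (rule ballI) (rule Y)
  show "\<forall>j1\<in>{1..n}. \<forall>j2\<in>{1..n}. measure_entropy shift_map (m j1) = measure_entropy shift_map (m j2)"
   by (intro ballI) (rule ent)
  show "\<forall>\<phi>\<in>cone F. (\<forall>j\<in>{1..n}. 0 \<le> a \<phi> j \<and> a \<phi> j \<le> 1) \<and> (\<Sum>j\<in>{1..n}. a \<phi> j) = 1
    \<and> zero_temperature_measure X \<phi> (measure_comb X {1..n} (a \<phi>) m)"
   by (rule ballI) (rule a)
 qed (rule fin)
qed

lemma unit_cones_dense:
 "LC_topology X k closure_of (\<Union>F\<in>{F \<in> edges ` LC X k. unit_edges F}. cone F) = LC X k"
 unfolding LC_topology_def LC.metric_closure_of
proof (intro equalityI subsetI CollectI conjI allI impI)
 fix \<phi> and r :: real assume \<phi>: "\<phi> \<in> LC X k" and r: "r > 0"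
 obtain \<psi> where "\<psi> \<in> LC X k" "LC_dist X k \<phi> \<psi> < r" "unit_edges (edges \<psi>)"
  by (rule unit_edges_dense[OF \<phi> r])
 then show "\<exists>y\<in>\<Union>F\<in>{F \<in> edges ` LC X k. unit_edges F}. cone F. y \<in> LC.mball \<phi> r"
  using \<phi> by (intro bexI[of _ \<psi>]) (auto simp: cone_def)
qed simp

end

theorem theoremA:
 fixes A :: "nat mat" and X :: "(nat => nat) set" and k :: nat
 assumes "sft_matrix A" and "irreducible_mat A" and "X = sft A" and "k \<ge> 1"
 shows "\<exists>(l1::nat) (l2::nat) (N::nat)
      (U :: nat => ((nat => nat) => real) set)
      (M :: nat => (nat => nat) measure set).
   1 \<le> l1 \<and> l1 \<le> l2 \<and> l2 \<le> N
  \<and> partition_on (LC X k) (U ` {1..N}) \<and> inj_on U {1..N}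
  \<and> (\<forall>i\<in>{1..N}. fun_convex_cone (U i))
  \<and> (\<forall>i\<in>{1..N}. finite (M i) \<and> (\<forall>\<mu>\<in>M i. ergodic_measure X \<mu>))
  \<and> (\<forall>i\<in>{1..l1}. openin (LC_topology X k) (U i))
  \<and> LC_topology X k closure_of (\<Union>i\<in>{1..l1}. U i) = LC X k
  \<and> (\<forall>i\<in>{1..l1}. \<exists>x. k_elementary X k x \<and> M i = {orbit_measure X x}
    \<and> (\<forall>\<phi>\<in>U i. zero_temperature_measure X \<phi> (orbit_measure X x)
       \<and> (\<forall>\<nu>. maximizing_measure X \<phi> \<nu> \<longleftrightarrow> \<nu> = orbit_measure X x)))
  \<and> (\<forall>i\<in>{l1<..l2}. \<exists>\<mu> Y. M i = {\<mu>} \<and> transitive_sub_sft X Y \<and> \<not> topological_space_class.discrete Y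
    \<and> unique_max_entropy_measure X Y \<mu>
    \<and> (\<forall>\<phi>\<in>U i. zero_temperature_measure X \<phi> \<mu>))
  \<and> (\<forall>i\<in>{l2<..N}. \<exists>(n::nat) m Y. n \<ge> 2 \<and> bij_betw m {1..n} (M i)
    \<and> (\<forall>j\<in>{1..n}. transitive_sub_sft X (Y j) \<and> unique_max_entropy_measure X (Y j) (m j))
    \<and> (\<forall>j1\<in>{1..n}. \<forall>j2\<in>{1..n}.
       measure_entropy shift_map (m j1) = measure_entropy shift_map (m j2))
    \<and> (\<exists>a :: ((nat => nat) => real) => nat => real.
       (\<forall>\<phi>\<in>U i. (\<forall>j\<in>{1..n}. 0 \<le> a \<phi> j \<and> a \<phi> j \<le> 1) \<and> (\<Sum>j\<in>{1..n}. a \<phi> j) = 1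
        \<and> zero_temperature_measure X \<phi> (measure_comb X {1..n} (a \<phi>) m))
       \<and> finite ((%\<phi>. restrict (a \<phi>) {1..n}) ` U i)))"
proof -
 interpret S: irreducible_sft A k by unfold_locales (use assms in auto)
 have X: "sft A = X" using assms(3) by simp
 define top where "top = (top_components :: (nat list \<times> nat list) set => nat list set set)"
 define Fs where "Fs = S.edges ` LC X k"
 have fin: "finite Fs" unfolding Fs_def using S.finite_edges X by simp
 have sys: "component_system S.X S.V S.E (word k) F" if "F \<in> Fs" for F
  using that S.component_system_edges unfolding Fs_def by blast
 have rec: "recurrent F" if "F \<in> Fs" for F
  using sys[OF that] by (simp add: component_system_def component_system_axioms_def)
 \<comment> \<open>Several disjoint cycles without a component of larger growth fall into
   \<open>FC\<close>, with common entropy 0; a single top component of growth 1 falls into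
   \<open>FA\<close>.\<close>
 define FA FB FC where "FA = {F \<in> Fs. S.unit_edges F}" and "FB = {F \<in> Fs. (\<exists>K. top F = {K}) \<and> \<not> S.unit_edges F}"
  and "FC = {F \<in> Fs. card (top F) \<ge> 2}"
 have cover: "FA \<union> FB \<union> FC = Fs"
 proof -
  have "(\<exists>K. top F = {K}) \<or> card (top F) \<ge> 2" if "F \<in> Fs" for F
  proof -
   have "finite (top F)" "top F ~= {}" unfolding top_def using top_components_nonempty[OF rec[OF that]] by auto
   then have "card (top F) ~= 0" by simp
   then have "card (top F) = 1 \<or> card (top F) \<ge> 2" by linarith
   then show ?thesis by (auto simp: card_1_singleton_iff)
  qed
  then show ?thesis by (auto simp: FA_def FB_def FC_def)
 qed
 have disj: "FA \<inter> FB = {}" "FA \<inter> FC = {}" "FB \<inter> FC = {}"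
  by (auto simp: FA_def FB_def FC_def S.unit_edges_def top_def)
 have finABC: "finite FA" "finite FB" "finite FC" using fin cover by auto
 obtain f l1 l2 N where f: "l1 = card FA" "l1 \<le> l2" "l2 \<le> N" "bij_betw f {1..N} (FA \<union> FB \<union> FC)"
  "f ` {1..l1} = FA" "f ` {l1<..l2} = FB" "f ` {l2<..N} = FC"
  by (rule enumerate_three[OF finABC disj]) blast
 have fF: "f ` {1..N} = Fs" "inj_on f {1..N}" using f(4) cover by (auto simp: bij_betw_def)
 have ne: "S.cone F ~= {}" if "F \<in> Fs" for F using that X unfolding Fs_def S.cone_def by blast
 define U where "U i = S.cone (f i)" for i
 define M where "M i = S.comp_gibbs (f i) ` top (f i)" for i
 have inF: "f i \<in> Fs" if "i \<in> {1..N}" for i using fF(1) that by blast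
 have inA: "f i \<in> FA" if "i \<in> {1..l1}" for i using f(5) that by blast
 have inB: "f i \<in> FB" if "i \<in> {l1<..l2}" for i using f(6) that by blast
 have inC: "f i \<in> FC" if "i \<in> {l2<..N}" for i using f(7) that by blast
 have zero: "(%_. 0) \<in> LC (sft A) k" by (simp add: LC_def)
 \<comment> \<open>Applied near the zero function, density provides a cone of the first kind, hence
   \<open>1 \<le> l1\<close>.\<close>
 obtain \<psi> where "\<psi> \<in> LC (sft A) k" "S.unit_edges (S.edges \<psi>)"
  by (rule S.unit_edges_dense[of "%_. 0" 1]) (use zero in auto)
 then have "S.edges \<psi> \<in> FA" unfolding FA_def Fs_def X by blast
 then have "FA ~= {}" by blast
 then have l1: "1 \<le> l1" using f(1) finABC(1) by (simp add: Suc_le_eq card_gt_0_iff)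
 have eqF: "F = F'" if "\<phi> \<in> S.cone F" "\<phi> \<in> S.cone F'" for F F' \<phi>
  using that by (simp add: S.cone_def)
 have part: "partition_on (LC X k) (U ` {1..N})"
 proof (rule partition_onI)
  have "\<Union> (U ` {1..N}) = (\<Union>F\<in>Fs. S.cone F)" unfolding U_def fF(1)[symmetric] by blast
  also have "\<dots> = LC X k" unfolding Fs_def S.cone_def X by blast
  finally show "\<Union> (U ` {1..N}) = LC X k" .
  show "disjnt p q" if "p \<in> U ` {1..N}" "q \<in> U ` {1..N}" "p ~= q" for p q
  proof -
   obtain i j where ij: "p = S.cone (f i)" "q = S.cone (f j)" using \<open>p \<in> _\<close> \<open>q \<in> _\<close> unfolding U_def by blast
   have "\<phi> \<notin> q" if "\<phi> \<in> p" for \<phi>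
   proof
    assume "\<phi> \<in> q"
    then have "f i = f j" using eqF[of \<phi> "f i" "f j"] that ij by simp
    then show False using ij \<open>p ~= q\<close> by simp
   qed
   then show ?thesis unfolding disjnt_def by blast
  qed
  show "{} \<notin> U ` {1..N}" using ne[OF inF] unfolding U_def by force
 qed
 have inj: "inj_on U {1..N}"
 proof (rule inj_onI)
  fix i j assume ij: "i \<in> {1..N}" "j \<in> {1..N}" "U i = U j"
  obtain \<phi> where "\<phi> \<in> U i" using ne[OF inF[OF ij(1)]] unfolding U_def by blast
  then have "f i = f j" using ij(3) eqF[of \<phi> "f i" "f j"] unfolding U_def by simp
  then show "i = j" using fF(2) ij by (auto dest: inj_onD)
 qed
 have "(\<Union>i\<in>{1..l1}. U i) = (\<Union>F\<in>FA. S.cone F)" unfolding U_def f(5)[symmetric] by blast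
 then have dense: "LC_topology X k closure_of (\<Union>i\<in>{1..l1}. U i) = LC X k"
  using S.unit_cones_dense unfolding FA_def Fs_def X by simp
 have erg: "finite (M i) \<and> (\<forall>\<mu>\<in>M i. ergodic_measure X \<mu>)" if "i \<in> {1..N}" for i
 proof -
  interpret component_system S.X S.V S.E "word k" "f i" by (rule sys[OF inF[OF that]])
  show ?thesis unfolding M_def top_def
   using top_components_nonempty(1)[OF recF] component_subshift(2) X by (auto simp: top_components_def)
 qed
 have convex: "\<forall>i\<in>{1..N}. fun_convex_cone (U i)" unfolding U_def using S.cone_convex by blast
 have a: "openin (LC_topology X k) (U i)" "unit_cell X k (U i) (M i)" if "i \<in> {1..l1}" for i
 proof -
  have "S.unit_edges (f i)" "f i \<in> Fs" using inA[OF that] by (auto simp: FA_def)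
  from S.unit_edges_cone[OF this(1) ne[OF this(2)]]
  show "openin (LC_topology X k) (U i)" "unit_cell X k (U i) (M i)" unfolding X U_def M_def top_def .
 qed
 have b: "uniform_cell X (U i) (M i)" if i: "i \<in> {l1<..l2}" for i
 proof -
  obtain K where K: "f i \<in> Fs" "top_components (f i) = {K}" "\<not> S.unit_edges (f i)"
   using inB[OF i] by (auto simp: FB_def top_def)
  from S.single_component_cone[OF sys[OF K(1)] K(2,3)] show ?thesis unfolding X U_def M_def top_def .
 qed
 have c: "mixed_cell X (U i) (M i)" if "i \<in> {l2<..N}" for i
 proof -
  have C: "f i \<in> Fs" "2 \<le> card (top_components (f i))" using inC[OF that] by (auto simp: FC_def top_def)
  from S.several_components_cone[OF sys[OF C(1)] C(2)] show ?thesis unfolding X U_def M_def top_def .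
 qed
 note a = a(1) a(2)[unfolded unit_cell_def] and b = b[unfolded uniform_cell_def] and c = c[unfolded mixed_cell_def]
 show ?thesis
  by (rule exI[of _ l1], rule exI[of _ l2], rule exI[of _ N], rule exI[of _ U], rule exI[of _ M])
   (intro conjI ballI l1 f(2,3) part inj convex dense a b c erg[THEN conjunct1] erg[THEN conjunct2, rule_format] convex[rule_format])
qed

end
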